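(* Let $n\ge 1$ and $\alpha\neq 0$. There exist an open neighborhood $V$ of zero in $C^\infty_{\mathrm{ap}}(\mathbb{R}^n,\mathbb{R}^n)$ and an open neighborhood $U$ of the identity in $\mathrm{Diff}^\infty_{\mathrm{ap}}(\mathbb{R}^n)$ such that the Riemannian exponential map of the weak Riemannian metric $\nu_\alpha$, $$\mathrm{Exp}: V\to U,$$ is well-defined and is a $C^1_F$-diffeomorphism.
   Context: Hölder spaces: for real $m\ge 0$ let $[m]$ be its integer part. For integer $m$, $C^m_b(\mathbb{R}^n,\mathbb{R})$ is the space of $C^m$ functions whose partial derivatives of order $\le m$ are bounded and continuous, with norm $|f|_m=\max_{|\beta|\le m}\sup_x|\partial^\beta f(x)|$; for $m=k+\gamma$ with $k$ integer and $0<\gamma<1$ it consists of $f\in C^k_b$ whose derivatives of order $k$ are $\gamma$-Hölder, with norm $|f|_k+\max_{|\beta|=k}\sup_{x\ne y}|\partial^\beta f(x)-\partial^\beta f(y)|/|x-y|^\gamma$. For $f\in C^m_b$ and $c\in\mathbb{R}^n$ put $f_c(x)=f(x+c)$ and $\mathcal S_f=\{f_c\}_{c\in\mathbb{R}^n}$. $C^m_{\mathrm{ap}}(\mathbb{R}^n,\mathbb{R})=\{f\in C^m_b:\mathcal S_f\text{ precompact in }C^m_b\}$ with the $C^m_b$-norm; vector-valued spaces are defined componentwise (norm = maximum of component norms). $C^\infty_{\mathrm{ap}}=\bigcap_{k\ge1\text{ integer}}C^k_{\mathrm{ap}}$ with the Fréchet topology of the norms $|\cdot|_k$. $\mathrm{Diff}^m_{\mathrm{ap}}(\mathbb{R}^n)$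 ($m\ge1$) is the set of maps $\varphi(x)=x+f(x)$ with $f\in C^m_{\mathrm{ap}}(\mathbb{R}^n,\mathbb{R}^n)$ and $\det(I+[d_xf])>\varepsilon$ for all $x$ and some $\varepsilon>0$; it is identified (via $\varphi\mapsto\varphi-\mathrm{id}$) with an open subset of $C^m_{\mathrm{ap}}(\mathbb{R}^n,\mathbb{R}^n)$, and it is a group under composition. $\mathrm{Diff}^\infty_{\mathrm{ap}}(\mathbb{R}^n)=\bigcap_{k\ge1}\mathrm{Diff}^k_{\mathrm{ap}}(\mathbb{R}^n)$ with the Fréchet topology of $C^\infty_{\mathrm{ap}}$; its tangent spaces are identified with $C^\infty_{\mathrm{ap}}(\mathbb{R}^n,\mathbb{R}^n)$. Metric: $A_\alpha=I-\alpha^2\Delta$ (componentwise Laplacian); for $u,v\in C^\infty_{\mathrm{ap}}(\mathbb{R}^n,\mathbb{R}^n)$, $\langle u,v\rangle_\alpha=\lim_{T\to\infty}(2T)^{-n}\int_{[-T,T]^n}(A_\alpha u,v)_{\mathbb{R}^n}dx$, and $\nu_\alpha(\varphi)(\xi,\eta)=\langle\xi\circ\varphi^{-1},\eta\circ\varphi^{-1}\rangle_\alpha$. Geodesics/exponential map: for $u\in C^\infty_{\mathrm{ap}}$ let $B_\alpha(u)=A_\alpha[(\nabla u)u]-(\nabla[A_\alpha u])u-((\mathrm{div}\,u)I+(\nabla u)^T)A_\alpha u$, where $\nabla u$ is the Jacobian matrix. $\mathrm{Exp}(u_0)=\varphi(1)$, where $(\varphi,v)$ is the solution on $[0,1]$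 in $\mathrm{Diff}^\infty_{\mathrm{ap}}(\mathbb{R}^n)\times C^\infty_{\mathrm{ap}}$ of $\dot\varphi=v$, $\dot v=\big(A_\alpha^{-1}B_\alpha(v\circ\varphi^{-1})\big)\circ\varphi$, $\varphi(0)=\mathrm{id}$, $v(0)=u_0$; equivalently $\dot\varphi=u\circ\varphi$, $\varphi(0)=\mathrm{id}$, where $u$ solves $\mathrm m_t+(\nabla\mathrm m)u+((\mathrm{div}\,u)I+(\nabla u)^T)\mathrm m=0$, $\mathrm m=A_\alpha u$, $u(0)=u_0$. Fréchet calculus: a map $f:U\to Y$ ($U$ open in a Fréchet space $X$) is $C^1_F$ if the directional derivatives $d_xf(h)=\lim_{\varepsilon\to0}(f(x+\varepsilon h)-f(x))/\varepsilon$ exist for all $x\in U,h\in X$ and $(x,h)\mapsto d_xf(h)$ is continuous on $U\times X$; a $C^1_F$-diffeomorphism is a homeomorphism that is $C^1_F$ with $C^1_F$ inverse. *)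

theory Defs
  imports "HOL-Analysis.Analysis"
begin

type_synonym 'n vfun = "real^'n \<Rightarrow> real^'n"

definition pd :: "'n::finite \<Rightarrow> (real^'n \<Rightarrow> real) \<Rightarrow> real^'n \<Rightarrow> real" where
  "pd i f x = deriv (\<lambda>t. f (x + t *\<^sub>R axis i 1)) 0"

fun dpart :: "'n::finite list \<Rightarrow> (real^'n \<Rightarrow> real) \<Rightarrow> real^'n \<Rightarrow> real" where
  "dpart [] f = f"
| "dpart (i # is) f = pd i (dpart is f)"

definition Ckb :: "nat \<Rightarrow> (real^'n::finite \<Rightarrow> real) \<Rightarrow> bool" where
  "Ckb k f \<longleftrightarrow>
     (\<forall>is::'n list. length is \<le> k \<longrightarrow>
        continuous_on UNIV (dpart is f) \<and> bounded (range (dpart is f)) \<and>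
        (length is < k \<longrightarrow> (\<forall>i x. ((\<lambda>t. dpart is f (x + t *\<^sub>R axis i 1))
                                      has_real_derivative dpart (i # is) f x) (at 0))))"

definition normk :: "nat \<Rightarrow> (real^'n::finite \<Rightarrow> real) \<Rightarrow> real" where
  "normk k f = Sup {\<bar>dpart is f x\<bar> | (is::'n list) x. length is \<le> k}"

definition precompact_Ckb :: "nat \<Rightarrow> (real^'n::finite \<Rightarrow> real) set \<Rightarrow> bool" where
  "precompact_Ckb k S \<longleftrightarrow>
     (\<forall>s::nat \<Rightarrow> real^'n \<Rightarrow> real. (\<forall>j. s j \<in> S) \<longrightarrow>
        (\<exists>r g. strict_mono r \<and> Ckb k g \<and>
               (\<lambda>j. normk k (\<lambda>x. s (r j) x - g x)) \<longlonglongrightarrow> 0))"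

definition Cap :: "nat \<Rightarrow> (real^'n::finite \<Rightarrow> real) \<Rightarrow> bool" where
  "Cap k f \<longleftrightarrow> Ckb k f \<and> precompact_Ckb k {(\<lambda>x. f (x + c)) | c. True}"

definition comp :: "'n::finite \<Rightarrow> 'n vfun \<Rightarrow> real^'n \<Rightarrow> real" where
  "comp j F = (\<lambda>x. F x $ j)"

definition Cap_vec :: "nat \<Rightarrow> 'n::finite vfun \<Rightarrow> bool" where
  "Cap_vec k F \<longleftrightarrow> (\<forall>j. Cap k (comp j F))"

definition normk_vec :: "nat \<Rightarrow> 'n::finite vfun \<Rightarrow> real" where
  "normk_vec k F = Max (range (\<lambda>j. normk k (comp j F)))"

definition Cinf_ap :: "'n::finite vfun \<Rightarrow> bool" where
  "Cinf_ap F \<longleftrightarrow> (\<forall>k\<ge>1. Cap_vec k F)"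

definition fadd :: "'n::finite vfun \<Rightarrow> 'n vfun \<Rightarrow> 'n vfun" where
  "fadd F G = (\<lambda>x. F x + G x)"
definition fsub :: "'n::finite vfun \<Rightarrow> 'n vfun \<Rightarrow> 'n vfun" where
  "fsub F G = (\<lambda>x. F x - G x)"
definition fscale :: "real \<Rightarrow> 'n::finite vfun \<Rightarrow> 'n vfun" where
  "fscale c F = (\<lambda>x. c *\<^sub>R F x)"

(* Frechet topology of C^\<infinity>_ap given by the seminorms |.|_k, k \<ge> 1
   (generated by the seminorm balls; topspace = C^\<infinity>_ap) *)
definition ap_top :: "'n::finite vfun topology" where
  "ap_top = topology_generated_by
     {{G. Cinf_ap G \<and> normk_vec k (fsub G F) < e} | F k e. Cinf_ap F \<and> k \<ge> 1 \<and> e > 0}"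

definition jac :: "'n::finite vfun \<Rightarrow> real^'n \<Rightarrow> real^'n^'n" where
  "jac F x = (\<chi> j k. pd k (comp j F) x)"

definition divg :: "'n::finite vfun \<Rightarrow> real^'n \<Rightarrow> real" where
  "divg F x = (\<Sum>i\<in>UNIV. pd i (comp i F) x)"

definition lap :: "'n::finite vfun \<Rightarrow> 'n vfun" where
  "lap F = (\<lambda>x. \<chi> j. (\<Sum>i\<in>UNIV. pd i (pd i (comp j F)) x))"

definition Aop :: "real \<Rightarrow> 'n::finite vfun \<Rightarrow> 'n vfun" where
  "Aop \<alpha> F = (\<lambda>x. F x - (\<alpha>^2) *\<^sub>R lap F x)"

definition Ainv :: "real \<Rightarrow> 'n::finite vfun \<Rightarrow> 'n vfun" where
  "Ainv \<alpha> G = (THE F. Cinf_ap F \<and> Aop \<alpha> F = G)"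

definition Bop :: "real \<Rightarrow> 'n::finite vfun \<Rightarrow> 'n vfun" where
  "Bop \<alpha> u = (\<lambda>x.
      Aop \<alpha> (\<lambda>y. jac u y *v u y) x
      - jac (Aop \<alpha> u) x *v u x
      - (divg u x *\<^sub>R Aop \<alpha> u x + transpose (jac u x) *v Aop \<alpha> u x))"

definition Diff_ap :: "nat \<Rightarrow> 'n::finite vfun \<Rightarrow> bool" where
  "Diff_ap k \<phi> \<longleftrightarrow> (let f = fsub \<phi> id in
      Cap_vec k f \<and> (\<exists>\<epsilon>>0. \<forall>x. det (mat 1 + jac f x) > \<epsilon>))"

definition Diff_inf :: "'n::finite vfun \<Rightarrow> bool" where
  "Diff_inf \<phi> \<longleftrightarrow> (\<forall>k\<ge>1. Diff_ap k \<phi>)"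

(* chart identifying Diff^\<infinity>_ap with an open subset of C^\<infinity>_ap *)
definition chart :: "'n::finite vfun \<Rightarrow> 'n vfun" where
  "chart \<phi> = fsub \<phi> id"

definition curve_deriv :: "(real \<Rightarrow> 'n::finite vfun) \<Rightarrow> real \<Rightarrow> 'n vfun \<Rightarrow> bool" where
  "curve_deriv \<gamma> t D \<longleftrightarrow>
     limitin ap_top (\<lambda>s. fscale (1 / s) (fsub (\<gamma> (t + s)) (\<gamma> t))) D
        (at 0 within {s. t + s \<in> {0..1}})"

definition geod_sol :: "real \<Rightarrow> 'n::finite vfun \<Rightarrow> (real \<Rightarrow> 'n vfun) \<Rightarrow> (real \<Rightarrow> 'n vfun) \<Rightarrow> bool" where
  "geod_sol \<alpha> u0 \<phi> v \<longleftrightarrow>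
     \<phi> 0 = id \<and> v 0 = u0 \<and>
     (\<forall>t\<in>{0..1}. Diff_inf (\<phi> t) \<and> Cinf_ap (v t) \<and>
        curve_deriv \<phi> t (v t) \<and>
        curve_deriv v t (\<lambda>x. Ainv \<alpha> (Bop \<alpha> (\<lambda>y. v t (inv (\<phi> t) y))) (\<phi> t x)))"

definition Exp_wd :: "real \<Rightarrow> 'n::finite vfun \<Rightarrow> bool" where
  "Exp_wd \<alpha> u0 \<longleftrightarrow> (\<exists>!p. \<exists>\<phi> v. geod_sol \<alpha> u0 \<phi> v \<and> \<phi> 1 = p)"

definition Exp :: "real \<Rightarrow> 'n::finite vfun \<Rightarrow> 'n vfun" where
  "Exp \<alpha> u0 = (THE p. \<exists>\<phi> v. geod_sol \<alpha> u0 \<phi> v \<and> \<phi> 1 = p)"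

definition has_dirderiv :: "('n::finite vfun \<Rightarrow> 'n vfun) \<Rightarrow> 'n vfun \<Rightarrow> 'n vfun \<Rightarrow> 'n vfun \<Rightarrow> bool" where
  "has_dirderiv f x h D \<longleftrightarrow>
     limitin ap_top (\<lambda>\<epsilon>. fscale (1 / \<epsilon>) (fsub (f (fadd x (fscale \<epsilon> h))) (f x))) D (at 0)"

definition dirderiv :: "('n::finite vfun \<Rightarrow> 'n vfun) \<Rightarrow> 'n vfun \<Rightarrow> 'n vfun \<Rightarrow> 'n vfun" where
  "dirderiv f x h = (THE D. has_dirderiv f x h D)"

definition C1F :: "'n::finite vfun set \<Rightarrow> ('n vfun \<Rightarrow> 'n vfun) \<Rightarrow> bool" where
  "C1F U f \<longleftrightarrow> openin ap_top U \<and> f ` U \<subseteq> topspace ap_top \<and>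
     (\<forall>x\<in>U. \<forall>h\<in>topspace ap_top. \<exists>D. has_dirderiv f x h D) \<and>
     continuous_map (subtopology (prod_topology ap_top ap_top) (U \<times> topspace ap_top)) ap_top
        (\<lambda>(x, h). dirderiv f x h)"

definition C1F_diffeo :: "'n::finite vfun set \<Rightarrow> 'n vfun set \<Rightarrow> ('n vfun \<Rightarrow> 'n vfun) \<Rightarrow> bool" where
  "C1F_diffeo V W f \<longleftrightarrow>
     (\<exists>g. homeomorphic_maps (subtopology ap_top V) (subtopology ap_top W) f g \<and>
          C1F V f \<and> C1F W g)"

end

theory Submission
  imports Defs "HOL-Probability.Probability" "HOL-Library.Function_Algebras" "HOL-Real_Asymp.Real_Asymp"
begin

text \<open>In Lagrangian coordinates \<open>\<phi> = id + f\<close>, \<open>v = \<phi>'\<close>, \<open>w = v'\<close> the geodesic equation reads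
  \<open>w = S (Q (f, v, w))\<close>, where \<open>S = (1 - a \<Delta>)\<^sup>-\<^sup>1\<close> and \<open>Q\<close> is at least quadratic and involves at most two derivatives,
  which \<open>S\<close> regains. Hence geodesics are fixed points of a contraction on small data. All the estimates hold with the same
  constants for a whole family of algebra norms: \<open>N + l * (N of the first derivatives)\<close> satisfies the estimates whenever \<open>N\<close> does,
  and for small \<open>l\<close> it is close to \<open>N\<close>. So smallness is needed only for the weakest norm (a Hoelder norm), there is no loss of
  derivatives, and everything takes place in the space of smooth almost periodic functions.
  The functions also depend on a complex number \<open>\<epsilon> + i t\<close>. The time derivative is replaced by integration over \<open>t\<close>, whereas
  the parameter \<open>\<epsilon>\<close> is treated like a space variable: solving the system with initial velocity \<open>u + \<eta> sin \<epsilon> h\<close> yields the directional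
  derivative of the exponential map at once.
  The inverse of the exponential map solves the same system with a prescribed final position,
  \<open>v t = y + \<integral>\<^sub>0\<^sup>t w - \<integral>\<^sub>0\<^sup>1 \<integral>\<^sub>0\<^sup>s w\<close>, so it is treated by the same argument and no inverse function theorem is needed.
  The operator \<open>S\<close> is a Gaussian average, which preserves almost periodicity; integration by parts yields its gain of
  derivatives.\<close>

section \<open>Smooth almost periodic fields\<close>

text \<open>In Eulerian variables the equation transports \<open>A u\<close> and loses a derivative.
  As an equation for the flow it is an ODE with a locally Lipschitz right side, because the third
  derivatives in \<open>A[(grad u) u] - (grad A u) u\<close> cancel. The price is a Laplacian with
  coefficients depending on \<open>f\<close>; they are nearly constant, and the difference is moved
  to the right side. The base norm is of Hoelder type because in the sup norm the resolvent does not
  gain two full derivatives. The parameter enters through a sine because fields have to be bounded.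
  The contraction yields uniqueness only among small solutions, whereas the exponential map
  quantifies over all curves that solve the equation. Uniqueness of geodesics is therefore proved
  apart: the set of times at which a geodesic agrees with a small one is open and closed. Moreover
  \<open>Ainv\<close> is a definite description, so it requires uniqueness for the Helmholtz
  equation among bounded functions, which the maximum principle gives.\<close>

type_synonym 'n fld = "complex => real^'n => real"

abbreviation transl_cauchy :: "'n::finite fld => (nat => real^'n) => (nat => nat) => real => bool" where
  "transl_cauchy F c r e \<equiv> \<exists>M. \<forall>m\<ge>M. \<forall>n\<ge>M. \<forall>\<tau> x. \<bar>F \<tau> (x + c (r m)) - F \<tau> (x + c (r n))\<bar> < e"

text \<open>Bochner's criterion for almost periodicity in \<open>x\<close>, uniformly in the
  parameter; in the Cauchy form no limit has to be named. Joint uniform continuity is demanded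
  separately, since compactness of the translates in \<open>x\<close> says nothing about
  \<tau>.\<close>

definition AC :: "'n::finite fld => bool" where
  "AC F \<longleftrightarrow> (\<exists>M. \<forall>\<tau> x. \<bar>F \<tau> x\<bar> <= M) \<and>
     (\<forall>e>0. \<exists>d>0. \<forall>\<tau> \<tau>' x x'. dist \<tau> \<tau>' < d --> dist x x' < d --> \<bar>F \<tau> x - F \<tau>' x'\<bar> < e) \<and>
     (\<forall>c::nat => real^'n. \<exists>r::nat=>nat. strict_mono r \<and>
        (\<forall>e>0. transl_cauchy F c r e))"

text \<open>\<open>None\<close> is the direction of the parameter \<open>Re \<tau>\<close>,
  \<open>Some i\<close> that of the i-th coordinate. The time \<open>Im \<tau>\<close> has no index:
  fields are never differentiated in it and are only continuous there.\<close>

fun shf :: "'n::finite option => real => 'n fld => 'n fld" where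
  "shf None s F = (%\<tau> x. F (\<tau> + of_real s) x)"
| "shf (Some i) s F = (%\<tau> x. F \<tau> (x + s *\<^sub>R axis i 1))"

definition D :: "'n::finite option => 'n fld => 'n fld" where
  "D i F = (%\<tau> x. deriv (%s. shf i s F \<tau> x) 0)"

definition hasD :: "'n::finite option => 'n fld => 'n fld => bool" where
  "hasD i F G \<longleftrightarrow> (\<forall>\<tau> x. ((%s. shf i s F \<tau> x) has_real_derivative G \<tau> x) (at 0))"

fun CC :: "nat => 'n::finite fld => bool" where
  "CC 0 F = AC F"
| "CC (Suc k) F = (AC F \<and> (\<forall>i. hasD i F (D i F) \<and> CC k (D i F)))"

definition smooth :: "'n::finite fld => bool" where "smooth F \<longleftrightarrow> (\<forall>k. CC k F)"

abbreviation cst :: "real => 'n::finite fld" where "cst c \<equiv> (%_ _. c)"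

lemma sum_fld_apply: "(\<Sum>i\<in>A. F i) \<tau> x = (\<Sum>i\<in>A. (F i :: 'n::finite fld) \<tau> x)"
  by (induction A rule: infinite_finite_induct) auto

lemma ACI:
  fixes F :: "'n::finite fld"
  assumes "\<exists>M. \<forall>\<tau> x. \<bar>F \<tau> x\<bar> <= M"
    and "\<And>e. e > 0 ==> \<exists>d>0. \<forall>\<tau> \<tau>' x x'. dist \<tau> \<tau>' < d --> dist x x' < d --> \<bar>F \<tau> x - F \<tau>' x'\<bar> < e"
    and "\<And>c::nat => real^'n. \<exists>r::nat=>nat. strict_mono r \<and>
        (\<forall>e>0. transl_cauchy F c r e)"
  shows "AC F"
  unfolding AC_def by (intro conjI allI impI assms)

lemma AC_bdd: "AC F ==> \<exists>M. \<forall>\<tau> x. \<bar>F \<tau> x\<bar> <= M"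
  unfolding AC_def by blast

lemma AC_bdd_pos: assumes "AC F" shows "\<exists>M>0. \<forall>\<tau> x. \<bar>F \<tau> x\<bar> <= M"
proof -
  obtain M where "\<And>\<tau> x. \<bar>F \<tau> x\<bar> <= M" using AC_bdd[OF assms] by blast
  then have "\<bar>F \<tau> x\<bar> <= max M 1" for \<tau> x by (meson max.cobounded1 order_trans)
  then show ?thesis by (intro exI[of _ "max M 1"]) simp
qed

lemma AC_ucont: "AC F ==> e > 0 ==> \<exists>d>0. \<forall>\<tau> \<tau>' x x'. dist \<tau> \<tau>' < d --> dist x x' < d --> \<bar>F \<tau> x - F \<tau>' x'\<bar> < e"
  unfolding AC_def by blast

lemma AC_seq: "AC F ==> \<exists>r::nat=>nat. strict_mono r \<and>
        (\<forall>e>0. transl_cauchy F c r e)"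
  unfolding AC_def by blast

lemma AC_seq2:
  assumes "AC F" "AC G"
  shows "\<exists>r::nat=>nat. strict_mono r \<and>
        (\<forall>e>0. transl_cauchy F c r e) \<and>
        (\<forall>e>0. transl_cauchy G c r e)"
proof -
  obtain r :: "nat => nat" where r: "strict_mono r" "\<forall>e>0. transl_cauchy F c r e"
    using AC_seq[OF assms(1), of c] by blast
  obtain q :: "nat => nat" where q: "strict_mono q" "\<forall>e>0. transl_cauchy G (c \<circ> r) q e"
    using AC_seq[OF assms(2), of "c \<circ> r"] by blast
  have "\<forall>e>0. transl_cauchy F c (r \<circ> q) e"
  proof (intro allI impI)
    fix e :: real assume "e > 0"
    then obtain M where M: "\<forall>m\<ge>M. \<forall>n\<ge>M. \<forall>\<tau> x. \<bar>F \<tau> (x + c (r m)) - F \<tau> (x + c (r n))\<bar> < e" using r(2)[rule_format] by blast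
    have "m >= M ==> q m >= M" for m using seq_suble[OF q(1), of m] by linarith
    then show "transl_cauchy F c (r \<circ> q) e"
      using M by (intro exI[of _ M]) simp
  qed
  then show ?thesis using q r strict_mono_o[OF r(1) q(1)] by (intro exI[of _ "r \<circ> q"]) (simp add: o_def)
qed

text \<open>Uniform continuity and the Cauchy clause speak of differences of values only, and
  boundedness follows by comparison with one fixed value. So \<open>AC\<close> passes to any
  \<open>H\<close> whose differences are controlled by those of \<open>F\<close> and
  \<open>G\<close>; this covers sums, differences and products.\<close>

lemma AC_lip2:
  assumes F: "AC F" and G: "AC G" and C: "C > 0"
    and L: "\<And>\<tau> x \<tau>' x'. \<bar>H \<tau> x - H \<tau>' x'\<bar> <= C * (\<bar>F \<tau> x - F \<tau>' x'\<bar> + \<bar>G \<tau> x - G \<tau>' x'\<bar>)"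
  shows "AC H"
proof -
  obtain MF where MF: "\<And>\<tau> x. \<bar>F \<tau> x\<bar> <= MF" using AC_bdd[OF F] by blast
  obtain MG where MG: "\<And>\<tau> x. \<bar>G \<tau> x\<bar> <= MG" using AC_bdd[OF G] by blast
  have "\<bar>H \<tau> x\<bar> <= \<bar>H 0 0\<bar> + C * (2*MF + 2*MG)" for \<tau> x
  proof -
    have "\<bar>F \<tau> x - F 0 0\<bar> + \<bar>G \<tau> x - G 0 0\<bar> <= 2*MF + 2*MG"
      using MF[of \<tau> x] MF[of 0 0] MG[of \<tau> x] MG[of 0 0] by linarith
    then have "C * (\<bar>F \<tau> x - F 0 0\<bar> + \<bar>G \<tau> x - G 0 0\<bar>) <= C * (2*MF + 2*MG)" using C by simp
    then show ?thesis using L[of \<tau> x 0 0] by linarith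
  qed
  moreover have "\<exists>d>0. \<forall>\<tau> \<tau>' x x'. dist \<tau> \<tau>' < d --> dist x x' < d --> \<bar>H \<tau> x - H \<tau>' x'\<bar> < e" if "e > 0" for e
  proof -
    have e: "e / (2*C) > 0" using C that by simp
    obtain d1 where d1: "d1>0" "\<forall>\<tau> \<tau>' x x'. dist \<tau> \<tau>' < d1 --> dist x x' < d1 --> \<bar>F \<tau> x - F \<tau>' x'\<bar> < e / (2*C)"
      using AC_ucont[OF F e] by blast
    obtain d2 where d2: "d2>0" "\<forall>\<tau> \<tau>' x x'. dist \<tau> \<tau>' < d2 --> dist x x' < d2 --> \<bar>G \<tau> x - G \<tau>' x'\<bar> < e / (2*C)"
      using AC_ucont[OF G e] by blast
    have "\<bar>H \<tau> x - H \<tau>' x'\<bar> < e" if "dist \<tau> \<tau>' < min d1 d2" "dist x x' < min d1 d2" for \<tau> \<tau>' x x'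
    proof -
      have "\<bar>F \<tau> x - F \<tau>' x'\<bar> + \<bar>G \<tau> x - G \<tau>' x'\<bar> < e / (2*C) + e/(2*C)"
        using d1(2) d2(2) that by (intro add_strict_mono) auto
      then have "C * (\<bar>F \<tau> x - F \<tau>' x'\<bar> + \<bar>G \<tau> x - G \<tau>' x'\<bar>) < C * (e / (2*C) + e/(2*C))" using C by (intro mult_strict_left_mono)
      also have "\<dots> = e" using C by (simp add: field_simps)
      finally show ?thesis using L[of \<tau> x \<tau>' x'] by linarith
    qed
    then show ?thesis using d1 d2 by (intro exI[of _ "min d1 d2"]) auto
  qed
  moreover have "\<exists>r::nat=>nat. strict_mono r \<and>
        (\<forall>e>0. transl_cauchy H c r e)" for c
  proof -
    obtain r :: "nat => nat" where r: "strict_mono r"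
       "\<forall>e>0. transl_cauchy F c r e"
       "\<forall>e>0. transl_cauchy G c r e"
      using AC_seq2[OF F G, of c] by blast
    have "transl_cauchy H c r e" if "e > 0" for e
    proof -
      have e: "e / (2*C) > 0" using C that by simp
      obtain M1 where M1: "\<forall>m\<ge>M1. \<forall>n\<ge>M1. \<forall>\<tau> x. \<bar>F \<tau> (x + c (r m)) - F \<tau> (x + c (r n))\<bar> < e/(2*C)" using r(2)[rule_format, OF e] by blast
      obtain M2 where M2: "\<forall>m\<ge>M2. \<forall>n\<ge>M2. \<forall>\<tau> x. \<bar>G \<tau> (x + c (r m)) - G \<tau> (x + c (r n))\<bar> < e/(2*C)" using r(3)[rule_format, OF e] by blast
      have "\<bar>H \<tau> (x + c (r m)) - H \<tau> (x + c (r n))\<bar> < e" if "m >= max M1 M2" "n >= max M1 M2" for m n \<tau> x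
      proof -
        have "\<bar>F \<tau> (x + c (r m)) - F \<tau> (x + c (r n))\<bar> + \<bar>G \<tau> (x + c (r m)) - G \<tau> (x + c (r n))\<bar> < e / (2*C) + e/(2*C)"
          using M1 M2 that by (intro add_strict_mono) auto
        then have "C * (\<bar>F \<tau> (x + c (r m)) - F \<tau> (x + c (r n))\<bar> + \<bar>G \<tau> (x + c (r m)) - G \<tau> (x + c (r n))\<bar>) < C * (e / (2*C) + e/(2*C))" using C by (intro mult_strict_left_mono)
        also have "\<dots> = e" using C by (simp add: field_simps)
        finally show ?thesis using L[of \<tau> "x + c (r m)" \<tau> "x + c (r n)"] by linarith
      qed
      then show ?thesis by blast
    qed
    then show ?thesis using r(1) by blast
  qed
  ultimately show ?thesis by (intro ACI) blast+
qed

lemma AC_cst [simp, intro]: "AC (cst c)"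
proof (rule ACI)
  show "\<exists>d>0. \<forall>\<tau> \<tau>' x x'. dist \<tau> \<tau>' < d --> dist x x' < d --> \<bar>c - c\<bar> < e" if "e > 0" for e
    using that by (intro exI[of _ 1]) simp
  show "\<exists>r::nat=>nat. strict_mono r \<and> (\<forall>e>0. \<exists>M. \<forall>m\<ge>M. \<forall>n\<ge>M. \<forall>\<tau> x. \<bar>c - c\<bar> < e)"
    by (intro exI[of _ "%n. n"]) (simp add: strict_mono_def)
qed auto

lemma AC_add: "AC F ==> AC G ==> AC (F + G)"
  by (rule AC_lip2[of F G 1]) auto

lemma AC_mult: assumes "AC F" "AC G" shows "AC (F * G)"
proof -
  obtain MF where MF: "MF > 0" "\<And>\<tau> x. \<bar>F \<tau> x\<bar> <= MF" using AC_bdd_pos[OF assms(1)] by blast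
  obtain MG where MG: "MG > 0" "\<And>\<tau> x. \<bar>G \<tau> x\<bar> <= MG" using AC_bdd_pos[OF assms(2)] by blast
  show ?thesis
  proof (rule AC_lip2[OF assms, of "MF + MG"])
    fix \<tau> x \<tau>' x'
    have "(F * G) \<tau> x - (F * G) \<tau>' x' = F \<tau> x * (G \<tau> x - G \<tau>' x') + G \<tau>' x' * (F \<tau> x - F \<tau>' x')"
      by (simp add: algebra_simps)
    then have "\<bar>(F * G) \<tau> x - (F * G) \<tau>' x'\<bar> <= \<bar>F \<tau> x\<bar> * \<bar>G \<tau> x - G \<tau>' x'\<bar> + \<bar>G \<tau>' x'\<bar> * \<bar>F \<tau> x - F \<tau>' x'\<bar>"
      by (metis abs_mult abs_triangle_ineq)
    also have "\<dots> <= (MF+MG) * \<bar>G \<tau> x - G \<tau>' x'\<bar> + (MF+MG) * \<bar>F \<tau> x - F \<tau>' x'\<bar>"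
    proof (intro add_mono mult_right_mono)
      show "\<bar>F \<tau> x\<bar> <= MF + MG" using MF(2)[of \<tau> x] MG(1) by linarith
      show "\<bar>G \<tau>' x'\<bar> <= MF + MG" using MG(2)[of \<tau>' x'] MF(1) by linarith
    qed auto
    finally show "\<bar>(F * G) \<tau> x - (F * G) \<tau>' x'\<bar> <= (MF+MG) * (\<bar>F \<tau> x - F \<tau>' x'\<bar> + \<bar>G \<tau> x - G \<tau>' x'\<bar>)"
      by (simp add: algebra_simps)
  qed (use MF MG in auto)
qed

section \<open>Uniform limits of fields\<close>

definition uconv :: "(nat => 'n::finite fld) => 'n fld => bool" where
  "uconv Fn F \<longleftrightarrow> (\<forall>e>0. \<exists>M. \<forall>n\<ge>M. \<forall>\<tau> x. \<bar>Fn n \<tau> x - F \<tau> x\<bar> < e)"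

definition ucauchy :: "(nat => 'n::finite fld) => bool" where
  "ucauchy Fn \<longleftrightarrow> (\<forall>e>0. \<exists>M. \<forall>m\<ge>M. \<forall>n\<ge>M. \<forall>\<tau> x. \<bar>Fn m \<tau> x - Fn n \<tau> x\<bar> < e)"

text \<open>Compactness of translates needs a diagonal sequence: the n-th requirement is the Cauchy
  property with precision \<open>1 / Suc n\<close>, met by approximating \<open>F\<close> by one
  member \<open>Fn j\<close> and extracting a subsequence for that member.\<close>

lemma AC_uconv:
  assumes A: "\<And>n. AC (Fn n)" and U: "uconv Fn F"
  shows "AC F"
proof -
  have U': "\<exists>n. \<forall>\<tau> x. \<bar>Fn n \<tau> x - F \<tau> x\<bar> < e" if "e > 0" for e using U that unfolding uconv_def by blast
  obtain n where n: "\<forall>\<tau> x. \<bar>Fn n \<tau> x - F \<tau> x\<bar> < 1" using U'[of 1] by auto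
  obtain M where M: "\<And>\<tau> x. \<bar>Fn n \<tau> x\<bar> <= M" using AC_bdd[OF A] by blast
  have "\<bar>F \<tau> x\<bar> <= M + 1" for \<tau> x using n[rule_format, of \<tau> x] M[of \<tau> x] by linarith
  moreover have "\<exists>d>0. \<forall>\<tau> \<tau>' x x'. dist \<tau> \<tau>' < d --> dist x x' < d --> \<bar>F \<tau> x - F \<tau>' x'\<bar> < e" if e: "e > 0" for e
  proof -
    obtain n where n: "\<forall>\<tau> x. \<bar>Fn n \<tau> x - F \<tau> x\<bar> < e/3" using U'[of "e/3"] e by auto
    obtain d where d: "d>0" "\<forall>\<tau> \<tau>' x x'. dist \<tau> \<tau>' < d --> dist x x' < d --> \<bar>Fn n \<tau> x - Fn n \<tau>' x'\<bar> < e/3"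
      using AC_ucont[OF A[of n], of "e/3"] e by auto
    have "\<bar>F \<tau> x - F \<tau>' x'\<bar> < e" if "dist \<tau> \<tau>' < d" "dist x x' < d" for \<tau> \<tau>' x x'
    proof -
      have "\<bar>Fn n \<tau> x - Fn n \<tau>' x'\<bar> < e/3" using d that by blast
      then show ?thesis using n[rule_format, of \<tau> x] n[rule_format, of \<tau>' x'] by linarith
    qed
    then show ?thesis using d(1) by blast
  qed
  moreover have "\<exists>r::nat=>nat. strict_mono r \<and>
        (\<forall>e>0. transl_cauchy F c r e)" for c :: "nat => real^'a"
  proof -
    define P where "P n (s::nat => nat) \<longleftrightarrow> (\<exists>M. \<forall>k\<ge>M. \<forall>l\<ge>M. \<forall>\<tau> x. \<bar>F \<tau> (x + c (s k)) - F \<tau> (x + c (s l))\<bar> < 1 / real (Suc n))" for n s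
    interpret subseqs P
    proof
      fix n and s :: "nat => nat" assume s: "strict_mono s"
      obtain j where j: "\<forall>\<tau> x. \<bar>Fn j \<tau> x - F \<tau> x\<bar> < 1/(3 * real (Suc n))" using U'[of "1/(3 * real (Suc n))"] by auto
      obtain r :: "nat => nat" where r: "strict_mono r" "\<forall>e>0. \<exists>M. \<forall>k\<ge>M. \<forall>l\<ge>M. \<forall>\<tau> x. \<bar>Fn j \<tau> (x + (c\<circ>s) (r k)) - Fn j \<tau> (x + (c\<circ>s) (r l))\<bar> < e"
        using AC_seq[OF A[of j], of "c \<circ> s"] by blast
      have e: "1/(3 * real (Suc n)) > 0" by simp
      obtain M where M: "\<forall>k\<ge>M. \<forall>l\<ge>M. \<forall>\<tau> x. \<bar>Fn j \<tau> (x + (c\<circ>s) (r k)) - Fn j \<tau> (x + (c\<circ>s) (r l))\<bar> < 1/(3 * real (Suc n))"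
        using r(2)[THEN spec, THEN mp, OF e] by blast
      have "\<bar>F \<tau> (x + c ((s\<circ>r) k)) - F \<tau> (x + c ((s\<circ>r) l))\<bar> < 1 / real (Suc n)" if "k >= M" "l >= M" for k l \<tau> x
      proof -
        have 1: "\<bar>Fn j \<tau> (x + c (s (r k))) - Fn j \<tau> (x + c (s (r l)))\<bar> < 1/(3 * real (Suc n))"
          using M that by (simp add: o_def)
        have 2: "1 / real (Suc n) = 1/(3 * real (Suc n)) + 1/(3 * real (Suc n)) + 1/(3 * real (Suc n))" by (simp add: field_simps)
        show ?thesis unfolding 2 using 1 j[rule_format, of \<tau> "x + c (s (r k))"] j[rule_format, of \<tau> "x + c (s (r l))"]
          unfolding o_def by linarith
      qed
      then have "P n (s \<circ> r)" unfolding P_def by blast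
      then show "\<exists>r'. strict_mono r' \<and> P n (s \<circ> r')" using r(1) by blast
    qed
    have Pd': "P n (diagseq \<circ> (+) (Suc n))" for n
    proof (rule diagseq_holds)
      fix n and r s :: "nat => nat" assume "strict_mono r" and "P n s"
      then obtain M where M: "\<forall>k\<ge>M. \<forall>l\<ge>M. \<forall>\<tau> x. \<bar>F \<tau> (x + c (s k)) - F \<tau> (x + c (s l))\<bar> < 1 / real (Suc n)"
        unfolding P_def by blast
      have "m >= M ==> r m >= M" for m using seq_suble[OF \<open>strict_mono r\<close>, of m] by linarith
      then show "P n (s \<circ> r)" using M unfolding P_def by (intro exI[of _ M]) simp
    qed
    \<comment> \<open>So far the property holds after the first n + 1 terms are dropped; a Cauchy
      property is insensitive to that.\<close>
    have Pd: "P n diagseq" for n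
    proof -
      obtain M where M: "\<And>k l \<tau> x. k >= M ==> l >= M ==> \<bar>F \<tau> (x + c (diagseq (Suc n + k))) - F \<tau> (x + c (diagseq (Suc n + l)))\<bar> < 1 / real (Suc n)"
        using Pd'[of n] unfolding P_def o_def by blast
      have "\<bar>F \<tau> (x + c (diagseq k)) - F \<tau> (x + c (diagseq l))\<bar> < 1 / real (Suc n)" if "k >= M + Suc n" "l >= M + Suc n" for k l \<tau> x
        using M[of "k - Suc n" "l - Suc n" \<tau> x] that by simp
      then show ?thesis unfolding P_def by blast
    qed
    have "transl_cauchy F c diagseq e" if e: "e > 0" for e
    proof -
      obtain n where "1 / real (Suc n) < e" using reals_Archimedean[OF e] by (auto simp: field_simps)
      then show ?thesis using Pd[of n] unfolding P_def by (meson order_less_trans)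
    qed
    then show ?thesis using subseq_diagseq by blast
  qed
  ultimately show ?thesis by (intro ACI) blast+
qed

section \<open>Partial derivatives and smoothness\<close>

lemma hasD_D: "hasD i F G ==> D i F = G"
  unfolding hasD_def D_def by (intro ext) (auto intro: DERIV_imp_deriv)

lemma hasD_at:
  assumes "hasD i F G"
  shows "((%s. shf i s F \<tau> x) has_real_derivative shf i s0 G \<tau> x) (at s0)"
proof (cases i)
  case None
  have "((%s. shf None s F (\<tau> + of_real s0) x) has_real_derivative G (\<tau> + of_real s0) x) (at 0)"
    using assms None unfolding hasD_def by blast
  moreover have "(%s. shf None s F (\<tau> + of_real s0) x) = (%s. shf None (s + s0) F \<tau> x)"
    by (simp add: add_ac)
  ultimately show ?thesis using None DERIV_shift[of "%s. shf None s F \<tau> x" _ 0 s0] by simp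
next
  case (Some j)
  have "((%s. shf (Some j) s F \<tau> (x + s0 *\<^sub>R axis j 1)) has_real_derivative G \<tau> (x + s0 *\<^sub>R axis j 1)) (at 0)"
    using assms Some unfolding hasD_def by blast
  moreover have "(%s. shf (Some j) s F \<tau> (x + s0 *\<^sub>R axis j 1)) = (%s. shf (Some j) (s + s0) F \<tau> x)"
    by (simp add: algebra_simps)
  ultimately show ?thesis using Some DERIV_shift[of "%s. shf (Some j) s F \<tau> x" _ 0 s0] by simp
qed

lemma shf_0 [simp]: "shf i 0 F = F" by (cases i) auto

lemma shf_add: "shf i s (F + G) \<tau> x = shf i s F \<tau> x + shf i s G \<tau> x" by (cases i) auto
lemma shf_mult: "shf i s (F * G) \<tau> x = shf i s F \<tau> x * shf i s G \<tau> x" by (cases i) auto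
lemma shf_cst: "shf i s (cst c) = cst c" by (cases i) auto

lemma shf_commute: "shf i s (shf j t F) = shf j t (shf i s F)"
  by (cases i; cases j) (auto simp: algebra_simps)

lemma shf_app: "\<exists>\<tau>' x'. \<forall>F. shf i s F \<tau> x = F \<tau>' x'"
  by (cases i) (auto intro: exI[of _ \<tau>])

lemma hasD_cst: "hasD i (cst c) (cst 0)" unfolding hasD_def by (auto simp: shf_cst)

lemma hasD_add: "hasD i F F' ==> hasD i G G' ==> hasD i (F + G) (F' + G')"
  unfolding hasD_def shf_add by (auto intro!: derivative_eq_intros)

lemma hasD_mult: "hasD i F F' ==> hasD i G G' ==> hasD i (F * G) (F' * G + F * G')"
  unfolding hasD_def shf_mult by (auto intro!: derivative_eq_intros)

lemma CC_SucI:
  assumes "AC F" "\<And>i. hasD i F (G i)" "\<And>i. CC k (G i)"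
  shows "CC (Suc k) F"
  using assms hasD_D[OF assms(2)] by auto

lemma CC_AC: "CC k F ==> AC F" by (cases k) auto

lemma CC_Suc_CC: "CC (Suc k) F ==> CC k F"
  by (induction k arbitrary: F) auto

lemma CC_cst: "CC k (cst c)"
proof (induction k arbitrary: c)
  case (Suc k) show ?case by (rule CC_SucI[OF AC_cst hasD_cst Suc])
qed auto

lemma CC_add: "CC k F ==> CC k G ==> CC k (F + G)"
proof (induction k arbitrary: F G)
  case (Suc k)
  have F: "AC F" "\<And>i. hasD i F (D i F)" "\<And>i. CC k (D i F)" and G: "AC G" "\<And>i. hasD i G (D i G)" "\<And>i. CC k (D i G)"
    using Suc.prems by auto
  show ?case
    by (rule CC_SucI[where G="%i. D i F + D i G", OF AC_add[OF F(1) G(1)] hasD_add[OF F(2) G(2)] Suc.IH[OF F(3) G(3)]])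
qed (simp only: CC.simps AC_add)

lemma CC_mult: "CC k F ==> CC k G ==> CC k (F * G)"
proof (induction k arbitrary: F G)
  case (Suc k)
  have F: "AC F" "\<And>i. hasD i F (D i F)" "\<And>i. CC k (D i F)" and G: "AC G" "\<And>i. hasD i G (D i G)" "\<And>i. CC k (D i G)"
    using Suc.prems by auto
  have "CC k F" "CC k G" using Suc.prems by (auto simp del: CC.simps dest: CC_Suc_CC)
  then show ?case
    by (intro CC_SucI[where G="%i. D i F * G + F * D i G", OF AC_mult[OF F(1) G(1)] hasD_mult[OF F(2) G(2)]]
      CC_add Suc.IH F(3) G(3))
qed (simp only: CC.simps AC_mult)

lemma smooth_AC: "smooth F ==> AC F" unfolding smooth_def using CC_AC by blast
lemma smooth_hasD: "smooth F ==> hasD i F (D i F)" unfolding smooth_def by (meson CC.simps(2))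
lemma smooth_D: "smooth F ==> smooth (D i F)" unfolding smooth_def by (meson CC.simps(2))
lemma smooth_cst: "smooth (cst c)" unfolding smooth_def using CC_cst by blast
lemma smooth_add: "smooth F ==> smooth G ==> smooth (F + G)" unfolding smooth_def using CC_add by blast
lemma smooth_mult: "smooth F ==> smooth G ==> smooth (F * G)" unfolding smooth_def using CC_mult by blast
lemma smooth_0: "smooth 0" using smooth_cst[of 0] by (simp add: zero_fun_def)
lemma fld_uminus: "- F = cst (-1) * (F :: 'n::finite fld)" by (intro ext) simp
lemma smooth_uminus: "smooth F ==> smooth (- F)" unfolding fld_uminus by (intro smooth_mult smooth_cst)
lemma smooth_diff: "smooth F ==> smooth G ==> smooth (F - G)" using smooth_add[OF _ smooth_uminus, of F G] by simp
lemma smooth_sum: "(\<And>i. i \<in> A ==> smooth (F i)) ==> smooth (\<Sum>i\<in>A. F i)"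
  by (induction A rule: infinite_finite_induct) (auto intro: smooth_0 smooth_add)
lemmas smooth_intros = smooth_D smooth_cst smooth_0 smooth_add smooth_mult smooth_uminus smooth_diff smooth_sum

text \<open>\<open>smooth\<close> is the largest class of \<open>AC\<close> fields closed under all
  derivatives, so any invariant \<open>P\<close> of this kind is contained in it. Below,
  \<open>P\<close> describes fields of one shape: limits, images under an operator,
  compositions.\<close>

lemma smoothI_coind:
  assumes "P F" and A: "\<And>F. P F ==> AC F" and S: "\<And>F i. P F ==> hasD i F (D i F) \<and> P (D i F)"
  shows "smooth F"
proof -
  have "P F ==> CC k F" for k F by (induction k arbitrary: F) (use A S in auto)
  then show ?thesis using assms(1) unfolding smooth_def by blast
qed

lemma D_cst: "D i (cst c) = 0" using hasD_D[OF hasD_cst] by (simp add: zero_fun_def)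
lemma D_0: "D i 0 = 0" using D_cst[of i 0] by (simp add: zero_fun_def)
lemma D_add: "smooth F ==> smooth G ==> D i (F + G) = D i F + D i G" by (intro hasD_D hasD_add smooth_hasD)
lemma D_mult: "smooth F ==> smooth G ==> D i (F * G) = D i F * G + F * D i G" by (intro hasD_D hasD_mult smooth_hasD)
lemma D_cmult: "smooth F ==> D i (cst c * F) = cst c * D i F" using D_mult[OF smooth_cst, of F i c] by (simp add: D_cst)
lemma D_uminus: "smooth F ==> D i (- F) = - D i F" unfolding fld_uminus by (rule D_cmult)
lemma D_diff: "smooth F ==> smooth G ==> D i (F - G) = D i F - D i G"
  using D_add[OF _ smooth_uminus, of F G i] by (simp add: D_uminus)
lemma D_sum: "(\<And>j. j \<in> A ==> smooth (F j)) ==> D i (\<Sum>j\<in>A. F j) = (\<Sum>j\<in>A. D i (F j))"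
  by (induction A rule: infinite_finite_induct) (auto simp: D_0 D_add smooth_sum)

lemma hasD_shf: "hasD i F G ==> hasD i (shf j t F) (shf j t G)"
  unfolding hasD_def
proof (intro allI)
  fix \<tau> x
  assume a: "\<forall>\<tau> x. ((%s. shf i s F \<tau> x) has_real_derivative G \<tau> x) (at 0)"
  obtain \<tau>' x' where b: "\<And>F. shf j t F \<tau> x = F \<tau>' x'" using shf_app[of j t \<tau> x] by blast
  show "((%s. shf i s (shf j t F) \<tau> x) has_real_derivative shf j t G \<tau> x) (at 0)"
    using a unfolding shf_commute[of i _ j t F] b by blast
qed

text \<open>Both mixed derivatives are limits of one second difference over a square of side
  \<open>h\<close>: the mean value theorem, applied twice in either order, turns it into
  \<open>h * h\<close> times a value of one or the other at a nearby point.\<close>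

lemma D_commute:
  assumes "smooth F" shows "D i (D j F) = D j (D i F)"
proof (intro ext)
  fix \<tau> x
  have key: "\<exists>s t. 0 < s \<and> s < h \<and> 0 < t \<and> t < h \<and>
     shf i h (shf j h F) \<tau> x - shf i h F \<tau> x - shf j h F \<tau> x + F \<tau> x = h * h * shf j t (shf i s (D j (D i F))) \<tau> x"
    if h: "h > 0" for i j h
  proof -
    have 1: "((%s. shf i s (shf j h F) \<tau> x - shf i s F \<tau> x) has_real_derivative
        shf i s (shf j h (D i F)) \<tau> x - shf i s (D i F) \<tau> x) (at s)" for s
      by (intro derivative_intros hasD_at hasD_shf smooth_hasD assms)
    obtain s where s: "0 < s" "s < h" "(shf i h (shf j h F) \<tau> x - shf i h F \<tau> x) - (shf i 0 (shf j h F) \<tau> x - shf i 0 F \<tau> x)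
       = (h - 0) * (shf i s (shf j h (D i F)) \<tau> x - shf i s (D i F) \<tau> x)"
      using MVT2[OF h, of "%s. shf i s (shf j h F) \<tau> x - shf i s F \<tau> x" "%s. shf i s (shf j h (D i F)) \<tau> x - shf i s (D i F) \<tau> x"] 1 by blast
    have 2: "((%t. shf j t (shf i s (D i F)) \<tau> x) has_real_derivative shf j t (shf i s (D j (D i F))) \<tau> x) (at t)" for t
      by (intro hasD_at hasD_shf smooth_hasD smooth_D assms)
    obtain t where t: "0 < t" "t < h" "shf j h (shf i s (D i F)) \<tau> x - shf j 0 (shf i s (D i F)) \<tau> x = (h - 0) * shf j t (shf i s (D j (D i F))) \<tau> x"
      using MVT2[OF h, of "%t. shf j t (shf i s (D i F)) \<tau> x" "%t. shf j t (shf i s (D j (D i F))) \<tau> x"] 2 by blast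
    show ?thesis
    proof (rule exI[of _ s], rule exI[of _ t], intro conjI)
      have "shf i s (shf j h (D i F)) \<tau> x - shf i s (D i F) \<tau> x = h * shf j t (shf i s (D j (D i F))) \<tau> x"
        using t(3) by (simp add: shf_commute[of i s j h])
      then show "shf i h (shf j h F) \<tau> x - shf i h F \<tau> x - shf j h F \<tau> x + F \<tau> x = h * h * shf j t (shf i s (D j (D i F))) \<tau> x"
        using s(3) by simp
    qed (use s t in auto)
  qed
  have close: "\<exists>d>0. \<forall>s t. 0 < s \<and> s < d \<and> 0 < t \<and> t < d --> \<bar>shf j t (shf i s G) \<tau> x - G \<tau> x\<bar> < e"
    if "AC G" "e > 0" for e G i j
  proof -
    obtain d where d: "d>0" "\<And>\<tau> \<tau>' x x'. dist \<tau> \<tau>' < d ==> dist x x' < d ==> \<bar>G \<tau> x - G \<tau>' x'\<bar> < e"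
      using AC_ucont[OF \<open>AC G\<close> \<open>e>0\<close>] by blast
    have "\<bar>shf j t (shf i s G) \<tau> x - G \<tau> x\<bar> < e" if st: "0 < s" "s < d/2" "0 < t" "t < d/2" for s t
    proof -
      have "norm (s *\<^sub>R axis k (1::real) + t *\<^sub>R axis l 1 :: real^'a) < d" for k l
        using norm_triangle_ineq[of "s *\<^sub>R axis k (1::real) :: real^'a" "t *\<^sub>R axis l 1"] st by (auto simp: norm_axis_1)
      moreover have "norm (complex_of_real s + of_real t) < d"
        unfolding of_real_add[symmetric] norm_of_real using st by auto
      ultimately show ?thesis
        by (cases i; cases j) (auto intro!: d(2) simp: dist_norm algebra_simps st d(1), (use st d in \<open>simp_all add: algebra_simps\<close>)?)
    qed
    then show ?thesis using d(1) by (intro exI[of _ "d/2"]) auto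
  qed
  have A: "AC (D i (D j F))" "AC (D j (D i F))" by (intro smooth_AC smooth_D assms)+
  have "\<bar>D i (D j F) \<tau> x - D j (D i F) \<tau> x\<bar> <= e" if e: "e > 0" for e
  proof -
    obtain d1 where d1: "d1>0" "\<forall>s t. 0 < s \<and> s < d1 \<and> 0 < t \<and> t < d1 --> \<bar>shf j t (shf i s (D j (D i F))) \<tau> x - D j (D i F) \<tau> x\<bar> < e/2"
      using close[OF A(2), of "e/2" j i] half_gt_zero[OF e] by blast
    obtain d2 where d2: "d2>0" "\<forall>s t. 0 < s \<and> s < d2 \<and> 0 < t \<and> t < d2 --> \<bar>shf i t (shf j s (D i (D j F))) \<tau> x - D i (D j F) \<tau> x\<bar> < e/2"
      using close[OF A(1), of "e/2" i j] half_gt_zero[OF e] by blast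
    define h where "h = min d1 d2"
    have h: "h > 0" using d1 d2 by (simp add: h_def)
    obtain s t where st: "0 < s" "s < h" "0 < t" "t < h"
     "shf i h (shf j h F) \<tau> x - shf i h F \<tau> x - shf j h F \<tau> x + F \<tau> x = h * h * shf j t (shf i s (D j (D i F))) \<tau> x"
      using key[OF h, of i j] by blast
    obtain s' t' where st': "0 < s'" "s' < h" "0 < t'" "t' < h"
     "shf j h (shf i h F) \<tau> x - shf j h F \<tau> x - shf i h F \<tau> x + F \<tau> x = h * h * shf i t' (shf j s' (D i (D j F))) \<tau> x"
      using key[OF h, of j i] by blast
    have "h * h * shf j t (shf i s (D j (D i F))) \<tau> x = h * h * shf i t' (shf j s' (D i (D j F))) \<tau> x"
      using st(5) st'(5) unfolding shf_commute[of i h j h F] by linarith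
    then have "shf j t (shf i s (D j (D i F))) \<tau> x = shf i t' (shf j s' (D i (D j F))) \<tau> x" using h by simp
    moreover have "\<bar>shf j t (shf i s (D j (D i F))) \<tau> x - D j (D i F) \<tau> x\<bar> < e/2" using d1(2) st by (simp add: h_def)
    moreover have "\<bar>shf i t' (shf j s' (D i (D j F))) \<tau> x - D i (D j F) \<tau> x\<bar> < e/2" using d2(2) st' by (simp add: h_def)
    ultimately show ?thesis by linarith
  qed
  then have "\<bar>D i (D j F) \<tau> x - D j (D i F) \<tau> x\<bar> <= 0" by (rule field_le_epsilon) simp
  then show "D i (D j F) \<tau> x = D j (D i F) \<tau> x" by simp
qed

section \<open>Iterated derivatives and completeness\<close>

fun DL :: "'n::finite option list => 'n fld => 'n fld" where
  "DL [] F = F"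
| "DL (i # is) F = DL is (D i F)"

lemma smooth_DL: "smooth F ==> smooth (DL is F)"
  by (induction "is" arbitrary: F) (auto intro: smooth_D)

lemma DL_diff: "smooth F ==> smooth G ==> DL is (F - G) = DL is F - DL is G"
  by (induction "is" arbitrary: F G) (auto simp: D_diff intro: smooth_D)

lemma uconv_tendsto: "uconv Fn F ==> (%n. Fn n \<tau> x) \<longlonglongrightarrow> F \<tau> x"
  unfolding uconv_def LIMSEQ_def dist_real_def by blast

lemma ucauchy_uconv: assumes "ucauchy Fn" shows "uconv Fn (%\<tau> x. lim (%n. Fn n \<tau> x))"
proof -
  have l: "(%n. Fn n \<tau> x) \<longlonglongrightarrow> lim (%n. Fn n \<tau> x)" for \<tau> x
  proof -
    have "Cauchy (%n. Fn n \<tau> x)" using assms unfolding ucauchy_def Cauchy_def dist_real_def by meson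
    then show ?thesis using Cauchy_convergent convergent_LIMSEQ_iff by blast
  qed
  show ?thesis unfolding uconv_def
  proof (intro allI impI)
    fix e :: real assume e: "e > 0"
    then obtain M where M: "\<forall>m\<ge>M. \<forall>n\<ge>M. \<forall>\<tau> x. \<bar>Fn m \<tau> x - Fn n \<tau> x\<bar> < e/2" using assms half_gt_zero unfolding ucauchy_def by blast
    have "\<bar>Fn n \<tau> x - lim (%n. Fn n \<tau> x)\<bar> <= e/2" if "n >= M" for n \<tau> x
    proof (rule tendsto_upperbound)
      show "((%m. \<bar>Fn n \<tau> x - Fn m \<tau> x\<bar>) \<longlongrightarrow> \<bar>Fn n \<tau> x - lim (%n. Fn n \<tau> x)\<bar>) sequentially"
        by (intro tendsto_intros l)
      show "\<forall>\<^sub>F m in sequentially. \<bar>Fn n \<tau> x - Fn m \<tau> x\<bar> <= e/2"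
        using M that by (intro eventually_sequentiallyI[of M]) (simp add: less_imp_le)
    qed auto
    moreover have "e/2 < e" using e by simp
    ultimately show "\<exists>M. \<forall>n\<ge>M. \<forall>\<tau> x. \<bar>Fn n \<tau> x - lim (%n. Fn n \<tau> x)\<bar> < e"
      by (meson le_less_trans)
  qed
qed

lemma hasD_limit:
  assumes "\<And>n. hasD i (Fn n) (Gn n)" "uconv Gn G" "\<And>\<tau> x. (%n. Fn n \<tau> x) \<longlonglongrightarrow> F \<tau> x"
  shows "hasD i F G"
  unfolding hasD_def
proof (intro allI)
  fix \<tau> x
  have 1: "((%s. shf i s (Fn n) \<tau> x) has_derivative (%h. shf i s (Gn n) \<tau> x * h)) (at s within UNIV)" for n s
    using hasD_at[OF assms(1)] by (simp add: has_field_derivative_def)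
  have 2: "\<forall>\<^sub>F n in sequentially. \<forall>s\<in>UNIV. \<forall>h. norm (shf i s (Gn n) \<tau> x * h - shf i s G \<tau> x * h) <= e * norm h"
    if "e > 0" for e
  proof -
    obtain M where M: "\<forall>n\<ge>M. \<forall>\<tau> x. \<bar>Gn n \<tau> x - G \<tau> x\<bar> < e" using assms(2) \<open>e > 0\<close> unfolding uconv_def by blast
    have "norm (shf i s (Gn n) \<tau> x * h - shf i s G \<tau> x * h) <= e * norm h" if "n >= M" for n s h
    proof -
      have "\<bar>shf i s (Gn n) \<tau> x - shf i s G \<tau> x\<bar> <= e"
        using shf_app[of i s \<tau> x] M[rule_format, OF that] by (metis less_imp_le)
      then have "\<bar>shf i s (Gn n) \<tau> x - shf i s G \<tau> x\<bar> * \<bar>h\<bar> <= e * \<bar>h\<bar>" by (intro mult_right_mono) auto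
      then show ?thesis by (simp add: left_diff_distrib[symmetric] abs_mult)
    qed
    then show ?thesis unfolding eventually_sequentially by blast
  qed
  have 3: "(%n. shf i 0 (Fn n) \<tau> x) \<longlonglongrightarrow> F \<tau> x" using assms(3) by simp
  have "\<exists>g. \<forall>s\<in>UNIV. (%n. shf i s (Fn n) \<tau> x) \<longlonglongrightarrow> g s \<and> (g has_derivative (%h. shf i s G \<tau> x * h)) (at s within UNIV)"
    by (rule has_derivative_sequence[where f' = "%n s h. shf i s (Gn n) \<tau> x * h", OF convex_UNIV 1 2 UNIV_I 3])
  then obtain g where g: "\<And>s. (%n. shf i s (Fn n) \<tau> x) \<longlonglongrightarrow> g s" "\<And>s. (g has_derivative (%h. shf i s G \<tau> x * h)) (at s)" by auto
  have "(%n. shf i s (Fn n) \<tau> x) \<longlonglongrightarrow> shf i s F \<tau> x" for s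
    using shf_app[of i s \<tau> x] assms(3) by fastforce
  then have "g = (%s. shf i s F \<tau> x)" using g(1) LIMSEQ_unique by blast
  then show "((%s. shf i s F \<tau> x) has_real_derivative G \<tau> x) (at 0)" using g(2)[of 0] by (simp add: has_field_derivative_def)
qed

text \<open>Completeness for uniform convergence of all derivatives. The invariant \<open>P\<close>
  of the coinduction is to be the uniform limit of such a Cauchy sequence; termwise differentiation
  preserves it.\<close>

lemma smooth_complete:
  assumes "\<And>n. smooth (Fn n)" and "\<And>is. ucauchy (%n. DL is (Fn n))"
  defines "L \<equiv> %\<tau> x. lim (%n. Fn n \<tau> x)"
  shows "smooth L" "\<And>is. uconv (%n. DL is (Fn n)) (DL is L)"
proof -
  define P where "P L \<longleftrightarrow> (\<exists>Fn. (\<forall>n. smooth (Fn n)) \<and> (\<forall>is. ucauchy (%n. DL is (Fn n))) \<and> uconv Fn L)" for L :: "'a fld"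
  have step: "hasD i F (D i F) \<and> uconv (%n. D i (Fn n)) (D i F)"
    if F: "\<And>n. smooth (Fn n)" "\<And>is. ucauchy (%n. DL is (Fn n))" "uconv Fn F" for F i Fn
  proof -
    have u: "uconv (%n. D i (Fn n)) (%\<tau> x. lim (%n. D i (Fn n) \<tau> x))" (is "uconv _ ?G")
      using ucauchy_uconv[OF F(2)[of "[i]"]] by simp
    have "hasD i F ?G" by (rule hasD_limit[OF smooth_hasD[OF F(1)] u uconv_tendsto[OF F(3)]])
    then show ?thesis using u hasD_D by metis
  qed
  have c0: "uconv Fn L" unfolding L_def using ucauchy_uconv[OF assms(2)[of "[]"]] by simp
  have "P L" unfolding P_def using assms(1,2) c0 by blast
  then show "smooth L"
  proof (rule smoothI_coind)
    show "P F ==> AC F" for F unfolding P_def using AC_uconv smooth_AC by blast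
    fix F i assume "P F"
    then obtain Fn where F: "\<And>n. smooth (Fn n)" "\<And>is. ucauchy (%n. DL is (Fn n))" "uconv Fn F" unfolding P_def by blast
    have c: "ucauchy (%n. DL is (D i (Fn n)))" for "is" using F(2)[of "i # is"] by simp
    have "P (D i F)" unfolding P_def
      using step[OF F, of i] smooth_D[OF F(1)] c by (intro exI[of _ "%n. D i (Fn n)"]) blast
    then show "hasD i F (D i F) \<and> P (D i F)" using step[OF F] by blast
  qed
  show "uconv (%n. DL is (Fn n)) (DL is L)" for "is"
    using assms(1,2) c0
  proof (induction "is" arbitrary: Fn L)
    case (Cons i "is")
    have c: "ucauchy (%n. DL is (D i (Fn n)))" for "is" using Cons.prems(2)[of "i # is"] by simp
    show ?case using Cons.IH[of "%n. D i (Fn n)" "D i L"] step[OF Cons.prems, of i] smooth_D[OF Cons.prems(1)] c by simp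
  qed simp
qed

section \<open>Operators commuting with translations\<close>

text \<open>The mean value inequality after subtraction of a linear function of slope
  \<open>g\<close>; with uniform continuity of \<open>G\<close> it makes difference quotients
  converge uniformly in the base point.\<close>

lemma hasD_mvt_bound:
  assumes "hasD i F G" and "\<And>s. \<bar>s\<bar> <= \<bar>h\<bar> ==> \<bar>shf i s G \<tau> x - g\<bar> <= e"
  shows "\<bar>shf i h F \<tau> x - F \<tau> x - h * g\<bar> <= e * \<bar>h\<bar>"
proof -
  let ?r = "%s. shf i s F \<tau> x - s * g"
  have "norm (?r h - ?r 0) <= e * norm (h - 0)"
  proof (rule field_differentiable_bound[of "{-\<bar>h\<bar>..\<bar>h\<bar>}" ?r "%s. shf i s G \<tau> x - g"])
    fix s assume "s \<in> {-\<bar>h\<bar>..\<bar>h\<bar>}"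
    have "(?r has_field_derivative shf i s G \<tau> x - g) (at s)"
      by (auto intro!: derivative_eq_intros hasD_at[OF assms(1)])
    then show "(?r has_field_derivative shf i s G \<tau> x - g) (at s within {-\<bar>h\<bar>..\<bar>h\<bar>})"
      by (rule has_field_derivative_at_within)
    show "norm (shf i s G \<tau> x - g) <= e" using \<open>s \<in> _\<close> assms(2) by auto
  qed auto
  then show ?thesis by (simp add: algebra_simps)
qed

lemma AC_shf: assumes "AC F" shows "AC (shf i s F)"
proof (rule ACI)
  show "\<exists>M. \<forall>\<tau> x. \<bar>shf i s F \<tau> x\<bar> <= M" using AC_bdd[OF assms] by (cases i) auto
  show "\<exists>d>0. \<forall>\<tau> \<tau>' x x'. dist \<tau> \<tau>' < d --> dist x x' < d --> \<bar>shf i s F \<tau> x - shf i s F \<tau>' x'\<bar> < e" if "e > 0" for e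
    using AC_ucont[OF assms that] by (cases i) (auto simp: dist_norm)
  fix c :: "nat => real^'a"
  obtain r :: "nat => nat" where r: "strict_mono r" "\<forall>e>0. transl_cauchy F c r e"
    using AC_seq[OF assms, of c] by blast
  have "transl_cauchy (shf i s F) c r e" if e: "e > 0" for e
  proof -
    obtain M where M: "\<And>m n \<tau> x. m >= M ==> n >= M ==> \<bar>F \<tau> (x + c (r m)) - F \<tau> (x + c (r n))\<bar> < e"
      using r(2)[rule_format, OF e] by blast
    have "\<bar>shf i s F \<tau> (x + c (r m)) - shf i s F \<tau> (x + c (r n))\<bar> < e" if "m >= M" "n >= M" for m n \<tau> x
    proof (cases i)
      case (Some j)
      show ?thesis using M[OF that, of \<tau> "x + s *\<^sub>R axis j 1"] by (simp add: Some add_ac)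
    qed (use M[OF that] in simp)
    then show ?thesis by blast
  qed
  then show "\<exists>r::nat=>nat. strict_mono r \<and> (\<forall>e>0. transl_cauchy (shf i s F) c r e)"
    using r(1) by blast
qed

lemma AC_shf_small:
  assumes "AC G" "e > 0"
  shows "\<exists>d>0. \<forall>s \<tau> x. \<bar>s\<bar> < d --> \<bar>shf i s G \<tau> x - G \<tau> x\<bar> < e"
proof -
  obtain d where d: "d>0" "\<And>\<tau> \<tau>' x x'. dist \<tau> \<tau>' < d ==> dist x x' < d ==> \<bar>G \<tau> x - G \<tau>' x'\<bar> < e"
    using AC_ucont[OF assms] by blast
  have "\<bar>shf i s G \<tau> x - G \<tau> x\<bar> < e" if "\<bar>s\<bar> < d" for s \<tau> x
    using that d(1) by (cases i) (auto intro!: d(2) simp: dist_norm norm_axis_1)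
  then show ?thesis using d(1) by blast
qed

text \<open>Isolates what time integration, evaluation at time 1, Gaussian averages and the
  resolvent have in common. These properties alone imply commutation with derivatives and
  preservation of smoothness.\<close>

definition fop :: "('n::finite fld => 'n fld) => bool" where
  "fop L \<longleftrightarrow> (\<forall>F. AC F --> AC (L F)) \<and>
     (\<forall>F G. AC F --> AC G --> L (F + G) = L F + L G) \<and>
     (\<forall>c F. AC F --> L (cst c * F) = cst c * L F) \<and>
     (\<forall>F M. AC F --> (\<forall>\<tau> x. \<bar>F \<tau> x\<bar> <= M) --> (\<forall>\<tau> x. \<bar>L F \<tau> x\<bar> <= M)) \<and>
     (\<forall>i s F. AC F --> L (shf i s F) = shf i s (L F))"

lemma fopD:
  assumes "fop L"
  shows "AC F ==> AC (L F)" "AC F ==> AC G ==> L (F + G) = L F + L G"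
    "AC F ==> L (cst c * F) = cst c * L F"
    "AC F ==> (\<And>\<tau> x. \<bar>F \<tau> x\<bar> <= M) ==> \<bar>L F \<tau> x\<bar> <= M"
    "AC F ==> L (shf i s F) = shf i s (L F)"
  using assms unfolding fop_def by blast+

lemma AC_diff: "AC F ==> AC G ==> AC (F - G)"
  by (rule AC_lip2[of F G 1]) auto

lemma fop_diff: assumes "fop L" "AC F" "AC G" shows "L (F - G) = L F - L G"
proof -
  have "L ((F - G) + G) = L (F - G) + L G" by (rule fopD(2)[OF assms(1) AC_diff[OF assms(2,3)] assms(3)])
  then show ?thesis by simp
qed

text \<open>Because \<open>L\<close> commutes with shifts, the difference quotient of
  \<open>L F\<close> is the image of that of \<open>F\<close>; the sup norm bound then carries the
  uniform convergence over.\<close>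

lemma fop_hasD:
  assumes L: "fop L" and F: "AC F" and G: "AC G" and h: "hasD i F G"
  shows "hasD i (L F) (L G)"
  unfolding hasD_def
proof (intro allI)
  fix \<tau> x
  have "(%s. (shf i s (L F) \<tau> x - L F \<tau> x) / s) \<midarrow>0\<rightarrow> L G \<tau> x"
  proof (rule LIM_I)
    fix e :: real assume e: "e > 0"
    then obtain d where d: "d > 0" "\<And>s \<tau> x. \<bar>s\<bar> < d ==> \<bar>shf i s G \<tau> x - G \<tau> x\<bar> < e/2"
      using AC_shf_small[OF G, of "e/2" i] by auto
    have "norm ((shf i s (L F) \<tau> x - L F \<tau> x) / s - L G \<tau> x) < e" if s: "s \<noteq> 0" "norm (s - 0) < d" for s
    proof -
      let ?H = "cst (1/s) * (shf i s F - F) - G"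
      have eq: "L ?H = cst (1/s) * (shf i s (L F) - L F) - L G"
        unfolding fop_diff[OF L AC_mult[OF AC_cst AC_diff[OF AC_shf[OF F] F]] G] fopD(3)[OF L AC_diff[OF AC_shf[OF F] F]]
          fop_diff[OF L AC_shf[OF F] F] fopD(5)[OF L F] ..
      have b: "\<bar>?H \<tau>' x'\<bar> <= e/2" for \<tau>' x'
      proof -
        have "\<bar>shf i s F \<tau>' x' - F \<tau>' x' - s * G \<tau>' x'\<bar> <= (e/2) * \<bar>s\<bar>"
          by (rule hasD_mvt_bound[OF h]) (use d(2) s less_imp_le in \<open>force simp: less_imp_le\<close>)
        moreover have "?H \<tau>' x' = (shf i s F \<tau>' x' - F \<tau>' x' - s * G \<tau>' x') / s" using s by (simp add: field_simps)
        ultimately show ?thesis using s by (simp add: abs_divide divide_le_eq)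
      qed
      have "\<bar>L ?H \<tau> x\<bar> <= e/2" by (rule fopD(4)[OF L AC_diff[OF AC_mult[OF AC_cst AC_diff[OF AC_shf[OF F] F]] G] b])
      moreover have "L ?H \<tau> x = (shf i s (L F) \<tau> x - L F \<tau> x) / s - L G \<tau> x" unfolding eq by simp
      ultimately show ?thesis using e by simp
    qed
    then show "\<exists>d>0. \<forall>s. s \<noteq> 0 \<and> norm (s - 0) < d --> norm ((shf i s (L F) \<tau> x - L F \<tau> x) / s - L G \<tau> x) < e"
      using d(1) by blast
  qed
  then show "((%s. shf i s (L F) \<tau> x) has_real_derivative L G \<tau> x) (at 0)"
    by (simp add: DERIV_def)
qed

lemma fop_smooth: assumes L: "fop L" and "smooth F" shows "smooth (L F)"
proof (rule smoothI_coind[where P = "%H. \<exists>F. smooth F \<and> H = L F"])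
  show "\<exists>F'. smooth F' \<and> L F = L F'" using assms by blast
  show "\<exists>F. smooth F \<and> H = L F ==> AC H" for H using fopD(1)[OF L] smooth_AC by blast
  fix H i assume "\<exists>F. smooth F \<and> H = L F"
  then obtain F where F: "smooth F" "H = L F" by blast
  have "hasD i H (L (D i F))" unfolding F(2) by (intro fop_hasD[OF L] smooth_AC smooth_hasD smooth_D F)
  then show "hasD i H (D i H) \<and> (\<exists>F. smooth F \<and> D i H = L F)" using hasD_D smooth_D[OF F(1)] by metis
qed

lemma fop_D: "fop L ==> smooth F ==> D i (L F) = L (D i F)"
  by (rule hasD_D[OF fop_hasD[OF _ smooth_AC smooth_AC[OF smooth_D] smooth_hasD]])

section \<open>Integration and evaluation in time\<close>

definition clamp :: "real => real" where "clamp t = max 0 (min 1 t)"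

text \<open>The upper limit is clamped to [0,1] so that the integral of a bounded field is bounded
  on the whole complex plane, by the same constant.\<close>

definition J :: "'n::finite fld => 'n fld" where
  "J F = (%\<tau> x. integral {0..clamp (Im \<tau>)} (%s. F (Complex (Re \<tau>) s) x))"

definition E1 :: "'n::finite fld => 'n fld" where
  "E1 F = (%\<tau> x. F (Complex (Re \<tau>) 1) x)"

lemma clamp_bounds: "0 <= clamp t" "clamp t <= 1" by (auto simp: clamp_def)
lemma clamp_lip: "\<bar>clamp t - clamp s\<bar> <= \<bar>t - s\<bar>" by (auto simp: clamp_def max_def min_def abs_if)
lemma clamp_id: "0 <= t ==> t <= 1 ==> clamp t = t" by (auto simp: clamp_def)

lemma dist_Complex_Re: "dist (Complex a s) (Complex b s) = \<bar>a - b\<bar>"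
  by (simp add: dist_complex_def cmod_def)
lemma dist_Complex_Im: "dist (Complex a s) (Complex a t) = \<bar>s - t\<bar>"
  by (simp add: dist_complex_def cmod_def)

lemma AC_cont_t: assumes "AC F" shows "continuous_on A (%s. F (Complex a s) x)"
proof (rule continuous_on_subset[OF _ subset_UNIV])
  show "continuous_on UNIV (%s. F (Complex a s) x)"
    unfolding continuous_on_iff
  proof (intro ballI allI impI)
    fix s e :: real assume "e > 0"
    then obtain d where d: "d>0" "\<And>\<tau> \<tau>' x x'. dist \<tau> \<tau>' < d ==> dist x x' < d ==> \<bar>F \<tau> x - F \<tau>' x'\<bar> < e"
      using AC_ucont[OF assms] by blast
    then show "\<exists>d>0. \<forall>s'\<in>UNIV. dist s' s < d --> dist (F (Complex a s') x) (F (Complex a s) x) < e"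
      by (intro exI[of _ d]) (auto simp: dist_Complex_Im dist_real_def)
  qed
qed

lemma AC_integrable_t: "AC F ==> (%s. F (Complex a s) x) integrable_on {b..c}"
  by (intro integrable_continuous_real AC_cont_t)

lemma AC_cont_x: assumes "AC F" shows "continuous_on A (F \<tau>)"
proof (rule continuous_on_subset[OF _ subset_UNIV])
  show "continuous_on UNIV (F \<tau>)"
    unfolding continuous_on_iff
  proof (intro ballI allI impI)
    fix x and e :: real assume "e > 0"
    then obtain d where d: "d>0" "\<And>\<tau> \<tau>' x x'. dist \<tau> \<tau>' < d ==> dist x x' < d ==> \<bar>F \<tau> x - F \<tau>' x'\<bar> < e"
      using AC_ucont[OF assms] by blast
    then show "\<exists>d>0. \<forall>x'\<in>UNIV. dist x' x < d --> dist (F \<tau> x') (F \<tau> x) < e"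
      by (intro exI[of _ d]) (auto simp: dist_real_def)
  qed
qed

lemma HK_integral_abs_bound:
  assumes "f integrable_on {a..b::real}" "a <= b" "\<And>s. s \<in> {a..b} ==> \<bar>f s\<bar> <= M"
  shows "\<bar>integral {a..b} f\<bar> <= M * (b - a)"
proof -
  have "norm (integral {a..b} f) <= integral {a..b} (%s. M)"
    by (rule integral_norm_bound_integral) (use assms in auto)
  then show ?thesis using assms(2) by (simp add: mult.commute)
qed

lemma J_bound: assumes "AC F" "\<And>\<tau> x. \<bar>F \<tau> x\<bar> <= M" shows "\<bar>J F \<tau> x\<bar> <= M"
proof -
  have M: "M >= 0" using assms(2)[of 0 0] by linarith
  have "\<bar>J F \<tau> x\<bar> <= M * (clamp (Im \<tau>) - 0)" unfolding J_def
    by (rule HK_integral_abs_bound) (use assms clamp_bounds AC_integrable_t in auto)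
  also have "\<dots> <= M * 1" using M clamp_bounds by (intro mult_left_mono) auto
  finally show ?thesis by simp
qed

lemma J_add: "AC F ==> AC G ==> J (F + G) = J F + J G"
  unfolding J_def by (intro ext) (simp add: integral_add AC_integrable_t)

lemma J_cmult: "J (cst c * F) = cst c * J F"
  unfolding J_def by (intro ext) simp

lemma J_diff_apply:
  assumes F: "AC F" and M: "\<And>\<tau> x. \<bar>F \<tau> x\<bar> <= M"
    and e: "\<And>s. s \<in> {0..1} ==> \<bar>F (Complex (Re \<tau>) s) x - F (Complex (Re \<tau>') s) x'\<bar> <= e"
  shows "\<bar>J F \<tau> x - J F \<tau>' x'\<bar> <= e + M * \<bar>Im \<tau> - Im \<tau>'\<bar>"
proof -
  define c c' where "c = clamp (Im \<tau>)" and "c' = clamp (Im \<tau>')"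
  have c: "0 <= c" "c <= 1" "0 <= c'" "c' <= 1" unfolding c_def c'_def by (auto simp: clamp_bounds)
  have M0: "M >= 0" using M[of 0 0] by linarith
  have e0: "e >= 0" using e[of 0] by force
  define f g where "f = (%s. F (Complex (Re \<tau>) s) x)" and "g = (%s. F (Complex (Re \<tau>') s) x')"
  have int: "f integrable_on {u..v}" "g integrable_on {u..v}" for u v unfolding f_def g_def by (intro AC_integrable_t F)+
  have 1: "\<bar>integral {0..c} f - integral {0..c} g\<bar> <= e"
  proof -
    have "integral {0..c} f - integral {0..c} g = integral {0..c} (%s. f s - g s)" using int by (simp add: integral_diff)
    moreover have "\<bar>integral {0..c} (%s. f s - g s)\<bar> <= e * (c - 0)"
      by (rule HK_integral_abs_bound) (use int c e in \<open>auto simp: f_def g_def intro!: integrable_diff\<close>)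
    moreover have "e * (c - 0) <= e * 1" using c e0 by (intro mult_left_mono) auto
    ultimately show ?thesis by simp
  qed
  have g: "\<bar>g s\<bar> <= M" for s unfolding g_def by (rule M)
  have 2: "\<bar>integral {0..v} g - integral {0..u} g\<bar> <= M * (v - u)" if "0 <= u" "u <= v" for u v
  proof -
    have "integral {0..u} g + integral {u..v} g = integral {0..v} g"
      by (rule Henstock_Kurzweil_Integration.integral_combine) (use that int in auto)
    moreover have "\<bar>integral {u..v} g\<bar> <= M * (v - u)" by (rule HK_integral_abs_bound) (use that int g in auto)
    ultimately show ?thesis by linarith
  qed
  have "\<bar>integral {0..c} g - integral {0..c'} g\<bar> <= M * \<bar>c - c'\<bar>"
    using 2[of c c'] 2[of c' c] c by (cases "c <= c'") (auto simp: abs_minus_commute)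
  also have "\<dots> <= M * \<bar>Im \<tau> - Im \<tau>'\<bar>" unfolding c_def c'_def by (intro mult_left_mono clamp_lip M0)
  finally show ?thesis using 1 unfolding J_def f_def g_def c_def c'_def by linarith
qed

lemma AC_J: assumes F: "AC F" shows "AC (J F)"
proof (rule ACI)
  obtain M where M: "M > 0" "\<And>\<tau> x. \<bar>F \<tau> x\<bar> <= M" using AC_bdd_pos[OF F] by blast
  show "\<exists>M. \<forall>\<tau> x. \<bar>J F \<tau> x\<bar> <= M" using J_bound[OF F M(2)] by blast
  show "\<exists>d>0. \<forall>\<tau> \<tau>' x x'. dist \<tau> \<tau>' < d --> dist x x' < d --> \<bar>J F \<tau> x - J F \<tau>' x'\<bar> < e" if e: "e > 0" for e
  proof -
    obtain d where d: "d>0" "\<And>\<tau> \<tau>' x x'. dist \<tau> \<tau>' < d ==> dist x x' < d ==> \<bar>F \<tau> x - F \<tau>' x'\<bar> < e/2"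
      using AC_ucont[OF F, of "e/2"] e by auto
    have "\<bar>J F \<tau> x - J F \<tau>' x'\<bar> < e" if t: "dist \<tau> \<tau>' < min d (e/(2*M))" "dist x x' < min d (e/(2*M))" for \<tau> \<tau>' x x'
    proof -
      have re: "\<bar>Re \<tau> - Re \<tau>'\<bar> <= dist \<tau> \<tau>'" "\<bar>Im \<tau> - Im \<tau>'\<bar> <= dist \<tau> \<tau>'"
        using abs_Re_le_cmod[of "\<tau> - \<tau>'"] abs_Im_le_cmod[of "\<tau> - \<tau>'"] by (auto simp: dist_norm)
      have "\<bar>J F \<tau> x - J F \<tau>' x'\<bar> <= e/2 + M * \<bar>Im \<tau> - Im \<tau>'\<bar>"
        by (rule J_diff_apply[OF F M(2)]) (use re t d(2) in \<open>force simp: dist_Complex_Re intro!: less_imp_le\<close>)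
      also have "\<bar>Im \<tau> - Im \<tau>'\<bar> < e/(2*M)" using re t by linarith
      then have "M * \<bar>Im \<tau> - Im \<tau>'\<bar> < M * (e/(2*M))" using M by (intro mult_strict_left_mono)
      also have "M * (e/(2*M)) = e/2" using M by simp
      finally show ?thesis by simp
    qed
    then show ?thesis using d(1) e M(1) by (intro exI[of _ "min d (e/(2*M))"]) auto
  qed
  fix c :: "nat => real^'a"
  obtain r :: "nat => nat" where r: "strict_mono r" "\<forall>e>0. transl_cauchy F c r e"
    using AC_seq[OF F, of c] by blast
  have "transl_cauchy (J F) c r e" if e: "e > 0" for e
  proof -
    obtain N where N: "\<And>m n \<tau> x. m >= N ==> n >= N ==> \<bar>F \<tau> (x + c (r m)) - F \<tau> (x + c (r n))\<bar> < e/2"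
      using r(2)[rule_format, OF half_gt_zero[OF e]] by blast
    have "\<bar>J F \<tau> (x + c (r m)) - J F \<tau> (x + c (r n))\<bar> < e" if "m >= N" "n >= N" for m n \<tau> x
    proof -
      have "\<bar>J F \<tau> (x + c (r m)) - J F \<tau> (x + c (r n))\<bar> <= e/2 + M * \<bar>Im \<tau> - Im \<tau>\<bar>"
        by (rule J_diff_apply[OF F M(2)]) (use N[OF that] in \<open>auto intro: less_imp_le\<close>)
      then show ?thesis using e by simp
    qed
    then show ?thesis by blast
  qed
  then show "\<exists>r::nat=>nat. strict_mono r \<and> (\<forall>e>0. transl_cauchy (J F) c r e)"
    using r(1) by blast
qed

lemma Complex_add_real: "Complex a s + of_real b = Complex (a + b) s"
  by (simp add: complex_eq_iff)

lemma fop_J: "fop J"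
  unfolding fop_def
proof (intro conjI allI impI)
  fix i s and F :: "'a fld"
  show "J (shf i s F) = shf i s (J F)"
    by (cases i) (auto simp: J_def Complex_add_real)
qed (auto intro: AC_J J_add J_cmult J_bound)

lemma fop_E1: "fop E1"
  unfolding fop_def
proof (intro conjI allI impI)
  fix F :: "'a fld" assume F: "AC F"
  show "AC (E1 F)"
  proof (rule ACI)
    show "\<exists>M. \<forall>\<tau> x. \<bar>E1 F \<tau> x\<bar> <= M" using AC_bdd[OF F] by (auto simp: E1_def)
    show "\<exists>d>0. \<forall>\<tau> \<tau>' x x'. dist \<tau> \<tau>' < d --> dist x x' < d --> \<bar>E1 F \<tau> x - E1 F \<tau>' x'\<bar> < e" if e: "e > 0" for e
    proof -
      obtain d where d: "d>0" "\<And>\<tau> \<tau>' x x'. dist \<tau> \<tau>' < d ==> dist x x' < d ==> \<bar>F \<tau> x - F \<tau>' x'\<bar> < e"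
        using AC_ucont[OF F e] by blast
      have re: "\<bar>Re \<tau> - Re \<tau>'\<bar> <= dist \<tau> \<tau>'" for \<tau> \<tau>'
        using abs_Re_le_cmod[of "\<tau> - \<tau>'"] by (auto simp: dist_norm)
      show ?thesis unfolding E1_def
        by (intro exI[of _ d] conjI allI impI d) (auto simp: dist_Complex_Re intro: le_less_trans[OF re])
    qed
    fix c :: "nat => real^'a"
    show "\<exists>r::nat=>nat. strict_mono r \<and> (\<forall>e>0. transl_cauchy (E1 F) c r e)"
      using AC_seq[OF F, of c] unfolding E1_def by meson
  qed
next
  fix i s and F :: "'a fld"
  show "E1 (shf i s F) = shf i s (E1 F)"
    by (cases i) (auto simp: E1_def Complex_add_real)
qed (auto simp: E1_def fun_eq_iff)

text \<open>The fundamental theorem of calculus with a rate uniform in \<open>x\<close> and in the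
  parameter. It is this uniformity that makes the time integral differentiable as a curve in the
  Frechet topology.\<close>

lemma J_quot:
  assumes F: "AC F" and e: "e > 0"
  shows "\<exists>d>0. \<forall>s t a x. \<bar>s - t\<bar> < d --> s \<in> {0..1} --> t \<in> {0..1} -->
    \<bar>J F (Complex a s) x - J F (Complex a t) x - (s - t) * F (Complex a t) x\<bar> <= e * \<bar>s - t\<bar>"
proof -
  obtain d where d: "d>0" "\<And>\<tau> \<tau>' x x'. dist \<tau> \<tau>' < d ==> dist x x' < d ==> \<bar>F \<tau> x - F \<tau>' x'\<bar> < e"
    using AC_ucont[OF F e] by blast
  have key: "\<bar>J F (Complex a v) x - J F (Complex a u) x - (v - u) * y\<bar> <= e * (v - u)"
    if uv: "0 <= u" "u <= v" "v <= 1" "v - u < d" and y: "\<And>s. s \<in> {u..v} ==> \<bar>F (Complex a s) x - y\<bar> <= e" for u v a x y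
  proof -
    let ?f = "%s. F (Complex a s) x"
    have int: "?f integrable_on {p..q}" for p q by (rule AC_integrable_t[OF F])
    have "integral {0..u} ?f + integral {u..v} ?f = integral {0..v} ?f"
      by (rule Henstock_Kurzweil_Integration.integral_combine) (use uv int in auto)
    moreover have "integral {u..v} ?f - (v - u) * y = integral {u..v} (%s. ?f s - y)"
      using int uv by (subst integral_diff) auto
    moreover have "\<bar>integral {u..v} (%s. ?f s - y)\<bar> <= e * (v - u)"
      by (rule HK_integral_abs_bound) (use uv int y in \<open>auto intro!: integrable_diff\<close>)
    ultimately show ?thesis unfolding J_def using uv by (simp add: clamp_id)
  qed
  show ?thesis
  proof (intro exI[of _ d] conjI allI impI)
    fix s t a :: real and x
    assume st: "\<bar>s - t\<bar> < d" "s \<in> {0..1}" "t \<in> {0..1}"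
    have y: "\<bar>F (Complex a s') x - F (Complex a t) x\<bar> <= e" if "\<bar>s' - t\<bar> < d" for s'
      using d(2)[of "Complex a s'" "Complex a t" x x] that d(1) by (auto simp: dist_Complex_Im)
    show "\<bar>J F (Complex a s) x - J F (Complex a t) x - (s - t) * F (Complex a t) x\<bar> <= e * \<bar>s - t\<bar>"
    proof (cases "t <= s")
      case True
      then show ?thesis using key[of t s a x "F (Complex a t) x"] st y by auto
    next
      case False
      then have "\<bar>J F (Complex a t) x - J F (Complex a s) x - (t - s) * F (Complex a t) x\<bar> <= e * (t - s)"
        using st by (intro key y) auto
      then show ?thesis using False by (simp add: abs_if algebra_simps split: if_splits)
    qed
  qed (rule d(1))
qed

text \<open>Shifting a field by a real number only affects its parameter \<open>\<epsilon>\<close>, so reparametrised fields do not depend on \<open>\<epsilon>\<close>.\<close>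

definition reparam :: "(complex => complex) => bool" where
  "reparam g \<longleftrightarrow> (\<forall>\<tau> s. g (\<tau> + of_real s) = g \<tau>) \<and> (\<forall>\<tau> \<tau>'. dist (g \<tau>) (g \<tau>') <= dist \<tau> \<tau>')"

definition rp :: "(complex => complex) => 'n::finite fld => 'n fld" where "rp g F = (%\<tau>. F (g \<tau>))"

abbreviation slice :: "complex => 'n::finite fld => 'n fld" where "slice \<sigma> \<equiv> rp (%_. \<sigma>)"

lemma reparam_const: "reparam (%_. \<sigma>)" by (simp add: reparam_def)

lemma AC_rp: assumes g: "reparam g" and "AC F" shows "AC (rp g F)"
proof (rule ACI)
  show "\<exists>M. \<forall>\<tau> x. \<bar>rp g F \<tau> x\<bar> <= M" using AC_bdd[OF assms(2)] by (auto simp: rp_def)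
  show "\<exists>d>0. \<forall>\<tau> \<tau>' x x'. dist \<tau> \<tau>' < d --> dist x x' < d --> \<bar>rp g F \<tau> x - rp g F \<tau>' x'\<bar> < e" if "e > 0" for e
    using AC_ucont[OF assms(2) that] g unfolding rp_def reparam_def by (meson order_le_less_trans)
  fix c :: "nat => real^'a"
  show "\<exists>r::nat=>nat. strict_mono r \<and> (\<forall>e>0. transl_cauchy (rp g F) c r e)"
    using AC_seq[OF assms(2), of c] unfolding rp_def by meson
qed

lemma hasD_rp: assumes "reparam g" "smooth F"
  shows "hasD i (rp g F) (case i of None => 0 | Some j => rp g (D i F))"
  using smooth_hasD[OF assms(2), of i] assms(1) by (cases i) (auto simp: hasD_def rp_def reparam_def)

lemma smooth_rp: assumes g: "reparam g" and "smooth F" shows "smooth (rp g F)"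
proof (rule smoothI_coind[where P = "%H. \<exists>F. smooth F \<and> H = rp g F"])
  show "\<exists>F'. smooth F' \<and> rp g F = rp g F'" using assms by blast
  show "\<exists>F. smooth F \<and> H = rp g F ==> AC H" for H using AC_rp[OF g] smooth_AC by blast
  fix H :: "'a fld" and i assume "\<exists>F. smooth F \<and> H = rp g F"
  then obtain F where F: "smooth F" "H = rp g F" by blast
  have z: "(0 :: 'a fld) = rp g 0" by (simp add: rp_def fun_eq_iff)
  have s: "smooth (case i of None => 0 | Some j => D i F)" by (cases i) (auto intro: smooth_0 smooth_D F)
  have "hasD i H (rp g (case i of None => 0 | Some j => D i F))"
    using hasD_rp[OF g F(1), of i] z[symmetric] unfolding F(2) by (cases i) (simp_all only: option.case)
  then show "hasD i H (D i H) \<and> (\<exists>F. smooth F \<and> D i H = rp g F)" using hasD_D s by metis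
qed

lemma D_rp: "reparam g ==> smooth F ==> D (Some i) (rp g F) = rp g (D (Some i) F)"
  using hasD_D[OF hasD_rp[of g F "Some i"]] by simp

lemma rp_ops: "rp g (F + G) = rp g F + rp g G" "rp g (F - G) = rp g F - rp g G" "rp g (F * G) = rp g F * rp g G"
    "rp g (cst r) = cst r" "rp g (\<Sum>i\<in>A. H i) = (\<Sum>i\<in>A. rp g (H i))" "rp g 0 = 0" "rp g (- F) = - rp g F"
  by (simp_all add: fun_eq_iff rp_def sum_fld_apply)

text \<open>The parameter may enter only through functions that are bounded with all their
  derivatives, which excludes \<open>Re \<tau>\<close> itself. The sine qualifies and has derivative
  1 at 0; combinations of sine and cosine are closed under differentiation.\<close>

lemma smooth_trig: "smooth (%\<tau> x::real^'n::finite. a * sin (Re \<tau>) + b * cos (Re \<tau>))"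
proof (rule smoothI_coind[where P = "%H. \<exists>a b. H = (%\<tau> x. a * sin (Re \<tau>) + b * cos (Re \<tau>))"])
  show "AC H" if H': "\<exists>a b. H = (%\<tau> x. a * sin (Re \<tau>) + b * cos (Re \<tau>))" for H :: "'n fld"
  proof -
    obtain a b where H: "H = (%\<tau> x. a * sin (Re \<tau>) + b * cos (Re \<tau>))" using H' by blast
    show ?thesis
    proof (rule ACI)
      have "\<bar>H \<tau> x\<bar> <= \<bar>a\<bar> * 1 + \<bar>b\<bar> * 1" for \<tau> x
      proof -
        have "\<bar>H \<tau> x\<bar> <= \<bar>a\<bar> * \<bar>sin (Re \<tau>)\<bar> + \<bar>b\<bar> * \<bar>cos (Re \<tau>)\<bar>"
          unfolding H by (metis abs_mult abs_triangle_ineq)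
        also have "\<dots> <= \<bar>a\<bar> * 1 + \<bar>b\<bar> * 1" by (intro add_mono mult_left_mono) auto
        finally show ?thesis .
      qed
      then show "\<exists>M. \<forall>\<tau> x. \<bar>H \<tau> x\<bar> <= M" by blast
      show "\<exists>d>0. \<forall>\<tau> \<tau>' x x'. dist \<tau> \<tau>' < d --> dist x x' < d --> \<bar>H \<tau> x - H \<tau>' x'\<bar> < e" if e: "e > 0" for e
      proof -
        define K where "K = \<bar>a\<bar> + \<bar>b\<bar> + 1"
        have K: "K > 0" by (simp add: K_def)
        have lip: "\<bar>H \<tau> x - H \<tau>' x'\<bar> <= K * \<bar>Re \<tau> - Re \<tau>'\<bar>" for \<tau> \<tau>' x x'
        proof -
          let ?h = "%r. a * sin r + b * cos r"
          have "norm (?h (Re \<tau>) - ?h (Re \<tau>')) <= K * norm (Re \<tau> - Re \<tau>')"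
          proof (rule field_differentiable_bound[of UNIV ?h "%r. a * cos r - b * sin r"])
            show "(?h has_field_derivative a * cos z - b * sin z) (at z within UNIV)" for z
              by (auto intro!: derivative_eq_intros)
            fix z
            have "\<bar>a * cos z\<bar> <= \<bar>a\<bar> * 1" "\<bar>b * sin z\<bar> <= \<bar>b\<bar> * 1" unfolding abs_mult by (intro mult_left_mono; simp)+
            then show "norm (a * cos z - b * sin z) <= K" unfolding K_def real_norm_def by linarith
          qed auto
          then show ?thesis unfolding H by simp
        qed
        have "\<bar>H \<tau> x - H \<tau>' x'\<bar> < e" if "dist \<tau> \<tau>' < e / K" for \<tau> \<tau>' x x'
        proof -
          have "\<bar>Re \<tau> - Re \<tau>'\<bar> < e / K" using abs_Re_le_cmod[of "\<tau> - \<tau>'"] that by (simp add: dist_norm)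
          then have "K * \<bar>Re \<tau> - Re \<tau>'\<bar> < e" using K by (simp add: pos_less_divide_eq mult.commute)
          then show ?thesis using lip[of \<tau> x \<tau>' x'] by linarith
        qed
        then show ?thesis using K e by (intro exI[of _ "e/K"]) auto
      qed
      show "\<exists>r::nat=>nat. strict_mono r \<and> (\<forall>e>0. transl_cauchy H c r e)" for c
        by (intro exI[of _ "%n. n"]) (simp add: H strict_mono_def)
    qed
  qed
  fix H :: "'n fld" and i :: "'n option" assume "\<exists>a b. H = (%\<tau> x. a * sin (Re \<tau>) + b * cos (Re \<tau>))"
  then obtain a b where H: "H = (%\<tau> x. a * sin (Re \<tau>) + b * cos (Re \<tau>))" by blast
  define a' b' where "a' = (if i = None then - b else 0)" and "b' = (if i = None then a else 0)"
  have "hasD i H (%\<tau> x. a' * sin (Re \<tau>) + b' * cos (Re \<tau>))"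
    unfolding hasD_def H a'_def b'_def by (cases i) (auto intro!: derivative_eq_intros)
  then show "hasD i H (D i H) \<and> (\<exists>a b. D i H = (%\<tau> x. a * sin (Re \<tau>) + b * cos (Re \<tau>)))" using hasD_D by metis
qed blast

definition snf :: "'n::finite fld" where "snf = (%\<tau> x. sin (Re \<tau>))"
definition csf :: "'n::finite fld" where "csf = (%\<tau> x. cos (Re \<tau>))"
lemma smooth_snf: "smooth snf" using smooth_trig[of 1 0] by (simp add: snf_def)
lemma D_snf: "D i snf = (case i of None => csf | Some j => 0)"
  by (rule hasD_D) (cases i, auto simp: hasD_def snf_def csf_def intro!: derivative_eq_intros)

text \<open>The increment is split into steps along the axes, each estimated by
  \<open>hasD_mvt_bound\<close>; uniform continuity of the partial derivatives makes the sum of the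
  errors small.\<close>

lemma smooth_has_derivative:
  assumes "smooth F"
  shows "(F \<tau> has_derivative (%h. \<Sum>i\<in>UNIV. h $ i * D (Some i) F \<tau> x)) (at x)"
  unfolding has_derivative_at_alt
proof (intro conjI allI impI)
  show "bounded_linear (%h::real^'a. \<Sum>i\<in>UNIV. h $ i * D (Some i) F \<tau> x)"
    by (intro bounded_linear_sum bounded_linear_mult_const bounded_linear_vec_nth)
  fix e :: real assume e: "e > 0"
  define n where "n = real CARD('a)"
  have n: "n > 0" by (simp add: n_def)
  have "\<exists>d>0. \<forall>i y. dist y x < d --> \<bar>D (Some i) F \<tau> y - D (Some i) F \<tau> x\<bar> <= e/n"
  proof -
    have "\<exists>d>0. \<forall>y. dist y x < d --> \<bar>D (Some i) F \<tau> y - D (Some i) F \<tau> x\<bar> < e/n" for i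
      using AC_ucont[OF smooth_AC[OF smooth_D[OF assms, of "Some i"]], of "e/n"] e n by (metis divide_pos_pos dist_self)
    then obtain d where d: "\<And>i. d i > 0" "\<And>i y. dist y x < d i ==> \<bar>D (Some i) F \<tau> y - D (Some i) F \<tau> x\<bar> < e/n" by metis
    show ?thesis
      by (rule exI[of _ "Min (range d)"]) (use d in \<open>auto intro!: less_imp_le\<close>)
  qed
  then obtain d where d: "d > 0" "\<And>i y. dist y x < d ==> \<bar>D (Some i) F \<tau> y - D (Some i) F \<tau> x\<bar> <= e/n" by blast
  \<comment> \<open>Induction on the set of axes still to be walked. The hypothesis on
    \<open>dist\<close> keeps the whole path inside the ball in which the partial derivatives vary
    by at most \<open>e/n\<close>.\<close>
  have key: "\<bar>F \<tau> (y + (\<Sum>i\<in>A. h $ i *\<^sub>R axis i 1)) - F \<tau> y - (\<Sum>i\<in>A. h $ i * D (Some i) F \<tau> x)\<bar> <= (e/n) * (\<Sum>i\<in>A. \<bar>h $ i\<bar>)"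
    if "finite A" "dist y x + (\<Sum>i\<in>A. \<bar>h $ i\<bar>) < d" for A y and h :: "real^'a"
    using that
  proof (induction A arbitrary: y rule: finite_induct)
    case (insert j A)
    define y' where "y' = y + h $ j *\<^sub>R axis j 1"
    have "dist y' x <= dist y x + \<bar>h $ j\<bar>"
    proof -
      have "dist y' x <= dist y' y + dist y x" by (rule dist_triangle)
      then show ?thesis by (simp add: y'_def dist_norm norm_axis_1)
    qed
    then have 1: "\<bar>F \<tau> (y' + (\<Sum>i\<in>A. h $ i *\<^sub>R axis i 1)) - F \<tau> y' - (\<Sum>i\<in>A. h $ i * D (Some i) F \<tau> x)\<bar> <= (e/n) * (\<Sum>i\<in>A. \<bar>h $ i\<bar>)"
      using insert by (intro insert.IH) auto
    have nn: "(\<Sum>i\<in>A. \<bar>h $ i\<bar>) >= 0" by (intro sum_nonneg) auto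
    have "\<bar>shf (Some j) (h $ j) F \<tau> y - F \<tau> y - h $ j * D (Some j) F \<tau> x\<bar> <= (e/n) * \<bar>h $ j\<bar>"
    proof (rule hasD_mvt_bound[OF smooth_hasD[OF assms]])
      fix s assume s: "\<bar>s\<bar> <= \<bar>h $ j\<bar>"
      have "dist (y + s *\<^sub>R axis j 1) x <= dist (y + s *\<^sub>R axis j 1) y + dist y x" by (rule dist_triangle)
      also have "\<dots> = \<bar>s\<bar> + dist y x" by (simp add: dist_norm norm_axis_1)
      also have "\<dots> < d"
      proof -
        have "dist y x + (\<bar>h $ j\<bar> + (\<Sum>i\<in>A. \<bar>h $ i\<bar>)) < d" using insert.prems insert.hyps by simp
        then show ?thesis using s nn by linarith
      qed
      finally show "\<bar>shf (Some j) s (D (Some j) F) \<tau> y - D (Some j) F \<tau> x\<bar> <= e/n" using d(2) by simp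
    qed
    then have 2: "\<bar>F \<tau> y' - F \<tau> y - h $ j * D (Some j) F \<tau> x\<bar> <= (e/n) * \<bar>h $ j\<bar>" by (simp add: y'_def)
    have 3: "y + (\<Sum>i\<in>insert j A. h $ i *\<^sub>R axis i 1) = y' + (\<Sum>i\<in>A. h $ i *\<^sub>R axis i 1)"
      using insert by (simp add: y'_def add_ac)
    have 4: "(\<Sum>i\<in>insert j A. h $ i * D (Some i) F \<tau> x) = h $ j * D (Some j) F \<tau> x + (\<Sum>i\<in>A. h $ i * D (Some i) F \<tau> x)"
      "(e/n) * (\<Sum>i\<in>insert j A. \<bar>h $ i\<bar>) = (e/n) * \<bar>h $ j\<bar> + (e/n) * (\<Sum>i\<in>A. \<bar>h $ i\<bar>)"
      using insert by (simp_all add: distrib_left add_divide_distrib)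
    show ?case unfolding 3 4 using 1 2 by linarith
  qed simp
  have "norm (F \<tau> y - F \<tau> x - (\<Sum>i\<in>UNIV. (y - x) $ i * D (Some i) F \<tau> x)) <= e * norm (y - x)" if "norm (y - x) < d / n" for y
  proof -
    have s: "(\<Sum>i\<in>UNIV. \<bar>(y - x) $ i\<bar>) <= n * norm (y - x)"
      using sum_bounded_above[of "UNIV::'a set" "%i. \<bar>(y - x) $ i\<bar>" "norm (y - x)"] component_le_norm_cart[of "y - x"]
      by (simp add: n_def)
    also have "\<dots> < d" using that n by (simp add: field_simps)
    finally have "\<bar>F \<tau> (x + (\<Sum>i\<in>UNIV. (y - x) $ i *\<^sub>R axis i 1)) - F \<tau> x - (\<Sum>i\<in>UNIV. (y - x) $ i * D (Some i) F \<tau> x)\<bar> <= (e/n) * (\<Sum>i\<in>UNIV. \<bar>(y - x) $ i\<bar>)"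
      by (intro key) auto
    also have "(\<Sum>i\<in>UNIV. (y - x) $ i *\<^sub>R axis i 1) = y - x"
      using basis_expansion[of "y - x"] by (simp add: scalar_mult_eq_scaleR)
    also have "(e/n) * (\<Sum>i\<in>UNIV. \<bar>(y - x) $ i\<bar>) <= (e/n) * (n * norm (y - x))"
      using s e n by (intro mult_left_mono) auto
    also have "\<dots> = e * norm (y - x)" using n by simp
    finally show ?thesis by simp
  qed
  then show "\<exists>d>0. \<forall>y. norm (y - x) < d --> norm (F \<tau> y - F \<tau> x - (\<Sum>i\<in>UNIV. (y - x) $ i * D (Some i) F \<tau> x)) <= e * norm (y - x)"
    using d(1) n by (intro exI[of _ "d/n"]) auto
qed

section \<open>Gaussian averages\<close>

abbreviation N1 :: "real measure" where "N1 \<equiv> density lborel (%x. ennreal (std_normal_density x))"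

lemma prob_N1: "prob_space N1" using prob_space_normal_density[of 1 0] by simp

lemma exp8: "0 <= t ==> 1 + t <= 8 * exp (t / 8)" for t :: real
  using exp_ge_add_one_self[of "t/8"] by linarith

lemma exp12: "0 <= t ==> (1 + t)^3 <= 1728 * exp (t / 4)" for t :: real
proof -
  assume t: "0 <= t"
  have "1 + t <= 12 * exp (t/12)" using exp_ge_add_one_self[of "t/12"] t by linarith
  then have "(1 + t)^3 <= (12 * exp (t/12))^3" using t by (intro power_mono) auto
  also have "\<dots> = 1728 * exp (t/4)" by (simp add: power_mult_distrib exp_of_nat_mult[symmetric])
  finally show ?thesis .
qed

text \<open>The weight turns the standard normal density into a multiple of the normal density of
  variance 2. It is the majorant for all Gaussian integrals below.\<close>

lemma W1: "integrable N1 (%y. exp (y\<^sup>2 / 4))"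
proof -
  have "integrable lborel (%y. sqrt 2 * normal_density 0 (sqrt 2) y)" by (intro integrable_mult_right) auto
  also have "(%y. sqrt 2 * normal_density 0 (sqrt 2) y) = (%y. std_normal_density y * exp (y\<^sup>2 / 4))"
  proof
    fix y :: real
    have "exp (- (y\<^sup>2) / 4) = exp (- y\<^sup>2 / 2) * exp (y\<^sup>2 / 4)" by (simp add: exp_add[symmetric])
    then show "sqrt 2 * normal_density 0 (sqrt 2) y = std_normal_density y * exp (y\<^sup>2 / 4)"
      by (simp add: normal_density_def std_normal_density_def real_sqrt_mult field_simps)
  qed
  finally show ?thesis by (subst integrable_density) auto
qed

lemma N1_integrable:
  assumes "h \<in> borel_measurable borel" "\<And>y. \<bar>h y\<bar> <= K * exp (y\<^sup>2 / 4)"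
  shows "integrable N1 h"
proof (rule Bochner_Integration.integrable_bound)
  show "integrable N1 (%y. K * exp (y\<^sup>2 / 4))" using W1 by (intro integrable_mult_right)
  show "AE y in N1. norm (h y) <= norm (K * exp (y\<^sup>2 / 4))"
    using assms(2) by (intro AE_I2) (metis abs_ge_self order_trans real_norm_def)
qed (use assms in simp)

text \<open>Stein's identity: the normal density satisfies \<open>p' = - y p\<close>, so the
  difference of the integrands is the derivative of \<open>p g\<close>, which vanishes at both ends.
  Growth up to \<open>exp (y^2/8)\<close> leaves room for the factor \<open>y\<close> below the
  integrable \<open>exp (y^2/4)\<close>.\<close>

lemma stein1:
  assumes d: "\<And>y. (g has_real_derivative g' y) (at y)" and c: "\<And>y. isCont g' y"
    and b: "\<And>y. \<bar>g y\<bar> <= C * exp (y\<^sup>2/8)" "\<And>y. \<bar>g' y\<bar> <= C * exp (y\<^sup>2/8)"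
  shows "(\<integral>y. y * g y \<partial>N1) = (\<integral>y. g' y \<partial>N1)"
proof -
  let ?p = std_normal_density
  have C: "C >= 0" using order_trans[OF abs_ge_zero b(1)[of 0]] by simp
  have cg: "isCont g y" for y using d DERIV_isCont by blast
  have m: "g \<in> borel_measurable borel" "g' \<in> borel_measurable borel"
    by (intro borel_measurable_continuous_onI continuous_at_imp_continuous_on ballI cg c)+
  have e: "exp (y\<^sup>2/8) * exp (y\<^sup>2/8) = exp (y\<^sup>2/4)" for y :: real by (simp add: exp_add[symmetric])
  have i1: "integrable N1 (%y. y * g y)"
  proof (rule N1_integrable[where K="8*C"])
    fix y :: real
    have "\<bar>y\<bar> <= 1 + y\<^sup>2" using zero_le_power2[of "\<bar>y\<bar> - 1"] zero_le_power2[of y] by (simp add: power2_diff)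
    also have "\<dots> <= 8 * exp (y\<^sup>2/8)" by (rule exp8) simp
    finally have "\<bar>y\<bar> * \<bar>g y\<bar> <= (8 * exp (y\<^sup>2/8)) * (C * exp (y\<^sup>2/8))" by (intro mult_mono b) auto
    then show "\<bar>y * g y\<bar> <= 8 * C * exp (y\<^sup>2/4)" by (simp add: abs_mult e[symmetric] mult_ac)
  qed (use m in measurable)
  have i2: "integrable N1 g'"
  proof (rule N1_integrable[where K=C])
    fix y :: real
    have "exp (y\<^sup>2/8) <= exp (y\<^sup>2/4)" by simp
    then show "\<bar>g' y\<bar> <= C * exp (y\<^sup>2/4)" using b(2)[of y] C by (meson mult_left_mono order_trans)
  qed (use m in measurable)
  have j1: "integrable lborel (%y. ?p y * (y * g y))" using i1 by (subst (asm) integrable_density) (use m in auto)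
  have j2: "integrable lborel (%y. ?p y * g' y)" using i2 by (subst (asm) integrable_density) (use m in auto)
  let ?f = "%y. ?p y * g' y - ?p y * (y * g y)"
  have dp: "(?p has_real_derivative - y * ?p y) (at y)" for y
    unfolding std_normal_density_def by (auto intro!: derivative_eq_intros simp: field_simps)
  have lim: "((%y. ?p y * g y) \<longlongrightarrow> 0) F" if F: "F = at_top \<or> F = at_bot" for F
  proof (rule Lim_null_comparison)
    show "\<forall>\<^sub>F y in F. norm (?p y * g y) <= C * exp (- 3 * y\<^sup>2 / 8)"
    proof (rule always_eventually, rule allI)
      fix y
      have "?p y <= exp (- y\<^sup>2 / 2)"
      proof -
        have "sqrt (2 * pi) >= 1" using pi_ge_two by simp
        then have "1 / sqrt (2 * pi) <= 1" by simp
        then have "1 / sqrt (2 * pi) * exp (- y\<^sup>2 / 2) <= 1 * exp (- y\<^sup>2 / 2)" by (intro mult_right_mono) auto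
        then show ?thesis by (simp add: std_normal_density_def)
      qed
      then have "?p y * \<bar>g y\<bar> <= exp (- y\<^sup>2 / 2) * (C * exp (y\<^sup>2/8))" by (intro mult_mono b) auto
      also have "\<dots> = C * exp (- 3 * y\<^sup>2 / 8)" by (simp add: exp_add[symmetric])
      finally show "norm (?p y * g y) <= C * exp (- 3 * y\<^sup>2 / 8)" by (simp add: abs_mult)
    qed
    have "((%y::real. exp (- 3 * y\<^sup>2 / 8)) \<longlongrightarrow> 0) at_top" "((%y::real. exp (- 3 * y\<^sup>2 / 8)) \<longlongrightarrow> 0) at_bot"
      by real_asymp+
    then have "((%y. exp (- 3 * y\<^sup>2 / 8)) \<longlongrightarrow> 0) F" using F by auto
    then show "((%y. C * exp (- 3 * y\<^sup>2 / 8)) \<longlongrightarrow> 0) F" by (rule tendsto_mult_right_zero)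
  qed
  have "(LBINT y=-\<infinity>..\<infinity>. ?f y) = 0 - 0"
  proof (rule interval_integral_FTC_integrable[where F = "%y. ?p y * g y"])
    show "((%y. ?p y * g y) has_vector_derivative ?f y) (at y)" for y
      unfolding has_real_derivative_iff_has_vector_derivative[symmetric]
      by (auto intro!: derivative_eq_intros d dp simp: algebra_simps)
    show "isCont ?f y" for y using DERIV_isCont[OF dp] cg c by (intro continuous_intros) auto
    show "set_integrable lborel (einterval (-\<infinity>) \<infinity>) ?f"
      using j1 j2 by (auto simp: set_integrable_def intro!: integrable_diff)
    show "(((%y. ?p y * g y) \<circ> real_of_ereal) \<longlongrightarrow> 0) (at_right (-\<infinity>))"
      using lim by (simp add: ereal_tendsto_simps)
    show "(((%y. ?p y * g y) \<circ> real_of_ereal) \<longlongrightarrow> 0) (at_left \<infinity>)"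
      using lim by (simp add: ereal_tendsto_simps)
  qed auto
  then have "(\<integral>y. ?f y \<partial>lborel) = 0"
    by (simp add: interval_lebesgue_integral_def set_lebesgue_integral_def)
  then have "(\<integral>y. ?p y * g' y \<partial>lborel) = (\<integral>y. ?p y * (y * g y) \<partial>lborel)" using j1 j2 by simp
  then show ?thesis using m by (simp add: integral_density)
qed

section \<open>The Gaussian measure in several variables and integration by parts\<close>

definition GM :: "('n::finite => real) measure" where "GM = PiM UNIV (%_. N1)"

definition zv :: "('n::finite => real) => real^'n" where "zv z = (\<chi> i. z i)"

definition sq :: "('n::finite => real) => real" where "sq z = (\<Sum>i\<in>UNIV. (z i)\<^sup>2)"

lemma prob_GM: "prob_space (GM :: ('n::finite => real) measure)"
  unfolding GM_def by (intro prob_space_PiM prob_N1)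

lemma coord_meas [measurable]: "(%z. z i) \<in> borel_measurable GM"
proof -
  have "(%z. z i) \<in> measurable GM N1" unfolding GM_def by (rule measurable_component_singleton) simp
  moreover have "measurable GM N1 = measurable GM (borel :: real measure)" by (rule measurable_cong_sets) simp_all
  ultimately show ?thesis by simp
qed

lemma zv_meas [measurable]: "zv \<in> borel_measurable (GM :: ('n::finite => real) measure)"
proof (rule borel_measurable_euclidean_space[THEN iffD2], rule ballI)
  fix b :: "real^'n" assume "b \<in> Basis"
  then obtain i where "b = axis i 1" by (auto simp: Basis_vec_def)
  then show "(%z. zv z \<bullet> b) \<in> borel_measurable GM" by (simp add: zv_def inner_axis)
qed

lemma sq_meas [measurable]: "sq \<in> borel_measurable GM" unfolding sq_def by measurable

lemma sq_nonneg: "sq z >= 0" unfolding sq_def by (intro sum_nonneg) auto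

lemma norm_zv: "(norm (zv z))\<^sup>2 = sq z"
  unfolding power2_norm_eq_inner inner_vec_def zv_def sq_def by (simp add: power2_eq_square)

lemma coord_le_sq: "(z i)\<^sup>2 <= sq z" unfolding sq_def by (intro member_le_sum) auto

lemma abs_le_1sq: "\<bar>t\<bar> <= 1 + t\<^sup>2" for t :: real
  using zero_le_power2[of "\<bar>t\<bar> - 1"] zero_le_power2[of t] by (simp add: power2_diff)

lemma abs_coord: "\<bar>z i\<bar> <= 1 + sq z" using abs_le_1sq[of "z i"] coord_le_sq[of z i] by linarith

lemma WI: "integrable (GM :: ('n::finite => real) measure) (%z. exp (sq z / 4))"
proof -
  interpret product_sigma_finite "%_::'n. N1"
    by (intro product_sigma_finite.intro prob_space_imp_sigma_finite prob_N1)
  have "integrable (PiM UNIV (%_::'n. N1)) (%z. \<Prod>i\<in>UNIV. exp ((z i)\<^sup>2 / 4))"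
    by (rule product_integrable_prod) (auto intro: W1)
  also have "(%z::'n => real. \<Prod>i\<in>UNIV. exp ((z i)\<^sup>2 / 4)) = (%z. exp (sq z / 4))"
    by (intro ext) (simp add: sq_def exp_sum sum_divide_distrib)
  finally show ?thesis unfolding GM_def .
qed

lemma GM_integrable:
  assumes "h \<in> borel_measurable GM" "\<And>z. \<bar>h z\<bar> <= K * exp (sq z / 4)"
  shows "integrable GM h"
proof (rule Bochner_Integration.integrable_bound)
  show "integrable GM (%z. K * exp (sq z / 4))" using WI by (intro integrable_mult_right)
  show "AE z in GM. norm (h z) <= norm (K * exp (sq z / 4))"
    using assms(2) by (intro AE_I2) (metis abs_ge_self order_trans real_norm_def)
qed (use assms in simp)

text \<open>Fubini isolates the coordinate \<open>i\<close>. With the others fixed this is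
  \<open>stein1\<close>, where their squares only enlarge the constant by the factor
  \<open>exp (r/8)\<close>.\<close>

lemma steinN:
  fixes G G' :: "('n::finite => real) => real"
  assumes m [measurable]: "G \<in> borel_measurable GM" "G' \<in> borel_measurable GM"
    and d: "\<And>z y. ((%y. G (z(i := y))) has_real_derivative G' (z(i := y))) (at y)"
    and c: "\<And>z y. isCont (%y. G' (z(i := y))) y"
    and b: "\<And>z. \<bar>G z\<bar> <= C * exp (sq z/8)" "\<And>z. \<bar>G' z\<bar> <= C * exp (sq z/8)"
  shows "(\<integral>z. z i * G z \<partial>GM) = (\<integral>z. G' z \<partial>GM)" "integrable GM (%z. z i * G z)" "integrable GM G'"
proof -
  interpret product_sigma_finite "%_::'n. N1"
    by (intro product_sigma_finite.intro prob_space_imp_sigma_finite prob_N1)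
  have C: "C >= 0" using order_trans[OF abs_ge_zero b(1)[of "%_. 0"]] by (simp add: sq_def)
  have e: "exp (sq z/8) * exp (sq z/8) = exp (sq z/4)" for z :: "'n => real" by (simp add: exp_add[symmetric])
  show i1: "integrable GM (%z. z i * G z)"
  proof (rule GM_integrable[where K="8*C"])
    fix z :: "'n => real"
    have "\<bar>z i\<bar> <= 8 * exp (sq z/8)" using abs_coord[of z i] exp8[OF sq_nonneg[of z]] by linarith
    then have "\<bar>z i\<bar> * \<bar>G z\<bar> <= (8 * exp (sq z/8)) * (C * exp (sq z/8))" by (intro mult_mono b) auto
    then show "\<bar>z i * G z\<bar> <= 8 * C * exp (sq z/4)" by (simp add: abs_mult e[symmetric] mult_ac)
  qed measurable
  show i2: "integrable GM G'"
  proof (rule GM_integrable[where K=C])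
    fix z :: "'n => real"
    have "exp (sq z/8) <= exp (sq z/4)" using sq_nonneg[of z] by simp
    then show "\<bar>G' z\<bar> <= C * exp (sq z/4)" using b(2)[of z] C by (meson mult_left_mono order_trans)
  qed measurable
  define I where "I = UNIV - {i}"
  have GI: "GM = PiM (insert i I) (%_::'n. N1)" unfolding GM_def I_def by (simp add: insert_absorb)
  have I: "finite I" "i \<notin> I" unfolding I_def by auto
  have "(\<integral>z. z i * G z \<partial>GM) = (\<integral>x. (\<integral>y. y * G (x(i := y)) \<partial>N1) \<partial>PiM I (%_. N1))"
    unfolding GI using i1[unfolded GI] by (subst product_integral_insert[OF I]) auto
  also have "\<dots> = (\<integral>x. (\<integral>y. G' (x(i := y)) \<partial>N1) \<partial>PiM I (%_. N1))"
  proof (rule Bochner_Integration.integral_cong[OF refl])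
    fix x :: "'n => real"
    define r where "r = (\<Sum>l\<in>I. (x l)\<^sup>2)"
    have s: "sq (x(i := y)) = y\<^sup>2 + r" for y
    proof -
      have "sq (x(i := y)) = (\<Sum>l\<in>insert i I. ((x(i := y)) l)\<^sup>2)" unfolding sq_def I_def by (simp add: insert_absorb)
      also have "\<dots> = y\<^sup>2 + r" using I by (simp add: r_def) (intro sum.cong, auto)
      finally show ?thesis .
    qed
    have e2: "C * exp ((y\<^sup>2 + r) / 8) = (C * exp (r/8)) * exp (y\<^sup>2/8)" for y by (simp add: add_divide_distrib exp_add)
    show "(\<integral>y. y * G (x(i := y)) \<partial>N1) = (\<integral>y. G' (x(i := y)) \<partial>N1)"
    proof (rule stein1[where C = "C * exp (r/8)"])
      show "\<bar>G (x(i := y))\<bar> <= C * exp (r/8) * exp (y\<^sup>2/8)" for y using b(1)[of "x(i := y)"] by (simp only: s e2)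
      show "\<bar>G' (x(i := y))\<bar> <= C * exp (r/8) * exp (y\<^sup>2/8)" for y using b(2)[of "x(i := y)"] by (simp only: s e2)
    qed (rule d c)+
  qed
  also have "\<dots> = (\<integral>z. G' z \<partial>GM)"
    unfolding GI using i2[unfolded GI] by (subst product_integral_insert[OF I]) auto
  finally show "(\<integral>z. z i * G z \<partial>GM) = (\<integral>z. G' z \<partial>GM)" .
qed

lemma fld_meas: "AC F ==> (%z. F \<tau> (x + s *\<^sub>R zv z)) \<in> borel_measurable GM"
  by (rule measurable_compose[OF _ borel_measurable_continuous_onI[OF AC_cont_x]]) auto

lemma zv_upd: "zv (z(i := y)) = zv z + (y - z i) *\<^sub>R axis i 1"
  by (auto simp: zv_def vec_eq_iff axis_def)

lemma fld_upd: "F \<tau> (x + s *\<^sub>R zv (z(i := y))) = shf (Some i) (s * (y - z i)) F \<tau> (x + s *\<^sub>R zv z)"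
  by (simp add: zv_upd algebra_simps)

lemma fld_upd_DERIV:
  assumes "smooth F"
  shows "((%y. F \<tau> (x + s *\<^sub>R zv (z(i := y)))) has_real_derivative s * D (Some i) F \<tau> (x + s *\<^sub>R zv (z(i := y)))) (at y)"
proof -
  have 1: "((%y. s * (y - z i)) has_real_derivative s) (at y)" by (auto intro!: derivative_eq_intros)
  have 2: "((%r. shf (Some i) r F \<tau> (x + s *\<^sub>R zv z)) has_real_derivative
      shf (Some i) (s * (y - z i)) (D (Some i) F) \<tau> (x + s *\<^sub>R zv z)) (at (s * (y - z i)))"
    by (rule hasD_at[OF smooth_hasD[OF assms]])
  show ?thesis unfolding fld_upd using DERIV_chain2[OF 2 1] by (simp only: mult.commute)
qed

text \<open>The derivative is moved from \<open>F\<close> to the kernel \<open>q\<close> at the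
  price of a factor \<open>1/s\<close>: this is \<open>steinN\<close> for the product of
  \<open>q z\<close> and \<open>F (x + s z)\<close>.\<close>

lemma stein_fld:
  assumes F: "smooth F" and m [measurable]: "q \<in> borel_measurable GM" "q' \<in> borel_measurable GM"
    and d: "\<And>z y. ((%y. q (z(i := y))) has_real_derivative q' (z(i := y))) (at y)"
    and c: "\<And>z y. isCont (%y. q' (z(i := y))) y"
    and b: "\<And>z. \<bar>q z\<bar> <= K * (1 + sq z)" "\<And>z. \<bar>q' z\<bar> <= K * (1 + sq z)"
  shows "s * (\<integral>z. q z * D (Some i) F \<tau> (x + s *\<^sub>R zv z) \<partial>GM) = (\<integral>z. (z i * q z - q' z) * F \<tau> (x + s *\<^sub>R zv z) \<partial>GM)"
proof -
  let ?f = "%z. F \<tau> (x + s *\<^sub>R zv z)" and ?g = "%z. D (Some i) F \<tau> (x + s *\<^sub>R zv z)"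
  note AF = smooth_AC[OF F] and AD = smooth_AC[OF smooth_D[OF F, of "Some i"]]
  note [measurable] = fld_meas[OF AF] fld_meas[OF AD]
  obtain M1 where M1: "M1 > 0" "\<And>\<tau> x. \<bar>F \<tau> x\<bar> <= M1" using AC_bdd_pos[OF AF] by blast
  obtain M2 where M2: "M2 > 0" "\<And>\<tau> x. \<bar>D (Some i) F \<tau> x\<bar> <= M2" using AC_bdd_pos[OF AD] by blast
  have K: "K >= 0" using order_trans[OF abs_ge_zero b(1)[of "%_. 0"]] by (simp add: sq_def)
  define C where "C = 8 * K * (M1 + (M1 + \<bar>s\<bar> * M2))"
  have q8: "\<bar>q z\<bar> <= 8 * K * exp (sq z / 8)" "\<bar>q' z\<bar> <= 8 * K * exp (sq z / 8)" for z
  proof -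
    have "K * (1 + sq z) <= K * (8 * exp (sq z/8))" by (intro mult_left_mono exp8 sq_nonneg K)
    then show "\<bar>q z\<bar> <= 8 * K * exp (sq z / 8)" "\<bar>q' z\<bar> <= 8 * K * exp (sq z / 8)" using b[of z] by auto
  qed
  have bd: "\<bar>q z * ?f z\<bar> <= C * exp (sq z / 8)" "\<bar>q' z * ?f z\<bar> <= 8 * K * M1 * exp (sq z / 8)"
     "\<bar>s * (q z * ?g z)\<bar> <= 8 * K * (\<bar>s\<bar> * M2) * exp (sq z / 8)" for z
  proof -
    have "\<bar>q z\<bar> * \<bar>?f z\<bar> <= (8 * K * exp (sq z / 8)) * M1" by (intro mult_mono q8 M1) (use K in auto)
    also have "\<dots> <= (8 * K * exp (sq z / 8)) * (M1 + (M1 + \<bar>s\<bar> * M2))" using M1 M2 K by (intro mult_left_mono) auto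
    finally show "\<bar>q z * ?f z\<bar> <= C * exp (sq z / 8)" by (simp add: abs_mult C_def algebra_simps)
    have "\<bar>q' z\<bar> * \<bar>?f z\<bar> <= (8 * K * exp (sq z / 8)) * M1" by (intro mult_mono q8 M1) (use K in auto)
    then show "\<bar>q' z * ?f z\<bar> <= 8 * K * M1 * exp (sq z / 8)" by (simp add: abs_mult mult_ac)
    have "\<bar>q z\<bar> * \<bar>?g z\<bar> <= (8 * K * exp (sq z / 8)) * M2" by (intro mult_mono q8 M2) (use K in auto)
    then have "\<bar>s\<bar> * (\<bar>q z\<bar> * \<bar>?g z\<bar>) <= \<bar>s\<bar> * ((8 * K * exp (sq z / 8)) * M2)" by (intro mult_left_mono) auto
    then show "\<bar>s * (q z * ?g z)\<bar> <= 8 * K * (\<bar>s\<bar> * M2) * exp (sq z / 8)" by (simp add: abs_mult mult_ac)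
  qed
  let ?G' = "%z. q' z * ?f z + s * (q z * ?g z)"
  have bd2: "\<bar>?G' z\<bar> <= C * exp (sq z/8)" for z
  proof -
    have "8 * K * M1 * exp (sq z / 8) + 8 * K * (\<bar>s\<bar> * M2) * exp (sq z / 8) <= C * exp (sq z / 8)"
      unfolding C_def using K M1 by (simp add: algebra_simps)
    then show ?thesis using bd(2,3)[of z] by linarith
  qed
  have dG: "((%y. q (z(i := y)) * ?f (z(i := y))) has_real_derivative ?G' (z(i := y))) (at y)" for z y
    by (rule derivative_eq_intros d fld_upd_DERIV[OF F] refl)+ (simp add: algebra_simps)
  have cG: "isCont (%y. ?G' (z(i := y))) y" for z y
    using DERIV_isCont[OF d] DERIV_isCont[OF fld_upd_DERIV[OF F]] DERIV_isCont[OF fld_upd_DERIV[OF smooth_D[OF F, of "Some i"]]] c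
    by (intro continuous_intros)
  have mG: "(%z. q z * ?f z) \<in> borel_measurable GM" and mG': "?G' \<in> borel_measurable GM" by measurable
  have st: "(\<integral>z. z i * (q z * ?f z) \<partial>GM) = (\<integral>z. ?G' z \<partial>GM)" "integrable GM (%z. z i * (q z * ?f z))"
    by (rule steinN(1)[OF mG mG' dG cG bd(1) bd2], rule steinN(2)[OF mG mG' dG cG bd(1) bd2])
  have mono: "8 * K * a * exp (sq z / 8) <= 8 * K * a * exp (sq z/4)" if "a >= 0" for z and a :: real
    using sq_nonneg[of z] K that by (intro mult_left_mono) auto
  have i1: "integrable GM (%z. q' z * ?f z)"
  proof (rule GM_integrable[where K = "8 * K * M1"])
    show "\<bar>q' z * ?f z\<bar> <= 8 * K * M1 * exp (sq z / 4)" for z by (rule order_trans[OF bd(2) mono]) (use M1 in simp)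
  qed measurable
  have i2: "integrable GM (%z. s * (q z * ?g z))"
  proof (rule GM_integrable[where K = "8 * K * (\<bar>s\<bar> * M2)"])
    show "\<bar>s * (q z * ?g z)\<bar> <= 8 * K * (\<bar>s\<bar> * M2) * exp (sq z / 4)" for z by (rule order_trans[OF bd(3) mono]) (use M2 in simp)
  qed measurable
  have "(\<integral>z. (z i * q z - q' z) * ?f z \<partial>GM) = (\<integral>z. z i * (q z * ?f z) - q' z * ?f z \<partial>GM)"
    by (simp add: algebra_simps)
  also have "\<dots> = (\<integral>z. z i * (q z * ?f z) \<partial>GM) - (\<integral>z. q' z * ?f z \<partial>GM)" using st(2) i1 by simp
  also have "\<dots> = (\<integral>z. s * (q z * ?g z) \<partial>GM)" unfolding st(1) using i1 i2 by simp
  finally show ?thesis by simp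
qed

section \<open>Averages of fields and their Hermite kernels\<close>

definition EF :: "real => 'n::finite fld => 'n fld" where
  "EF s F = (%\<tau> x. \<integral>z. F \<tau> (x + s *\<^sub>R zv z) \<partial>GM)"

definition kd :: "'a => 'a => real" where "kd i j = (if i = j then 1 else 0)"

lemma upd_DERIV: "((%y. (z(i := y)) j) has_real_derivative kd i j) (at y)"
  by (cases "i = j") (auto simp: kd_def)

lemma EF_D1:
  assumes "smooth F"
  shows "s * EF s (D (Some i) F) \<tau> x = (\<integral>z. z i * F \<tau> (x + s *\<^sub>R zv z) \<partial>GM)"
  using stein_fld[OF assms, of "%_. 1" "%_. 0" i 1 s \<tau> x] by (simp add: EF_def sq_nonneg)

text \<open>\<open>H2\<close> and \<open>H3\<close> are the Hermite polynomials of degree two and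
  three in several variables; they are the kernels left by two and three integrations by
  parts.\<close>

definition H2 :: "'n::finite => 'n => ('n => real) => real" where "H2 i j z = z i * z j - kd i j"
definition H3 :: "'n::finite => 'n => 'n => ('n => real) => real" where
  "H3 k i j z = z k * H2 i j z - (kd k i * z j + z i * kd k j)"

lemma H2_meas [measurable]: "H2 i j \<in> borel_measurable GM" unfolding H2_def by measurable
lemma H3_meas [measurable]: "H3 k i j \<in> borel_measurable GM" unfolding H3_def by measurable

lemma kd_abs: "\<bar>kd i j\<bar> <= 1" by (simp add: kd_def)

lemma prod_coord: "\<bar>z i * z j\<bar> <= sq z"
proof -
  have "2 * \<bar>z i * z j\<bar> <= (z i)\<^sup>2 + (z j)\<^sup>2"
    using sum_squares_bound[of "\<bar>z i\<bar>" "\<bar>z j\<bar>"] by (simp add: abs_mult)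
  then show ?thesis using coord_le_sq[of z i] coord_le_sq[of z j] by linarith
qed

lemma H2_bound: "\<bar>H2 i j z\<bar> <= 1 + sq z"
  using prod_coord[of z i j] kd_abs[of i j] unfolding H2_def by linarith

lemma EF_D2:
  assumes "smooth F"
  shows "s^2 * EF s (D (Some i) (D (Some j) F)) \<tau> x = (\<integral>z. H2 i j z * F \<tau> (x + s *\<^sub>R zv z) \<partial>GM)"
proof -
  have k: "\<bar>kd j i\<bar> <= 1 + sq z" for z :: "'a => real" using kd_abs[of j i] sq_nonneg[of z] by linarith
  have a: "\<bar>z i\<bar> <= 1 + sq z" for z :: "'a => real" by (rule abs_coord)
  have "s^2 * EF s (D (Some i) (D (Some j) F)) \<tau> x = s * (\<integral>z. z i * D (Some j) F \<tau> (x + s *\<^sub>R zv z) \<partial>GM)"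
    using EF_D1[OF smooth_D[OF assms, of "Some j"], of s i \<tau> x] by (simp add: power2_eq_square mult.assoc)
  also have "\<dots> = (\<integral>z. (z j * z i - kd j i) * F \<tau> (x + s *\<^sub>R zv z) \<partial>GM)"
    by (rule stein_fld[OF assms, where K=1]) (use upd_DERIV k a in auto)
  finally show ?thesis by (simp add: H2_def mult.commute kd_def eq_commute)
qed

lemma EF_D3:
  assumes "smooth F"
  shows "s^3 * EF s (D (Some i) (D (Some j) (D (Some k) F))) \<tau> x = (\<integral>z. H3 k i j z * F \<tau> (x + s *\<^sub>R zv z) \<partial>GM)"
proof -
  have m: "(%z. kd k i * z j + z i * kd k j) \<in> borel_measurable GM" by measurable
  have b: "\<bar>kd k i * z j + z i * kd k j\<bar> <= 2 * (1 + sq z)" for z :: "'a => real"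
    using abs_coord[of z i] abs_coord[of z j] sq_nonneg[of z] by (auto simp: kd_def)
  have b2: "\<bar>H2 i j z\<bar> <= 2 * (1 + sq z)" for z :: "'a => real" using H2_bound[of i j z] sq_nonneg[of z] unfolding distrib_left by linarith
  have "s^3 * EF s (D (Some i) (D (Some j) (D (Some k) F))) \<tau> x = s * (\<integral>z. H2 i j z * D (Some k) F \<tau> (x + s *\<^sub>R zv z) \<partial>GM)"
    using EF_D2[OF smooth_D[OF assms, of "Some k"], of s i j \<tau> x] by (simp add: power3_eq_cube power2_eq_square mult.assoc)
  also have "\<dots> = (\<integral>z. (z k * H2 i j z - (kd k i * z j + z i * kd k j)) * F \<tau> (x + s *\<^sub>R zv z) \<partial>GM)"
  proof (rule stein_fld[OF assms H2_meas m, where K=2])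
    show "((%y. H2 i j (z(k := y))) has_real_derivative kd k i * (z(k := y)) j + (z(k := y)) i * kd k j) (at y)" for z y
      unfolding H2_def by (rule derivative_eq_intros upd_DERIV refl)+ simp
    show "isCont (%y. kd k i * (z(k := y)) j + (z(k := y)) i * kd k j) y" for z y
      using DERIV_isCont[OF upd_DERIV] by (intro continuous_intros)
  qed (rule b2 b)+
  finally show ?thesis by (simp add: H3_def)
qed

text \<open>The integrand dominates \<open>3 * (1 + sq z)^3\<close>, two powers for the kernel and
  one for the Hoelder increment; 5184 is 3 times the constant 1728 of \<open>exp12\<close>.\<close>

definition KG :: "'n::finite itself => real" where
  "KG _ = (\<integral>z. 5184 * exp (sq z / 4) \<partial>(GM :: ('n => real) measure))"

lemma KG_nonneg: "KG TYPE('n::finite) >= 0" unfolding KG_def by (intro integral_nonneg_AE) auto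

lemma sqrt_norm_zv: "sqrt (norm (zv z)) <= 1 + sq z"
proof -
  have "sqrt (norm (zv z)) <= 1 + (norm (zv z))\<^sup>2"
  proof (cases "norm (zv z) <= 1")
    case True
    then have "sqrt (norm (zv z)) <= 1" by simp
    then show ?thesis using zero_le_power2[of "norm (zv z)"] by linarith
  next
    case False
    then have "norm (zv z) <= (norm (zv z))^4" using self_le_power[of "norm (zv z)" 4] by simp
    then have "sqrt (norm (zv z)) <= sqrt ((norm (zv z))^4)" by simp
    also have "\<dots> = (norm (zv z))\<^sup>2" by (rule real_sqrt_unique) auto
    finally show ?thesis by simp
  qed
  then show ?thesis by (simp add: norm_zv)
qed

lemma H_bounds: "\<bar>H2 i j z\<bar> <= 3 * (1 + sq z)\<^sup>2" "\<bar>H3 k i j z\<bar> <= 3 * (1 + sq z)\<^sup>2"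
proof -
  have s: "sq z >= 0" by (rule sq_nonneg)
  have "1 + sq z <= (1 + sq z)\<^sup>2" using s by (simp add: power2_eq_square algebra_simps)
  then show "\<bar>H2 i j z\<bar> <= 3 * (1 + sq z)\<^sup>2" using H2_bound[of i j z] s by arith
  have "\<bar>z k * H2 i j z\<bar> <= (1 + sq z) * (1 + sq z)"
    unfolding abs_mult by (intro mult_mono abs_coord H2_bound) (use s in auto)
  moreover have "\<bar>kd k i * z j + z i * kd k j\<bar> <= 2 * (1 + sq z)"
    using abs_coord[of z i] abs_coord[of z j] s by (auto simp: kd_def)
  ultimately show "\<bar>H3 k i j z\<bar> <= 3 * (1 + sq z)\<^sup>2"
    using \<open>1 + sq z <= (1 + sq z)\<^sup>2\<close> unfolding H3_def by (simp add: power2_eq_square)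
qed

text \<open>Since the kernel has mean zero, \<open>F \<tau> x\<close> may be subtracted. The Hoelder
  condition then puts \<open>sqrt (s * norm (zv z))\<close> under the integral, whence the gain
  \<open>sqrt s\<close>.\<close>

lemma kernel_bound:
  fixes F :: "'n::finite fld"
  assumes F: "AC F" and L: "\<And>x y. \<bar>F \<tau> x - F \<tau> y\<bar> <= L * sqrt (dist x y)" and s: "s >= 0"
    and q [measurable]: "q \<in> borel_measurable GM" and b: "\<And>z. \<bar>q z\<bar> <= 3 * (1 + sq z)\<^sup>2" and q0: "(\<integral>z. q z \<partial>GM) = 0"
  shows "\<bar>\<integral>z. q z * F \<tau> (x + s *\<^sub>R zv z) \<partial>GM\<bar> <= L * sqrt s * KG TYPE('n)"
proof -
  note [measurable] = fld_meas[OF F]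
  obtain M where M: "M > 0" "\<And>\<tau> x. \<bar>F \<tau> x\<bar> <= M" using AC_bdd_pos[OF F] by blast
  have L0: "L >= 0"
  proof -
    have "0 <= L * sqrt (dist (axis undefined 1 :: real^'n) 0)" using L[of "axis undefined 1" 0] by linarith
    then show ?thesis by (simp add: norm_axis_1)
  qed
  have e3: "3 * (1 + sq z)^3 <= 5184 * exp (sq z / 4)" for z :: "'n => real" using exp12[OF sq_nonneg[of z]] by linarith
  have b3: "3 * (1 + sq z)\<^sup>2 <= 5184 * exp (sq z / 4)" for z :: "'n => real"
  proof -
    have "(1 + sq z)\<^sup>2 <= (1 + sq z)^3" using sq_nonneg[of z] by (intro power_increasing) auto
    then show ?thesis using e3[of z] by linarith
  qed
  have iq: "integrable GM q" by (rule GM_integrable[OF q, where K=5184]) (use order_trans[OF b b3] in blast)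
  have iqF: "integrable GM (%z. q z * F \<tau> (x + s *\<^sub>R zv z))"
  proof (rule GM_integrable[where K="5184 * M"])
    fix z
    have "\<bar>q z\<bar> * \<bar>F \<tau> (x + s *\<^sub>R zv z)\<bar> <= (5184 * exp (sq z / 4)) * M"
      by (intro mult_mono order_trans[OF b b3] M) auto
    then show "\<bar>q z * F \<tau> (x + s *\<^sub>R zv z)\<bar> <= 5184 * M * exp (sq z / 4)" by (simp add: abs_mult mult_ac)
  qed measurable
  have "(\<integral>z. q z * F \<tau> (x + s *\<^sub>R zv z) \<partial>GM) = (\<integral>z. q z * F \<tau> (x + s *\<^sub>R zv z) - q z * F \<tau> x \<partial>GM)"
    using iq iqF q0 by simp
  also have "\<bar>\<dots>\<bar> <= (\<integral>z. norm (q z * F \<tau> (x + s *\<^sub>R zv z) - q z * F \<tau> x) \<partial>GM)"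
    using integral_norm_bound[of GM "%z. q z * F \<tau> (x + s *\<^sub>R zv z) - q z * F \<tau> x"] by simp
  also have "\<dots> <= (\<integral>z. L * sqrt s * (5184 * exp (sq z / 4)) \<partial>(GM :: ('n => real) measure))"
  proof (rule Bochner_Integration.integral_mono)
    show "integrable GM (%z. norm (q z * F \<tau> (x + s *\<^sub>R zv z) - q z * F \<tau> x))" using iq iqF by (intro integrable_norm Bochner_Integration.integrable_diff integrable_mult_left)
    show "integrable GM (%z. L * sqrt s * (5184 * exp (sq z / 4)))" using WI by auto
    fix z :: "'n => real"
    have "\<bar>F \<tau> (x + s *\<^sub>R zv z) - F \<tau> x\<bar> <= L * sqrt (s * norm (zv z))"
      using L[of "x + s *\<^sub>R zv z" x] s by (simp add: dist_norm)
    also have "\<dots> = L * sqrt s * sqrt (norm (zv z))" by (simp add: real_sqrt_mult)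
    also have "\<dots> <= L * sqrt s * (1 + sq z)" by (intro mult_left_mono sqrt_norm_zv) (use L0 s in auto)
    finally have "\<bar>q z\<bar> * \<bar>F \<tau> (x + s *\<^sub>R zv z) - F \<tau> x\<bar> <= (3 * (1 + sq z)\<^sup>2) * (L * sqrt s * (1 + sq z))"
      by (intro mult_mono b) auto
    also have "\<dots> = L * sqrt s * (3 * (1 + sq z)^3)" by (simp add: power3_eq_cube power2_eq_square)
    also have "\<dots> <= L * sqrt s * (5184 * exp (sq z / 4))" by (intro mult_left_mono e3) (use L0 s in auto)
    finally show "norm (q z * F \<tau> (x + s *\<^sub>R zv z) - q z * F \<tau> x) <= L * sqrt s * (5184 * exp (sq z / 4))"
      by (simp add: abs_mult right_diff_distrib[symmetric])
  qed
  also have "\<dots> = L * sqrt s * KG TYPE('n)" by (simp add: KG_def)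
  finally show ?thesis .
qed

text \<open>Integration by parts applied to the constant field 1.\<close>

lemma H2_mean: "(\<integral>z. H2 i j z \<partial>GM) = 0"
  using EF_D2[OF smooth_cst[of 1], of 1 i j 0 0] by (simp add: D_cst D_0 EF_def)

lemma H3_mean: "(\<integral>z. H3 k i j z \<partial>GM) = 0"
  using EF_D3[OF smooth_cst[of 1], of 1 i j k 0 0] by (simp add: D_cst D_0 EF_def)

text \<open>On Hoelder functions two derivatives thus cost \<open>s^(-3/2)\<close> instead of
  \<open>s^(-2)\<close>. The half power makes the integral over \<open>s\<close> in the resolvent
  converge at 0, where the density only contributes a factor \<open>s\<close>.\<close>

lemma EF_D2_bound:
  fixes F :: "'n::finite fld"
  assumes F: "smooth F" and L: "\<And>x y. \<bar>F \<tau> x - F \<tau> y\<bar> <= L * sqrt (dist x y)" and s: "s >= 0"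
  shows "\<bar>s^2 * EF s (D (Some i) (D (Some j) F)) \<tau> x\<bar> <= L * sqrt s * KG TYPE('n)"
  unfolding EF_D2[OF F] by (rule kernel_bound[OF smooth_AC[OF F] L s H2_meas H_bounds(1) H2_mean])

lemma EF_D3_bound:
  fixes F :: "'n::finite fld"
  assumes F: "smooth F" and L: "\<And>x y. \<bar>F \<tau> x - F \<tau> y\<bar> <= L * sqrt (dist x y)" and s: "s >= 0"
  shows "\<bar>s^3 * EF s (D (Some i) (D (Some j) (D (Some k) F))) \<tau> x\<bar> <= L * sqrt s * KG TYPE('n)"
  unfolding EF_D3[OF F] by (rule kernel_bound[OF smooth_AC[OF F] L s H3_meas H_bounds(2) H3_mean])

section \<open>The resolvent of the Laplacian\<close>

lemma prob_abs_le:
  assumes "prob_space M" "f \<in> borel_measurable M" "\<And>x. \<bar>f x\<bar> <= (e::real)"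
  shows "\<bar>\<integral>x. f x \<partial>M\<bar> <= e" "integrable M f"
proof -
  interpret prob_space M by fact
  show i: "integrable M f" by (rule integrable_const_bound[where B=e]) (use assms in auto)
  have "\<bar>\<integral>x. f x \<partial>M\<bar> <= (\<integral>x. \<bar>f x\<bar> \<partial>M)" using integral_norm_bound[of M f] by simp
  also have "\<dots> <= (\<integral>x. e \<partial>M)" by (rule Bochner_Integration.integral_mono) (use i assms in auto)
  also have "\<dots> = e" by (simp add: prob_space)
  finally show "\<bar>\<integral>x. f x \<partial>M\<bar> <= e" .
qed

lemma EF_diff_bound:
  assumes F: "AC F" and G: "AC G" and e: "\<And>y. \<bar>F \<tau> (x + y) - G \<tau>' (x' + y)\<bar> <= e"
  shows "\<bar>EF s F \<tau> x - EF s G \<tau>' x'\<bar> <= e"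
proof -
  note [measurable] = fld_meas[OF F] fld_meas[OF G]
  obtain MF where MF: "\<And>\<tau> x. \<bar>F \<tau> x\<bar> <= MF" using AC_bdd[OF F] by blast
  obtain MG where MG: "\<And>\<tau> x. \<bar>G \<tau> x\<bar> <= MG" using AC_bdd[OF G] by blast
  have i: "integrable GM (%z. F \<tau> (x + s *\<^sub>R zv z))" "integrable GM (%z. G \<tau>' (x' + s *\<^sub>R zv z))"
    by (rule prob_abs_le(2)[OF prob_GM _ MF]; measurable) (rule prob_abs_le(2)[OF prob_GM _ MG]; measurable)
  have "EF s F \<tau> x - EF s G \<tau>' x' = (\<integral>z. F \<tau> (x + s *\<^sub>R zv z) - G \<tau>' (x' + s *\<^sub>R zv z) \<partial>GM)"
    unfolding EF_def using i by simp
  also have "\<bar>\<dots>\<bar> <= e" by (rule prob_abs_le(1)[OF prob_GM _ e]) measurable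
  finally show ?thesis .
qed

text \<open>The hypothesis \<open>df\<close> compares two points along common translations; it
  yields uniform continuity and compactness of the translates at once.\<close>

lemma fopI:
  assumes add: "\<And>F G. AC F ==> AC G ==> L (F + G) = L F + L G"
    and mul: "\<And>c F. AC F ==> L (cst c * F) = cst c * L F"
    and bd: "\<And>F M \<tau> x. AC F ==> (\<And>\<tau> x. \<bar>F \<tau> x\<bar> <= M) ==> \<bar>L F \<tau> x\<bar> <= M"
    and df: "\<And>F \<tau> x \<tau>' x' e. AC F ==> (\<And>y. \<bar>F \<tau> (x + y) - F \<tau>' (x' + y)\<bar> <= e) ==> \<bar>L F \<tau> x - L F \<tau>' x'\<bar> <= e"
    and sh: "\<And>i s F. AC F ==> L (shf i s F) = shf i s (L F)"
  shows "fop (L :: 'n::finite fld => 'n fld)"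
  unfolding fop_def
proof (intro conjI allI impI)
  fix F :: "'n fld" assume F: "AC F"
  show "AC (L F)"
  proof (rule ACI)
    show "\<exists>M. \<forall>\<tau> x. \<bar>L F \<tau> x\<bar> <= M" using AC_bdd[OF F] bd[OF F] by blast
    show "\<exists>d>0. \<forall>\<tau> \<tau>' x x'. dist \<tau> \<tau>' < d --> dist x x' < d --> \<bar>L F \<tau> x - L F \<tau>' x'\<bar> < e" if e: "e > 0" for e
    proof -
      obtain d where d: "d>0" "\<And>\<tau> \<tau>' x x'. dist \<tau> \<tau>' < d ==> dist x x' < d ==> \<bar>F \<tau> x - F \<tau>' x'\<bar> < e/2"
        using AC_ucont[OF F half_gt_zero[OF e]] by blast
      have "\<bar>L F \<tau> x - L F \<tau>' x'\<bar> < e" if "dist \<tau> \<tau>' < d" "dist x x' < d" for \<tau> \<tau>' x x'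
      proof -
        have "\<bar>L F \<tau> x - L F \<tau>' x'\<bar> <= e/2" by (rule df[OF F], rule less_imp_le, rule d(2)) (use that in \<open>auto simp: dist_norm\<close>)
        then show ?thesis using e by linarith
      qed
      then show ?thesis using d(1) by blast
    qed
    fix c :: "nat => real^'n"
    obtain r :: "nat => nat" where r: "strict_mono r" "\<forall>e>0. transl_cauchy F c r e"
      using AC_seq[OF F, of c] by blast
    have "transl_cauchy (L F) c r e" if e: "e > 0" for e
    proof -
      obtain N where N: "\<And>m n \<tau> x. m >= N ==> n >= N ==> \<bar>F \<tau> (x + c (r m)) - F \<tau> (x + c (r n))\<bar> < e/2"
        using r(2)[rule_format, OF half_gt_zero[OF e]] by blast
      have "\<bar>L F \<tau> (x + c (r m)) - L F \<tau> (x + c (r n))\<bar> < e" if mn: "m >= N" "n >= N" for m n \<tau> x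
      proof -
        have "\<bar>F \<tau> (x + c (r m) + y) - F \<tau> (x + c (r n) + y)\<bar> <= e/2" for y
          using N[OF mn, of \<tau> "x + y"] by (simp add: add_ac)
        from df[OF F this] show ?thesis using e by (smt (verit) half_gt_zero field_sum_of_halves)
      qed
      then show ?thesis by blast
    qed
    then show "\<exists>r::nat=>nat. strict_mono r \<and> (\<forall>e>0. transl_cauchy (L F) c r e)"
      using r(1) by blast
  qed
qed (use add mul bd sh in blast)+

lemma EF_bound: "AC F ==> (\<And>\<tau> x. \<bar>F \<tau> x\<bar> <= M) ==> \<bar>EF s F \<tau> x\<bar> <= M"
  unfolding EF_def by (rule prob_abs_le(1)[OF prob_GM]) (auto intro: fld_meas)

lemma fld_integrable: assumes "AC F" shows "integrable GM (%z. F \<tau> (x + s *\<^sub>R zv z))"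
proof -
  obtain M where "\<And>\<tau> x. \<bar>F \<tau> x\<bar> <= M" using AC_bdd[OF assms] by blast
  then show ?thesis by (intro prob_abs_le(2)[OF prob_GM]) (auto intro: fld_meas assms)
qed

lemma fop_EF: "fop (EF s)"
proof (rule fopI)
  fix F G :: "'a fld" assume "AC F" "AC G"
  then show "EF s (F + G) = EF s F + EF s G"
    by (intro ext) (simp add: EF_def fld_integrable)
next
  fix i t and F :: "'a fld" assume "AC F"
  show "EF s (shf i t F) = shf i t (EF s F)"
    by (cases i) (auto simp: EF_def add_ac intro!: ext)
qed (auto simp: EF_def[of s] intro!: ext EF_bound[unfolded EF_def] EF_diff_bound[unfolded EF_def])

text \<open>The resolvent is the integral of \<open>exp (-t)\<close> times the heat semigroup
  generated by \<open>a\<close> times the Laplacian, over t > 0. That semigroup at time t is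
  \<open>EF s\<close> with \<open>s^2 = 2 a t\<close>, and the substitution gives the density
  \<open>rho\<close> for \<open>s\<close>.\<close>

definition rho :: "real => real => real" where "rho a s = s / a * exp (- s\<^sup>2 / (2 * a))"

definition RM :: "real => real measure" where
  "RM a = density lborel (%s. ennreal (indicator {0<..} s * rho a s))"

definition SS :: "real => 'n::finite fld => 'n fld" where
  "SS a F = (%\<tau> x. \<integral>s. EF s F \<tau> x \<partial>RM a)"

lemma rho_meas [measurable]: "rho a \<in> borel_measurable borel" unfolding rho_def by measurable

lemma irho_nonneg: "a > 0 ==> 0 <= indicator {0<..} s * rho a s"
  by (auto simp: rho_def indicator_def)

lemma prob_RM: assumes a: "a > 0" shows "prob_space (RM a)"
proof
  have "emeasure (RM a) (space (RM a)) = (\<integral>\<^sup>+s. ennreal (indicator {0<..} s * rho a s) \<partial>lborel)"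
    unfolding RM_def by (subst emeasure_density) auto
  also have "\<dots> = (\<integral>\<^sup>+s. ennreal (rho a s) * indicator {0..} s \<partial>lborel)"
    by (intro nn_integral_cong) (auto simp: indicator_def rho_def)
  also have "\<dots> = ennreal (0 - (- exp (- 0\<^sup>2 / (2 * a))))"
  proof (rule nn_integral_FTC_atLeast[where F = "%s. - exp (- s\<^sup>2 / (2 * a))"])
    show "((%s. - exp (- s\<^sup>2 / (2 * a))) has_real_derivative rho a s) (at s)" for s
      unfolding rho_def using a by (auto intro!: derivative_eq_intros simp: field_simps)
    show "((%s. - exp (- s\<^sup>2 / (2 * a))) \<longlongrightarrow> 0) at_top" using a by real_asymp
  qed (use a in \<open>auto simp: rho_def\<close>)
  finally show "emeasure (RM a) (space (RM a)) = 1" by simp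
qed

lemma EF_meas: assumes "AC F" shows "(%s. EF s F \<tau> x) \<in> borel_measurable borel"
proof -
  interpret prob_space "GM :: ('a => real) measure" by (rule prob_GM)
  have [measurable]: "F \<tau> \<in> borel_measurable borel" by (rule borel_measurable_continuous_onI[OF AC_cont_x[OF assms]])
  show ?thesis unfolding EF_def by measurable
qed

lemma sets_RM [measurable_cong]: "sets (RM a) = sets borel" by (simp add: RM_def)

lemma RM_meas: "f \<in> borel_measurable borel ==> f \<in> borel_measurable (RM a)"
  unfolding RM_def by simp

lemma EF_integrable: assumes "a > 0" "AC F" shows "integrable (RM a) (%s. EF s F \<tau> x)"
proof -
  obtain M where M: "\<And>\<tau> x. \<bar>F \<tau> x\<bar> <= M" using AC_bdd[OF assms(2)] by blast
  show ?thesis by (rule prob_abs_le(2)[OF prob_RM[OF assms(1)] RM_meas[OF EF_meas[OF assms(2)]] EF_bound[OF assms(2) M]])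
qed

lemma SS_diff_bound:
  assumes a: "a > 0" and F: "AC F" and e: "\<And>y. \<bar>F \<tau> (x + y) - F \<tau>' (x' + y)\<bar> <= e"
  shows "\<bar>SS a F \<tau> x - SS a F \<tau>' x'\<bar> <= e"
proof -
  have m: "(%s. EF s F \<tau> x - EF s F \<tau>' x') \<in> borel_measurable (RM a)"
    by (intro RM_meas borel_measurable_diff EF_meas F)
  have "SS a F \<tau> x - SS a F \<tau>' x' = (\<integral>s. EF s F \<tau> x - EF s F \<tau>' x' \<partial>RM a)"
    unfolding SS_def using EF_integrable[OF a F] by simp
  also have "\<bar>\<dots>\<bar> <= e" by (rule prob_abs_le(1)[OF prob_RM[OF a] m EF_diff_bound[OF F F e]])
  finally show ?thesis .
qed

lemma fop_SS: assumes a: "a > 0" shows "fop (SS a)"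
proof (rule fopI)
  fix F G :: "'a fld" assume F: "AC F" "AC G"
  then show "SS a (F + G) = SS a F + SS a G"
    by (intro ext) (simp add: SS_def fopD(2)[OF fop_EF] EF_integrable a)
next
  fix c and F :: "'a fld" assume "AC F"
  then show "SS a (cst c * F) = cst c * SS a F"
    by (intro ext) (simp add: SS_def fopD(3)[OF fop_EF])
next
  fix F :: "'a fld" and M \<tau> x assume F: "AC F" and M: "\<And>\<tau> x. \<bar>F \<tau> x\<bar> <= M"
  show "\<bar>SS a F \<tau> x\<bar> <= M"
    unfolding SS_def by (rule prob_abs_le(1)[OF prob_RM[OF a] RM_meas[OF EF_meas[OF F]] EF_bound[OF F M]])
next
  fix F :: "'a fld" and \<tau> x \<tau>' x' e assume F: "AC F" and e: "\<And>y. \<bar>F \<tau> (x + y) - F \<tau>' (x' + y)\<bar> <= e"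
  show "\<bar>SS a F \<tau> x - SS a F \<tau>' x'\<bar> <= e" by (rule SS_diff_bound[OF a F e])
next
  fix i t and F :: "'a fld" assume F: "AC F"
  show "SS a (shf i t F) = shf i t (SS a F)"
    unfolding SS_def fopD(5)[OF fop_EF F] by (cases i) auto
qed

section \<open>Hoelder estimates for the resolvent\<close>

lemma smooth_lipschitz:
  fixes F :: "'n::finite fld"
  assumes F: "smooth F" and B: "\<And>i x. \<bar>D (Some i) F \<tau> x\<bar> <= B"
  shows "\<bar>F \<tau> x - F \<tau> y\<bar> <= real CARD('n) * B * dist x y"
proof -
  have "norm (F \<tau> x - F \<tau> y) <= real CARD('n) * B * norm (x - y)"
  proof (rule differentiable_bound[of UNIV])
    show "(F \<tau> has_derivative (%h. \<Sum>i\<in>UNIV. h $ i * D (Some i) F \<tau> z)) (at z within UNIV)" for z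
      by (rule has_derivative_at_withinI[OF smooth_has_derivative[OF F]])
    fix z
    show "onorm (%h. \<Sum>i\<in>UNIV. h $ i * D (Some i) F \<tau> z) <= real CARD('n) * B"
    proof (rule onorm_le)
      fix h :: "real^'n"
      have "norm (\<Sum>i\<in>UNIV. h $ i * D (Some i) F \<tau> z) <= (\<Sum>i\<in>(UNIV::'n set). norm h * B)"
        by (rule sum_norm_le) (auto simp: abs_mult intro!: mult_mono component_le_norm_cart B)
      then show "norm (\<Sum>i\<in>UNIV. h $ i * D (Some i) F \<tau> z) <= real CARD('n) * B * norm h" by (simp add: mult_ac)
    qed
  qed auto
  then show ?thesis by (simp add: dist_norm)
qed

text \<open>Majorant for splitting the integral over \<open>s\<close> at the scale \<open>h\<close>:
  \<open>s^(-1/2)\<close> is integrable at 0 and \<open>s^(-3/2)\<close> at infinity. The two parts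
  integrate to \<open>4 sqrt h\<close> and \<open>2 sqrt h\<close>, which reproduces the Hoelder
  exponent one half.\<close>

definition mm :: "real => real => real" where
  "mm h s = (if s \<in> {0..h} then 2 * (1 / sqrt s) else 0) + (if s \<in> {h..} then h * (1 / (s * sqrt s)) else 0)"

lemma powr_m12: "s >= 0 ==> s powr (-(1/2)) = 1 / sqrt s"
  by (cases "s = 0") (auto simp: powr_minus_divide powr_half_sqrt)
lemma powr_m32: "s >= 0 ==> s powr (-(3/2)) = 1 / (s * sqrt s)"
proof (cases "s = 0")
  case False
  assume "s >= 0"
  have "s powr (-(3/2)) = s powr (-1 + -(1/2))" by simp
  also have "\<dots> = s powr (-1) * s powr (-(1/2))" by (rule powr_add)
  finally show ?thesis using False \<open>s >= 0\<close> by (simp only: powr_m12) (simp add: powr_minus_divide)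
qed auto

lemma mm_nonneg: "h >= 0 ==> mm h s >= 0" by (auto simp: mm_def)

lemma mm_integral: assumes h: "h > 0" shows "has_bochner_integral lborel (mm h) (6 * sqrt h)"
proof -
  have 1: "((%s. 1 / sqrt s) has_integral 2 * sqrt h) {0..h}"
  proof -
    have "((%s. s powr (-1/2)) has_integral (h powr (-1/2+1) / (-1/2+1))) {0..h}"
      by (rule has_integral_powr_from_0) (use h in auto)
    then have "((%s. 1 / sqrt s) has_integral (h powr (-1/2+1) / (-1/2+1))) {0..h}"
      by (rule has_integral_eq[rotated]) (simp add: powr_m12)
    then show ?thesis using h by (simp add: powr_half_sqrt mult.commute)
  qed
  have 2: "((%s. 1 / (s * sqrt s)) has_integral 2 / sqrt h) {h..}"
  proof -
    have "((%s. s powr (-3/2)) has_integral -(h powr (-3/2+1)) / (-3/2+1)) {h..}"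
      by (rule has_integral_powr_to_inf) (use h in auto)
    then have "((%s. 1 / (s * sqrt s)) has_integral -(h powr (-3/2+1)) / (-3/2+1)) {h..}"
      by (rule has_integral_eq[rotated]) (use h in \<open>simp add: powr_m32\<close>)
    then show ?thesis using h powr_m12[of h] by simp
  qed
  have "(mm h has_integral 2 * (2 * sqrt h) + h * (2 / sqrt h)) UNIV"
    unfolding mm_def[abs_def]
    by (intro has_integral_add; subst has_integral_restrict_UNIV) (intro has_integral_mult_right 1 2)+
  moreover have "2 * (2 * sqrt h) + h * (2 / sqrt h) = 6 * sqrt h"
  proof -
    have "h * (2 / sqrt h) = 2 * (h / sqrt h)" by simp
    then show ?thesis using h real_div_sqrt[of h] by simp
  qed
  ultimately have m: "(mm h has_integral 6 * sqrt h) UNIV" by simp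
  have [measurable]: "mm h \<in> borel_measurable borel" unfolding mm_def[abs_def] by measurable
  show ?thesis
  proof (rule has_bochner_integral_nn_integral)
    show "(\<integral>\<^sup>+s. ennreal (mm h s) \<partial>lborel) = ennreal (6 * sqrt h)"
      by (rule nn_integral_has_integral_lborel[OF _ _ m]) (use h mm_nonneg in \<open>auto intro: less_imp_le\<close>)
  qed (use h mm_nonneg in \<open>auto intro: less_imp_le\<close>)
qed

lemma RM_bound:
  assumes a: "a > 0" and h: "h > 0" and g [measurable]: "g \<in> borel_measurable borel"
    and b: "\<And>s. s > 0 ==> rho a s * \<bar>g s\<bar> <= c * mm h s" and c: "c >= 0"
  shows "\<bar>\<integral>s. g s \<partial>RM a\<bar> <= c * (6 * sqrt h)"
proof -
  have r: "rho a s >= 0" if "s > 0" for s using a that by (simp add: rho_def)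
  have m: "has_bochner_integral lborel (mm h) (6 * sqrt h)" by (rule mm_integral[OF h])
  have bd: "norm (indicator {0<..} s * rho a s * g s) <= c * mm h s" for s
    using b[of s] r[of s] c mm_nonneg[of h s] h by (cases "s > 0") (auto simp: abs_mult)
  have i: "integrable lborel (%s. c * mm h s)" using m by (auto simp: has_bochner_integral_iff)
  have i2: "integrable lborel (%s. indicator {0<..} s * rho a s * g s)"
    by (rule Bochner_Integration.integrable_bound[OF i]) (use bd in \<open>auto intro: order_trans[OF _ abs_ge_self]\<close>)
  have "(\<integral>s. g s \<partial>RM a) = (\<integral>s. indicator {0<..} s * rho a s * g s \<partial>lborel)"
    unfolding RM_def by (subst integral_density) (auto simp: irho_nonneg[OF a])
  also have "\<bar>\<dots>\<bar> <= (\<integral>s. norm (indicator {0<..} s * rho a s * g s) \<partial>lborel)"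
    using integral_norm_bound[of lborel "%s. indicator {0<..} s * rho a s * g s"] by simp
  also have "\<dots> <= (\<integral>s. c * mm h s \<partial>lborel)"
    by (rule Bochner_Integration.integral_mono) (use bd i2 i in auto)
  also have "\<dots> = c * (6 * sqrt h)" using m by (simp add: has_bochner_integral_iff)
  finally show ?thesis .
qed

text \<open>The bound \<open>s / a\<close> serves small \<open>s\<close>; the bound
  \<open>2 / s\<close>, which comes from \<open>u * exp (- u) \<le> 1\<close>, supplies decay for
  large \<open>s\<close>.\<close>

lemma rho_bounds: assumes "a > 0" "s > 0" shows "rho a s >= 0" "rho a s <= s / a" "rho a s <= 2 / s"
proof -
  show "rho a s >= 0" using assms by (simp add: rho_def)
  have "s / a * exp (- s\<^sup>2 / (2 * a)) <= s / a * 1" using assms by (intro mult_left_mono) auto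
  then show "rho a s <= s / a" by (simp add: rho_def)
  define u where "u = s\<^sup>2 / (2 * a)"
  have "u <= exp u" using exp_ge_add_one_self[of u] by linarith
  then have "u * exp (- u) <= 1" by (simp add: exp_minus field_simps)
  moreover have "rho a s = 2 / s * (u * exp (- u))" using assms by (simp add: rho_def u_def power2_eq_square field_simps)
  ultimately show "rho a s <= 2 / s" using mult_left_mono[of "u * exp (- u)" 1 "2/s"] assms by simp
qed

text \<open>A Schauder estimate. For the sup bound the integral over \<open>s\<close> is split at 1,
  for the Hoelder bound at \<open>dist x y\<close>: below, the two values are estimated separately
  by \<open>s^(-3/2)\<close>; above, their difference is estimated through third derivatives, by
  \<open>s^(-5/2)\<close> times the distance.\<close>

lemma SS_D2_bound:
  fixes F :: "'n::finite fld"
  assumes a: "a > 0" and F: "smooth F" and L: "\<And>x y. \<bar>F \<tau> x - F \<tau> y\<bar> <= L * sqrt (dist x y)" and L0: "L >= 0"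
  shows "\<bar>SS a (D (Some i) (D (Some j) F)) \<tau> x\<bar> <= L * (KG TYPE('n) * (1/a + 2) * 6)"
    and "\<bar>SS a (D (Some i) (D (Some j) F)) \<tau> x - SS a (D (Some i) (D (Some j) F)) \<tau> y\<bar>
      <= L * (KG TYPE('n) * (1/a) * CARD('n) * 6) * sqrt (dist x y)"
proof -
  define K where "K = L * KG TYPE('n)"
  have K: "K >= 0" unfolding K_def using L0 KG_nonneg[where 'n='n] by auto
  let ?G = "D (Some i) (D (Some j) F)"
  have G: "smooth ?G" by (intro smooth_D F)
  note [measurable] = EF_meas[OF smooth_AC[OF G]]
  have g: "\<bar>EF s ?G \<tau> x\<bar> <= K * (1 / (s * sqrt s))" if s: "s > 0" for s x
  proof -
    have "s\<^sup>2 * \<bar>EF s ?G \<tau> x\<bar> <= K * sqrt s"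
      using EF_D2_bound[OF F L, of s i j x] s by (simp add: abs_mult K_def mult_ac)
    also have "\<dots> = s\<^sup>2 * (K * (1 / (s * sqrt s)))" using s by (simp add: power2_eq_square field_simps)
    finally show ?thesis using s by (subst (asm) mult_le_cancel_left_pos) auto
  qed
  have g3: "\<bar>EF s ?G \<tau> x - EF s ?G \<tau> y\<bar> <= CARD('n) * (K * (1 / (s\<^sup>2 * sqrt s))) * dist x y" if s: "s > 0" for s x y
  proof (rule smooth_lipschitz[OF fop_smooth[OF fop_EF G]])
    fix k x
    have "s^3 * \<bar>EF s (D (Some k) ?G) \<tau> x\<bar> <= K * sqrt s"
      using EF_D3_bound[OF F L, of s k i j x] s by (simp add: abs_mult K_def mult_ac)
    also have "\<dots> = s^3 * (K * (1 / (s\<^sup>2 * sqrt s)))" using s by (simp add: power2_eq_square power3_eq_cube field_simps)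
    finally show "\<bar>D (Some k) (EF s ?G) \<tau> x\<bar> <= K * (1 / (s\<^sup>2 * sqrt s))"
      using s unfolding fop_D[OF fop_EF G] by (subst (asm) mult_le_cancel_left_pos) auto
  qed
  have "\<bar>SS a ?G \<tau> x\<bar> <= (K * (1/a + 2)) * (6 * sqrt 1)"
    unfolding SS_def
  proof (rule RM_bound[OF a])
    fix s :: real assume s: "s > 0"
    show "rho a s * \<bar>EF s ?G \<tau> x\<bar> <= K * (1/a + 2) * mm 1 s"
    proof (cases "s <= 1")
      case True
      have "rho a s * \<bar>EF s ?G \<tau> x\<bar> <= (s / a) * (K * (1 / (s * sqrt s)))"
        by (intro mult_mono g rho_bounds) (use a s in auto)
      also have "\<dots> = K * (1/a) * (1 / sqrt s)" using s by simp
      also have "\<dots> <= K * (1/a + 2) * mm 1 s"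
        unfolding mm_def using True s a K by (intro mult_mono) (auto simp: divide_right_mono)
      finally show ?thesis .
    next
      case False
      have "rho a s * \<bar>EF s ?G \<tau> x\<bar> <= (2 / s) * (K * (1 / (s * sqrt s)))"
        by (intro mult_mono g rho_bounds) (use a s in auto)
      also have "\<dots> <= 2 * (K * (1 / (s * sqrt s)))"
        using False K s by (intro mult_right_mono) (auto simp: field_simps)
      also have "\<dots> = K * 2 * (1 / (s * sqrt s))" by simp
      also have "\<dots> <= K * (1/a + 2) * mm 1 s"
        unfolding mm_def using False s a K by (intro mult_mono) auto
      finally show ?thesis .
    qed
  qed (use K a in auto)
  then show "\<bar>SS a ?G \<tau> x\<bar> <= L * (KG TYPE('n) * (1/a + 2) * 6)" by (simp add: K_def mult_ac)
  show "\<bar>SS a ?G \<tau> x - SS a ?G \<tau> y\<bar> <= L * (KG TYPE('n) * (1/a) * CARD('n) * 6) * sqrt (dist x y)"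
  proof (cases "x = y")
    case False
    then have h: "dist x y > 0" by simp
    define N where "N = real CARD('n)"
    have N: "N >= 1" unfolding N_def using zero_less_card_finite[where 'a='n] by simp
    have "SS a ?G \<tau> x - SS a ?G \<tau> y = (\<integral>s. EF s ?G \<tau> x - EF s ?G \<tau> y \<partial>RM a)"
      unfolding SS_def using EF_integrable[OF a smooth_AC[OF G]] by simp
    also have "\<bar>\<dots>\<bar> <= (K * (1/a) * N) * (6 * sqrt (dist x y))"
    proof (rule RM_bound[OF a h])
      fix s :: real assume s: "s > 0"
      have pos: "1 / sqrt s >= 0" "1 / (s * sqrt s) >= 0" using s by auto
      show "rho a s * \<bar>EF s ?G \<tau> x - EF s ?G \<tau> y\<bar> <= K * (1/a) * N * mm (dist x y) s"
      proof (cases "s <= dist x y")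
        case True
        have "\<bar>EF s ?G \<tau> x - EF s ?G \<tau> y\<bar> <= 2 * (K * (1 / (s * sqrt s)))" using g[OF s, of x] g[OF s, of y] by linarith
        then have "rho a s * \<bar>EF s ?G \<tau> x - EF s ?G \<tau> y\<bar> <= (s / a) * (2 * (K * (1 / (s * sqrt s))))"
          by (intro mult_mono rho_bounds) (use a s in auto)
        also have "\<dots> = (K * (1/a) * 1) * (2 * (1 / sqrt s))" using s by simp
        also have "\<dots> <= K * (1/a) * N * mm (dist x y) s"
          unfolding mm_def using True s a K N pos by (intro mult_mono mult_left_mono) auto
        finally show ?thesis .
      next
        case False
        have "rho a s * \<bar>EF s ?G \<tau> x - EF s ?G \<tau> y\<bar> <= (s / a) * (CARD('n) * (K * (1 / (s\<^sup>2 * sqrt s))) * dist x y)"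
          by (intro mult_mono rho_bounds g3) (use a s in auto)
        also have "\<dots> = K * (1/a) * N * (dist x y * (1 / (s * sqrt s)))" using s by (simp add: N_def power2_eq_square)
        also have "\<dots> <= K * (1/a) * N * mm (dist x y) s"
          unfolding mm_def using False s a K N pos by (intro mult_left_mono) auto
        finally show ?thesis .
      qed
    qed (use K a N in auto)
    finally show ?thesis by (simp add: K_def N_def mult_ac)
  qed simp
qed

lemma H1_mean: "(\<integral>z. z i \<partial>GM) = 0"
  using EF_D1[OF smooth_cst[of 1], of 1 i 0 0] by (simp add: D_cst D_0 EF_def)

text \<open>The coordinate \<open>z i\<close> is a kernel of mean zero as well, so one derivative
  costs only \<open>s^(-1/2)\<close>.\<close>

lemma SS_D1_bound:
  fixes F :: "'n::finite fld"
  assumes a: "a > 0" and F: "smooth F" and L: "\<And>x y. \<bar>F \<tau> x - F \<tau> y\<bar> <= L * sqrt (dist x y)" and L0: "L >= 0"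
  shows "\<bar>SS a (D (Some i) F) \<tau> x\<bar> <= L * (KG TYPE('n) * (1/a + 2) * 6)"
proof -
  define K where "K = L * KG TYPE('n)"
  have K: "K >= 0" unfolding K_def using L0 KG_nonneg[where 'n='n] by auto
  let ?G = "D (Some i) F"
  have G: "smooth ?G" by (intro smooth_D F)
  have b: "\<bar>z i\<bar> <= 3 * (1 + sq z)\<^sup>2" for z :: "'n => real"
  proof -
    have "1 + sq z <= (1 + sq z)\<^sup>2" using sq_nonneg[of z] by (simp add: power2_eq_square algebra_simps)
    then show ?thesis using abs_coord[of z i] sq_nonneg[of z] by linarith
  qed
  have g: "\<bar>EF s ?G \<tau> x\<bar> <= K * (1 / sqrt s)" if s: "s > 0" for s x
  proof -
    have "s * \<bar>EF s ?G \<tau> x\<bar> <= K * sqrt s"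
      using kernel_bound[OF smooth_AC[OF F] L less_imp_le[OF s] coord_meas b H1_mean, of x] s
      unfolding EF_D1[OF F, symmetric] by (simp add: abs_mult K_def mult_ac)
    also have "\<dots> = s * (K * (1 / sqrt s))" using s by (simp add: field_simps)
    finally show ?thesis using s by (subst (asm) mult_le_cancel_left_pos) auto
  qed
  have "\<bar>SS a ?G \<tau> x\<bar> <= (K * (1/a + 2)) * (6 * sqrt 1)"
    unfolding SS_def
  proof (rule RM_bound[OF a _ EF_meas[OF smooth_AC[OF G]]])
    fix s :: real assume s: "s > 0"
    show "rho a s * \<bar>EF s ?G \<tau> x\<bar> <= K * (1/a + 2) * mm 1 s"
    proof (cases "s <= 1")
      case True
      have "rho a s * \<bar>EF s ?G \<tau> x\<bar> <= (s / a) * (K * (1 / sqrt s))"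
        by (intro mult_mono g rho_bounds) (use a s in auto)
      also have "\<dots> = (s * (1/a)) * (K * (1 / sqrt s))" by simp
      also have "\<dots> <= (1 * (1/a)) * (K * (1 / sqrt s))" using True s a K by (intro mult_right_mono) auto
      also have "\<dots> = K * (1/a) * (1 / sqrt s)" by simp
      also have "\<dots> <= K * (1/a + 2) * mm 1 s"
        unfolding mm_def using True s a K by (intro mult_mono) (auto simp: divide_right_mono)
      finally show ?thesis .
    next
      case False
      have "rho a s * \<bar>EF s ?G \<tau> x\<bar> <= (2 / s) * (K * (1 / sqrt s))"
        by (intro mult_mono g rho_bounds) (use a s in auto)
      also have "\<dots> = K * 2 * (1 / (s * sqrt s))" by simp
      also have "\<dots> <= K * (1/a + 2) * mm 1 s"
        unfolding mm_def using False s a K by (intro mult_mono) auto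
      finally show ?thesis .
    qed
  qed (use K a in auto)
  then show ?thesis by (simp add: K_def mult_ac)
qed

section \<open>The resolvent inverts the Helmholtz operator\<close>

lemma line_DERIV:
  assumes "smooth F"
  shows "((%s. F \<tau> (x + s *\<^sub>R w)) has_real_derivative (\<Sum>i\<in>UNIV. w $ i * D (Some i) F \<tau> (x + s *\<^sub>R w))) (at s)"
proof -
  have "((%s. x + s *\<^sub>R w) has_derivative (%h. h *\<^sub>R w)) (at s)" by (auto intro!: derivative_eq_intros)
  from has_derivative_compose[OF this smooth_has_derivative[OF assms]]
  have "((%s. F \<tau> (x + s *\<^sub>R w)) has_derivative (%h. \<Sum>i\<in>UNIV. (h *\<^sub>R w) $ i * D (Some i) F \<tau> (x + s *\<^sub>R w))) (at s)" .
  moreover have "(%h. \<Sum>i\<in>UNIV. (h *\<^sub>R w) $ i * D (Some i) F \<tau> (x + s *\<^sub>R w)) = (%h. (\<Sum>i\<in>UNIV. w $ i * D (Some i) F \<tau> (x + s *\<^sub>R w)) * h)"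
    by (intro ext) (simp add: sum_distrib_left mult_ac)
  ultimately show ?thesis by (simp add: has_field_derivative_def)
qed

text \<open>For s > 0, \<open>H s z\<close> is minus the \<open>s\<close>-derivative of
  \<open>exp (-s^2/(2a)) * F (x + s z)\<close>. Integrated over \<open>s\<close> first it gives
  \<open>F x\<close>. Integrated over \<open>z\<close> first, Stein's identity turns the derivative
  in direction \<open>z\<close> into \<open>s\<close> times the averaged Laplacian, and
  \<open>s * exp (-s^2/(2a))\<close> is \<open>a * rho a s\<close>. Fubini equates the
  results.\<close>

lemma SS_inverse:
  fixes F :: "'n::finite fld"
  assumes a: "a > 0" and F: "smooth F"
  shows "SS a F \<tau> x - a * (\<Sum>i\<in>UNIV. SS a (D (Some i) (D (Some i) F)) \<tau> x) = F \<tau> x"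
proof -
  define ee where "ee s = exp (- s\<^sup>2 / (2 * a))" for s :: real
  define DF where "DF s z = (\<Sum>i\<in>UNIV. zv z $ i * D (Some i) F \<tau> (x + s *\<^sub>R zv z))" for s and z :: "'n => real"
  define I where "I s = (indicator {0<..} s :: real)" for s :: real
  define H where "H s z = I s * (rho a s * F \<tau> (x + s *\<^sub>R zv z) - ee s * DF s z)" for s and z :: "'n => real"
  have sD: "smooth (D (Some i) F)" for i by (rule smooth_D[OF F])
  have [measurable]: "F \<tau> \<in> borel_measurable borel" "D (Some i) F \<tau> \<in> borel_measurable borel" for i
    by (intro borel_measurable_continuous_onI AC_cont_x smooth_AC F sD)+
  have [measurable]: "ee \<in> borel_measurable borel" "I \<in> borel_measurable borel" unfolding ee_def I_def by measurable
  have zvi: "zv z $ i = z i" for z :: "'n => real" and i by (simp add: zv_def)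
  have DFm [measurable]: "(%p. DF (fst p) (snd p)) \<in> borel_measurable (lborel \<Otimes>\<^sub>M GM)" unfolding DF_def zvi by measurable
  obtain M0 where M0: "M0 > 0" "\<And>\<tau> x. \<bar>F \<tau> x\<bar> <= M0" using AC_bdd_pos[OF smooth_AC[OF F]] by blast
  have "\<exists>M. \<forall>i \<tau> x. \<bar>D (Some i) F \<tau> x\<bar> <= M"
  proof -
    have "\<exists>M. \<forall>\<tau> x. \<bar>D (Some i) F \<tau> x\<bar> <= M" for i using AC_bdd[OF smooth_AC[OF sD]] .
    then obtain M where M: "\<And>i \<tau> x. \<bar>D (Some i) F \<tau> x\<bar> <= M i" by metis
    have "M i <= Max (range M)" for i by simp
    then show ?thesis using M order_trans by (intro exI[of _ "Max (range M)"]) blast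
  qed
  then obtain M1 where M1: "\<And>i \<tau> x. \<bar>D (Some i) F \<tau> x\<bar> <= M1" by blast
  have M10: "M1 >= 0" using M1[of undefined 0 0] by linarith
  have DFb: "\<bar>DF s z\<bar> <= CARD('n) * M1 * (1 + sq z)" for s z
  proof -
    have "\<bar>DF s z\<bar> <= (\<Sum>i\<in>(UNIV::'n set). (1 + sq z) * M1)"
      unfolding DF_def zvi real_norm_def[symmetric]
      by (rule sum_norm_le) (auto simp: abs_mult intro!: mult_mono abs_coord M1 add_nonneg_nonneg sq_nonneg)
    then show ?thesis by (simp add: mult_ac)
  qed
  have ee0: "ee s > 0" for s by (simp add: ee_def)
  have Iee: "integrable lborel ee"
  proof -
    have "integrable lborel (%s. sqrt (2 * pi * (sqrt a)\<^sup>2) * normal_density 0 (sqrt a) s)"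
      using a by (intro integrable_mult_right) auto
    also have "(%s. sqrt (2 * pi * (sqrt a)\<^sup>2) * normal_density 0 (sqrt a) s) = ee"
      using a by (intro ext) (simp add: normal_density_def ee_def)
    finally show ?thesis .
  qed
  have Irho: "integrable lborel (%s. I s * rho a s)"
  proof -
    interpret prob_space "RM a" by (rule prob_RM[OF a])
    have "integrable (RM a) (%_. 1::real)" by simp
    then show ?thesis unfolding RM_def by (subst (asm) integrable_density) (auto simp: irho_nonneg[OF a] I_def)
  qed
  \<comment> \<open>The majorant of \<open>H\<close> has to be a product of a function of
    \<open>s\<close> and one of \<open>z\<close>, so that its integrability on the product space is
    immediate.\<close>
  define A where "A s = I s * rho a s * M0 + \<bar>I s * ee s\<bar> * (CARD('n) * M1)" for s
  have A0: "A s >= 0" for s using M0 M10 irho_nonneg[OF a, of s] by (auto simp: A_def I_def)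
  have AI: "integrable lborel A"
  proof -
    have "integrable lborel (%s. I s * ee s)"
      by (rule Bochner_Integration.integrable_bound[OF Iee]) (auto simp: I_def indicator_def)
    then show ?thesis unfolding A_def[abs_def] using Irho by (intro Bochner_Integration.integrable_add integrable_mult_left integrable_abs)
  qed
  have Hb: "\<bar>H s z\<bar> <= A s * (8 * exp (sq z / 4))" for s z
  proof -
    have "1 + sq z <= 8 * exp (sq z / 4)"
    proof -
      have "exp (sq z/8) <= exp (sq z/4)" using sq_nonneg[of z] by simp
      then show ?thesis using exp8[OF sq_nonneg[of z]] by linarith
    qed
    then have e: "1 <= 8 * exp (sq z / 4)" "1 + sq z <= 8 * exp (sq z / 4)" using sq_nonneg[of z] by linarith+
    have 1: "\<bar>I s * rho a s * F \<tau> (x + s *\<^sub>R zv z)\<bar> <= (I s * rho a s) * M0 * (8 * exp (sq z / 4))"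
    proof -
      have "\<bar>I s * rho a s * F \<tau> (x + s *\<^sub>R zv z)\<bar> <= (I s * rho a s) * M0"
        unfolding abs_mult[of "I s * rho a s"] using irho_nonneg[OF a, of s] M0(2) by (auto simp: I_def intro!: mult_left_mono)
      also have "\<dots> * 1 <= (I s * rho a s) * M0 * (8 * exp (sq z / 4))" using irho_nonneg[OF a, of s] M0(1) e by (intro mult_left_mono) (auto simp: I_def)
      finally show ?thesis by simp
    qed
    have 2: "\<bar>I s * ee s * DF s z\<bar> <= \<bar>I s * ee s\<bar> * (CARD('n) * M1) * (8 * exp (sq z / 4))"
    proof -
      have "\<bar>DF s z\<bar> <= CARD('n) * M1 * (8 * exp (sq z / 4))"
        by (rule order_trans[OF DFb[of s z] mult_left_mono[OF e(2), of "real CARD('n) * M1"]]) (use M10 in simp)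
      then have "\<bar>I s * ee s\<bar> * \<bar>DF s z\<bar> <= \<bar>I s * ee s\<bar> * (CARD('n) * M1 * (8 * exp (sq z / 4)))" by (rule mult_left_mono) simp
      then show ?thesis by (simp add: abs_mult mult_ac)
    qed
    have "H s z = I s * rho a s * F \<tau> (x + s *\<^sub>R zv z) - I s * ee s * DF s z" by (simp add: H_def algebra_simps)
    then show ?thesis using 1 2 unfolding A_def distrib_right by linarith
  qed
  interpret G: prob_space "GM :: ('n => real) measure" by (rule prob_GM)
  interpret P: pair_sigma_finite lborel "GM :: ('n => real) measure" ..
  have Hm [measurable]: "(%p. H (fst p) (snd p)) \<in> borel_measurable (lborel \<Otimes>\<^sub>M GM)" unfolding H_def by measurable
  have HI: "integrable (lborel \<Otimes>\<^sub>M GM) (%(s, z). H s z)"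
  proof (rule Bochner_Integration.integrable_bound)
    show "integrable (lborel \<Otimes>\<^sub>M GM) (%(s, z::'n => real). A s * (8 * exp (sq z / 4)))"
    proof (rule P.Fubini_integrable)
      have [measurable]: "A \<in> borel_measurable borel" unfolding A_def by measurable
      show "(%(s, z::'n => real). A s * (8 * exp (sq z / 4))) \<in> borel_measurable (lborel \<Otimes>\<^sub>M GM)" by measurable
      have "integrable lborel (%s. A s * (\<integral>z. 8 * exp (sq z / 4) \<partial>(GM :: ('n => real) measure)))" using AI by (intro integrable_mult_left)
      then show "integrable lborel (%s. \<integral>z. norm (case (s, z) of (s, z) => A s * (8 * exp (sq z / 4))) \<partial>(GM :: ('n => real) measure))"
        using A0 by (simp add: abs_mult)
      show "AE s in lborel. integrable GM (%z::'n => real. case (s, z) of (s, z) => A s * (8 * exp (sq z / 4)))"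
        using WI[where 'n='n] by auto
    qed
    show "AE p in lborel \<Otimes>\<^sub>M GM. norm (case p of (s, z) => H s z) <= norm (case p of (s, z::'n => real) => A s * (8 * exp (sq z / 4)))"
      using Hb A0 by (intro AE_I2) (auto simp: abs_mult)
  qed (use Hm in \<open>simp add: split_beta'\<close>)
  have inner1: "(\<integral>s. H s z \<partial>lborel) = F \<tau> x" for z
  proof -
    let ?f = "%s. F \<tau> (x + s *\<^sub>R zv z)" and ?h = "%s. rho a s * F \<tau> (x + s *\<^sub>R zv z) - ee s * DF s z"
    have dee: "(ee has_real_derivative - rho a s) (at s)" for s
      unfolding ee_def rho_def using a by (auto intro!: derivative_eq_intros simp: field_simps)
    have dd: "((%s. - (ee s * ?f s)) has_real_derivative ?h s) (at s)" for s
      unfolding DF_def by (rule derivative_eq_intros dee line_DERIV[OF F] refl)+ (simp add: algebra_simps)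
    have cc: "isCont ?h s" for s
      unfolding DF_def rho_def using DERIV_isCont[OF line_DERIV[OF F]] DERIV_isCont[OF line_DERIV[OF sD]] DERIV_isCont[OF dee] a
      by (intro continuous_intros) auto
    have "(LBINT s=0..\<infinity>. ?h s) = 0 - (- F \<tau> x)"
    proof (rule interval_integral_FTC_integrable[where F = "%s. - (ee s * ?f s)"])
      show "((%s. - (ee s * ?f s)) has_vector_derivative ?h s) (at s)" for s
        using dd by (simp add: has_real_derivative_iff_has_vector_derivative)
      show "isCont ?h s" for s by (rule cc)
      have "integrable lborel (%s. A s * (8 * exp (sq z / 4)))" using AI by (intro integrable_mult_left)
      then have "integrable lborel (%s. H s z)"
      proof (rule Bochner_Integration.integrable_bound)
        have "(%s. H s z) \<in> borel_measurable borel"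
          unfolding H_def by (intro borel_measurable_times borel_measurable_continuous_onI[of ?h] continuous_at_imp_continuous_on ballI cc) measurable
        then show "(%s. H s z) \<in> borel_measurable lborel" by simp
        show "AE s in lborel. norm (H s z) <= norm (A s * (8 * exp (sq z / 4)))"
          using Hb[of _ z] A0 by (intro AE_I2) (auto simp: abs_mult)
      qed
      then show "set_integrable lborel (einterval 0 \<infinity>) ?h"
        by (simp add: set_integrable_def H_def I_def einterval_def greaterThan_def)
      have "isCont (%s. - (ee s * ?f s)) 0" using dd DERIV_isCont by blast
      then have "((%s. - (ee s * ?f s)) \<longlongrightarrow> - F \<tau> x) (at_right 0)"
        using tendsto_within_subset[OF _ subset_UNIV, of "%s. - (ee s * ?f s)" _ 0 "{0<..}"] by (simp add: isCont_def ee_def)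
      then show "(((%s. - (ee s * ?f s)) \<circ> real_of_ereal) \<longlongrightarrow> - F \<tau> x) (at_right 0)"
        by (simp add: ereal_tendsto_simps zero_ereal_def)
      have "((%s. - (ee s * ?f s)) \<longlongrightarrow> 0) at_top"
      proof (rule Lim_null_comparison)
        show "\<forall>\<^sub>F s in at_top. norm (- (ee s * ?f s)) <= M0 * ee s"
          using M0(2) ee0 by (intro always_eventually allI) (simp add: abs_mult less_imp_le mult.commute mult_left_mono)
        have "(ee \<longlongrightarrow> 0) at_top" unfolding ee_def using a by real_asymp
        then show "((%s. M0 * ee s) \<longlongrightarrow> 0) at_top" by (rule tendsto_mult_right_zero)
      qed
      then show "(((%s. - (ee s * ?f s)) \<circ> real_of_ereal) \<longlongrightarrow> 0) (at_left \<infinity>)"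
        by (simp add: ereal_tendsto_simps)
    qed auto
    then show ?thesis
      by (simp add: interval_lebesgue_integral_def set_lebesgue_integral_def H_def I_def einterval_def greaterThan_def)
  qed
  have inner2: "(\<integral>z. H s z \<partial>GM) = I s * rho a s * EF s F \<tau> x - a * (\<Sum>i\<in>UNIV. I s * rho a s * EF s (D (Some i) (D (Some i) F)) \<tau> x)" for s
  proof -
    have i1: "integrable GM (%z. F \<tau> (x + s *\<^sub>R zv z))" by (rule fld_integrable[OF smooth_AC[OF F]])
    have i2: "integrable GM (%z. z i * D (Some i) F \<tau> (x + s *\<^sub>R zv z))" for i
    proof (rule GM_integrable[where K="8 * M1"])
      fix z :: "'n => real"
      have "\<bar>z i\<bar> <= 8 * exp (sq z / 4)"
      proof -
        have "exp (sq z/8) <= exp (sq z/4)" using sq_nonneg[of z] by simp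
        then show ?thesis using exp8[OF sq_nonneg[of z]] abs_coord[of z i] by linarith
      qed
      then have "\<bar>z i\<bar> * \<bar>D (Some i) F \<tau> (x + s *\<^sub>R zv z)\<bar> <= (8 * exp (sq z / 4)) * M1" by (intro mult_mono M1) auto
      then show "\<bar>z i * D (Some i) F \<tau> (x + s *\<^sub>R zv z)\<bar> <= 8 * M1 * exp (sq z / 4)" by (simp add: abs_mult mult_ac)
    qed measurable
    have "(\<integral>z. H s z \<partial>GM) = I s * (rho a s * EF s F \<tau> x - ee s * (\<Sum>i\<in>UNIV. \<integral>z. z i * D (Some i) F \<tau> (x + s *\<^sub>R zv z) \<partial>GM))"
      unfolding H_def DF_def zvi EF_def using i1 i2 by simp
    also have "(\<Sum>i\<in>UNIV. \<integral>z. z i * D (Some i) F \<tau> (x + s *\<^sub>R zv z) \<partial>GM) = (\<Sum>i\<in>UNIV. s * EF s (D (Some i) (D (Some i) F)) \<tau> x)"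
      by (intro sum.cong refl EF_D1[symmetric] sD)
    also have "ee s * \<dots> = a * (rho a s * (\<Sum>i\<in>UNIV. EF s (D (Some i) (D (Some i) F)) \<tau> x))"
      using a by (simp add: rho_def ee_def sum_distrib_left[symmetric])
    finally show ?thesis by (simp add: algebra_simps sum_distrib_left)
  qed
  have SSd: "SS a G \<tau> x = (\<integral>s. I s * rho a s * EF s G \<tau> x \<partial>lborel)" "integrable lborel (%s. I s * rho a s * EF s G \<tau> x)" if G: "AC G" for G
  proof -
    note [measurable] = EF_meas[OF G]
    show "SS a G \<tau> x = (\<integral>s. I s * rho a s * EF s G \<tau> x \<partial>lborel)"
      unfolding SS_def RM_def I_def by (subst integral_density) (auto simp: irho_nonneg[OF a])
    show "integrable lborel (%s. I s * rho a s * EF s G \<tau> x)"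
      using EF_integrable[OF a G, of \<tau> x] unfolding RM_def I_def by (subst (asm) integrable_density) (auto simp: irho_nonneg[OF a])
  qed
  have "F \<tau> x = (\<integral>z. (\<integral>s. H s z \<partial>lborel) \<partial>GM)" unfolding inner1 by (simp add: G.prob_space)
  also have "\<dots> = (\<integral>s. (\<integral>z. H s z \<partial>GM) \<partial>lborel)" by (rule P.Fubini_integral[OF HI])
  also have "\<dots> = SS a F \<tau> x - a * (\<Sum>i\<in>UNIV. SS a (D (Some i) (D (Some i) F)) \<tau> x)"
    unfolding inner2 using SSd[OF smooth_AC[OF F]] SSd[OF smooth_AC[OF smooth_D[OF sD]]] by simp
  finally show ?thesis ..
qed

section \<open>Algebra norms\<close>

definition sn :: "'n::finite fld => real" where
  "sn F = (SUP p\<in>UNIV. \<bar>F (fst p) (snd p)\<bar>)"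

text \<open>The Hoelder seminorm of exponent one half, in \<open>x\<close> only and uniform in
  \<tau>: the resolvent smooths in \<open>x\<close> alone, and the time operators do not mix points
  \<open>x\<close>. Pairs of equal points contribute 0 since division by zero yields 0.\<close>

definition hs :: "'n::finite fld => real" where
  "hs F = (SUP q\<in>UNIV. \<bar>F (fst q) (fst (snd q)) - F (fst q) (snd (snd q))\<bar> / sqrt (dist (fst (snd q)) (snd (snd q))))"

definition N0 :: "'n::finite fld => real" where "N0 F = sn F + hs F"

lemma sn_le: assumes "\<And>\<tau> x. \<bar>F \<tau> x\<bar> <= c" shows "sn F <= c"
  unfolding sn_def using assms by (intro cSUP_least) auto

lemma sn_ge: assumes "AC F" shows "\<bar>F \<tau> x\<bar> <= sn F"
proof -
  obtain M where M: "\<And>\<tau> x. \<bar>F \<tau> x\<bar> <= M" using AC_bdd[OF assms] by blast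
  have "\<bar>F (fst (\<tau>, x)) (snd (\<tau>, x))\<bar> <= sn F"
    unfolding sn_def by (rule cSUP_upper) (auto intro!: bdd_aboveI[of _ M] M)
  then show ?thesis by simp
qed

lemma hs_le: assumes "\<And>\<tau> x y. \<bar>F \<tau> x - F \<tau> y\<bar> <= c * sqrt (dist x y)" "c >= 0" shows "hs F <= c"
  unfolding hs_def
proof (rule cSUP_least)
  fix q :: "complex \<times> (real^'a) \<times> (real^'a)"
  show "\<bar>F (fst q) (fst (snd q)) - F (fst q) (snd (snd q))\<bar> / sqrt (dist (fst (snd q)) (snd (snd q))) <= c"
    using assms(1)[of "fst q" "fst (snd q)" "snd (snd q)"] assms(2)
    by (cases "fst (snd q) = snd (snd q)") (auto simp: pos_divide_le_eq)
qed simp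

text \<open>At distance at most 1 the Lipschitz bound suffices, since the distance is then below its
  square root; at larger distance twice the sup bound does.\<close>

lemma interpolation:
  fixes F :: "'n::finite fld"
  assumes F: "smooth F" and A: "\<And>x. \<bar>F \<tau> x\<bar> <= A" and B: "\<And>i x. \<bar>D (Some i) F \<tau> x\<bar> <= B"
  shows "\<bar>F \<tau> x - F \<tau> y\<bar> <= (2 * A + real CARD('n) * B) * sqrt (dist x y)"
proof -
  have A0: "A >= 0" using A[of 0] by linarith
  have B0: "real CARD('n) * B >= 0" using B[of undefined 0] by (intro mult_nonneg_nonneg) auto
  have d0: "0 <= sqrt (dist x y)" by simp
  show ?thesis
  proof (cases "dist x y <= 1")
    case True
    have "dist x y <= sqrt (dist x y)" using True by (intro real_le_rsqrt) (simp add: power2_eq_square mult_left_le)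
    have "\<bar>F \<tau> x - F \<tau> y\<bar> <= real CARD('n) * B * dist x y" by (rule smooth_lipschitz[OF F B])
    also have "\<dots> <= real CARD('n) * B * sqrt (dist x y)" by (intro mult_left_mono B0) fact
    also have "\<dots> <= (2 * A + real CARD('n) * B) * sqrt (dist x y)" using A0 d0 by (intro mult_right_mono) auto
    finally show ?thesis .
  next
    case False
    then have 1: "1 <= sqrt (dist x y)" by simp
    have "\<bar>F \<tau> x - F \<tau> y\<bar> <= 2 * A" using A[of x] A[of y] by linarith
    also have "\<dots> <= (2 * A + real CARD('n) * B) * 1" using B0 by simp
    also have "\<dots> <= (2 * A + real CARD('n) * B) * sqrt (dist x y)" using A0 B0 1 by (intro mult_left_mono) auto
    finally show ?thesis .
  qed
qed

lemma smooth_D_bdd: assumes "smooth F" shows "\<exists>M. \<forall>i \<tau> x. \<bar>D (Some i) F \<tau> x\<bar> <= M"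
proof -
  have "\<exists>M. \<forall>\<tau> x. \<bar>D (Some i) F \<tau> x\<bar> <= M" for i using AC_bdd[OF smooth_AC[OF smooth_D[OF assms]]] .
  then obtain M where M: "\<And>i \<tau> x. \<bar>D (Some i) F \<tau> x\<bar> <= M i" by metis
  have "M i <= Max (range M)" for i by simp
  then show ?thesis using M order_trans by (intro exI[of _ "Max (range M)"]) blast
qed

lemma hs_ge: assumes "smooth F" shows "\<bar>F \<tau> x - F \<tau> y\<bar> <= hs F * sqrt (dist x y)"
proof (cases "x = y")
  case False
  obtain A where A: "\<And>\<tau> x. \<bar>F \<tau> x\<bar> <= A" using AC_bdd[OF smooth_AC[OF assms]] by blast
  obtain B where B: "\<And>i \<tau> x. \<bar>D (Some i) F \<tau> x\<bar> <= B" using smooth_D_bdd[OF assms] by blast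
  have bdd: "bdd_above (range (%q. \<bar>F (fst q) (fst (snd q)) - F (fst q) (snd (snd q))\<bar> / sqrt (dist (fst (snd q)) (snd (snd q)))))"
  proof (rule bdd_aboveI)
    fix t assume "t \<in> range (%q. \<bar>F (fst q) (fst (snd q)) - F (fst q) (snd (snd q))\<bar> / sqrt (dist (fst (snd q)) (snd (snd q))))"
    then obtain q where q: "t = \<bar>F (fst q) (fst (snd q)) - F (fst q) (snd (snd q))\<bar> / sqrt (dist (fst (snd q)) (snd (snd q)))" by blast
    have "0 <= 2 * A + real CARD('a) * B"
    proof -
      have "A >= 0" using A[of 0 0] by linarith
      moreover have "real CARD('a) * B >= 0" using B[of undefined 0 0] by (intro mult_nonneg_nonneg) auto
      ultimately show ?thesis by simp
    qed
    then show "t <= 2 * A + real CARD('a) * B" unfolding q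
      using interpolation[OF assms A B, of "fst q" "fst (snd q)" "snd (snd q)"]
      by (cases "fst (snd q) = snd (snd q)") (auto simp: pos_divide_le_eq)
  qed
  have "\<bar>F (fst (\<tau>,x,y)) (fst (snd (\<tau>,x,y))) - F (fst (\<tau>,x,y)) (snd (snd (\<tau>,x,y)))\<bar> / sqrt (dist (fst (snd (\<tau>,x,y))) (snd (snd (\<tau>,x,y)))) <= hs F"
    unfolding hs_def by (rule cSUP_upper[OF UNIV_I bdd])
  then show ?thesis using False by (simp add: pos_divide_le_eq)
qed simp

lemma sn_nonneg: "AC F ==> sn F >= 0" using sn_ge[of F 0 0] by (meson abs_ge_zero order_trans)

lemma hs_nonneg: assumes "smooth F" shows "hs F >= 0"
proof -
  have "0 <= hs F * sqrt (dist (axis undefined 1 :: real^'a) 0)"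
    using hs_ge[OF assms, of 0 "axis undefined 1" 0] by linarith
  then show ?thesis by (simp add: norm_axis_1)
qed

lemma N0_le:
  assumes "\<And>\<tau> x. \<bar>F \<tau> x\<bar> <= A" "\<And>\<tau> x y. \<bar>F \<tau> x - F \<tau> y\<bar> <= B * sqrt (dist x y)" "B >= 0"
  shows "N0 F <= A + B"
  unfolding N0_def by (intro add_mono sn_le hs_le assms)

lemma N0_sn: "smooth F ==> \<bar>F \<tau> x\<bar> <= N0 F"
  unfolding N0_def using sn_ge[OF smooth_AC, of F \<tau> x] hs_nonneg[of F] by linarith

text \<open>The Leibniz rule for differences gives three of the four terms of
  \<open>N0 F * N0 G\<close>; the fourth, \<open>hs F * hs G\<close>, is nonnegative.\<close>

lemma N0_mult:
  assumes F: "smooth F" and G: "smooth G" shows "N0 (F * G) <= N0 F * N0 G"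
proof -
  have f: "sn F >= 0" "hs F >= 0" "sn G >= 0" "hs G >= 0" using F G by (auto intro: sn_nonneg hs_nonneg smooth_AC)
  have "N0 (F * G) <= sn F * sn G + (hs F * sn G + sn F * hs G)"
  proof (rule N0_le)
    show "\<bar>(F * G) \<tau> x\<bar> <= sn F * sn G" for \<tau> x
      by (simp add: abs_mult) (intro mult_mono sn_ge smooth_AC F G; use f in simp)
    fix \<tau> x y
    have "(F * G) \<tau> x - (F * G) \<tau> y = (F \<tau> x - F \<tau> y) * G \<tau> x + F \<tau> y * (G \<tau> x - G \<tau> y)" by (simp add: algebra_simps)
    also have "\<bar>\<dots>\<bar> <= \<bar>F \<tau> x - F \<tau> y\<bar> * \<bar>G \<tau> x\<bar> + \<bar>F \<tau> y\<bar> * \<bar>G \<tau> x - G \<tau> y\<bar>"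
      by (metis abs_mult abs_triangle_ineq)
    also have "\<dots> <= (hs F * sqrt (dist x y)) * sn G + sn F * (hs G * sqrt (dist x y))"
      by (intro add_mono mult_mono sn_ge hs_ge smooth_AC F G) (use f in auto)
    finally show "\<bar>(F * G) \<tau> x - (F * G) \<tau> y\<bar> <= (hs F * sn G + sn F * hs G) * sqrt (dist x y)" by (simp add: algebra_simps)
  qed (use f in auto)
  also have "\<dots> <= N0 F * N0 G" using f by (simp add: N0_def algebra_simps)
  finally show ?thesis .
qed

lemma N0_op:
  assumes L: "smooth F" and sb: "\<And>\<tau> x. \<bar>L \<tau> x\<bar> <= sn F" and hb: "\<And>\<tau> x y. \<bar>L \<tau> x - L \<tau> y\<bar> <= hs F * sqrt (dist x y)"
  shows "N0 L <= N0 F"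
  using N0_le[of L "sn F" "hs F", OF sb hb hs_nonneg[OF L]] by (simp add: N0_def)

text \<open>The norms for which the contraction argument runs: algebra norms for which the resolvent gains two derivatives.\<close>

definition adm :: "real => real => ('n::finite fld => real) => bool" where
  "adm a C N \<longleftrightarrow> (\<forall>F. smooth F --> 0 <= N F \<and> (\<forall>c. N (cst c * F) <= \<bar>c\<bar> * N F) \<and> N (J F) <= N F \<and> N (E1 F) <= N F \<and>
     N (SS a F) <= C * N F \<and> (\<forall>i. N (SS a (D (Some i) F)) <= C * N F) \<and>
     (\<forall>i j. N (SS a (D (Some i) (D (Some j) F))) <= C * N F) \<and>
     (\<forall>G. smooth G --> N (F + G) <= N F + N G \<and> N (F * G) <= N F * N G))"

lemma admD:
  assumes "adm a C N" "smooth F"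
  shows "0 <= N F" "N (cst c * F) <= \<bar>c\<bar> * N F" "N (J F) <= N F" "N (E1 F) <= N F"
    "N (SS a F) <= C * N F" "N (SS a (D (Some i) F)) <= C * N F" "N (SS a (D (Some i) (D (Some j) F))) <= C * N F"
    "smooth G ==> N (F + G) <= N F + N G" "smooth G ==> N (F * G) <= N F * N G"
  using assms unfolding adm_def by blast+

lemma adm_N0:
  assumes a: "a > 0"
  shows "\<exists>C\<ge>1. adm a C (N0 :: 'n::finite fld => real)"
proof -
  define c1 where "c1 = KG TYPE('n) * (1/a + 2) * 6"
  define c2 where "c2 = KG TYPE('n) * (1/a) * CARD('n) * 6"
  have c: "c1 >= 0" "c2 >= 0" unfolding c1_def c2_def using a KG_nonneg[where 'n='n] by auto
  \<comment> \<open>The summands serve the resolvent itself (1), one derivative, whose Hoelder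
    seminorm comes by \<open>interpolation\<close> from the bounds on one and two derivatives
    (\<open>3 + CARD('n)\<close> times \<open>c1\<close>), and two derivatives
    (\<open>c1 + c2\<close>).\<close>
  define C where "C = 1 + (3 + CARD('n)) * c1 + c2"
  have C1: "C >= 1" unfolding C_def using c by simp
  have "adm a C (N0 :: 'n fld => real)"
    unfolding adm_def
  proof (intro allI impI conjI)
    fix F :: "'n fld" assume F: "smooth F"
    note A = smooth_AC[OF F]
    have f: "sn F >= 0" "hs F >= 0" using F by (auto intro: sn_nonneg hs_nonneg smooth_AC)
    show N: "0 <= N0 F" using f by (simp add: N0_def)
    show "N0 (cst c * F) <= \<bar>c\<bar> * N0 F" for c
    proof -
      have "N0 (cst c * F) <= \<bar>c\<bar> * sn F + \<bar>c\<bar> * hs F"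
      proof (rule N0_le)
        show "\<bar>(cst c * F) \<tau> x - (cst c * F) \<tau> y\<bar> <= \<bar>c\<bar> * hs F * sqrt (dist x y)" for \<tau> x y
          using mult_left_mono[OF hs_ge[OF F, of \<tau> x y], of "\<bar>c\<bar>"] by (simp add: abs_mult[symmetric] algebra_simps)
      qed (use f in \<open>auto simp: abs_mult intro!: mult_left_mono sn_ge A\<close>)
      then show ?thesis by (simp add: N0_def algebra_simps)
    qed
    have hs': "\<bar>F \<tau> (x + u) - F \<tau> (y + u)\<bar> <= hs F * sqrt (dist x y)" for \<tau> x y u
      using hs_ge[OF F, of \<tau> "x + u" "y + u"] by simp
    show "N0 (J F) <= N0 F"
    proof (rule N0_op[OF F])
      show "\<bar>J F \<tau> x\<bar> <= sn F" for \<tau> x by (rule J_bound[OF A sn_ge[OF A]])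
      show "\<bar>J F \<tau> x - J F \<tau> y\<bar> <= hs F * sqrt (dist x y)" for \<tau> x y
        using J_diff_apply[OF A sn_ge[OF A], of \<tau> x \<tau> y "hs F * sqrt (dist x y)"] hs_ge[OF F] by simp
    qed
    show "N0 (E1 F) <= N0 F"
      by (rule N0_op[OF F]) (auto simp: E1_def intro: sn_ge A hs_ge F)
    have "N0 (SS a F) <= N0 F"
      by (rule N0_op[OF F]) (auto intro!: fopD(4)[OF fop_SS[OF a] A] sn_ge[OF A] SS_diff_bound[OF a A] hs')
    also have "\<dots> <= C * N0 F" using C1 N mult_right_mono[of 1 C "N0 F"] by simp
    finally show "N0 (SS a F) <= C * N0 F" .
    have D1: "\<bar>SS a (D (Some i) F) \<tau> x\<bar> <= hs F * c1" for i \<tau> x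
      unfolding c1_def by (rule SS_D1_bound[OF a F hs_ge[OF F] f(2)])
    have D2: "\<bar>SS a (D (Some i) (D (Some j) F)) \<tau> x\<bar> <= hs F * c1" for i j \<tau> x
      unfolding c1_def by (rule SS_D2_bound(1)[OF a F hs_ge[OF F] f(2)])
    have D2h: "\<bar>SS a (D (Some i) (D (Some j) F)) \<tau> x - SS a (D (Some i) (D (Some j) F)) \<tau> y\<bar> <= (hs F * c2) * sqrt (dist x y)" for i j \<tau> x y
      unfolding c2_def by (rule SS_D2_bound(2)[OF a F hs_ge[OF F] f(2)])
    have hC: "hs F * t <= C * N0 F" if "t <= C" for t
    proof -
      have "hs F * t <= hs F * C" using that f by (intro mult_left_mono) auto
      also have "\<dots> <= C * N0 F" using f C1 by (simp add: N0_def algebra_simps)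
      finally show ?thesis .
    qed
    show "N0 (SS a (D (Some i) F)) <= C * N0 F" for i
    proof -
      have sm: "smooth (SS a (D (Some i) F))" by (rule fop_smooth[OF fop_SS[OF a] smooth_D[OF F]])
      have "N0 (SS a (D (Some i) F)) <= hs F * c1 + (2 * (hs F * c1) + real CARD('n) * (hs F * c1))"
      proof (rule N0_le)
        show "\<bar>SS a (D (Some i) F) \<tau> x - SS a (D (Some i) F) \<tau> y\<bar> <= (2 * (hs F * c1) + real CARD('n) * (hs F * c1)) * sqrt (dist x y)" for \<tau> x y
        proof (rule interpolation[OF sm D1])
          show "\<bar>D (Some j) (SS a (D (Some i) F)) \<tau> x\<bar> <= hs F * c1" for j x
            unfolding fop_D[OF fop_SS[OF a] smooth_D[OF F]] by (rule D2)
        qed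
      qed (use D1 f c in auto)
      also have "\<dots> = hs F * ((3 + real CARD('n)) * c1)" by (simp add: algebra_simps)
      also have "\<dots> <= C * N0 F" by (rule hC) (use c in \<open>simp add: C_def\<close>)
      finally show ?thesis .
    qed
    show "N0 (SS a (D (Some i) (D (Some j) F))) <= C * N0 F" for i j
    proof -
      have "N0 (SS a (D (Some i) (D (Some j) F))) <= hs F * c1 + hs F * c2"
        by (rule N0_le[OF D2 D2h]) (use f c in auto)
      also have "\<dots> = hs F * (c1 + c2)" by (simp add: algebra_simps)
      also have "\<dots> <= C * N0 F"
      proof (rule hC)
        have "1 * c1 <= (3 + real CARD('n)) * c1" using c by (intro mult_right_mono) auto
        then show "c1 + c2 <= C" by (simp add: C_def)
      qed
      finally show ?thesis .
    qed
    fix G :: "'n fld" assume G: "smooth G"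
    show "N0 (F * G) <= N0 F * N0 G" by (rule N0_mult[OF F G])
    have "N0 (F + G) <= (sn F + sn G) + (hs F + hs G)"
    proof (rule N0_le)
      show "\<bar>(F + G) \<tau> x\<bar> <= sn F + sn G" for \<tau> x
        using sn_ge[OF A, of \<tau> x] sn_ge[OF smooth_AC[OF G], of \<tau> x] by simp
      show "\<bar>(F + G) \<tau> x - (F + G) \<tau> y\<bar> <= (hs F + hs G) * sqrt (dist x y)" for \<tau> x y
        using hs_ge[OF F, of \<tau> x y] hs_ge[OF G, of \<tau> x y] by (simp add: distrib_right)
    qed (use f hs_nonneg[OF G] in auto)
    then show "N0 (F + G) <= N0 F + N0 G" by (simp add: N0_def)
  qed
  then show ?thesis using C1 by blast
qed

section \<open>Norms of higher order\<close>

lemma smooth_J: "smooth F ==> smooth (J F)" by (rule fop_smooth[OF fop_J])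
lemma smooth_E1: "smooth F ==> smooth (E1 F)" by (rule fop_smooth[OF fop_E1])
lemma smooth_SS: "a > 0 ==> smooth F ==> smooth (SS a F)" by (rule fop_smooth[OF fop_SS])

text \<open>The operators commute with derivatives, so the linear estimates pass with unchanged
  constant. For products, Leibniz gives exactly the terms of order at most one in \<open>l\<close>
  of the right side; the remaining term, of order \<open>l^2\<close>, is nonnegative.\<close>

lemma adm_step:
  assumes a: "a > 0" and N: "adm a C (N :: 'n::finite fld => real)" and l: "l >= 0"
  shows "adm a C (%F. N F + l * (\<Sum>i\<in>UNIV. N (D i F)))"
proof -
  have lin: "N (L F) + l * (\<Sum>i\<in>UNIV. N (D i (L F))) <= c * (N F + l * (\<Sum>i\<in>UNIV. N (D i F)))"
    if F: "smooth F" and L: "\<And>F. smooth F ==> N (L F) <= c * N F" and c: "\<And>i. D i (L F) = L (D i F)" for L c F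
  proof -
    have "(\<Sum>i\<in>UNIV. N (D i (L F))) <= (\<Sum>i\<in>UNIV. c * N (D i F))"
      unfolding c by (intro sum_mono L smooth_D F)
    then have "l * (\<Sum>i\<in>UNIV. N (D i (L F))) <= l * (c * (\<Sum>i\<in>UNIV. N (D i F)))"
      using l by (intro mult_left_mono) (auto simp: sum_distrib_left)
    then show ?thesis using L[OF F] by (simp add: algebra_simps)
  qed
  show ?thesis
    unfolding adm_def
  proof (intro allI impI conjI)
    fix F :: "'n fld" assume F: "smooth F"
    note D = smooth_D[OF F]
    show "0 <= N F + l * (\<Sum>i\<in>UNIV. N (D i F))" using l by (intro add_nonneg_nonneg mult_nonneg_nonneg sum_nonneg admD(1)[OF N] F D)
    show "N (cst c * F) + l * (\<Sum>i\<in>UNIV. N (D i (cst c * F))) <= \<bar>c\<bar> * (N F + l * (\<Sum>i\<in>UNIV. N (D i F)))" for c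
      by (rule lin[where L = "%F. cst c * F", OF F admD(2)[OF N] D_cmult[OF F]])
    show "N (J F) + l * (\<Sum>i\<in>UNIV. N (D i (J F))) <= N F + l * (\<Sum>i\<in>UNIV. N (D i F))"
      using lin[OF F, of J 1] admD(3)[OF N] fop_D[OF fop_J F] by simp
    show "N (E1 F) + l * (\<Sum>i\<in>UNIV. N (D i (E1 F))) <= N F + l * (\<Sum>i\<in>UNIV. N (D i F))"
      using lin[OF F, of E1 1] admD(4)[OF N] fop_D[OF fop_E1 F] by simp
    show "N (SS a F) + l * (\<Sum>i\<in>UNIV. N (D i (SS a F))) <= C * (N F + l * (\<Sum>i\<in>UNIV. N (D i F)))"
      by (rule lin[OF F admD(5)[OF N] fop_D[OF fop_SS[OF a] F]])
    show "N (SS a (D (Some j) F)) + l * (\<Sum>i\<in>UNIV. N (D i (SS a (D (Some j) F)))) <= C * (N F + l * (\<Sum>i\<in>UNIV. N (D i F)))" for j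
    proof (rule lin[OF F])
      show "D i (SS a (D (Some j) F)) = SS a (D (Some j) (D i F))" for i
        unfolding fop_D[OF fop_SS[OF a] D] D_commute[OF F, of i] ..
    qed (rule admD(6)[OF N])
    show "N (SS a (D (Some j) (D (Some k) F))) + l * (\<Sum>i\<in>UNIV. N (D i (SS a (D (Some j) (D (Some k) F))))) <= C * (N F + l * (\<Sum>i\<in>UNIV. N (D i F)))" for j k
    proof (rule lin[OF F])
      show "D i (SS a (D (Some j) (D (Some k) F))) = SS a (D (Some j) (D (Some k) (D i F)))" for i
        unfolding fop_D[OF fop_SS[OF a] smooth_D[OF D]] D_commute[OF D, of i] D_commute[OF F, of i] ..
    qed (rule admD(7)[OF N])
    fix G :: "'n fld" assume G: "smooth G"
    note D' = smooth_D[OF G]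
    have "(\<Sum>i\<in>UNIV. N (D i (F + G))) <= (\<Sum>i\<in>UNIV. N (D i F) + N (D i G))"
      unfolding D_add[OF F G] by (intro sum_mono admD(8)[OF N] D D')
    then have "l * (\<Sum>i\<in>UNIV. N (D i (F + G))) <= l * (\<Sum>i\<in>UNIV. N (D i F) + N (D i G))" using l by (intro mult_left_mono)
    then show "N (F + G) + l * (\<Sum>i\<in>UNIV. N (D i (F + G))) <= (N F + l * (\<Sum>i\<in>UNIV. N (D i F))) + (N G + l * (\<Sum>i\<in>UNIV. N (D i G)))"
      using admD(8)[OF N F G] by (simp add: sum.distrib algebra_simps)
    have "N (D i (F * G)) <= N (D i F) * N G + N F * N (D i G)" for i
      unfolding D_mult[OF F G]
      by (rule order_trans[OF admD(8)[OF N] add_mono[OF admD(9)[OF N] admD(9)[OF N]]]) (intro smooth_mult D D' F G)+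
    then have "(\<Sum>i\<in>UNIV. N (D i (F * G))) <= (\<Sum>i\<in>UNIV. N (D i F) * N G + N F * N (D i G))" by (intro sum_mono)
    also have "\<dots> = (\<Sum>i\<in>UNIV. N (D i F)) * N G + N F * (\<Sum>i\<in>UNIV. N (D i G))" by (simp add: sum.distrib sum_distrib_left sum_distrib_right)
    finally have "l * (\<Sum>i\<in>UNIV. N (D i (F * G))) <= l * ((\<Sum>i\<in>UNIV. N (D i F)) * N G + N F * (\<Sum>i\<in>UNIV. N (D i G)))" using l by (intro mult_left_mono)
    moreover have "0 <= (l * (\<Sum>i\<in>UNIV. N (D i F))) * (l * (\<Sum>i\<in>UNIV. N (D i G)))"
      using l by (intro mult_nonneg_nonneg sum_nonneg admD(1)[OF N] D D')
    ultimately show "N (F * G) + l * (\<Sum>i\<in>UNIV. N (D i (F * G))) <= (N F + l * (\<Sum>i\<in>UNIV. N (D i F))) * (N G + l * (\<Sum>i\<in>UNIV. N (D i G)))"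
      using admD(9)[OF N F G] by (simp add: algebra_simps)
  qed
qed

fun NN :: "nat => real => 'n::finite fld => real" where
  "NN 0 l F = N0 F"
| "NN (Suc k) l F = NN k l F + l * (\<Sum>i\<in>UNIV. NN k l (D i F))"

lemma adm_NN: "a > 0 ==> adm a C (N0 :: 'a::finite fld => real) ==> l >= 0 ==> adm a C (NN k l :: 'a fld => real)"
proof (induction k)
  case 0
  have "NN 0 l = (N0 :: 'a fld => real)" by (intro ext) simp
  then show ?case using 0 by simp
next
  case (Suc k)
  have "NN (Suc k) l = (%F. NN k l F + l * (\<Sum>i\<in>UNIV. NN k l (D i F)))" by (intro ext) simp
  then show ?case using adm_step[OF Suc.prems(1) Suc.IH[OF Suc.prems] Suc.prems(3)] by simp
qed

lemma N0_nonneg: "smooth F ==> N0 F >= 0"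
  unfolding N0_def by (intro add_nonneg_nonneg sn_nonneg hs_nonneg smooth_AC)

lemma NN_nonneg: "smooth F ==> l >= 0 ==> NN k l F >= 0"
  by (induction k arbitrary: F) (auto intro!: N0_nonneg add_nonneg_nonneg mult_nonneg_nonneg sum_nonneg smooth_D)

text \<open>Each derivative in \<open>NN\<close> carries a factor \<open>l\<close>, so for fixed
  \<open>F\<close> the bound tends to \<open>N0 F\<close> as \<open>l\<close> tends to 0.\<close>

lemma NN_small:
  assumes "smooth F" shows "\<exists>P\<ge>0. \<forall>l. 0 <= l --> l <= 1 --> NN k l F <= N0 F + l * P"
  using assms
proof (induction k arbitrary: F)
  case (Suc k)
  have "\<exists>P\<ge>0. \<forall>l. 0 <= l --> l <= 1 --> NN k l (D i F) <= N0 (D i F) + l * P" for i by (rule Suc.IH[OF smooth_D[OF Suc.prems]])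
  then obtain Q where Q: "\<And>i. Q i >= 0" "\<And>i l. 0 <= l ==> l <= 1 ==> NN k l (D i F) <= N0 (D i F) + l * Q i" by metis
  obtain P where P: "P >= 0" "\<And>l. 0 <= l ==> l <= 1 ==> NN k l F <= N0 F + l * P" using Suc.IH[OF Suc.prems] by blast
  define R where "R = P + (\<Sum>i\<in>UNIV. N0 (D i F) + Q i)"
  have "R >= 0" unfolding R_def by (intro add_nonneg_nonneg sum_nonneg P Q N0_nonneg smooth_D Suc.prems)
  moreover have "NN (Suc k) l F <= N0 F + l * R" if l: "0 <= l" "l <= 1" for l
  proof -
    have "NN k l (D i F) <= N0 (D i F) + Q i" for i using Q(2)[OF l, of i] mult_right_mono[OF l(2) Q(1)[of i]] by simp
    then have "l * (\<Sum>i\<in>UNIV. NN k l (D i F)) <= l * (\<Sum>i\<in>UNIV. N0 (D i F) + Q i)" using l by (intro mult_left_mono sum_mono)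
    then show ?thesis using P(2)[OF l] by (simp add: R_def algebra_simps)
  qed
  ultimately show ?case by blast
qed (auto intro: exI[of _ 0])

text \<open>For fixed l > 0 the norm controls every derivative of order up to \<open>k\<close>,
  those in the parameter included, at the price of a factor \<open>1 / l^k\<close>.\<close>

lemma NN_DL:
  assumes "smooth F" "length is <= k" "0 <= l"
  shows "l ^ length is * N0 (DL is F) <= NN k l F"
  using assms
proof (induction k arbitrary: F "is")
  case (Suc k)
  have nn: "0 <= l * (\<Sum>i\<in>UNIV. NN k l (D i F))" using Suc.prems by (intro mult_nonneg_nonneg sum_nonneg NN_nonneg smooth_D)
  show ?case
  proof (cases "length is <= k")
    case True
    then show ?thesis using Suc.IH[OF Suc.prems(1) True Suc.prems(3)] nn by simp
  next
    case False
    then obtain i js where js: "is = i # js" "length js <= k" using Suc.prems(2) by (cases "is") auto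
    have "l ^ length js * N0 (DL js (D i F)) <= NN k l (D i F)" by (rule Suc.IH[OF smooth_D[OF Suc.prems(1)] js(2) Suc.prems(3)])
    also have "\<dots> <= (\<Sum>i\<in>UNIV. NN k l (D i F))"
      by (rule member_le_sum) (auto intro: NN_nonneg smooth_D Suc.prems)
    finally have "l * (l ^ length js * N0 (DL js (D i F))) <= l * (\<Sum>i\<in>UNIV. NN k l (D i F))" using Suc.prems(3) by (intro mult_left_mono)
    then show ?thesis using js NN_nonneg[OF Suc.prems(1,3), of k] by simp
  qed
qed simp

lemma N0_le_sn:
  fixes F :: "'n::finite fld"
  assumes F: "smooth F"
  shows "N0 F <= 3 * sn F + CARD('n) * (\<Sum>i\<in>UNIV. sn (D (Some i) F))"
proof -
  have s: "sn F >= 0" "sn (D (Some i) F) >= 0" for i by (intro sn_nonneg smooth_AC F smooth_D)+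
  have B: "\<bar>D (Some i) F \<tau> x\<bar> <= (\<Sum>i\<in>UNIV. sn (D (Some i) F))" for i \<tau> x
    using order_trans[OF sn_ge[OF smooth_AC[OF smooth_D[OF F]]] member_le_sum[of i UNIV "%i. sn (D (Some i) F)"]] s by auto
  have "N0 F <= sn F + (2 * sn F + real CARD('n) * (\<Sum>i\<in>UNIV. sn (D (Some i) F)))"
    by (rule N0_le[OF sn_ge[OF smooth_AC[OF F]] interpolation[OF F sn_ge[OF smooth_AC[OF F]] B]])
      (use s in \<open>auto intro!: add_nonneg_nonneg mult_nonneg_nonneg sum_nonneg\<close>)
  then show ?thesis by simp
qed

lemma NN_tendsto_0:
  assumes "\<And>n. smooth (Fn n)" "\<And>is. (%n. sn (DL is (Fn n))) \<longlonglongrightarrow> 0"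
  shows "(%n. NN k l (Fn n :: 'n::finite fld)) \<longlonglongrightarrow> 0"
  using assms
proof (induction k arbitrary: Fn)
  case 0
  have 1: "(%n. sn (Fn n)) \<longlonglongrightarrow> 0" using "0.prems"(2)[of "[]"] by simp
  have 2: "(%n. sn (D (Some i) (Fn n))) \<longlonglongrightarrow> 0" for i using "0.prems"(2)[of "[Some i]"] by simp
  have "(%n. 3 * sn (Fn n) + CARD('n) * (\<Sum>i\<in>UNIV. sn (D (Some i) (Fn n)))) \<longlonglongrightarrow> 3 * 0 + real CARD('n) * (\<Sum>i\<in>(UNIV::'n set). 0)"
    by (intro tendsto_intros 1 2)
  then have 3: "(%n. 3 * sn (Fn n) + CARD('n) * (\<Sum>i\<in>UNIV. sn (D (Some i) (Fn n)))) \<longlonglongrightarrow> 0" by simp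
  show ?case unfolding NN.simps
    by (rule tendsto_sandwich[OF _ _ tendsto_const 3]) (use N0_nonneg N0_le_sn "0.prems"(1) in \<open>auto intro!: always_eventually\<close>)
next
  case (Suc k)
  have "(%n. NN k l (D i (Fn n))) \<longlonglongrightarrow> 0" for i
  proof (rule Suc.IH)
    show "(%n. sn (DL is (D i (Fn n)))) \<longlonglongrightarrow> 0" for "is" using Suc.prems(2)[of "i # is"] by simp
  qed (intro smooth_D Suc.prems)
  then have "(%n. NN k l (Fn n) + l * (\<Sum>i\<in>UNIV. NN k l (D i (Fn n)))) \<longlonglongrightarrow> 0 + l * (\<Sum>i\<in>(UNIV :: 'n option set). 0)"
    using Suc.IH[OF Suc.prems] by (intro tendsto_intros)
  then show ?case by simp
qed

section \<open>The nonlinearity\<close>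

text \<open>A configuration consists of the components of \<open>f\<close>, \<open>v\<close>, \<open>w\<close> and of a matrix \<open>h\<close> with
  \<open>(1 + df)\<^sup>-\<^sup>1 = 1 + h - df\<close>: so \<open>h\<close> is quadratically small, and it solves \<open>h = - df (h - df)\<close>. The matrix \<open>gg = h - df\<close>
  expresses the derivatives \<open>G1\<close>, \<open>G2\<close> of a function composed with the inverse of \<open>id + f\<close>.\<close>

datatype 'n idx = IF 'n | IV 'n | IW 'n | IH 'n 'n

instance idx :: (finite) finite
proof
  have "(UNIV :: 'a idx set) = range IF \<union> range IV \<union> range IW \<union> range (%(i, j). IH i j)"
  proof -
    have "b \<in> range IF \<union> range IV \<union> range IW \<union> range (%(i, j). IH i j)" for b :: "'a idx" by (cases b) auto
    then show ?thesis by blast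
  qed
  moreover have "finite (range (IF :: 'a => 'a idx) \<union> range IV \<union> range IW \<union> range (%(i, j). IH i j))"
    by (intro finite_UnI finite_imageI finite_class.finite_UNIV)
  ultimately show "finite (UNIV :: 'a idx set)" by (simp only:)
qed

type_synonym 'n cfg = "'n idx => 'n fld"

abbreviation dx :: "'n::finite => 'n fld => 'n fld" where "dx k \<equiv> D (Some k)"

definition smc :: "'n::finite cfg => bool" where "smc c \<longleftrightarrow> (\<forall>b. smooth (c b))"

fun isH :: "'n idx => bool" where "isH (IH i j) = True" | "isH (IF j) = False" | "isH (IV j) = False" | "isH (IW j) = False"

text \<open>Entries of \<open>h\<close> are measured with one derivative less: they are built from
  first derivatives of \<open>f\<close>, which is measured with two, and only their first
  derivatives occur in the equation.\<close>

definition qn :: "('n::finite fld => real) => 'n idx => 'n fld => real" where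
  "qn N b F = N F + (\<Sum>k\<in>UNIV. N (dx k F)) + (if isH b then 0 else (\<Sum>k\<in>UNIV. \<Sum>l\<in>UNIV. N (dx k (dx l F))))"

definition nc :: "('n::finite fld => real) => 'n cfg => real" where
  "nc N c = (\<Sum>b\<in>UNIV. qn N b (c b))"

lemma smcD: "smc c ==> smooth (c b)" by (simp add: smc_def)
lemma cfg_plus: "((c :: 'n::finite cfg) + c') b = c b + c' b" by (rule plus_fun_apply)
lemma cfg_minus: "((c :: 'n::finite cfg) - c') b = c b - c' b" by (rule minus_apply)
lemma cfg_zero: "(0 :: 'n::finite cfg) b = 0" by (rule zero_fun_apply)

lemma smc_add: "smc c ==> smc c' ==> smc (c + c')" unfolding smc_def cfg_plus by (intro allI smooth_add) auto
lemma smc_diff: "smc c ==> smc c' ==> smc (c - c')" unfolding smc_def cfg_minus by (intro allI smooth_diff) auto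
lemma smc_0: "smc 0" unfolding smc_def cfg_zero by (intro allI smooth_0)

lemma adm_diff: assumes "adm a C N" "smooth F" "smooth G" shows "N (F - G) <= N F + N G"
proof -
  have "N (F + - G) <= N F + N (- G)" by (rule admD(8)[OF assms(1,2) smooth_uminus[OF assms(3)]])
  moreover have "N (- G) <= N G" using admD(2)[OF assms(1,3), of "-1"] unfolding fld_uminus[symmetric] by simp
  ultimately show ?thesis by simp
qed

lemma adm_0: assumes "adm a C N" shows "N (0 :: 'n::finite fld) = 0"
proof -
  have z: "cst 0 * (0 :: 'n fld) = 0" by simp
  have "N 0 <= 0" using admD(2)[OF assms smooth_0, of 0] unfolding z by simp
  then show ?thesis using admD(1)[OF assms smooth_0] by simp
qed

lemma qn_nonneg: "adm a C N ==> smooth F ==> 0 <= qn N b F"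
  unfolding qn_def by (auto intro!: add_nonneg_nonneg sum_nonneg admD(1)[of a C N] smooth_D)

lemma qn_mono:
  assumes N: "adm a C N" and F: "smooth F"
  shows "N F <= qn N b F" "N (dx k F) <= qn N b F" "\<not> isH b ==> N (dx k (dx l F)) <= qn N b F"
proof -
  have 1: "0 <= N F" by (rule admD(1)[OF N F])
  have 2: "0 <= N (dx k F)" for k by (rule admD(1)[OF N smooth_D[OF F]])
  have 3: "0 <= N (dx k (dx l F))" for k l by (rule admD(1)[OF N smooth_D[OF smooth_D[OF F]]])
  have s2: "0 <= (\<Sum>k\<in>UNIV. N (dx k F))" by (intro sum_nonneg 2)
  have s3: "0 <= (\<Sum>k\<in>UNIV. \<Sum>l\<in>UNIV. N (dx k (dx l F)))" by (intro sum_nonneg 3)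
  have m2: "N (dx k F) <= (\<Sum>k\<in>UNIV. N (dx k F))" by (rule member_le_sum) (auto intro: 2)
  have "N (dx k (dx l F)) <= (\<Sum>l\<in>UNIV. N (dx k (dx l F)))" by (rule member_le_sum) (auto intro: 3)
  also have "\<dots> <= (\<Sum>k\<in>UNIV. \<Sum>l\<in>UNIV. N (dx k (dx l F)))" by (rule member_le_sum) (auto intro!: sum_nonneg 3)
  finally have m3: "N (dx k (dx l F)) <= (\<Sum>k\<in>UNIV. \<Sum>l\<in>UNIV. N (dx k (dx l F)))" .
  show "N F <= qn N b F" "N (dx k F) <= qn N b F" "\<not> isH b ==> N (dx k (dx l F)) <= qn N b F"
    unfolding qn_def using 1 s2 s3 m2 m3 by auto
qed

lemma nc_mem: "adm a C N ==> smc c ==> qn N b (c b) <= nc N c"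
  unfolding nc_def by (rule member_le_sum) (auto intro: qn_nonneg smcD)

lemma nc_nonneg: "adm a C N ==> smc c ==> 0 <= nc N c"
  unfolding nc_def by (intro sum_nonneg qn_nonneg smcD)

lemma nc_cmp:
  assumes N: "adm a C N" and c: "smc c"
  shows "N (c b) <= nc N c" "N (dx k (c b)) <= nc N c" "\<not> isH b ==> N (dx k (dx l (c b))) <= nc N c"
  using qn_mono[OF N smcD[OF c]] nc_mem[OF N c, of b] order_trans by blast+

lemma nc_0: assumes "adm a C N" shows "nc N 0 = 0"
proof -
  have "qn N b 0 = 0" for b unfolding qn_def D_0 adm_0[OF assms] by (cases "isH b") simp_all
  then show ?thesis unfolding nc_def cfg_zero by simp
qed

lemma qn_diff:
  assumes N: "adm a C N" and F: "smooth F" and G: "smooth G"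
  shows "qn N b (F - G) <= qn N b F + qn N b G" "qn N b (F + G) <= qn N b F + qn N b G"
proof -
  note sm = F G smooth_D[OF F] smooth_D[OF G]
  have 1: "(\<Sum>k\<in>UNIV. N (dx k (F - G))) <= (\<Sum>k\<in>UNIV. N (dx k F)) + (\<Sum>k\<in>UNIV. N (dx k G))"
    unfolding D_diff[OF F G] sum.distrib[symmetric] by (intro sum_mono adm_diff[OF N] sm)
  have 2: "(\<Sum>k\<in>UNIV. \<Sum>l\<in>UNIV. N (dx k (dx l (F - G)))) <= (\<Sum>k\<in>UNIV. \<Sum>l\<in>UNIV. N (dx k (dx l F))) + (\<Sum>k\<in>UNIV. \<Sum>l\<in>UNIV. N (dx k (dx l G)))"
    unfolding D_diff[OF F G] D_diff[OF sm(3) sm(4)] sum.distrib[symmetric] by (intro sum_mono adm_diff[OF N] smooth_D sm)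
  show "qn N b (F - G) <= qn N b F + qn N b G"
    unfolding qn_def using 1 2 adm_diff[OF N F G] by auto
  have 1: "(\<Sum>k\<in>UNIV. N (dx k (F + G))) <= (\<Sum>k\<in>UNIV. N (dx k F)) + (\<Sum>k\<in>UNIV. N (dx k G))"
    unfolding D_add[OF F G] sum.distrib[symmetric] by (intro sum_mono admD(8)[OF N] sm)
  have 2: "(\<Sum>k\<in>UNIV. \<Sum>l\<in>UNIV. N (dx k (dx l (F + G)))) <= (\<Sum>k\<in>UNIV. \<Sum>l\<in>UNIV. N (dx k (dx l F))) + (\<Sum>k\<in>UNIV. \<Sum>l\<in>UNIV. N (dx k (dx l G)))"
    unfolding D_add[OF F G] D_add[OF sm(3) sm(4)] sum.distrib[symmetric] by (intro sum_mono admD(8)[OF N] smooth_D sm)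
  show "qn N b (F + G) <= qn N b F + qn N b G"
    unfolding qn_def using 1 2 admD(8)[OF N F G] by auto
qed

lemma nc_diff: assumes "adm a C N" "smc c" "smc c'" shows "nc N (c - c') <= nc N c + nc N c'"
  unfolding nc_def sum.distrib[symmetric] cfg_minus by (intro sum_mono qn_diff[OF assms(1)] smcD assms)

lemma nc_add: assumes "adm a C N" "smc c" "smc c'" shows "nc N (c + c') <= nc N c + nc N c'"
  unfolding nc_def sum.distrib[symmetric] cfg_plus by (intro sum_mono qn_diff[OF assms(1)] smcD assms)

lemma nc_triangle: assumes "adm a C N" "smc c" "smc c'" "smc c''" shows "nc N (c - c'') <= nc N (c - c') + nc N (c' - c'')"
  using nc_add[OF assms(1) smc_diff[OF assms(2,3)] smc_diff[OF assms(3,4)]] by simp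

lemma nc_commute: assumes "adm a C N" "smc c" "smc c'" shows "nc N (c - c') <= nc N (c' - c)"
  using nc_diff[OF assms(1) smc_0 smc_diff[OF assms(3,2)]] nc_0[OF assms(1)] by simp

text \<open>The two estimates of a quadratically small map: its size, and a Lipschitz constant
  proportional to the size of the arguments. \<open>K\<close> is chosen before \<open>N\<close>, so
  one constant serves all admissible norms; everything from here to \<open>Fout_bound\<close> is
  arranged to keep this order of quantifiers.\<close>

definition B2 :: "real => real => (('n::finite fld => real) => 'n cfg => real) => (('n fld => real) => 'n cfg => 'n cfg => real) => bool" where
  "B2 a C g gd \<longleftrightarrow> (\<exists>K\<ge>0. \<forall>N c c'. adm a C N --> smc c --> smc c' --> nc N c <= 1 --> nc N c' <= 1 -->
     g N c <= K * (nc N c)\<^sup>2 \<and> gd N c c' <= K * (nc N c + nc N c') * nc N (c - c'))"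

definition L2 :: "real => real => ('n::finite cfg => 'n fld) => bool" where
  "L2 a C \<Phi> \<longleftrightarrow> (\<forall>c. smc c --> smooth (\<Phi> c)) \<and> B2 a C (%N c. N (\<Phi> c)) (%N c c'. N (\<Phi> c - \<Phi> c'))"

definition L1 :: "real => real => ('n::finite cfg => 'n fld) => bool" where
  "L1 a C \<Phi> \<longleftrightarrow> (\<forall>c. smc c --> smooth (\<Phi> c)) \<and> (\<exists>K\<ge>0. \<forall>N c c'. adm a C N --> smc c --> smc c' --> nc N c <= 1 --> nc N c' <= 1 -->
     N (\<Phi> c) <= K * nc N c \<and> N (\<Phi> c - \<Phi> c') <= K * nc N (c - c'))"

lemma L1_smooth: "L1 a C \<Phi> ==> smc c ==> smooth (\<Phi> c)" unfolding L1_def by blast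
lemma L2_smooth: "L2 a C \<Phi> ==> smc c ==> smooth (\<Phi> c)" unfolding L2_def by blast

lemma B2_add: assumes "B2 a C g gd" "B2 a C h hh" shows "B2 a C (%N c. g N c + h N c) (%N c c'. gd N c c' + hh N c c')"
proof -
  obtain K where K: "K >= 0" "\<And>N c c'. adm a C N ==> smc c ==> smc c' ==> nc N c <= 1 ==> nc N c' <= 1 ==>
     g N c <= K * (nc N c)\<^sup>2 \<and> gd N c c' <= K * (nc N c + nc N c') * nc N (c - c')" using assms(1) unfolding B2_def by blast
  obtain K' where K': "K' >= 0" "\<And>N c c'. adm a C N ==> smc c ==> smc c' ==> nc N c <= 1 ==> nc N c' <= 1 ==>
     h N c <= K' * (nc N c)\<^sup>2 \<and> hh N c c' <= K' * (nc N c + nc N c') * nc N (c - c')" using assms(2) unfolding B2_def by blast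
  have "g N c + h N c <= (K + K') * (nc N c)\<^sup>2 \<and> gd N c c' + hh N c c' <= (K + K') * (nc N c + nc N c') * nc N (c - c')"
    if "adm a C N" "smc c" "smc c'" "nc N c <= 1" "nc N c' <= 1" for N c c'
    using K(2)[OF that] K'(2)[OF that] by (simp add: distrib_right)
  then show ?thesis unfolding B2_def using K(1) K'(1) by (intro exI[of _ "K + K'"]) auto
qed

lemma B2_0: "B2 a C (%N c. 0) (%N c c'. 0)"
  unfolding B2_def by (intro exI[of _ 0]) auto

lemma B2_sum: "(\<And>i. i \<in> A ==> B2 a C (g i) (gd i)) ==> B2 a C (%N c. \<Sum>i\<in>A. g i N c) (%N c c'. \<Sum>i\<in>A. gd i N c c')"
proof (induction A rule: infinite_finite_induct)
  case (insert i A)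
  then show ?case using B2_add[of a C "g i" "gd i"] by simp
qed (simp_all add: B2_0)

lemma B2_mono:
  assumes "B2 a C g gd"
    and "\<And>N (c :: 'n::finite cfg) (c' :: 'n cfg). adm a C N ==> smc c ==> smc c' ==> h N c <= g N c"
    and "\<And>N c c'. adm a C N ==> smc c ==> smc c' ==> hh N c c' <= gd N c c'"
  shows "B2 a C h hh"
proof -
  obtain K where K: "K >= 0" "\<And>N c c'. adm a C N ==> smc c ==> smc c' ==> nc N c <= 1 ==> nc N c' <= 1 ==>
     g N c <= K * (nc N c)\<^sup>2 \<and> gd N c c' <= K * (nc N c + nc N c') * nc N (c - c')" using assms(1) unfolding B2_def by blast
  have "h N c <= K * (nc N c)\<^sup>2 \<and> hh N c c' <= K * (nc N c + nc N c') * nc N (c - c')"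
    if "adm a C N" "smc c" "smc c'" "nc N c <= 1" "nc N c' <= 1" for N c c'
    using K(2)[OF that] assms(2,3)[OF that(1-3)] by linarith
  then show ?thesis unfolding B2_def using K(1) by (intro exI[of _ K]) auto
qed

definition linop :: "real => real => real => ('n::finite fld => 'n fld) => bool" where
  "linop a C B T \<longleftrightarrow> B >= 0 \<and> (\<forall>F. smooth F --> smooth (T F)) \<and> (\<forall>F G. smooth F --> smooth G --> T (F - G) = T F - T G) \<and>
    (\<forall>N F. adm a C N --> smooth F --> N (T F) <= B * N F)"

lemma L2_lin: assumes "L2 a C \<Phi>" "linop a C B T" shows "L2 a C (%c. T (\<Phi> c))"
proof -
  obtain K where K: "K >= 0" "\<And>N c c'. adm a C N ==> smc c ==> smc c' ==> nc N c <= 1 ==> nc N c' <= 1 ==>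
     N (\<Phi> c) <= K * (nc N c)\<^sup>2 \<and> N (\<Phi> c - \<Phi> c') <= K * (nc N c + nc N c') * nc N (c - c')" using assms(1) unfolding L2_def B2_def by blast
  note sm = L2_smooth[OF assms(1)]
  have T: "B >= 0" "\<And>F. smooth F ==> smooth (T F)" "\<And>F G. smooth F ==> smooth G ==> T (F - G) = T F - T G" "\<And>N F. adm a C N ==> smooth F ==> N (T F) <= B * N F"
    using assms(2) unfolding linop_def by blast+
  have "N (T (\<Phi> c)) <= B * K * (nc N c)\<^sup>2 \<and> N (T (\<Phi> c) - T (\<Phi> c')) <= B * K * (nc N c + nc N c') * nc N (c - c')"
    if h: "adm a C N" "smc c" "smc c'" "nc N c <= 1" "nc N c' <= 1" for N c c'
  proof -
    have "N (T (\<Phi> c)) <= B * N (\<Phi> c)" by (rule T(4)[OF h(1) sm[OF h(2)]])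
    moreover have "B * N (\<Phi> c) <= B * (K * (nc N c)\<^sup>2)" using K(2)[OF h] T(1) by (intro mult_left_mono) auto
    moreover have "N (T (\<Phi> c) - T (\<Phi> c')) <= B * N (\<Phi> c - \<Phi> c')" unfolding T(3)[OF sm[OF h(2)] sm[OF h(3)], symmetric]
      by (rule T(4)[OF h(1) smooth_diff[OF sm[OF h(2)] sm[OF h(3)]]])
    moreover have "B * N (\<Phi> c - \<Phi> c') <= B * (K * (nc N c + nc N c') * nc N (c - c'))" using K(2)[OF h] T(1) by (intro mult_left_mono) auto
    ultimately show ?thesis by (simp only: mult.assoc) linarith
  qed
  moreover have "0 <= B * K" using T(1) K(1) by simp
  ultimately have "B2 a C (%N c. N (T (\<Phi> c))) (%N c c'. N (T (\<Phi> c) - T (\<Phi> c')))" unfolding B2_def by blast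
  then show ?thesis unfolding L2_def using T(2) sm by blast
qed

lemma L1_lin: assumes "L1 a C \<Phi>" "linop a C B T" shows "L1 a C (%c. T (\<Phi> c))"
proof -
  obtain K where K: "K >= 0" "\<And>N c c'. adm a C N ==> smc c ==> smc c' ==> nc N c <= 1 ==> nc N c' <= 1 ==>
     N (\<Phi> c) <= K * nc N c \<and> N (\<Phi> c - \<Phi> c') <= K * nc N (c - c')" using assms(1) unfolding L1_def by blast
  note sm = L1_smooth[OF assms(1)]
  have T: "B >= 0" "\<And>F. smooth F ==> smooth (T F)" "\<And>F G. smooth F ==> smooth G ==> T (F - G) = T F - T G" "\<And>N F. adm a C N ==> smooth F ==> N (T F) <= B * N F"
    using assms(2) unfolding linop_def by blast+
  have "N (T (\<Phi> c)) <= B * K * nc N c \<and> N (T (\<Phi> c) - T (\<Phi> c')) <= B * K * nc N (c - c')"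
    if h: "adm a C N" "smc c" "smc c'" "nc N c <= 1" "nc N c' <= 1" for N c c'
  proof -
    have "N (T (\<Phi> c)) <= B * N (\<Phi> c)" by (rule T(4)[OF h(1) sm[OF h(2)]])
    moreover have "B * N (\<Phi> c) <= B * (K * nc N c)" using K(2)[OF h] T(1) by (intro mult_left_mono) auto
    moreover have "N (T (\<Phi> c) - T (\<Phi> c')) <= B * N (\<Phi> c - \<Phi> c')" unfolding T(3)[OF sm[OF h(2)] sm[OF h(3)], symmetric]
      by (rule T(4)[OF h(1) smooth_diff[OF sm[OF h(2)] sm[OF h(3)]]])
    moreover have "B * N (\<Phi> c - \<Phi> c') <= B * (K * nc N (c - c'))" using K(2)[OF h] T(1) by (intro mult_left_mono) auto
    ultimately show ?thesis by (simp only: mult.assoc) linarith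
  qed
  moreover have "0 <= B * K" using T(1) K(1) by simp
  ultimately show ?thesis unfolding L1_def using T(2) sm by blast
qed

lemma L2_add: assumes "L2 a C (\<Phi> :: 'n::finite cfg => _)" "L2 a C \<Psi>" shows "L2 a C (%c. \<Phi> c + \<Psi> c)"
proof -
  note s1 = L2_smooth[OF assms(1)] and s2 = L2_smooth[OF assms(2)]
  have "B2 a C (%N c. N (\<Phi> c) + N (\<Psi> c)) (%N c c'. N (\<Phi> c - \<Phi> c') + N (\<Psi> c - \<Psi> c'))"
    using assms unfolding L2_def by (intro B2_add) auto
  then have "B2 a C (%N c. N (\<Phi> c + \<Psi> c)) (%N c c'. N ((\<Phi> c + \<Psi> c) - (\<Phi> c' + \<Psi> c')))"
  proof (rule B2_mono)
    fix N :: "'n fld => real" and c c' :: "'n cfg" assume h: "adm a C N" "smc c" "smc c'"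
    show "N (\<Phi> c + \<Psi> c) <= N (\<Phi> c) + N (\<Psi> c)" by (rule admD(8)[OF h(1) s1[OF h(2)] s2[OF h(2)]])
    have e: "(\<Phi> c + \<Psi> c) - (\<Phi> c' + \<Psi> c') = (\<Phi> c - \<Phi> c') + (\<Psi> c - \<Psi> c')" by (simp add: algebra_simps)
    show "N ((\<Phi> c + \<Psi> c) - (\<Phi> c' + \<Psi> c')) <= N (\<Phi> c - \<Phi> c') + N (\<Psi> c - \<Psi> c')"
      unfolding e by (rule admD(8)[OF h(1) smooth_diff[OF s1[OF h(2)] s1[OF h(3)]] smooth_diff[OF s2[OF h(2)] s2[OF h(3)]]])
  qed
  then show ?thesis unfolding L2_def using smooth_add s1 s2 by blast
qed

lemma L1_add: assumes "L1 a C \<Phi>" "L1 a C \<Psi>" shows "L1 a C (%c. \<Phi> c + \<Psi> c)"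
proof -
  note s1 = L1_smooth[OF assms(1)] and s2 = L1_smooth[OF assms(2)]
  obtain K where K: "K >= 0" "\<And>N c c'. adm a C N ==> smc c ==> smc c' ==> nc N c <= 1 ==> nc N c' <= 1 ==>
     N (\<Phi> c) <= K * nc N c \<and> N (\<Phi> c - \<Phi> c') <= K * nc N (c - c')" using assms(1) unfolding L1_def by blast
  obtain K' where K': "K' >= 0" "\<And>N c c'. adm a C N ==> smc c ==> smc c' ==> nc N c <= 1 ==> nc N c' <= 1 ==>
     N (\<Psi> c) <= K' * nc N c \<and> N (\<Psi> c - \<Psi> c') <= K' * nc N (c - c')" using assms(2) unfolding L1_def by blast
  have "N (\<Phi> c + \<Psi> c) <= (K + K') * nc N c \<and> N ((\<Phi> c + \<Psi> c) - (\<Phi> c' + \<Psi> c')) <= (K + K') * nc N (c - c')"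
    if h: "adm a C N" "smc c" "smc c'" "nc N c <= 1" "nc N c' <= 1" for N c c'
  proof -
    have 1: "N (\<Phi> c + \<Psi> c) <= N (\<Phi> c) + N (\<Psi> c)" by (rule admD(8)[OF h(1) s1[OF h(2)] s2[OF h(2)]])
    have e: "(\<Phi> c + \<Psi> c) - (\<Phi> c' + \<Psi> c') = (\<Phi> c - \<Phi> c') + (\<Psi> c - \<Psi> c')" by (simp add: algebra_simps)
    have 2: "N ((\<Phi> c + \<Psi> c) - (\<Phi> c' + \<Psi> c')) <= N (\<Phi> c - \<Phi> c') + N (\<Psi> c - \<Psi> c')"
      unfolding e by (rule admD(8)[OF h(1) smooth_diff[OF s1[OF h(2)] s1[OF h(3)]] smooth_diff[OF s2[OF h(2)] s2[OF h(3)]]])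
    show ?thesis using 1 2 K(2)[OF h] K'(2)[OF h] unfolding distrib_right by linarith
  qed
  moreover have "0 <= K + K'" using K(1) K'(1) by simp
  moreover have "\<forall>c. smc c --> smooth (\<Phi> c + \<Psi> c)" using smooth_add s1 s2 by blast
  ultimately show ?thesis unfolding L1_def by blast
qed

lemma linop_cmult: "linop a C \<bar>r\<bar> (%F. cst r * F)"
  unfolding linop_def
proof (intro conjI allI impI)
  show "cst r * (F - G) = cst r * F - cst r * G" for F G :: "'a fld" by (rule right_diff_distrib)
qed (simp, erule smooth_mult[OF smooth_cst], erule admD(2), assumption)

lemma L2_cmult: "L2 a C \<Phi> ==> L2 a C (%c. cst r * \<Phi> c)" by (rule L2_lin[OF _ linop_cmult])
lemma L1_cmult: "L1 a C \<Phi> ==> L1 a C (%c. cst r * \<Phi> c)" by (rule L1_lin[OF _ linop_cmult])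
lemma L2_uminus: "L2 a C \<Phi> ==> L2 a C (%c. - \<Phi> c)" unfolding fld_uminus by (rule L2_cmult)
lemma L1_uminus: "L1 a C \<Phi> ==> L1 a C (%c. - \<Phi> c)" unfolding fld_uminus by (rule L1_cmult)
lemma L2_diff: "L2 a C \<Phi> ==> L2 a C \<Psi> ==> L2 a C (%c. \<Phi> c - \<Psi> c)"
  using L2_add[OF _ L2_uminus, of a C \<Phi> \<Psi>] by simp
lemma L1_diff: "L1 a C \<Phi> ==> L1 a C \<Psi> ==> L1 a C (%c. \<Phi> c - \<Psi> c)"
  using L1_add[OF _ L1_uminus, of a C \<Phi> \<Psi>] by simp

lemma L2_0: "L2 a C (%c. 0)"
proof -
  have "B2 a C (%N c. N (0::'a fld)) (%N c c'. N ((0::'a fld) - 0))"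
    by (rule B2_mono[OF B2_0]) (simp_all add: adm_0)
  then show ?thesis unfolding L2_def using smooth_0 by blast
qed

lemma L2_sum: "(\<And>i. i \<in> A ==> L2 a C (\<Phi> i)) ==> L2 a C (%c. \<Sum>i\<in>A. \<Phi> i c)"
proof (induction A rule: infinite_finite_induct)
  case (insert i A)
  have "L2 a C (%c. \<Phi> i c + (\<Sum>i\<in>A. \<Phi> i c))" using insert by (intro L2_add) auto
  then show ?case by (simp only: sum.insert[OF insert.hyps])
next
  case (infinite A)
  then show ?case using L2_0[unfolded zero_fun_def] by simp
qed (simp only: sum.empty L2_0)

lemma L2_L1: assumes "L2 a C \<Phi>" shows "L1 a C \<Phi>"
proof -
  obtain K where K: "K >= 0" "\<And>N c c'. adm a C N ==> smc c ==> smc c' ==> nc N c <= 1 ==> nc N c' <= 1 ==>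
     N (\<Phi> c) <= K * (nc N c)\<^sup>2 \<and> N (\<Phi> c - \<Phi> c') <= K * (nc N c + nc N c') * nc N (c - c')" using assms(1) unfolding L2_def B2_def by blast
  have "N (\<Phi> c) <= (2 * K) * nc N c \<and> N (\<Phi> c - \<Phi> c') <= (2 * K) * nc N (c - c')"
    if h: "adm a C N" "smc c" "smc c'" "nc N c <= 1" "nc N c' <= 1" for N c c'
  proof -
    note x = nc_nonneg[OF h(1) h(2)] and d = nc_nonneg[OF h(1) smc_diff[OF h(2,3)]]
    have "K * (nc N c)\<^sup>2 <= K * nc N c" using x h(4) K(1) by (intro mult_left_mono) (auto simp: power2_eq_square mult_left_le)
    moreover have "K * nc N c <= (2 * K) * nc N c" using x K(1) by (intro mult_right_mono) auto
    moreover have "K * (nc N c + nc N c') * nc N (c - c') <= K * 2 * nc N (c - c')"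
      using h K(1) d by (intro mult_right_mono mult_left_mono) auto
    ultimately show ?thesis using K(2)[OF h] by (simp only: mult.commute[of 2 K]) linarith
  qed
  moreover have "0 <= 2 * K" using K(1) by simp
  ultimately show ?thesis using L2_smooth[OF assms] unfolding L1_def by blast
qed

lemma L1_sum: assumes "\<And>i. i \<in> A ==> L1 a C (\<Phi> i)" shows "L1 a C (%c. \<Sum>i\<in>A. \<Phi> i c)"
  using assms
proof (induction A rule: infinite_finite_induct)
  case (insert i A)
  have "L1 a C (%c. \<Phi> i c + (\<Sum>i\<in>A. \<Phi> i c))" using insert by (intro L1_add) auto
  then show ?case by (simp only: sum.insert[OF insert.hyps])
next
  case (infinite A)
  then show ?case using L2_L1[OF L2_0, unfolded zero_fun_def] by simp
qed (simp only: sum.empty L2_L1[OF L2_0])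

text \<open>Products of maps that are Lipschitz and vanish at 0 are quadratically small; all
  nonlinear terms get their smallness from here.\<close>

lemma L2_mult: assumes "L1 a C \<Phi>" "L1 a C \<Psi>" shows "L2 a C (%c. \<Phi> c * \<Psi> c)"
proof -
  note s1 = L1_smooth[OF assms(1)] and s2 = L1_smooth[OF assms(2)]
  obtain K where K: "K >= 0" "\<And>N c c'. adm a C N ==> smc c ==> smc c' ==> nc N c <= 1 ==> nc N c' <= 1 ==>
     N (\<Phi> c) <= K * nc N c \<and> N (\<Phi> c - \<Phi> c') <= K * nc N (c - c')" using assms(1) unfolding L1_def by blast
  obtain K' where K': "K' >= 0" "\<And>N c c'. adm a C N ==> smc c ==> smc c' ==> nc N c <= 1 ==> nc N c' <= 1 ==>
     N (\<Psi> c) <= K' * nc N c \<and> N (\<Psi> c - \<Psi> c') <= K' * nc N (c - c')" using assms(2) unfolding L1_def by blast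
  have "N (\<Phi> c * \<Psi> c) <= (K * K') * (nc N c)\<^sup>2 \<and> N ((\<Phi> c * \<Psi> c) - (\<Phi> c' * \<Psi> c')) <= (K * K') * (nc N c + nc N c') * nc N (c - c')"
    if h: "adm a C N" "smc c" "smc c'" "nc N c <= 1" "nc N c' <= 1" for N c c'
  proof -
    note x = nc_nonneg[OF h(1) h(2)] and y = nc_nonneg[OF h(1) h(3)] and d = nc_nonneg[OF h(1) smc_diff[OF h(2,3)]]
    note A = s1[OF h(2)] s1[OF h(3)] s2[OF h(2)] s2[OF h(3)]
    note nn = admD(1)[OF h(1) A(1)] admD(1)[OF h(1) A(2)] admD(1)[OF h(1) A(3)] admD(1)[OF h(1) A(4)]
      admD(1)[OF h(1) smooth_diff[OF A(1,2)]] admD(1)[OF h(1) smooth_diff[OF A(3,4)]]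
    note B = K(2)[OF h] K'(2)[OF h] K(2)[OF h(1,3,2,5,4)]
    have "N (\<Phi> c * \<Psi> c) <= N (\<Phi> c) * N (\<Psi> c)" by (rule admD(9)[OF h(1) A(1,3)])
    also have "\<dots> <= (K * nc N c) * (K' * nc N c)" using B nn x K(1) by (intro mult_mono) auto
    finally have 1: "N (\<Phi> c * \<Psi> c) <= (K * K') * (nc N c)\<^sup>2" by (simp add: power2_eq_square mult_ac)
    have e: "(\<Phi> c * \<Psi> c) - (\<Phi> c' * \<Psi> c') = (\<Phi> c - \<Phi> c') * \<Psi> c + \<Phi> c' * (\<Psi> c - \<Psi> c')" by (simp add: algebra_simps)
    have "N ((\<Phi> c * \<Psi> c) - (\<Phi> c' * \<Psi> c')) <= N ((\<Phi> c - \<Phi> c') * \<Psi> c) + N (\<Phi> c' * (\<Psi> c - \<Psi> c'))"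
      unfolding e by (rule admD(8)[OF h(1)]) (intro smooth_mult smooth_diff A)+
    also have "\<dots> <= N (\<Phi> c - \<Phi> c') * N (\<Psi> c) + N (\<Phi> c') * N (\<Psi> c - \<Psi> c')"
      by (intro add_mono admD(9)[OF h(1)] smooth_diff A)
    also have "\<dots> <= (K * nc N (c - c')) * (K' * nc N c) + (K * nc N c') * (K' * nc N (c - c'))"
      using B nn x y d K(1) K'(1) by (intro add_mono mult_mono) auto
    finally have 2: "N ((\<Phi> c * \<Psi> c) - (\<Phi> c' * \<Psi> c')) <= (K * K') * (nc N c + nc N c') * nc N (c - c')" by (simp add: algebra_simps)
    show ?thesis using 1 2 by blast
  qed
  moreover have "0 <= K * K'" using K(1) K'(1) by simp
  ultimately have "B2 a C (%N c. N (\<Phi> c * \<Psi> c)) (%N c c'. N (\<Phi> c * \<Psi> c - \<Phi> c' * \<Psi> c'))" unfolding B2_def by blast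
  then show ?thesis unfolding L2_def using smooth_mult s1 s2 by blast
qed

lemma L1_mult: "L1 a C \<Phi> ==> L1 a C \<Psi> ==> L1 a C (%c. \<Phi> c * \<Psi> c)" by (rule L2_L1[OF L2_mult])

lemma L1_cmp: "L1 a C (%c. c b)" "L1 a C (%c. dx k (c b))" "\<not> isH b ==> L1 a C (%c. dx k (dx l (c b)))"
proof -
  have *: "L1 a C (%c. T (c b))"
    if T: "\<And>F. smooth F ==> smooth (T F)" "\<And>F G. smooth F ==> smooth G ==> T (F - G) = T F - T G"
      "\<And>N c. adm a C N ==> smc c ==> N (T (c b)) <= nc N c" for T
  proof -
    have "N (T (c b)) <= 1 * nc N c \<and> N (T (c b) - T (c' b)) <= 1 * nc N (c - c')" if h: "adm a C N" "smc c" "smc c'" for N c c'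
      using T(3)[OF h(1,2)] T(3)[OF h(1) smc_diff[OF h(2,3)]] T(2)[OF smcD[OF h(2)] smcD[OF h(3)]] by (simp only: cfg_minus mult_1 simp_thms)
    moreover have "\<forall>c. smc c --> smooth (T (c b))" using T(1) smcD by blast
    ultimately show ?thesis unfolding L1_def by (meson zero_le_one)
  qed
  show "L1 a C (%c. c b)" by (rule *[of "%F. F"]) (auto intro: nc_cmp)
  show "L1 a C (%c. dx k (c b))" by (rule *) (rule smooth_D D_diff nc_cmp(2), assumption+)+
  show "L1 a C (%c. dx k (dx l (c b)))" if "\<not> isH b"
  proof (rule *)
    show "dx k (dx l (F - G)) = dx k (dx l F) - dx k (dx l G)" if "smooth F" "smooth G" for F G :: "'a fld"
      unfolding D_diff[OF that] by (rule D_diff[OF smooth_D[OF that(1)] smooth_D[OF that(2)]])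
  qed (use that in \<open>auto intro: nc_cmp smooth_D\<close>)
qed

section \<open>The geodesic equation on configurations\<close>

definition gg :: "'n::finite cfg => 'n => 'n => 'n fld" where "gg c k i = c (IH k i) - dx i (c (IF k))"
text \<open>The derivative of \<open>gg\<close>, written out in components of the configuration so
  that \<open>L1_cmp\<close> applies to it.\<close>

definition dgg :: "'n::finite cfg => 'n => 'n => 'n => 'n fld" where "dgg c l k i = dx l (c (IH k i)) - dx l (dx i (c (IF k)))"
definition G1 :: "'n::finite cfg => 'n => 'n fld => 'n fld" where "G1 c i X = dx i X + (\<Sum>k\<in>UNIV. gg c k i * dx k X)"
definition dG1r :: "'n::finite cfg => 'n => 'n => 'n fld => 'n fld" where
  "dG1r c k j X = (\<Sum>l\<in>UNIV. dgg c k l j * dx l X + gg c l j * dx k (dx l X))"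
text \<open>What \<open>G2\<close> adds to the flat second derivative. Every term contains
  \<open>gg\<close> or a derivative of it and is therefore quadratically small.\<close>

definition G2r :: "'n::finite cfg => 'n => 'n => 'n fld => 'n fld" where
  "G2r c i j X = dG1r c i j X + (\<Sum>k\<in>UNIV. gg c k i * (dx k (dx j X) + dG1r c k j X))"
definition G2 :: "'n::finite cfg => 'n => 'n => 'n fld => 'n fld" where "G2 c i j X = dx i (dx j X) + G2r c i j X"

lemma smooth_gg: "smc c ==> smooth (gg c k i)" unfolding gg_def by (intro smooth_intros smcD)
lemma dx_gg: "smc c ==> dx l (gg c k i) = dgg c l k i" unfolding gg_def dgg_def by (intro D_diff smooth_D smcD)
lemma smooth_G1: "smc c ==> smooth X ==> smooth (G1 c i X)" unfolding G1_def by (intro smooth_intros smooth_gg)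
lemma dx_G1: assumes c: "smc c" and X: "smooth X" shows "dx k (G1 c j X) = dx k (dx j X) + dG1r c k j X"
proof -
  have m: "smooth (gg c l j * dx l X)" for l by (intro smooth_mult smooth_gg c smooth_D X)
  have "dx k (G1 c j X) = dx k (dx j X) + (\<Sum>l\<in>UNIV. dx k (gg c l j * dx l X))"
    unfolding G1_def D_add[OF smooth_D[OF X] smooth_sum[OF m]] D_sum[OF m] ..
  also have "(\<Sum>l\<in>UNIV. dx k (gg c l j * dx l X)) = dG1r c k j X"
    unfolding dG1r_def D_mult[OF smooth_gg[OF c] smooth_D[OF X]] dx_gg[OF c] ..
  finally show ?thesis .
qed

lemma G2_eq: assumes c: "smc c" and X: "smooth X" shows "G2 c i j X = G1 c i (G1 c j X)"
  unfolding G1_def[of c i] dx_G1[OF c X] G2_def G2r_def by (simp only: add.assoc)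

lemma L1_gg: "L1 a C (%c. gg c k i)" unfolding gg_def by (intro L1_diff L1_cmp)
lemma L1_dgg: "L1 a C (%c. dgg c l k i)" unfolding dgg_def by (intro L1_diff L1_cmp) simp
lemma L1_G1: "L1 a C (%c. G1 c i (c b))" unfolding G1_def by (intro L1_add L1_sum L1_mult L1_gg L1_cmp)
lemma L2_dG1r: "\<not> isH b ==> L2 a C (%c. dG1r c i j (c b))" unfolding dG1r_def by (intro L2_add L2_sum L2_mult L1_gg L1_dgg L1_cmp)
lemma L2_G2r: "\<not> isH b ==> L2 a C (%c. G2r c i j (c b))"
  unfolding G2r_def by (intro L2_add L2_sum L2_mult L1_add L1_gg L1_cmp L2_dG1r L2_L1[OF L2_dG1r])
lemma L1_G2: "\<not> isH b ==> L1 a C (%c. G2 c i j (c b))"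
  unfolding G2_def by (intro L1_add L1_cmp L2_L1[OF L2_G2r])

text \<open>\<open>B_alpha\<close> in the moving frame, in the form of \<open>vf_Bop\<close>. The
  first summand is what the cancellation of third derivatives leaves of
  \<open>A[(grad u) u] - (grad A u) u\<close>; the other two come from the divergence and from the
  transposed gradient.\<close>

definition bq :: "real => 'n::finite cfg => 'n => 'n fld" where
  "bq a c j = cst (- a) * (\<Sum>i\<in>UNIV. \<Sum>k\<in>UNIV. G2 c i i (c (IV k)) * G1 c k (c (IV j)) + cst 2 * (G1 c i (c (IV k)) * G2 c i k (c (IV j))))
    - (\<Sum>k\<in>UNIV. G1 c k (c (IV k)) * (c (IV j) - cst a * (\<Sum>i\<in>UNIV. G2 c i i (c (IV j)))))
    - (\<Sum>k\<in>UNIV. G1 c j (c (IV k)) * (c (IV k) - cst a * (\<Sum>i\<in>UNIV. G2 c i i (c (IV k)))))"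

text \<open>In the moving frame \<open>A\<close> becomes
  \<open>w - a * (\<Sum>i. G2 c i i w)\<close>. Its flat part stays on the left, to be inverted by
  \<open>SS a\<close>; the remainder \<open>G2r\<close> joins \<open>bq\<close>.\<close>

definition rhs :: "real => 'n::finite cfg => 'n => 'n fld" where
  "rhs a c j = cst a * (\<Sum>i\<in>UNIV. G2r c i i (c (IW j))) + bq a c j"

lemma L2_rhs: "L2 a C (%c. rhs a' c j)"
  unfolding rhs_def bq_def
  by (intro L2_add L2_diff L2_cmult L2_sum L2_G2r L2_mult L1_diff L1_cmult L1_sum L1_G1 L1_G2 L1_cmp) simp_all

lemma smooth_rhs: "smc c ==> smooth (rhs a c j)" using L2_smooth[OF L2_rhs] .

text \<open>The equations for \<open>w\<close> and \<open>h\<close>. The entries of \<open>f\<close>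
  and \<open>v\<close> are 0 because these arise from \<open>w\<close> by integration in time, which
  is left to an operator that differs between the initial value problem and the one with prescribed
  final position.\<close>

fun Fout :: "real => 'n::finite cfg => 'n cfg" where
  "Fout a c (IF j) = 0"
| "Fout a c (IV j) = 0"
| "Fout a c (IW j) = SS a (rhs a c j)"
| "Fout a c (IH j i) = - (\<Sum>k\<in>UNIV. dx k (c (IF j)) * gg c k i)"

lemma SS_diff: "a > 0 ==> smooth F ==> smooth G ==> SS a (F - G) = SS a F - SS a G"
  by (intro fop_diff fop_SS smooth_AC)

lemma linop_SS:
  assumes a: "a > 0" and C: "C >= 0"
  shows "linop a C C (SS a :: 'a::finite fld => 'a fld)" "linop a C C (%F. dx (i::'a) (SS a F))" "linop a C C (%F. dx (i::'a) (dx j (SS a F)))"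
proof -
  note sm = smooth_SS[OF a]
  have d1: "dx i (SS a F) = SS a (dx i F)" if "smooth F" for i and F :: "'a fld" by (rule fop_D[OF fop_SS[OF a] that])
  show "linop a C C (SS a)" unfolding linop_def using C sm SS_diff[OF a] admD(5) by blast
  show "linop a C C (%F. dx i (SS a F))" unfolding linop_def
  proof (intro conjI allI impI)
    show "dx i (SS a (F - G)) = dx i (SS a F) - dx i (SS a G)" if "smooth F" "smooth G" for F G
      unfolding SS_diff[OF a that] by (rule D_diff[OF sm[OF that(1)] sm[OF that(2)]])
    show "N (dx i (SS a F)) <= C * N F" if "adm a C N" "smooth F" for N F
      unfolding d1[OF that(2)] by (rule admD(6)[OF that])
  qed (use C smooth_D sm in blast)+
  show "linop a C C (%F. dx i (dx j (SS a F)))" unfolding linop_def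
  proof (intro conjI allI impI)
    show "dx i (dx j (SS a (F - G))) = dx i (dx j (SS a F)) - dx i (dx j (SS a G))" if "smooth F" "smooth G" for F G
      unfolding SS_diff[OF a that] D_diff[OF sm[OF that(1)] sm[OF that(2)]]
      by (rule D_diff[OF smooth_D[OF sm[OF that(1)]] smooth_D[OF sm[OF that(2)]]])
    show "N (dx i (dx j (SS a F))) <= C * N F" if "adm a C N" "smooth F" for N F
      unfolding d1[OF that(2)] d1[OF smooth_D[OF that(2)]] by (rule admD(7)[OF that])
  qed (use C smooth_D sm in blast)+
qed

lemma L2_Fout:
  assumes a: "a > 0" and C: "C >= 0"
  shows "L2 a C (%c. Fout a c b)" "L2 a C (%c. dx k (Fout a c b))" "\<not> isH b ==> L2 a C (%c. dx k (dx l (Fout a c b)))"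
proof -
  note S = L2_lin[OF L2_rhs linop_SS(1)[OF a C]] L2_lin[OF L2_rhs linop_SS(2)[OF a C]] L2_lin[OF L2_rhs linop_SS(3)[OF a C]]
  have H: "L2 a C (%c. - (\<Sum>k\<in>UNIV. dx k (c (IF j)) * gg c k i))" for i j
    by (intro L2_uminus L2_sum L2_mult L1_cmp L1_gg)
  show "L2 a C (%c. Fout a c b)" using S(1) H L2_0 by (cases b) (simp_all only: Fout.simps)
  \<comment> \<open>One derivative of the equation for \<open>h\<close> needs two derivatives of
    \<open>f\<close> and one of \<open>h\<close>, exactly what \<open>qn\<close> controls.\<close>
  have H': "L2 a C (%c. dx k (- (\<Sum>l\<in>UNIV. dx l (c (IF j)) * gg c l i)))" for i j
  proof -
    have e: "dx k (- (\<Sum>l\<in>UNIV. dx l (c (IF j)) * gg c l i)) = - (\<Sum>l\<in>UNIV. dx k (dx l (c (IF j))) * gg c l i + dx l (c (IF j)) * dgg c k l i)" if c: "smc c" for c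
    proof -
      have m: "smooth (dx l (c (IF j)) * gg c l i)" for l by (intro smooth_mult smooth_gg c smooth_D smcD)
      show ?thesis
        unfolding D_uminus[OF smooth_sum[OF m]] D_sum[OF m] D_mult[OF smooth_D[OF smcD[OF c]] smooth_gg[OF c]] dx_gg[OF c] ..
    qed
    have "L2 a C (%c. - (\<Sum>l\<in>UNIV. dx k (dx l (c (IF j))) * gg c l i + dx l (c (IF j)) * dgg c k l i))"
      by (intro L2_uminus L2_sum L2_add L2_mult L1_cmp L1_gg L1_dgg) simp
    then show ?thesis unfolding L2_def B2_def using e by (simp only: simp_thms cong: imp_cong conj_cong)
  qed
  show "L2 a C (%c. dx k (Fout a c b))" using S(2) H' L2_0 by (cases b) (simp_all only: Fout.simps D_0)
  show "\<not> isH b ==> L2 a C (%c. dx k (dx l (Fout a c b)))" using S(3) L2_0 by (cases b) (simp_all only: Fout.simps D_0 isH.simps simp_thms)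
qed

lemma smc_Fout: "a > 0 ==> smc c ==> smc (Fout a c)"
  unfolding smc_def[of "Fout a c"] using L2_smooth[OF L2_Fout(1)[of a 0]] by auto

lemma Fout_bound:
  assumes a: "a > 0" and C: "C >= 0"
  shows "\<exists>K\<ge>0. \<forall>N (c :: 'n::finite cfg) c'. adm a C N --> smc c --> smc c' --> nc N c <= 1 --> nc N c' <= 1 -->
     nc N (Fout a c) <= K * (nc N c)\<^sup>2 \<and> nc N (Fout a c - Fout a c') <= K * (nc N c + nc N c') * nc N (c - c')"
proof -
  let ?F = "Fout a :: 'n cfg => 'n cfg"
  let ?g = "%N c b. N (?F c b) + (\<Sum>k\<in>UNIV. N (dx k (?F c b))) + (if isH b then 0 else (\<Sum>k\<in>UNIV. \<Sum>l\<in>UNIV. N (dx k (dx l (?F c b)))))"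
  let ?d = "%N c c' b. N (?F c b - ?F c' b) + (\<Sum>k\<in>UNIV. N (dx k (?F c b) - dx k (?F c' b))) + (if isH b then 0 else (\<Sum>k\<in>UNIV. \<Sum>l\<in>UNIV. N (dx k (dx l (?F c b)) - dx k (dx l (?F c' b)))))"
  have *: "B2 a C (%N c. ?g N c b) (%N c c'. ?d N c c' b)" for b
  proof (cases "isH b")
    case True
    show ?thesis unfolding if_P[OF True]
      by (intro B2_add B2_sum B2_0) (rule L2_Fout(1,2)[OF a C, unfolded L2_def, THEN conjunct2])+
  next
    case False
    show ?thesis unfolding if_not_P[OF False]
      by (intro B2_add B2_sum) (rule L2_Fout(1,2)[OF a C, unfolded L2_def, THEN conjunct2] L2_Fout(3)[OF a C False, unfolded L2_def, THEN conjunct2])+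
  qed
  have "B2 a C (%N c. \<Sum>b\<in>UNIV. ?g N c b) (%N c c'. \<Sum>b\<in>UNIV. ?d N c c' b)" by (rule B2_sum) (rule *)
  then have "B2 a C (%N c. nc N (?F c)) (%N c c'. nc N (?F c - ?F c'))"
  proof (rule B2_mono)
    fix N :: "'n fld => real" and c c' :: "'n cfg" assume h: "adm a C N" "smc c" "smc c'"
    show "nc N (?F c) <= (\<Sum>b\<in>UNIV. ?g N c b)" unfolding nc_def qn_def by simp
    note s = smcD[OF smc_Fout[OF a h(2)]] smcD[OF smc_Fout[OF a h(3)]]
    show "nc N (?F c - ?F c') <= (\<Sum>b\<in>UNIV. ?d N c c' b)"
      unfolding nc_def qn_def cfg_minus D_diff[OF s] D_diff[OF smooth_D[OF s(1)] smooth_D[OF s(2)]] by simp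
  qed
  then show ?thesis unfolding B2_def by blast
qed

section \<open>The fixed point theorem\<close>

definition lop :: "real => real => real => ('n::finite cfg => 'n cfg) => bool" where
  "lop a C M A \<longleftrightarrow> M >= 0 \<and> (\<forall>z. smc z --> smc (A z)) \<and> (\<forall>z z'. smc z --> smc z' --> A (z - z') = A z - A z') \<and>
    (\<forall>N z. adm a C N --> smc z --> nc N (A z) <= M * nc N z)"

lemma lopD:
  assumes "lop a C M A"
  shows "M >= 0" "smc z ==> smc (A z)" "smc z ==> smc z' ==> A (z - z') = A z - A z'"
    "adm a C N ==> smc z ==> nc N (A z) <= M * nc N z"
  using assms unfolding lop_def by blast+

lemma nc_NN_small:
  assumes "smc c" shows "\<exists>P\<ge>0. \<forall>l. 0 <= l --> l <= 1 --> nc (NN k l) c <= nc N0 c + l * P"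
proof -
  note s0 = smcD[OF assms] note s1 = smooth_D[OF s0] note s2 = smooth_D[OF s1]
  have "\<exists>P\<ge>0. \<forall>l. 0 <= l --> l <= 1 --> NN k l (c b) <= N0 (c b) + l * P" for b by (rule NN_small[OF s0])
  then obtain P0 where P0: "\<And>b. P0 b >= 0" "\<And>b l. 0 <= l ==> l <= 1 ==> NN k l (c b) <= N0 (c b) + l * P0 b" by metis
  define P1 where "P1 b i = (SOME P. P >= 0 \<and> (\<forall>l. 0 <= l --> l <= 1 --> NN k l (dx i (c b)) <= N0 (dx i (c b)) + l * P))" for b i
  have P1: "P1 b i >= 0" "0 <= l ==> l <= 1 ==> NN k l (dx i (c b)) <= N0 (dx i (c b)) + l * P1 b i" for b i l
    using someI_ex[OF NN_small[OF s1, of k "Some i" b]] unfolding P1_def by blast+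
  define P2 where "P2 b i j = (SOME P. P >= 0 \<and> (\<forall>l. 0 <= l --> l <= 1 --> NN k l (dx i (dx j (c b))) <= N0 (dx i (dx j (c b))) + l * P))" for b i j
  have P2: "P2 b i j >= 0" "0 <= l ==> l <= 1 ==> NN k l (dx i (dx j (c b))) <= N0 (dx i (dx j (c b))) + l * P2 b i j" for b i j l
    using someI_ex[OF NN_small[OF s2, of k "Some i" "Some j" b]] unfolding P2_def by blast+
  define Q where "Q b = P0 b + (\<Sum>i\<in>UNIV. P1 b i) + (if isH b then 0 else \<Sum>i\<in>UNIV. \<Sum>j\<in>UNIV. P2 b i j)" for b
  have "(\<Sum>b\<in>UNIV. Q b) >= 0" unfolding Q_def by (auto intro!: sum_nonneg add_nonneg_nonneg P0 P1 P2)
  moreover have "nc (NN k l) c <= nc N0 c + l * (\<Sum>b\<in>UNIV. Q b)" if l: "0 <= l" "l <= 1" for l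
  proof -
    have "qn (NN k l) b (c b) <= qn N0 b (c b) + l * Q b" for b
    proof -
      have 1: "(\<Sum>i\<in>UNIV. NN k l (dx i (c b))) <= (\<Sum>i\<in>UNIV. N0 (dx i (c b))) + l * (\<Sum>i\<in>UNIV. P1 b i)"
        unfolding sum_distrib_left sum.distrib[symmetric] by (intro sum_mono P1 l)
      have 2: "(\<Sum>i\<in>UNIV. \<Sum>j\<in>UNIV. NN k l (dx i (dx j (c b)))) <= (\<Sum>i\<in>UNIV. \<Sum>j\<in>UNIV. N0 (dx i (dx j (c b)))) + l * (\<Sum>i\<in>UNIV. \<Sum>j\<in>UNIV. P2 b i j)"
        unfolding sum_distrib_left sum.distrib[symmetric] by (intro sum_mono P2 l)
      show ?thesis unfolding qn_def Q_def using 1 2 P0(2)[OF l, of b] by (auto simp: distrib_left)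
    qed
    then have "nc (NN k l) c <= (\<Sum>b\<in>UNIV. qn N0 b (c b) + l * Q b)" unfolding nc_def by (intro sum_mono)
    then show ?thesis by (simp add: nc_def sum.distrib sum_distrib_left)
  qed
  ultimately show ?thesis by blast
qed

lemma nc_NN_exists:
  assumes "smc c" "nc N0 c < r" shows "\<exists>l. 0 < l \<and> l <= 1 \<and> nc (NN k l) c < r"
proof -
  obtain P where P: "P >= 0" "\<And>l. 0 <= l ==> l <= 1 ==> nc (NN k l) c <= nc N0 c + l * P" using nc_NN_small[OF assms(1)] by blast
  define l where "l = min 1 ((r - nc N0 c) / (2 * (P + 1)))"
  have l: "0 < l" "l <= 1" unfolding l_def using assms(2) P(1) by auto
  have "l * P <= (r - nc N0 c) / (2 * (P + 1)) * P" unfolding l_def using P(1) by (intro mult_right_mono) auto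
  also have "\<dots> < r - nc N0 c"
  proof -
    have "(r - nc N0 c) * P < (r - nc N0 c) * (2 * (P + 1))" using assms(2) P(1) by (intro mult_strict_left_mono) auto
    then show ?thesis using P(1) by (simp add: pos_divide_less_eq)
  qed
  finally show ?thesis using P(2)[of l] l by (intro exI[of _ l]) auto
qed

lemma N0_eq_0: assumes "smooth F" "N0 F <= 0" shows "F = 0"
proof -
  have "\<bar>F \<tau> x\<bar> <= 0" for \<tau> x using N0_sn[OF assms(1), of \<tau> x] assms(2) by linarith
  then show ?thesis by (intro ext) simp
qed

text \<open>The radius \<open>r0\<close> precedes the norm \<open>N\<close>, the order
  \<open>k\<close>, the operator \<open>A\<close> and the data. The first conclusion gives
  uniqueness and Lipschitz dependence in any admissible norm in which both solutions are small; the
  second gives a smooth solution that inherits smallness in every norm \<open>NN k l\<close> in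
  which the data are small.\<close>

theorem fixed_point:
  fixes A :: "'n::finite cfg => 'n cfg"
  assumes a: "a > 0" and C: "C >= 0" and N0: "adm a C (N0 :: 'n fld => real)"
  shows "\<exists>r0>0. \<forall>r. 0 < r --> r <= r0 --> (\<forall>A. lop a C M A -->
    (\<forall>N p p' c c' :: 'n cfg. adm a C N --> smc p --> smc p' --> smc c --> smc c' -->
       nc N c <= 2 * r --> nc N c' <= 2 * r --> c = p + A (Fout a c) --> c' = p' + A (Fout a c') --> nc N (c - c') <= 2 * nc N (p - p')) \<and>
    (\<forall>p :: 'n cfg. smc p --> nc N0 p < r --> (\<exists>c. smc c \<and> c = p + A (Fout a c) \<and>
       (\<forall>k l. 0 <= l --> nc (NN k l) p <= r --> nc (NN k l) c <= 2 * r))))"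
proof -
  obtain K where K: "K >= 0" "\<And>N (c :: 'n cfg) c'. adm a C N ==> smc c ==> smc c' ==> nc N c <= 1 ==> nc N c' <= 1 ==>
     nc N (Fout a c) <= K * (nc N c)\<^sup>2 \<and> nc N (Fout a c - Fout a c') <= K * (nc N c + nc N c') * nc N (c - c')"
    using Fout_bound[OF a C] by blast
  \<comment> \<open>\<open>2 * r \<le> 1\<close> keeps the iterates in the unit ball where the
    estimates of \<open>Fout\<close> hold, and \<open>8 * M * K * r \<le> 1\<close> makes the
    Lipschitz constant \<open>4 * M * K * r\<close> on the ball of radius \<open>2 * r\<close> at
    most one half. The absolute value is taken because the sign of \<open>M\<close> is known only
    once an operator \<open>A\<close> is given.\<close>
  define M' where "M' = \<bar>M\<bar>"
  define r0 where "r0 = 1 / (8 * M' * K + 2)"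
  have den: "8 * M' * K + 2 > 0" using K(1) unfolding M'_def by (intro add_nonneg_pos mult_nonneg_nonneg) auto
  have r0: "r0 > 0" unfolding r0_def using den by simp
  show ?thesis
  proof (intro exI[of _ r0] conjI allI impI r0)
    fix r :: real and A :: "'n cfg => 'n cfg" assume r: "0 < r" "r <= r0" and A: "lop a C M A"
    have M: "M' = M" "M >= 0" using lopD(1)[OF A] unfolding M'_def by auto
    have rr: "r * (8 * M * K + 2) <= 1" using r(2) den unfolding r0_def M by (simp add: pos_le_divide_eq)
    have r1: "2 * r <= 1" "8 * M * K * r <= 1"
    proof -
      have "0 <= 8 * M * K * r" using M K(1) r by simp
      then show "2 * r <= 1" "8 * M * K * r <= 1" using rr r(1) by (auto simp: algebra_simps)
    qed
    have contr: "nc N (A (Fout a c) - A (Fout a c')) <= (1/2) * nc N (c - c')"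
      if N: "adm a C N" and s: "smc c" "smc c'" and b: "nc N c <= 2 * r" "nc N c' <= 2 * r" for N c c'
    proof -
      note sF = smc_Fout[OF a s(1)] smc_Fout[OF a s(2)]
      have d: "0 <= nc N (c - c')" by (rule nc_nonneg[OF N smc_diff[OF s]])
      have "nc N (A (Fout a c) - A (Fout a c')) <= M * nc N (Fout a c - Fout a c')"
        unfolding lopD(3)[OF A sF, symmetric] by (rule lopD(4)[OF A N smc_diff[OF sF]])
      also have "\<dots> <= M * (K * (nc N c + nc N c') * nc N (c - c'))"
        using K(2)[OF N s] b r1 M by (intro mult_left_mono) auto
      also have "\<dots> <= M * (K * (2 * r + 2 * r) * nc N (c - c'))"
        using b K(1) M d by (intro mult_left_mono mult_right_mono) auto
      also have "\<dots> = (1/2) * (8 * M * K * r) * nc N (c - c')" by simp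
      also have "\<dots> <= (1/2) * 1 * nc N (c - c')" using r1 d by (intro mult_right_mono mult_left_mono) auto
      finally show ?thesis by simp
    qed
    have self: "nc N (p + A (Fout a c)) <= 2 * r"
      if N: "adm a C N" and s: "smc c" "smc p" and b: "nc N c <= 2 * r" "nc N p <= r" for N c p
    proof -
      note sF = smc_Fout[OF a s(1)]
      have x: "0 <= nc N c" by (rule nc_nonneg[OF N s(1)])
      have "nc N (p + A (Fout a c)) <= nc N p + nc N (A (Fout a c))" by (rule nc_add[OF N s(2) lopD(2)[OF A sF]])
      moreover have "nc N (A (Fout a c)) <= M * nc N (Fout a c)" by (rule lopD(4)[OF A N sF])
      moreover have "M * nc N (Fout a c) <= M * (K * (nc N c)\<^sup>2)"
        using K(2)[OF N s(1) s(1)] b r1 M by (intro mult_left_mono) auto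
      moreover have "M * (K * (nc N c)\<^sup>2) <= M * (K * (2 * r)\<^sup>2)" using b K(1) M x by (intro mult_left_mono power_mono) auto
      moreover have "M * (K * (2 * r)\<^sup>2) = (1/2) * (8 * M * K * r) * r" by (simp add: power2_eq_square)
      moreover have "(1/2) * (8 * M * K * r) * r <= (1/2) * 1 * r" using r1 r by (intro mult_right_mono mult_left_mono) auto
      ultimately show ?thesis using b r by linarith
    qed
    show "nc N (c - c') <= 2 * nc N (p - p')"
      if N: "adm a C N" and s: "smc p" "smc p'" "smc c" "smc c'" and b: "nc N c <= 2 * r" "nc N c' <= 2 * r"
        and e: "c = p + A (Fout a c)" "c' = p' + A (Fout a c')" for N p p' c c'
    proof -
      have "c - c' = (p + A (Fout a c)) - (p' + A (Fout a c'))" using e by simp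
      also have "\<dots> = (p - p') + (A (Fout a c) - A (Fout a c'))" by (simp add: algebra_simps)
      finally have "nc N (c - c') <= nc N (p - p') + nc N (A (Fout a c) - A (Fout a c'))"
        using nc_add[OF N smc_diff[OF s(1,2)] smc_diff[OF lopD(2)[OF A smc_Fout[OF a s(3)]] lopD(2)[OF A smc_Fout[OF a s(4)]]]] by simp
      then show ?thesis using contr[OF N s(3,4) b] by linarith
    qed
    fix p :: "'n cfg" assume p: "smc p" "nc N0 p < r"
    define T where "T c = p + A (Fout a c)" for c
    define cs where "cs n = (T ^^ n) 0" for n
    have cs_Suc: "cs (Suc n) = p + A (Fout a (cs n))" for n by (simp add: cs_def T_def)
    have cs0: "cs 0 = 0" by (simp add: cs_def)
    have sc: "smc (cs n)" for n
    proof (induction n)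
      case 0 show ?case unfolding cs0 by (rule smc_0)
    next
      case (Suc n) show ?case unfolding cs_Suc by (intro smc_add p lopD(2)[OF A] smc_Fout[OF a] Suc)
    qed
    have bd: "nc N (cs n) <= 2 * r" if N: "adm a C N" and pN: "nc N p <= r" for N n
    proof (induction n)
      case 0 show ?case unfolding cs0 nc_0[OF N] using r by simp
    next
      case (Suc n) show ?case unfolding cs_Suc by (rule self[OF N sc p(1) Suc pN])
    qed
    have step: "nc N (cs (Suc n) - cs n) <= 2 * r * (1/2)^n" if N: "adm a C N" and pN: "nc N p <= r" for N n
    proof (induction n)
      case 0 show ?case using bd[OF N pN, of "Suc 0"] unfolding cs0 by simp
    next
      case (Suc n)
      have "cs (Suc (Suc n)) - cs (Suc n) = A (Fout a (cs (Suc n))) - A (Fout a (cs n))"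
        unfolding cs_Suc[of "Suc n"] cs_Suc[of n] by simp
      then have "nc N (cs (Suc (Suc n)) - cs (Suc n)) <= (1/2) * nc N (cs (Suc n) - cs n)"
        using contr[OF N sc sc bd[OF N pN] bd[OF N pN]] by simp
      moreover have "2 * r * (1/2)^(Suc n) = (1/2) * (2 * r * (1/2)^n)" by simp
      ultimately show ?case using Suc by linarith
    qed
    have tail: "nc N (cs (n + k) - cs n) <= 4 * r * (1/2)^n" if N: "adm a C N" and pN: "nc N p <= r" for N n k
    proof (induction k arbitrary: n)
      case 0 show ?case unfolding add_0_right diff_self nc_0[OF N] using r by simp
    next
      case (Suc k)
      have "nc N (cs (n + Suc k) - cs n) <= nc N (cs (Suc n + k) - cs (Suc n)) + nc N (cs (Suc n) - cs n)"
        using nc_triangle[OF N sc[of "n + Suc k"] sc[of "Suc n"] sc[of n]] by simp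
      also have "\<dots> <= 4 * r * (1/2)^(Suc n) + 2 * r * (1/2)^n" by (intro add_mono Suc.IH step[OF N pN])
      also have "\<dots> = 4 * r * (1/2)^n" by simp
      finally show ?case .
    qed
    \<comment> \<open>For derivatives of a given order, \<open>l\<close> is taken so small that the
      data are still below \<open>r\<close> in the corresponding norm. The same iteration then
      contracts in that norm, with the same factor.\<close>
    have cau: "ucauchy (%n. DL is (cs n b))" for b "is"
    proof -
      obtain l where l: "0 < l" "l <= 1" "nc (NN (length is) l) p < r" using nc_NN_exists[OF p] by blast
      have N: "adm a C (NN (length is) l :: 'n fld => real)" by (rule adm_NN[OF a N0]) (use l in simp)
      have key: "\<bar>DL is (cs (n + k) b) \<tau> x - DL is (cs n b) \<tau> x\<bar> <= 4 * r * (1/2)^n / l ^ length is" for n k \<tau> x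
      proof -
        have sd: "smooth (cs (n + k) b - cs n b)" by (intro smooth_diff smcD sc)
        have "l ^ length is * \<bar>DL is (cs (n + k) b - cs n b) \<tau> x\<bar> <= l ^ length is * N0 (DL is (cs (n + k) b - cs n b))"
          by (intro mult_left_mono N0_sn smooth_DL sd) (use l in simp)
        also have "\<dots> <= NN (length is) l (cs (n + k) b - cs n b)" by (rule NN_DL[OF sd]) (use l in auto)
        also have "\<dots> <= nc (NN (length is) l) (cs (n + k) - cs n)"
          using nc_cmp(1)[OF N smc_diff[OF sc sc], of "n + k" n b] by (simp only: cfg_minus)
        also have "\<dots> <= 4 * r * (1/2)^n" by (rule tail[OF N]) (use l in simp)
        finally have "\<bar>DL is (cs (n + k) b - cs n b) \<tau> x\<bar> <= 4 * r * (1/2)^n / l ^ length is"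
          using l by (simp add: pos_le_divide_eq mult.commute)
        then show ?thesis unfolding DL_diff[OF smcD[OF sc] smcD[OF sc]] by simp
      qed
      show ?thesis unfolding ucauchy_def
      proof (intro allI impI)
        fix e :: real assume e: "e > 0"
        have "(%n. 4 * r * (1/2)^n / l ^ length is) \<longlonglongrightarrow> 4 * r * 0 / l ^ length is"
          using l by (intro tendsto_intros LIMSEQ_realpow_zero) auto
        then have "\<forall>\<^sub>F n in sequentially. 4 * r * (1/2)^n / l ^ length is < e/2"
          using e by (intro order_tendstoD(2)) auto
        then obtain n where n: "4 * r * (1/2)^n / l ^ length is < e/2" by (auto simp: eventually_sequentially)
        have h: "\<bar>DL is (cs m b) \<tau> x - DL is (cs n b) \<tau> x\<bar> < e/2" if "m >= n" for m \<tau> x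
          using key[of n "m - n" \<tau> x] n that by simp
        have "\<bar>DL is (cs m b) \<tau> x - DL is (cs m' b) \<tau> x\<bar> < e" if "m >= n" "m' >= n" for m m' \<tau> x
          using h[OF that(1), of \<tau> x] h[OF that(2), of \<tau> x] by linarith
        then show "\<exists>M. \<forall>m\<ge>M. \<forall>n\<ge>M. \<forall>\<tau> x. \<bar>DL is (cs m b) \<tau> x - DL is (cs n b) \<tau> x\<bar> < e" by blast
      qed
    qed
    define L where "L b = (%\<tau> x. lim (%n. cs n b \<tau> x))" for b
    have sL: "smc L" unfolding smc_def L_def by (intro allI smooth_complete(1) smcD sc cau)
    have uL: "uconv (%n. DL is (cs n b)) (DL is (L b))" for b "is"
      unfolding L_def by (rule smooth_complete(2)[OF smcD[OF sc] cau])
    have snL: "(%n. sn (DL is (cs n b - L b))) \<longlonglongrightarrow> 0" for b "is"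
    proof (rule LIMSEQ_I)
      fix e :: real assume e: "e > 0"
      then obtain n0 where n0: "\<And>n \<tau> x. n >= n0 ==> \<bar>DL is (cs n b) \<tau> x - DL is (L b) \<tau> x\<bar> < e/2"
        using uL[of "is" b] half_gt_zero[OF e] unfolding uconv_def by blast
      have "norm (sn (DL is (cs n b - L b)) - 0) < e" if "n >= n0" for n
      proof -
        have "sn (DL is (cs n b - L b)) <= e/2"
          unfolding DL_diff[OF smcD[OF sc] smcD[OF sL]] by (rule sn_le) (use n0[OF that] in \<open>auto intro: less_imp_le\<close>)
        moreover have "sn (DL is (cs n b - L b)) >= 0" by (intro sn_nonneg smooth_AC smooth_DL smooth_diff smcD sc sL)
        ultimately show ?thesis using e by simp
      qed
      then show "\<exists>no. \<forall>n\<ge>no. norm (sn (DL is (cs n b - L b)) - 0) < e" by blast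
    qed
    have ncL: "(%n. nc (NN k l) (cs n - L)) \<longlonglongrightarrow> 0" for k l
    proof -
      have sd: "smooth (cs n b - L b)" for n b by (intro smooth_diff smcD sc sL)
      have t0: "(%n. NN k l (cs n b - L b)) \<longlonglongrightarrow> 0" for b by (rule NN_tendsto_0[OF sd snL])
      have t1: "(%n. NN k l (dx i (cs n b - L b))) \<longlonglongrightarrow> 0" for b i
        by (rule NN_tendsto_0[OF smooth_D[OF sd]]) (use snL[of "Some i # _"] in simp)
      have t2: "(%n. NN k l (dx i (dx j (cs n b - L b)))) \<longlonglongrightarrow> 0" for b i j
        by (rule NN_tendsto_0[OF smooth_D[OF smooth_D[OF sd]]]) (use snL[of "Some j # Some i # _"] in simp)
      have "(%n. qn (NN k l) b (cs n b - L b)) \<longlonglongrightarrow> 0" for b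
      proof (cases "isH b")
        case True
        have "(%n. qn (NN k l) b (cs n b - L b)) \<longlonglongrightarrow> 0 + (\<Sum>i\<in>(UNIV::'n set). 0) + 0"
          unfolding qn_def if_P[OF True] by (intro tendsto_intros t0 t1)
        then show ?thesis by simp
      next
        case False
        have "(%n. qn (NN k l) b (cs n b - L b)) \<longlonglongrightarrow> 0 + (\<Sum>i\<in>(UNIV::'n set). 0) + (\<Sum>i\<in>(UNIV::'n set). \<Sum>j\<in>(UNIV::'n set). 0)"
          unfolding qn_def if_not_P[OF False] by (intro tendsto_intros t0 t1 t2)
        then show ?thesis by simp
      qed
      then have "(%n. \<Sum>b\<in>UNIV. qn (NN k l) b (cs n b - L b)) \<longlonglongrightarrow> (\<Sum>b\<in>(UNIV :: 'n idx set). 0)" by (intro tendsto_intros)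
      then show ?thesis unfolding nc_def cfg_minus by simp
    qed
    have bL: "nc (NN k l) L <= 2 * r" if l: "0 <= l" and pN: "nc (NN k l) p <= r" for k l
    proof -
      have N: "adm a C (NN k l :: 'n fld => real)" by (rule adm_NN[OF a N0 l])
      have "nc (NN k l) L <= 2 * r + nc (NN k l) (cs n - L)" for n
      proof -
        have "nc (NN k l) (cs n - (cs n - L)) <= nc (NN k l) (cs n) + nc (NN k l) (cs n - L)"
          by (rule nc_diff[OF N sc smc_diff[OF sc sL]])
        then show ?thesis using bd[OF N pN, of n] by simp
      qed
      moreover have "(%n. 2 * r + nc (NN k l) (cs n - L)) \<longlonglongrightarrow> 2 * r + 0" by (intro tendsto_intros ncL)
      ultimately show ?thesis using LIMSEQ_le_const[of "%n. 2 * r + nc (NN k l) (cs n - L)" "2 * r + 0"] by auto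
    qed
    have fixL: "L = p + A (Fout a L)"
    proof -
      have NN0: "(NN 0 0 :: 'n fld => real) = N0" by (intro ext) simp
      have bL0: "nc N0 L <= 2 * r" using bL[of 0 0] p(2) unfolding NN0 by simp
      have t: "(%n. nc N0 (cs n - L)) \<longlonglongrightarrow> 0" using ncL[of 0 0] unfolding NN0 .
      note sT = smc_add[OF p(1) lopD(2)[OF A smc_Fout[OF a sL]]]
      have "nc N0 (L - (p + A (Fout a L))) <= nc N0 (cs (Suc n) - L) + (1/2) * nc N0 (cs n - L)" for n
      proof -
        have "nc N0 (L - (p + A (Fout a L))) <= nc N0 (L - cs (Suc n)) + nc N0 (cs (Suc n) - (p + A (Fout a L)))"
          by (rule nc_triangle[OF N0 sL sc sT])
        moreover have "nc N0 (L - cs (Suc n)) <= nc N0 (cs (Suc n) - L)" by (rule nc_commute[OF N0 sL sc])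
        moreover have "cs (Suc n) - (p + A (Fout a L)) = A (Fout a (cs n)) - A (Fout a L)" unfolding cs_Suc by simp
        moreover have "nc N0 (A (Fout a (cs n)) - A (Fout a L)) <= (1/2) * nc N0 (cs n - L)"
          by (rule contr[OF N0 sc sL bd[OF N0] bL0]) (use p in simp)
        ultimately show ?thesis by simp
      qed
      moreover have "(%n. nc N0 (cs (Suc n) - L) + (1/2) * nc N0 (cs n - L)) \<longlonglongrightarrow> 0 + (1/2) * 0"
        by (intro tendsto_intros t LIMSEQ_Suc)
      ultimately have z: "nc N0 (L - (p + A (Fout a L))) <= 0"
        using LIMSEQ_le_const[of "%n. nc N0 (cs (Suc n) - L) + (1/2) * nc N0 (cs n - L)" "0 + (1/2) * 0"] by auto
      show ?thesis
      proof
        fix b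
        have "N0 ((L - (p + A (Fout a L))) b) <= 0" using nc_cmp(1)[OF N0 smc_diff[OF sL sT], of b] z by linarith
        then have "(L - (p + A (Fout a L))) b = 0" by (rule N0_eq_0[OF smcD[OF smc_diff[OF sL sT]]])
        then show "L b = (p + A (Fout a L)) b" unfolding cfg_minus by (simp only: right_minus_eq)
      qed
    qed
    show "\<exists>c. smc c \<and> c = p + A (Fout a c) \<and> (\<forall>k l. 0 <= l --> nc (NN k l) p <= r --> nc (NN k l) c <= 2 * r)"
      using sL fixL bL by blast
  qed
qed

section \<open>Almost periodic functions as fields\<close>

definition cf :: "(real^'n::finite => real) => 'n fld" where "cf u = (%_. u)"

lemma cf_apply [simp]: "cf u \<tau> x = u x" by (simp add: cf_def)

lemma cf_ring: "cf (%x. f x + g x) = cf f + cf g" "cf (%x. f x - g x) = cf f - cf g" "cf (%x. f x * g x) = cf f * cf g"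
  "cf (%x. c * f x) = cst c * cf f" "cf (%x. c) = cst c"
  by (auto simp: fun_eq_iff)

lemma cf_inject: "cf f = cf g \<longleftrightarrow> f = g" unfolding cf_def by metis

lemma D_cf: "D (Some i) (cf u) = cf (pd i u)"
  unfolding D_def pd_def cf_def by simp

lemma hasD_cf: "hasD (Some i) (cf u) (cf g) \<longleftrightarrow> (\<forall>x. ((%t. u (x + t *\<^sub>R axis i 1)) has_real_derivative g x) (at 0))"
  unfolding hasD_def cf_def by simp

lemma hasD_cf_translate:
  assumes "hasD (Some i) (cf w) (cf g)" shows "hasD (Some i) (cf (%x. w (x + v))) (cf (%x. g (x + v)))"
  unfolding hasD_cf
proof
  fix x
  have "((%t. w (x + v + t *\<^sub>R axis i 1)) has_real_derivative g (x + v)) (at 0)" using assms unfolding hasD_cf by blast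
  then show "((%t. w (x + t *\<^sub>R axis i 1 + v)) has_real_derivative g (x + v)) (at 0)" by (simp add: add_ac)
qed

lemma hasD_None_cf: "hasD None (cf u) 0"
  unfolding hasD_def cf_def by simp

lemma cf_dpart: "cf (dpart (i # is) u) = D (Some i) (cf (dpart is u))" by (simp add: D_cf)

lemma smooth_cf_dpart: "smooth (cf u) ==> smooth (cf (dpart is u))"
proof (induction "is")
  case (Cons i "is")
  show ?case unfolding cf_dpart by (rule smooth_D[OF Cons.IH[OF Cons.prems]])
qed simp

lemma Ckb_smooth: assumes "smooth (cf u)" shows "Ckb k u"
  unfolding Ckb_def
proof (intro allI impI conjI)
  fix "is" :: "'a list" and i x
  note s = smooth_cf_dpart[OF assms, of "is"]
  show "continuous_on UNIV (dpart is u)" using AC_cont_x[OF smooth_AC[OF s], of UNIV 0] by (simp add: cf_def)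
  show "bounded (range (dpart is u))" using AC_bdd[OF smooth_AC[OF s]] by (auto simp: bounded_iff)
  have "hasD (Some i) (cf (dpart is u)) (cf (dpart (i # is) u))" unfolding cf_dpart by (rule smooth_hasD[OF s])
  then show "((%t. dpart is u (x + t *\<^sub>R axis i 1)) has_real_derivative dpart (i # is) u x) (at 0)" unfolding hasD_cf by blast
qed

lemma normk_le: assumes "\<And>is x. length is <= k ==> \<bar>dpart is f x\<bar> <= c" shows "normk k f <= c"
  unfolding normk_def using assms by (intro cSup_least) (auto intro!: exI[of _ "[]"])

lemma Ckb_bounds: assumes "Ckb k f" shows "\<exists>B. \<forall>is x. length is <= k --> \<bar>dpart is f x\<bar> <= B"
proof -
  have "\<exists>B. length is <= k --> (\<forall>x. \<bar>dpart is f x\<bar> <= B)" for "is"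
    using assms unfolding Ckb_def bounded_iff by auto
  from choice[OF allI[OF this]] obtain B where B0: "\<forall>is. length is <= k --> (\<forall>x. \<bar>dpart is f x\<bar> <= B is)" ..
  then have B: "length is <= k ==> \<bar>dpart is f x\<bar> <= B is" for "is" x by blast
  have fin: "finite {is :: 'a list. length is <= k}" using finite_lists_length_le[of "UNIV :: 'a set" k] by simp
  have "B is <= Max (B ` {is. length is <= k})" if "length is <= k" for "is" using fin that by (intro Max_ge) auto
  then show ?thesis using B order_trans by (intro exI[of _ "Max (B ` {is. length is <= k})"]) blast
qed

lemma normk_ge: assumes "Ckb k f" "length is <= k" shows "\<bar>dpart is f x\<bar> <= normk k f"
proof -
  obtain B where "\<And>is x. length is <= k ==> \<bar>dpart is f x\<bar> <= B" using Ckb_bounds[OF assms(1)] by blast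
  then show ?thesis unfolding normk_def using assms(2) by (intro cSup_upper) (auto intro!: bdd_aboveI[of _ B])
qed

lemma dpart_diff:
  assumes "Ckb k f" "Ckb k g" "length is <= k"
  shows "dpart is (%x. f x - g x) = (%x. dpart is f x - dpart is g x)"
  using assms(3)
proof (induction "is")
  case (Cons i "is")
  have l: "length is < k" using Cons.prems by simp
  have "((%t. dpart is f (x + t *\<^sub>R axis i 1) - dpart is g (x + t *\<^sub>R axis i 1)) has_real_derivative dpart (i # is) f x - dpart (i # is) g x) (at 0)" for x
    using assms(1,2) l unfolding Ckb_def by (intro derivative_intros) (meson less_imp_le)+
  then show ?case using Cons by (intro ext) (simp add: pd_def DERIV_imp_deriv)
qed simp

lemma dpart_shift: "dpart is (%x. f (x + c)) = (%x. dpart is f (x + c))"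
  by (induction "is") (auto simp: pd_def add_ac)

text \<open>Suppose \<open>X n\<close> and \<open>Y n\<close> approach each other while the values
  stay \<open>e\<close> apart. Along a subsequence the translates by \<open>X\<close> are uniformly
  Cauchy; evaluated at 0 and at \<open>Y - X\<close>, they allow both points to be replaced by
  points near one fixed \<open>X (r M)\<close>, where continuity contradicts the gap.\<close>

lemma bochner_ucont:
  fixes f :: "real^'n::finite => real"
  assumes c: "continuous_on UNIV f"
    and b: "\<And>c::nat => real^'n. \<exists>r::nat=>nat. strict_mono r \<and> (\<forall>e>0. \<exists>M. \<forall>m\<ge>M. \<forall>n\<ge>M. \<forall>x. \<bar>f (x + c (r m)) - f (x + c (r n))\<bar> < e)"
    and e: "e > 0"
  shows "\<exists>d>0. \<forall>x y. dist x y < d --> \<bar>f x - f y\<bar> < e"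
proof (rule ccontr)
  assume "\<not> ?thesis"
  then have "\<forall>n. \<exists>x y. dist x y < 1 / real (Suc n) \<and> \<not> \<bar>f x - f y\<bar> < e" by (metis of_nat_0_less_iff zero_less_Suc zero_less_divide_1_iff)
  then obtain X Y where XY: "\<And>n. dist (X n) (Y n) < 1 / real (Suc n)" "\<And>n. \<not> \<bar>f (X n) - f (Y n)\<bar> < e" by metis
  obtain r :: "nat => nat" where r: "strict_mono r" "\<forall>e>0. \<exists>M. \<forall>m\<ge>M. \<forall>n\<ge>M. \<forall>x. \<bar>f (x + X (r m)) - f (x + X (r n))\<bar> < e"
    using b[of X] by blast
  have e4: "e/4 > 0" using e by simp
  obtain M where M: "\<And>m n x. m >= M ==> n >= M ==> \<bar>f (x + X (r m)) - f (x + X (r n))\<bar> < e/4"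
    using r(2)[THEN spec, THEN mp, OF e4] by blast
  obtain d where d: "d > 0" "\<And>y. dist y (X (r M)) < d ==> \<bar>f y - f (X (r M))\<bar> < e/4"
    using c e4 unfolding continuous_on_iff dist_real_def by (metis UNIV_I)
  obtain n0 where n0: "1 / real (Suc n0) < d" using reals_Archimedean[OF d(1)] by (auto simp: field_simps)
  define n where "n = max M n0"
  have rn: "r n >= n0" using seq_suble[OF r(1), of n] unfolding n_def by linarith
  have "1 / real (Suc (r n)) <= 1 / real (Suc n0)" using rn by (intro divide_left_mono) auto
  then have hd: "dist (X (r n)) (Y (r n)) < d" using XY(1)[of "r n"] n0 by linarith
  define h where "h = Y (r n) - X (r n)"
  have "\<bar>f (h + X (r n)) - f (h + X (r M))\<bar> < e/4" "\<bar>f (0 + X (r n)) - f (0 + X (r M))\<bar> < e/4"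
    by (intro M; simp add: n_def)+
  moreover have "\<bar>f (h + X (r M)) - f (X (r M))\<bar> < e/4"
    by (rule d(2)) (use hd in \<open>simp add: h_def dist_norm norm_minus_commute\<close>)
  moreover have "h + X (r n) = Y (r n)" by (simp add: h_def)
  ultimately have "\<bar>f (X (r n)) - f (Y (r n))\<bar> < e" using e by (simp add: abs_if split: if_splits)
  then show False using XY(2) by blast
qed

lemma AC_seq_finite:
  assumes "finite I" "\<And>i. i \<in> I ==> AC (F i)"
  shows "\<exists>r::nat=>nat. strict_mono r \<and> (\<forall>i\<in>I. \<forall>e>0. transl_cauchy (F i) c r e)"
  using assms
proof (induction I rule: finite_induct)
  case empty
  then show ?case by (auto intro!: exI[of _ "%n::nat. n"] simp: strict_mono_def)
next
  case (insert j I)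
  then obtain r :: "nat => nat" where r: "strict_mono r" "\<And>i e. i \<in> I ==> e > 0 ==> transl_cauchy (F i) c r e"
    by auto
  obtain q :: "nat => nat" where q: "strict_mono q" "\<forall>e>0. transl_cauchy (F j) (c \<circ> r) q e"
    using AC_seq[of "F j" "c \<circ> r"] insert.prems by blast
  have "transl_cauchy (F i) c (r \<circ> q) e" if i: "i \<in> insert j I" and e: "e > 0" for i e
  proof (cases "i = j")
    case True
    then show ?thesis using q(2)[THEN spec, THEN mp, OF e] by simp
  next
    case False
    then obtain M where M: "\<And>m n \<tau> x. m >= M ==> n >= M ==> \<bar>F i \<tau> (x + c (r m)) - F i \<tau> (x + c (r n))\<bar> < e" using r(2)[of i e] i e by blast
    have "m >= M ==> q m >= M" for m using seq_suble[OF q(1), of m] by linarith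
    then show ?thesis using M by (intro exI[of _ M]) simp
  qed
  then show ?case using strict_mono_o[OF r(1) q(1)] by (intro exI[of _ "r \<circ> q"]) blast
qed

lemma AC_translate: assumes "AC F" shows "AC (%\<tau> x. F \<tau> (x + v))"
proof (rule ACI)
  show "\<exists>M. \<forall>\<tau> x. \<bar>F \<tau> (x + v)\<bar> <= M" using AC_bdd[OF assms] by blast
  show "\<exists>d>0. \<forall>\<tau> \<tau>' x x'. dist \<tau> \<tau>' < d --> dist x x' < d --> \<bar>F \<tau> (x + v) - F \<tau>' (x' + v)\<bar> < e" if e: "e > 0" for e
  proof -
    obtain d where "d>0" "\<And>\<tau> \<tau>' x x'. dist \<tau> \<tau>' < d ==> dist x x' < d ==> \<bar>F \<tau> x - F \<tau>' x'\<bar> < e"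
      using AC_ucont[OF assms e] by blast
    then show ?thesis by (intro exI[of _ d]) simp
  qed
  fix c :: "nat => real^'a"
  obtain r :: "nat => nat" where r: "strict_mono r" "\<forall>e>0. transl_cauchy F c r e"
    using AC_seq[OF assms, of c] by blast
  have "\<exists>M. \<forall>m\<ge>M. \<forall>n\<ge>M. \<forall>\<tau> x. \<bar>F \<tau> (x + c (r m) + v) - F \<tau> (x + c (r n) + v)\<bar> < e" if e: "e > 0" for e
  proof -
    obtain M where M: "\<And>m n \<tau> x. m >= M ==> n >= M ==> \<bar>F \<tau> (x + c (r m)) - F \<tau> (x + c (r n))\<bar> < e"
      using r(2)[THEN spec, THEN mp, OF e] by blast
    have "\<bar>F \<tau> (x + c (r m) + v) - F \<tau> (x + c (r n) + v)\<bar> < e" if "m >= M" "n >= M" for m n \<tau> x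
      using M[OF that, of \<tau> "x + v"] by (simp add: add_ac)
    then show ?thesis by blast
  qed
  then show "\<exists>r::nat=>nat. strict_mono r \<and> (\<forall>e>0. \<exists>M. \<forall>m\<ge>M. \<forall>n\<ge>M. \<forall>\<tau> x. \<bar>F \<tau> (x + c (r m) + v) - F \<tau> (x + c (r n) + v)\<bar> < e)"
    using r(1) by blast
qed

lemma Ckb_diff: assumes "Ckb k f" "Ckb k g" shows "Ckb k (%x. f x - g x)"
  unfolding Ckb_def
proof (intro allI impI conjI)
  fix "is" :: "'a list" and i x assume l: "length is <= k"
  note d = dpart_diff[OF assms l]
  show "continuous_on UNIV (dpart is (%x. f x - g x))" unfolding d using assms l unfolding Ckb_def by (intro continuous_intros) auto
  have "bounded (range (dpart is f))" "bounded (range (dpart is g))" using assms l unfolding Ckb_def by auto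
  then obtain A B where A: "\<And>x. \<bar>dpart is f x\<bar> <= A" and B: "\<And>x. \<bar>dpart is g x\<bar> <= B" unfolding bounded_iff by (metis rangeI real_norm_def)
  have "\<bar>dpart is f x - dpart is g x\<bar> <= A + B" for x using A[of x] B[of x] by linarith
  then show "bounded (range (dpart is (%x. f x - g x)))" unfolding d bounded_iff by (intro exI[of _ "A + B"]) auto
  assume l': "length is < k"
  then have l'': "length (i # is) <= k" by simp
  show "((%t. dpart is (%x. f x - g x) (x + t *\<^sub>R axis i 1)) has_real_derivative dpart (i # is) (%x. f x - g x) x) (at 0)"
    unfolding d dpart_diff[OF assms l''] using assms l l' unfolding Ckb_def by (intro derivative_intros) auto
qed

lemma Ckb_translate: assumes "Ckb k f" shows "Ckb k (%x. f (x + c))"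
  unfolding Ckb_def dpart_shift
proof (intro allI impI conjI)
  fix "is" :: "'a list" and i x assume l: "length is <= k"
  have "continuous_on UNIV (dpart is f)" "bounded (range (dpart is f))" using assms l unfolding Ckb_def by auto
  then show "continuous_on UNIV (%x. dpart is f (x + c))" "bounded (range (%x. dpart is f (x + c)))"
    by (auto intro!: continuous_on_compose2[of UNIV "dpart is f"] continuous_intros simp: bounded_iff)
  assume "length is < k"
  then have "((%t. dpart is f (x + c + t *\<^sub>R axis i 1)) has_real_derivative dpart (i # is) f (x + c)) (at 0)" using assms l unfolding Ckb_def by blast
  then show "((%t. dpart is f (x + t *\<^sub>R axis i 1 + c)) has_real_derivative dpart (i # is) f (x + c)) (at 0)" by (simp add: add_ac)
qed

text \<open>One subsequence is chosen for the finitely many derivatives of order up to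
  \<open>k\<close>. Uniform convergence then identifies the limit \<open>g is\<close> of each
  derivative with the derivative of the limit \<open>g []\<close>.\<close>

lemma smooth_Cap: assumes u: "smooth (cf u)" shows "Cap k u"
  unfolding Cap_def precompact_Ckb_def
proof (intro conjI allI impI)
  show "Ckb k u" by (rule Ckb_smooth[OF u])
  fix s :: "nat => real^'a => real" assume "\<forall>j. s j \<in> {%x. u (x + c) |c. True}"
  then have "\<forall>j. \<exists>c. s j = (%x. u (x + c))" by blast
  then obtain c where c: "\<And>j. s j = (%x. u (x + c j))" by metis
  have fin: "finite {is :: 'a list. length is <= k}" using finite_lists_length_le[of "UNIV :: 'a set" k] by simp
  obtain r :: "nat => nat" where r: "strict_mono r" "\<And>is e. length is <= k ==> e > 0 ==> transl_cauchy (cf (dpart is u)) c r e"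
    using AC_seq_finite[OF fin, of "%is. cf (dpart is u)" c] smooth_AC[OF smooth_cf_dpart[OF u]] by auto
  define G where "G is n = cf (%x. dpart is u (x + c (r n)))" for "is" n
  have cau: "ucauchy (G is)" if "length is <= k" for "is" using r(2)[OF that] unfolding ucauchy_def G_def by simp
  define g where "g is x = lim (%n. G is n 0 x)" for "is" x
  have cg: "(%\<tau> x. lim (%n. G is n \<tau> x)) = cf (g is)" for "is" by (simp add: fun_eq_iff g_def G_def)
  have ug: "uconv (G is) (cf (g is))" if "length is <= k" for "is" using ucauchy_uconv[OF cau[OF that]] unfolding cg .
  have ACG: "AC (G is n)" for "is" n
    using AC_translate[OF smooth_AC[OF smooth_cf_dpart[OF u, of "is"]], of "c (r n)"] by (simp add: G_def cf_def)
  have ACg: "AC (cf (g is))" if "length is <= k" for "is" by (rule AC_uconv[OF ACG ug[OF that]])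
  have hG: "hasD (Some i) (G is n) (G (i # is) n)" for i "is" n
  proof -
    have "hasD (Some i) (cf (dpart is u)) (cf (dpart (i # is) u))" unfolding cf_dpart by (rule smooth_hasD[OF smooth_cf_dpart[OF u]])
    then show ?thesis unfolding G_def by (rule hasD_cf_translate)
  qed
  have hg: "hasD (Some i) (cf (g is)) (cf (g (i # is)))" if l: "length is < k" for i "is"
    by (rule hasD_limit[OF hG ug uconv_tendsto[OF ug]]) (use l in auto)
  have dg: "length is <= k ==> dpart is (g []) = g is" for "is"
  proof (induction "is")
    case (Cons i "is")
    have "cf (pd i (g is)) = cf (g (i # is))" unfolding D_cf[symmetric] by (rule hasD_D[OF hg]) (use Cons.prems in simp)
    then show ?case using Cons unfolding cf_inject by simp
  qed simp
  have Cg: "Ckb k (g [])" unfolding Ckb_def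
  proof (intro allI impI conjI)
    fix "is" :: "'a list" and i x assume l: "length is <= k"
    show "continuous_on UNIV (dpart is (g []))" unfolding dg[OF l] using AC_cont_x[OF ACg[OF l], of UNIV 0] by (simp add: cf_def)
    show "bounded (range (dpart is (g [])))" unfolding dg[OF l] using AC_bdd[OF ACg[OF l]] by (auto simp: bounded_iff)
    assume l': "length is < k"
    then have l'': "length (i # is) <= k" by simp
    show "((%t. dpart is (g []) (x + t *\<^sub>R axis i 1)) has_real_derivative dpart (i # is) (g []) x) (at 0)"
      unfolding dg[OF l] dg[OF l''] using hg[OF l'] unfolding hasD_cf by blast
  qed
  have Cs: "Ckb k (%x. u (x + v))" for v by (rule Ckb_translate[OF Ckb_smooth[OF u]])
  have "(%j. normk k (%x. s (r j) x - g [] x)) \<longlonglongrightarrow> 0"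
  proof (rule LIMSEQ_I)
    fix e :: real assume e: "e > 0"
    have "\<forall>is\<in>{is. length is <= k}. \<exists>M. \<forall>n\<ge>M. \<forall>\<tau> x. \<bar>G is n \<tau> x - cf (g is) \<tau> x\<bar> < e/2"
      using ug half_gt_zero[OF e] unfolding uconv_def by blast
    from bchoice[OF this] obtain M where M0: "\<forall>is\<in>{is. length is <= k}. \<forall>n\<ge>M is. \<forall>\<tau> x. \<bar>G is n \<tau> x - cf (g is) \<tau> x\<bar> < e/2" ..
    have M: "\<bar>G is n \<tau> x - cf (g is) \<tau> x\<bar> < e/2" if "length is <= k" "n >= M is" for "is" n \<tau> x
      using M0 that by simp
    have "norm (normk k (%x. s (r n) x - g [] x) - 0) < e" if n: "n >= Max (M ` {is. length is <= k})" for n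
    proof -
      have b: "\<bar>dpart is (%x. s (r n) x - g [] x) x\<bar> <= e/2" if l: "length is <= k" for "is" x
      proof -
        have "M is <= Max (M ` {is. length is <= k})" by (rule Max_ge[OF finite_imageI[OF fin]]) (use l in simp)
        then have "M is <= n" using n by linarith
        then have "\<bar>G is n 0 x - cf (g is) 0 x\<bar> < e/2" by (rule M[OF l])
        then show ?thesis unfolding c dpart_diff[OF Cs Cg l] dpart_shift dg[OF l] by (simp add: G_def)
      qed
      have "0 <= normk k (%x. s (r n) x - g [] x)"
        unfolding c using order_trans[OF abs_ge_zero normk_ge[OF Ckb_diff[OF Cs Cg], of "[]"]] by simp
      moreover have "normk k (%x. s (r n) x - g [] x) <= e/2" by (rule normk_le[OF b])
      ultimately show ?thesis using e by simp
    qed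
    then show "\<exists>no. \<forall>n\<ge>no. norm (normk k (%x. s (r n) x - g [] x) - 0) < e" by blast
  qed
  then show "\<exists>r g. strict_mono r \<and> Ckb k g \<and> (%j. normk k (%x. s (r j) x - g x)) \<longlonglongrightarrow> 0" using r(1) Cg by blast
qed

text \<open>Precompactness of the translates in norm \<open>k\<close> gives Bochner's criterion for
  every derivative of order up to \<open>k\<close>; \<open>bochner_ucont\<close> supplies the
  uniform continuity that \<open>AC\<close> asks for.\<close>

lemma Cap_smooth: assumes u: "\<And>k. k >= 1 ==> Cap k u" shows "smooth (cf u)"
\<comment> \<open>The zero field belongs to the invariant because \<open>cf u\<close> is constant in
  the parameter, so its derivative in direction \<open>None\<close> vanishes.\<close>
proof (rule smoothI_coind[where P = "%F. F = 0 \<or> (\<exists>is. F = cf (dpart is u))"])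
  show "cf u = 0 \<or> (\<exists>is. cf u = cf (dpart is u))" by (intro disjI2 exI[of _ "[]"]) simp
  have C: "Ckb k u" if "k >= 1" for k using u[OF that] unfolding Cap_def by blast
  show "AC F" if F: "F = 0 \<or> (\<exists>is. F = cf (dpart is u))" for F
  proof (cases "F = 0")
    case True then show ?thesis using smooth_AC[OF smooth_0] by simp
  next
    case False
    then obtain "is" where F: "F = cf (dpart is u)" using F by blast
    define k where "k = Suc (length is)"
    have k: "k >= 1" "length is <= k" by (auto simp: k_def)
    have cont: "continuous_on UNIV (dpart is u)" using C[OF k(1)] k(2) unfolding Ckb_def by blast
    have boch: "\<exists>r::nat=>nat. strict_mono r \<and> (\<forall>e>0. \<exists>M. \<forall>m\<ge>M. \<forall>n\<ge>M. \<forall>x. \<bar>dpart is u (x + c (r m)) - dpart is u (x + c (r n))\<bar> < e)" for c :: "nat => real^'a"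
    proof -
      have "precompact_Ckb k {(%x. u (x + c)) | c. True}" using u[OF k(1)] unfolding Cap_def by blast
      then obtain r g where r: "strict_mono (r :: nat => nat)" "Ckb k g" "(%j. normk k (%x. u (x + c (r j)) - g x)) \<longlonglongrightarrow> 0"
        unfolding precompact_Ckb_def by (drule_tac x = "%j x. u (x + c j)" in spec) auto
      have b: "\<bar>dpart is u (x + c (r j)) - dpart is g x\<bar> <= normk k (%x. u (x + c (r j)) - g x)" for j x
        using normk_ge[OF Ckb_diff[OF Ckb_translate[OF C[OF k(1)]] r(2)] k(2)]
        unfolding dpart_diff[OF Ckb_translate[OF C[OF k(1)]] r(2) k(2)] dpart_shift .
      have "\<exists>M. \<forall>m\<ge>M. \<forall>n\<ge>M. \<forall>x. \<bar>dpart is u (x + c (r m)) - dpart is u (x + c (r n))\<bar> < e" if e: "e > 0" for e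
      proof -
        have "\<forall>\<^sub>F j in sequentially. normk k (%x. u (x + c (r j)) - g x) < e/2" using r(3) e by (intro order_tendstoD(2)) auto
        then obtain M where M: "\<And>j. j >= M ==> normk k (%x. u (x + c (r j)) - g x) < e/2" by (auto simp: eventually_sequentially)
        have "\<bar>dpart is u (x + c (r m)) - dpart is u (x + c (r n))\<bar> < e" if "m >= M" "n >= M" for m n x
          using b[of x m] b[of x n] M[OF that(1)] M[OF that(2)] by linarith
        then show ?thesis by blast
      qed
      then show ?thesis using r(1) by blast
    qed
    show ?thesis
    proof (rule ACI)
      have "bounded (range (dpart is u))" using C[OF k(1)] k(2) unfolding Ckb_def by blast
      then show "\<exists>M. \<forall>\<tau> x. \<bar>F \<tau> x\<bar> <= M" unfolding F by (auto simp: bounded_iff)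
      show "\<exists>d>0. \<forall>\<tau> \<tau>' x x'. dist \<tau> \<tau>' < d --> dist x x' < d --> \<bar>F \<tau> x - F \<tau>' x'\<bar> < e" if e: "e > 0" for e
        using bochner_ucont[OF cont boch e] unfolding F by auto
      show "\<exists>r::nat=>nat. strict_mono r \<and> (\<forall>e>0. transl_cauchy F c r e)" for c
        using boch[of c] unfolding F by simp
    qed
  qed
  fix F i assume F: "F = 0 \<or> (\<exists>is. F = cf (dpart is u))"
  show "hasD i F (D i F) \<and> (D i F = 0 \<or> (\<exists>is. D i F = cf (dpart is u)))"
  proof (cases "F = 0")
    case True then show ?thesis using smooth_hasD[OF smooth_0, of i] by (simp add: D_0)
  next
    case False
    then obtain "is" where F: "F = cf (dpart is u)" using F by blast
    show ?thesis
    proof (cases i)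
      case None then show ?thesis using hasD_None_cf[of "dpart is u"] hasD_D unfolding F by metis
    next
      case (Some j)
      have "hasD (Some j) (cf (dpart is u)) (cf (dpart (j # is) u))"
      proof -
        have "Ckb (Suc (length is)) u" by (rule C) simp
        then show ?thesis unfolding hasD_cf Ckb_def by (auto dest: spec[of _ "is"])
      qed
      then show ?thesis using hasD_D unfolding F Some by metis
    qed
  qed
qed

lemma Cinf_iff: "Cinf_ap F \<longleftrightarrow> (\<forall>j. smooth (cf (comp j F)))"
  unfolding Cinf_ap_def Cap_vec_def using Cap_smooth smooth_Cap by blast

definition vf :: "'n::finite vfun => 'n => 'n fld" where "vf F j = cf (comp j F)"

lemma vf_apply [simp]: "vf F j \<tau> x = F x $ j" by (simp add: vf_def comp_def)

lemma Cinf_vf: "Cinf_ap F \<longleftrightarrow> (\<forall>j. smooth (vf F j))" unfolding Cinf_iff vf_def ..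

lemma vf_ops: "vf (fadd F G) j = vf F j + vf G j" "vf (fsub F G) j = vf F j - vf G j" "vf (fscale c F) j = cst c * vf F j"
  by (auto simp: fun_eq_iff fadd_def fsub_def fscale_def)

lemma vf_inject: "(\<And>j. vf F j = vf G j) ==> F = G"
  by (intro ext vec_eq_iff[THEN iffD2] allI) (metis vf_apply)

lemma Cinf_ops: "Cinf_ap F ==> Cinf_ap G ==> Cinf_ap (fadd F G)" "Cinf_ap F ==> Cinf_ap G ==> Cinf_ap (fsub F G)"
  "Cinf_ap F ==> Cinf_ap (fscale c F)"
proof -
  show "Cinf_ap F ==> Cinf_ap G ==> Cinf_ap (fadd F G)" "Cinf_ap F ==> Cinf_ap G ==> Cinf_ap (fsub F G)"
    "Cinf_ap F ==> Cinf_ap (fscale c F)"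
    unfolding Cinf_vf vf_ops using smooth_add smooth_diff smooth_mult[OF smooth_cst] by blast+
qed

lemma Cinf_0: "Cinf_ap (%x. 0 :: real^'n::finite)"
proof -
  have "vf (%x. 0) j = cst 0" for j :: 'n by (simp add: fun_eq_iff)
  then show ?thesis unfolding Cinf_vf using smooth_cst by metis
qed

lemma kd_sum: "(\<Sum>k\<in>UNIV. kd j k * X k) = X j" "(\<Sum>k\<in>UNIV. X k * kd k i) = X i"
  "(\<Sum>k\<in>UNIV. kd k i * X k) = X i" for X :: "'n::finite => real"
  by (simp_all add: kd_def if_distrib[of "%z. z * _"] if_distrib[of "%z. _ * z"] cong: if_cong)

section \<open>The maximum principle\<close>

text \<open>The second derivative test along the i-th axis; \<open>2 * e\<close> is the second
  derivative of the subtracted quadratic.\<close>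

lemma dx_local_max:
  assumes F: "smooth F" and m: "\<And>y. F \<tau> y - e * (norm y)\<^sup>2 <= F \<tau> x - e * (norm x)\<^sup>2"
  shows "dx i (dx i F) \<tau> x <= 2 * e"
proof (rule ccontr)
  assume "\<not> ?thesis"
  then have g: "dx i (dx i F) \<tau> x > 2 * e" by simp
  let ?a = "axis i (1::real)"
  define h where "h s = F \<tau> (x + s *\<^sub>R ?a) - e * (norm (x + s *\<^sub>R ?a))\<^sup>2" for s
  define h' where "h' s = dx i F \<tau> (x + s *\<^sub>R ?a) - e * (2 * (x $ i + s))" for s
  have nrm: "(norm (x + s *\<^sub>R ?a))\<^sup>2 = (norm x)\<^sup>2 + 2 * s * x $ i + s\<^sup>2" for s
    unfolding power2_norm_eq_inner by (simp add: inner_add_left inner_add_right inner_axis inner_commute[of ?a] power2_eq_square inner_axis_axis algebra_simps)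
  have d1: "(h has_real_derivative h' s) (at s)" for s
    unfolding h_def h'_def nrm using hasD_at[OF smooth_hasD[OF F, of "Some i"], of \<tau> x s]
    by (auto intro!: derivative_eq_intros simp: algebra_simps)
  have d2: "(h' has_real_derivative dx i (dx i F) \<tau> x - 2 * e) (at 0)"
    unfolding h'_def using hasD_at[OF smooth_hasD[OF smooth_D[OF F, of "Some i"], of "Some i"], of \<tau> x 0]
    by (auto intro!: derivative_eq_intros simp: algebra_simps)
  have h0: "h s <= h 0" for s unfolding h_def using m[of "x + s *\<^sub>R ?a"] by simp
  have z: "h' 0 = 0" by (rule DERIV_local_max[OF d1, of 1]) (auto intro: h0)
  obtain d where d: "d > 0" "\<And>s. 0 < s ==> s < d ==> h' 0 < h' (0 + s)"
    using DERIV_pos_inc_right[OF d2] g by auto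
  obtain s where s: "0 < s" "s < d/2" "h (d/2) - h 0 = (d/2 - 0) * h' s" using MVT2[of 0 "d/2" h h'] d1 d(1) by auto
  have "h' s > 0" using d(2)[of s] s z d(1) by simp
  then have "h (d/2) > h 0" using s(3) d(1) by (metis diff_gt_0_iff_gt diff_zero half_gt_zero mult_pos_pos)
  then show False using h0[of "d/2"] by simp
qed

text \<open>A bounded function on the whole space need not attain its supremum; subtracting
  \<open>e\<close> times the squared norm forces a maximum. There the Laplacian is at most
  \<open>2 * e\<close> times the dimension, so the equation bounds \<open>F\<close> by a multiple of
  \<open>e\<close>, and \<open>e\<close> is arbitrary.\<close>

lemma max_principle:
  fixes F :: "'n::finite fld"
  assumes F: "smooth F" and a: "a >= 0" and eq: "\<And>x. F \<tau> x = a * (\<Sum>i\<in>UNIV. dx i (dx i F) \<tau> x)"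
  shows "F \<tau> x <= 0"
proof (rule field_le_epsilon)
  fix \<delta> :: real assume \<delta>: "\<delta> > 0"
  define c where "c = a * (real CARD('n) * 2) + (norm x)\<^sup>2 + 1"
  have c: "c > 0" unfolding c_def using a by (intro add_nonneg_pos add_nonneg_nonneg mult_nonneg_nonneg) auto
  define e where "e = \<delta> / c"
  have e: "e > 0" using \<delta> c by (simp add: e_def)
  obtain M where M: "M > 0" "\<And>\<tau> x. \<bar>F \<tau> x\<bar> <= M" using AC_bdd_pos[OF smooth_AC[OF F]] by blast
  \<comment> \<open>Outside this radius the penalty is at least \<open>2 * M + 1\<close>, so the
    penalized function lies below its value at 0.\<close>
  define R where "R = sqrt ((2 * M + 1) / e) + norm x"
  have R0: "R >= 0" unfolding R_def using e M by (intro add_nonneg_nonneg) auto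
  let ?h = "%y. F \<tau> y - e * (norm y)\<^sup>2"
  have "continuous_on (cball 0 R) ?h" by (intro continuous_intros AC_cont_x smooth_AC F)
  moreover have "cball (0 :: real^'n) R \<noteq> {}" using R0 by simp
  ultimately obtain x0 where x0: "x0 \<in> cball 0 R" "\<And>y. y \<in> cball 0 R ==> ?h y <= ?h x0"
    using continuous_attains_sup[OF compact_cball] by blast
  have "?h y <= ?h x0" for y
  proof (cases "y \<in> cball 0 R")
    case False
    then have "norm y > R" by simp
    then have "(norm y)\<^sup>2 >= (sqrt ((2 * M + 1) / e))\<^sup>2" unfolding R_def using e M
      by (intro power_mono) (auto intro: less_imp_le order_trans[rotated])
    then have "(norm y)\<^sup>2 >= (2 * M + 1) / e" using e M by simp
    then have "e * (norm y)\<^sup>2 >= 2 * M + 1" using e by (simp add: pos_divide_le_eq mult.commute)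
    then have "?h y <= - M" using M(2)[of \<tau> y] by linarith
    also have "\<dots> <= ?h 0" using M(2)[of \<tau> 0] by simp
    also have "\<dots> <= ?h x0" using x0(2)[of 0] R0 by simp
    finally show ?thesis .
  qed (rule x0)
  then have mx: "\<And>y. ?h y <= ?h x0" .
  have "(\<Sum>i\<in>UNIV. dx i (dx i F) \<tau> x0) <= (\<Sum>i\<in>(UNIV::'n set). 2 * e)" by (intro sum_mono dx_local_max[OF F mx])
  then have "a * (\<Sum>i\<in>UNIV. dx i (dx i F) \<tau> x0) <= a * (\<Sum>i\<in>(UNIV::'n set). 2 * e)" using a by (rule mult_left_mono)
  then have "F \<tau> x0 <= a * (real CARD('n) * 2) * e" using eq[of x0] by simp
  moreover have "0 <= e * (norm x0)\<^sup>2" using e by simp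
  ultimately have "F \<tau> x <= a * (real CARD('n) * 2) * e + e * (norm x)\<^sup>2" using mx[of x] by linarith
  also have "\<dots> <= c * e" unfolding c_def using e by (simp add: algebra_simps)
  also have "\<dots> = \<delta>" using c by (simp add: e_def)
  finally show "F \<tau> x <= 0 + \<delta>" by simp
qed

lemma helmholtz_unique:
  fixes F G :: "'n::finite fld"
  assumes F: "smooth F" and G: "smooth G" and a: "a >= 0"
    and eq: "\<And>x. F \<tau> x - a * (\<Sum>i\<in>UNIV. dx i (dx i F) \<tau> x) = G \<tau> x - a * (\<Sum>i\<in>UNIV. dx i (dx i G) \<tau> x)"
  shows "F \<tau> x = G \<tau> x"
proof -
  have le: "F \<tau> x <= G \<tau> x"
    if F: "smooth F" and G: "smooth G" and eq: "\<And>x. F \<tau> x - a * (\<Sum>i\<in>UNIV. dx i (dx i F) \<tau> x) = G \<tau> x - a * (\<Sum>i\<in>UNIV. dx i (dx i G) \<tau> x)" for F G :: "'n fld"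
  proof -
    have d: "dx i (dx i (F - G)) = dx i (dx i F) - dx i (dx i G)" for i
      unfolding D_diff[OF F G] by (rule D_diff[OF smooth_D[OF F] smooth_D[OF G]])
    have "(F - G) \<tau> x <= 0"
    proof (rule max_principle[OF smooth_diff[OF F G] a])
      show "(F - G) \<tau> x = a * (\<Sum>i\<in>UNIV. dx i (dx i (F - G)) \<tau> x)" for x
        unfolding d using eq[of x] by (simp add: sum_subtractf right_diff_distrib)
    qed
    then show ?thesis by simp
  qed
  show ?thesis using le[OF F G eq] le[OF G F eq[symmetric]] by (rule antisym)
qed

section \<open>Composition with the inverse of a small perturbation of the identity\<close>

text \<open>The situation at one time: \<open>hc\<close> says that \<open>1 + gg\<close> inverts
  \<open>1 + df\<close>, and \<open>lip\<close> makes \<open>x + f x\<close> a bijection by the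
  contraction principle.\<close>

locale small_diff =
  fixes c :: "'n::finite cfg" and f :: "'n vfun"
  assumes sm: "smc c" and fc: "\<And>j. c (IF j) = vf f j"
    and hc: "\<And>j i. c (IH j i) = - (\<Sum>k\<in>UNIV. dx k (c (IF j)) * gg c k i)"
    and lip: "\<And>x y. norm (f x - f y) <= (1/2) * norm (x - y)"
begin

definition "ph x = x + f x"

lemma ph_lower: "norm (x - y) <= 2 * norm (ph x - ph y)"
proof -
  have "x - y = (ph x - ph y) - (f x - f y)" by (simp add: ph_def)
  then have "norm (x - y) <= norm (ph x - ph y) + norm (f x - f y)" by (metis norm_triangle_ineq4)
  then show ?thesis using lip[of x y] by linarith
qed

lemma ph_bij: "bij ph"
proof (rule bijI)
  show "inj ph"
  proof (rule injI)
    fix x y assume "ph x = ph y"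
    then show "x = y" using ph_lower[of x y] by simp
  qed
  show "surj ph"
  proof (rule surjI[of _ "%y. THE x. y - f x = x"])
    fix y
    have c: "dist (y - f x) (y - f x') <= 1/2 * dist x x'" for x x'
      using lip[of x x'] by (simp add: dist_norm norm_minus_commute)
    have "\<exists>!x\<in>UNIV. y - f x = x" by (rule Banach_fix[OF complete_UNIV, of "1/2"]) (simp, simp, simp, simp, rule c)
    then have "\<exists>!x. y - f x = x" by simp
    from theI'[OF this] have "y - f (THE x. y - f x = x) = (THE x. y - f x = x)" .
    then show "ph (THE x. y - f x = x) = y" unfolding ph_def diff_eq_eq by (rule sym)
  qed
qed

definition "ps = inv ph"

lemma ps_ph [simp]: "ps (ph x) = x" and ph_ps [simp]: "ph (ps y) = y"
  unfolding ps_def using ph_bij by (simp_all add: bij_is_inj bij_is_surj surj_f_inv_f)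

lemma ps_lip: "norm (ps x - ps y) <= 2 * norm (x - y)"
  using ph_lower[of "ps x" "ps y"] by simp

lemma ps_cont: "continuous (at y) ps"
proof -
  have "continuous_on UNIV ps"
    unfolding continuous_on_iff dist_norm
  proof (intro ballI allI impI)
    fix x and e :: real assume "e > 0"
    then show "\<exists>d>0. \<forall>x'\<in>UNIV. norm (x' - x) < d --> norm (ps x' - ps x) < e"
      using ps_lip by (intro exI[of _ "e/2"]) (smt (verit) field_sum_of_halves half_gt_zero)
  qed
  then show ?thesis by (simp add: continuous_on_eq_continuous_at)
qed

lemma smooth_f: "smooth (vf f j)" using smcD[OF sm, of "IF j"] unfolding fc .

definition "Mx x = (\<chi> j k. kd j k + dx k (vf f j) 0 x)"
definition "Gx x = (\<chi> k i. kd k i + gg c k i 0 x)"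

text \<open>The equation for \<open>h\<close> says that \<open>Gx\<close> is a right inverse of
  \<open>Mx\<close>; for square matrices a right inverse is a left inverse.\<close>

lemma GM: "Gx x ** Mx x = mat 1"
proof -
  have "Mx x ** Gx x = mat 1"
  proof (intro vec_eq_iff[THEN iffD2] allI)
    fix j i
    have g: "gg c j i 0 x = - (\<Sum>k\<in>UNIV. dx k (vf f j) 0 x * gg c k i 0 x) - dx i (vf f j) 0 x"
      unfolding gg_def[of c j i] hc fc by (simp add: sum_fld_apply)
    have kdl: "(\<Sum>k\<in>UNIV. kd j k * X k) = X j" for X :: "'n => real" by (simp add: kd_def if_distrib[of "%z. z * _"] cong: if_cong)
    have kdr: "(\<Sum>k\<in>UNIV. X k * kd k i) = X i" for X :: "'n => real" by (simp add: kd_def if_distrib[of "%z. _ * z"] cong: if_cong)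
    have "(Mx x ** Gx x) $ j $ i = (\<Sum>k\<in>UNIV. kd j k * (kd k i + gg c k i 0 x)) + (\<Sum>k\<in>UNIV. dx k (vf f j) 0 x * kd k i) + (\<Sum>k\<in>UNIV. dx k (vf f j) 0 x * gg c k i 0 x)"
      by (simp add: matrix_matrix_mult_def Mx_def Gx_def distrib_right distrib_left sum.distrib)
    also have "\<dots> = kd j i" unfolding kdl kdr using g by simp
    finally show "(Mx x ** Gx x) $ j $ i = mat 1 $ j $ i" by (simp add: mat_def kd_def)
  qed
  then show ?thesis by (simp add: matrix_left_right_inverse)
qed

lemma ph_deriv: "(ph has_derivative (%h. Mx x *v h)) (at x)"
proof -
  have "((%x. ph x \<bullet> b) has_derivative (%h. (Mx x *v h) \<bullet> b)) (at x within UNIV)" if b: "b \<in> Basis" for b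
  proof -
    obtain j where j: "b = axis j 1" using b by (auto simp: Basis_vec_def)
    have 1: "((%x. ph x \<bullet> b) has_derivative (%h. h $ j + (\<Sum>i\<in>UNIV. h $ i * dx i (vf f j) 0 x))) (at x)"
      using has_derivative_add[OF bounded_linear_imp_has_derivative[OF bounded_linear_vec_nth, of j] smooth_has_derivative[OF smooth_f[of j], of 0 x]]
      by (simp add: ph_def j inner_axis vf_def cf_def comp_def)
    have "(Mx x *v h) \<bullet> b = h $ j + (\<Sum>i\<in>UNIV. h $ i * dx i (vf f j) 0 x)" for h
      by (simp add: j inner_axis matrix_vector_mult_def Mx_def distrib_right sum.distrib kd_sum) (simp add: mult.commute)
    then show ?thesis using 1 by simp
  qed
  then show ?thesis using has_derivative_componentwise_within[of ph "%h. Mx x *v h" x UNIV] by blast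
qed

lemma ps_deriv: "(ps has_derivative (%h. Gx (ps y) *v h)) (at y)"
proof (rule has_derivative_inverse_basic[OF ph_deriv _ _ ps_cont open_UNIV UNIV_I])
  show "bounded_linear (%h. Gx (ps y) *v h)" by (rule matrix_vector_mul_bounded_linear)
  show "(%h. Gx (ps y) *v h) \<circ> (%h. Mx (ps y) *v h) = id"
    by (simp add: fun_eq_iff matrix_vector_mul_assoc GM)
qed simp

text \<open>The point \<open>p = ps (x + c) - c\<close> solves \<open>p + f (p + c) = x\<close>, so
  it depends on \<open>c\<close> only through the translate of \<open>f\<close>. If two translates
  of \<open>f\<close> are uniformly close, so are the solutions, because \<open>f\<close> contracts
  by one half; closeness of the translates of \<open>w\<close> then finishes the estimate.\<close>

lemma AC_comp: assumes W: "AC (cf w)" shows "AC (cf (%y. w (ps y)))"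
proof (rule ACI)
  show "\<exists>M. \<forall>\<tau> x. \<bar>cf (%y. w (ps y)) \<tau> x\<bar> <= M" using AC_bdd[OF W] by auto
  show "\<exists>d>0. \<forall>\<tau> \<tau>' x x'. dist \<tau> \<tau>' < d --> dist x x' < d --> \<bar>cf (%y. w (ps y)) \<tau> x - cf (%y. w (ps y)) \<tau>' x'\<bar> < e" if e: "e > 0" for e
  proof -
    obtain d where d: "d>0" "\<And>\<tau> \<tau>' x x'. dist \<tau> \<tau>' < d ==> dist x x' < d ==> \<bar>cf w \<tau> x - cf w \<tau>' x'\<bar> < e"
      using AC_ucont[OF W e] by blast
    have "dist (ps x) (ps x') < d" if "dist x x' < d/2" for x x' using ps_lip[of x x'] that by (simp add: dist_norm)
    then show ?thesis using d(1) d(2)[of 0 0] by (intro exI[of _ "d/2"]) simp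
  qed
  fix cc :: "nat => real^'n"
  \<comment> \<open>One subsequence has to serve \<open>w\<close> and all components of
    \<open>f\<close>; \<open>None\<close> stands for \<open>w\<close>.\<close>
  define FF where "FF = case_option (cf w) (vf f)"
  have "AC (FF i)" for i unfolding FF_def using W smooth_AC[OF smooth_f] by (cases i) auto
  then obtain r :: "nat => nat" where r: "strict_mono r"
    "\<And>i e. e > 0 ==> transl_cauchy (FF i) cc r e"
    using AC_seq_finite[of UNIV FF cc] by auto
  have "transl_cauchy (cf (%y. w (ps y))) cc r e" if e: "e > 0" for e
  proof -
    obtain d where d: "d>0" "\<And>\<tau> \<tau>' x x'. dist \<tau> \<tau>' < d ==> dist x x' < d ==> \<bar>cf w \<tau> x - cf w \<tau>' x'\<bar> < e/2"
      using AC_ucont[OF W half_gt_zero[OF e]] by blast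
    \<comment> \<open>The bound \<open>2 * CARD('n) * d'\<close> on the distance of \<open>p\<close>
      and \<open>q\<close> found below must stay under \<open>d\<close>.\<close>
    define d' where "d' = d / (2 * real CARD('n) + 2)"
    have d': "d' > 0" using d(1) by (simp add: d'_def)
    obtain M0 where M0: "\<And>m n \<tau> x. m >= M0 ==> n >= M0 ==> \<bar>cf w \<tau> (x + cc (r m)) - cf w \<tau> (x + cc (r n))\<bar> < e/2"
      using r(2)[OF half_gt_zero[OF e], of None] unfolding FF_def by auto
    have "transl_cauchy (vf f j) cc r d'" for j
      using r(2)[OF d', of "Some j"] unfolding FF_def by simp
    from choice[OF allI[OF this]] obtain M1 where M1: "\<forall>j. \<forall>m\<ge>M1 j. \<forall>n\<ge>M1 j. \<forall>\<tau> x. \<bar>vf f j \<tau> (x + cc (r m)) - vf f j \<tau> (x + cc (r n))\<bar> < d'" ..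
    define M where "M = max M0 (Max (range M1))"
    have "\<bar>w (ps (x + cc (r m))) - w (ps (x + cc (r n)))\<bar> < e" if m: "m >= M" "n >= M" for m n x
    proof -
      define p q where "p = ps (x + cc (r m)) - cc (r m)" and "q = ps (x + cc (r n)) - cc (r n)"
      have 1: "p + f (p + cc (r m)) = x" "q + f (q + cc (r n)) = x"
        using ph_ps[of "x + cc (r m)"] ph_ps[of "x + cc (r n)"] unfolding ph_def p_def q_def by (simp_all add: algebra_simps)
      have "\<bar>(f (q + cc (r m)) - f (q + cc (r n))) $ j\<bar> <= d'" for j
      proof -
        have "M1 j <= Max (range M1)" by simp
        then have "m >= M1 j" "n >= M1 j" using m unfolding M_def by linarith+
        then show ?thesis using M1[rule_format, of j m n 0 q] by simp
      qed
      then have "norm (f (q + cc (r m)) - f (q + cc (r n))) <= (\<Sum>j\<in>(UNIV::'n set). d')"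
        by (intro order_trans[OF norm_le_l1_cart] sum_mono)
      then have 2: "norm (f (q + cc (r m)) - f (q + cc (r n))) <= real CARD('n) * d'" by simp
      have "p - q = - ((f (p + cc (r m)) - f (q + cc (r m))) + (f (q + cc (r m)) - f (q + cc (r n))))"
        using 1 by (simp add: algebra_simps)
      then have "norm (p - q) <= norm (f (p + cc (r m)) - f (q + cc (r m))) + norm (f (q + cc (r m)) - f (q + cc (r n)))"
        by (metis norm_minus_cancel norm_triangle_ineq)
      moreover have "norm (f (p + cc (r m)) - f (q + cc (r m))) <= (1/2) * norm (p - q)" using lip[of "p + cc (r m)" "q + cc (r m)"] by simp
      ultimately have "norm (p - q) <= 2 * real CARD('n) * d'" using 2 by linarith
      also have "\<dots> < d" unfolding d'_def using d(1) by (simp add: field_simps)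
      finally have "\<bar>w (p + cc (r m)) - w (q + cc (r m))\<bar> < e/2" using d(2)[of 0 0 "p + cc (r m)" "q + cc (r m)"] d(1) by (simp add: dist_norm)
      moreover have "\<bar>w (q + cc (r m)) - w (q + cc (r n))\<bar> < e/2" using M0[of m n 0 q] m unfolding M_def by simp
      moreover have "w (ps (x + cc (r m))) = w (p + cc (r m))" "w (ps (x + cc (r n))) = w (q + cc (r n))" unfolding p_def q_def by simp_all
      ultimately show ?thesis by linarith
    qed
    then show ?thesis unfolding cf_apply by blast
  qed
  then show "\<exists>r::nat=>nat. strict_mono r \<and> (\<forall>e>0. transl_cauchy (cf (%y. w (ps y))) cc r e)"
    using r(1) by blast
qed

lemma hasD_comp:
  assumes w: "smooth (cf w)"
  shows "hasD (Some i) (cf (%y. w (ps y))) (cf (%y. G1 c i (cf w) 0 (ps y)))"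
  unfolding hasD_cf
proof
  fix y
  have w': "(w has_derivative (%h. \<Sum>k\<in>UNIV. h $ k * dx k (cf w) 0 (ps y))) (at (ps y))"
    using smooth_has_derivative[OF w, of 0 "ps y"] by (simp add: cf_def)
  have 0: "((%t. y + t *\<^sub>R axis i (1::real)) has_derivative (%t. t *\<^sub>R axis i 1)) (at 0)" by (auto intro!: derivative_eq_intros)
  have ps': "(ps has_derivative (%h. Gx (ps y) *v h)) (at (y + 0 *\<^sub>R axis i (1::real)))" using ps_deriv by simp
  have 1: "((%t. ps (y + t *\<^sub>R axis i 1)) has_derivative (%t. Gx (ps y) *v (t *\<^sub>R axis i 1))) (at 0)"
    by (rule has_derivative_compose[OF 0 ps'])
  have w'': "(w has_derivative (%h. \<Sum>k\<in>UNIV. h $ k * dx k (cf w) 0 (ps y))) (at (ps (y + 0 *\<^sub>R axis i (1::real))))" using w' by simp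
  have 2: "((%t. w (ps (y + t *\<^sub>R axis i 1))) has_derivative (%t. \<Sum>k\<in>UNIV. (Gx (ps y) *v (t *\<^sub>R axis i 1)) $ k * dx k (cf w) 0 (ps y))) (at 0)"
    by (rule has_derivative_compose[OF 1 w''])
  have g: "(Gx (ps y) *v (t *\<^sub>R axis i 1)) $ k = t * (kd k i + gg c k i 0 (ps y))" for t k
  proof -
    have ax: "axis i (1::real) $ j = kd j i" for j by (simp add: axis_def kd_def)
    have "(Gx (ps y) *v (t *\<^sub>R axis i 1)) $ k = (\<Sum>j\<in>UNIV. ((kd k j + gg c k j 0 (ps y)) * t) * kd j i)"
      unfolding matrix_vector_mult_def Gx_def by (simp add: ax mult.assoc)
    then show ?thesis unfolding kd_sum by (simp add: mult.commute)
  qed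
  have "(\<Sum>k\<in>UNIV. (Gx (ps y) *v (t *\<^sub>R axis i 1)) $ k * dx k (cf w) 0 (ps y)) = t * G1 c i (cf w) 0 (ps y)" for t
  proof -
    have "(\<Sum>k\<in>UNIV. kd k i * dx k (cf w) 0 (ps y)) = dx i (cf w) 0 (ps y)"
      by (simp add: kd_def if_distrib[of "%z. z * _"] cong: if_cong)
    then show ?thesis unfolding g G1_def
      by (simp add: sum_fld_apply distrib_right distrib_left sum.distrib mult.assoc sum_distrib_left[symmetric])
  qed
  then have "(%t. \<Sum>k\<in>UNIV. (Gx (ps y) *v (t *\<^sub>R axis i 1)) $ k * dx k (cf w) 0 (ps y)) = (%t. G1 c i (cf w) 0 (ps y) * t)"
    by (intro ext) (simp add: mult.commute)
  then show "((%t. w (ps (y + t *\<^sub>R axis i 1))) has_real_derivative G1 c i (cf w) 0 (ps y)) (at 0)"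
    using 2 unfolding has_field_derivative_def by simp
qed

lemma smooth_cf_slice: "smooth F ==> smooth (cf (F 0))"
  using smooth_rp[OF reparam_const, of F 0] by (simp add: rp_def cf_def)

text \<open>Functions composed with \<open>ps\<close> are closed under derivatives, since by
  \<open>hasD_comp\<close> a derivative replaces \<open>w\<close> by the smooth
  \<open>G1 c i (cf w)\<close>. The zero field accounts for the derivative in the parameter.\<close>

lemma smooth_comp: assumes "smooth (cf w)" shows "smooth (cf (%y. w (ps y)))"
proof (rule smoothI_coind[where P = "%F. F = 0 \<or> (\<exists>w. smooth (cf w) \<and> F = cf (%y. w (ps y)))"])
  show "cf (%y. w (ps y)) = 0 \<or> (\<exists>w'. smooth (cf w') \<and> cf (%y. w (ps y)) = cf (%y. w' (ps y)))" using assms by blast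
  fix F :: "'n fld" assume P: "F = 0 \<or> (\<exists>w. smooth (cf w) \<and> F = cf (%y. w (ps y)))"
  show "AC F" using P AC_comp[OF smooth_AC] smooth_AC[OF smooth_0] by blast
  fix i
  show "hasD i F (D i F) \<and> (D i F = 0 \<or> (\<exists>w. smooth (cf w) \<and> D i F = cf (%y. w (ps y))))"
  proof (cases "F = 0")
    case True
    then show ?thesis using smooth_hasD[OF smooth_0, of i] by (simp add: D_0)
  next
    case False
    then obtain w where w: "smooth (cf w)" "F = cf (%y. w (ps y))" using P by blast
    show ?thesis
    proof (cases i)
      case None
      then show ?thesis using hasD_None_cf[of "%y. w (ps y)"] hasD_D unfolding w(2) by metis
    next
      case (Some j)
      have "smooth (cf (G1 c j (cf w) 0))" by (rule smooth_cf_slice[OF smooth_G1[OF sm w(1)]])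
      then show ?thesis using hasD_comp[OF w(1), of j] hasD_D unfolding w(2) Some by metis
    qed
  qed
qed

lemma dx_comp: "smooth (cf w) ==> dx i (cf (%y. w (ps y))) = cf (%y. G1 c i (cf w) 0 (ps y))"
  by (rule hasD_D[OF hasD_comp])

end

section \<open>The geodesic equation in Lagrangian coordinates\<close>

definition Af :: "real => 'n::finite fld => 'n fld" where "Af a F = F - cst a * (\<Sum>i\<in>UNIV. dx i (dx i F))"

lemma vf_Aop: "vf (Aop \<alpha> F) j = Af (\<alpha>\<^sup>2) (vf F j)"
  unfolding Af_def vf_def D_cf by (simp add: fun_eq_iff comp_def Aop_def lap_def sum_fld_apply)

lemma dx_Af: assumes F: "smooth F" shows "dx k (Af a F) = dx k F - cst a * (\<Sum>i\<in>UNIV. dx k (dx i (dx i F)))"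
proof -
  note s = smooth_D[OF smooth_D[OF F]]
  show ?thesis
    unfolding Af_def D_diff[OF F smooth_mult[OF smooth_cst smooth_sum[OF s]]] D_cmult[OF smooth_sum[OF s]] D_sum[OF s] ..
qed

lemma dxx_mult:
  assumes F: "smooth F" and G: "smooth G"
  shows "dx i (dx i (F * G)) = dx i (dx i F) * G + cst 2 * (dx i F * dx i G) + F * dx i (dx i G)"
proof -
  note F' = smooth_D[OF F] note G' = smooth_D[OF G]
  have "dx i (dx i (F * G)) = (dx i (dx i F) * G + dx i F * dx i G) + (dx i F * dx i G + F * dx i (dx i G))"
    unfolding D_mult[OF F G] D_add[OF smooth_mult[OF F' G] smooth_mult[OF F G']] D_mult[OF F' G] D_mult[OF F G'] ..
  then show ?thesis by (simp add: fun_eq_iff)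
qed

text \<open>The third derivatives of \<open>u\<close> in \<open>A[(grad u) u]\<close> and in
  \<open>(grad A u) u\<close> are the same double sum up to the order of differentiation and
  summation, hence cancel. What remains contains at most two derivatives, the number that the
  resolvent regains.\<close>

lemma vf_Bop:
  fixes u :: "'n::finite vfun"
  assumes u: "Cinf_ap u"
  defines "U \<equiv> vf u"
  shows "vf (Bop \<alpha> u) j = cst (- \<alpha>\<^sup>2) * (\<Sum>i\<in>UNIV. \<Sum>k\<in>UNIV. dx i (dx i (U k)) * dx k (U j) + cst 2 * (dx i (U k) * dx i (dx k (U j))))
     - (\<Sum>k\<in>UNIV. dx k (U k) * Af (\<alpha>\<^sup>2) (U j)) - (\<Sum>k\<in>UNIV. dx j (U k) * Af (\<alpha>\<^sup>2) (U k))"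
proof -
  let ?a = "\<alpha>\<^sup>2"
  have U: "smooth (U k)" for k using u unfolding Cinf_vf U_def by blast
  have B: "vf (Bop \<alpha> u) j = Af ?a (\<Sum>k\<in>UNIV. dx k (U j) * U k) - (\<Sum>k\<in>UNIV. dx k (Af ?a (U j)) * U k)
     - (\<Sum>k\<in>UNIV. dx k (U k) * Af ?a (U j)) - (\<Sum>k\<in>UNIV. dx j (U k) * Af ?a (U k))"
  proof (intro ext)
    fix \<tau> and x :: "real^'n"
    have 1: "vf (%y. jac u y *v u y) j = (\<Sum>k\<in>UNIV. dx k (U j) * U k)"
      unfolding U_def vf_def D_cf by (simp add: fun_eq_iff comp_def matrix_vector_mult_def jac_def sum_fld_apply)
    have A: "Aop \<alpha> F x $ i = Af ?a (vf F i) \<tau> x" for F i using vf_Aop[of \<alpha> F i] by (metis vf_apply)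
    have P: "pd k (comp i F) x = dx k (vf F i) \<tau> x" for F k i unfolding vf_def D_cf by simp
    have "Bop \<alpha> u x $ j = Aop \<alpha> (%y. jac u y *v u y) x $ j - (\<Sum>k\<in>UNIV. pd k (comp j (Aop \<alpha> u)) x * u x $ k)
       - (divg u x * Aop \<alpha> u x $ j + (\<Sum>k\<in>UNIV. pd j (comp k u) x * Aop \<alpha> u x $ k))"
      unfolding Bop_def by (simp add: matrix_vector_mult_def transpose_def jac_def)
    also have "\<dots> = Af ?a (\<Sum>k\<in>UNIV. dx k (U j) * U k) \<tau> x - (\<Sum>k\<in>UNIV. dx k (Af ?a (U j)) \<tau> x * U k \<tau> x)
       - ((\<Sum>k\<in>UNIV. dx k (U k) \<tau> x) * Af ?a (U j) \<tau> x + (\<Sum>k\<in>UNIV. dx j (U k) \<tau> x * Af ?a (U k) \<tau> x))"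
      unfolding divg_def P A 1 vf_Aop by (simp add: U_def)
    finally show "vf (Bop \<alpha> u) j \<tau> x = (Af ?a (\<Sum>k\<in>UNIV. dx k (U j) * U k) - (\<Sum>k\<in>UNIV. dx k (Af ?a (U j)) * U k)
       - (\<Sum>k\<in>UNIV. dx k (U k) * Af ?a (U j)) - (\<Sum>k\<in>UNIV. dx j (U k) * Af ?a (U k))) \<tau> x"
      by (simp only: vf_apply fun_diff_def times_fun_apply sum_fld_apply sum_distrib_right diff_diff_eq)
  qed
  have m: "smooth (dx k (U j) * U k)" for k by (intro smooth_mult smooth_D U)
  have D2: "dx i (dx i (\<Sum>k\<in>UNIV. dx k (U j) * U k)) =
      (\<Sum>k\<in>UNIV. dx i (dx i (dx k (U j))) * U k + cst 2 * (dx i (dx k (U j)) * dx i (U k)) + dx k (U j) * dx i (dx i (U k)))" for i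
    unfolding D_sum[OF m] D_sum[OF smooth_D[OF m]] dxx_mult[OF smooth_D[OF U] U] ..
  have c: "dx k (dx i (dx i (U j))) = dx i (dx i (dx k (U j)))" for i k
    unfolding D_commute[OF U, of "Some i" "Some k", symmetric] D_commute[OF smooth_D[OF U], of "Some i" "Some k", symmetric] ..
  have cs: "(\<Sum>i\<in>UNIV. dx k (dx i (dx i (U j)))) = (\<Sum>i\<in>UNIV. dx i (dx i (dx k (U j))))" for k
    by (rule sum.cong[OF refl c])
  show ?thesis unfolding B
  proof (intro ext, goal_cases)
    case (1 \<tau> x)
    have "Af ?a (\<Sum>k\<in>UNIV. dx k (U j) * U k) \<tau> x - (\<Sum>k\<in>UNIV. dx k (Af ?a (U j)) * U k) \<tau> x
      = (\<Sum>k\<in>UNIV. dx k (U j) \<tau> x * U k \<tau> x) - ?a * (\<Sum>i\<in>UNIV. \<Sum>k\<in>UNIV. dx i (dx i (dx k (U j))) \<tau> x * U k \<tau> x + 2 * (dx i (dx k (U j)) \<tau> x * dx i (U k) \<tau> x) + dx k (U j) \<tau> x * dx i (dx i (U k)) \<tau> x)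
       - (\<Sum>k\<in>UNIV. (dx k (U j) \<tau> x - ?a * (\<Sum>i\<in>UNIV. dx i (dx i (dx k (U j))) \<tau> x)) * U k \<tau> x)"
      unfolding dx_Af[OF U] cs unfolding Af_def D2
      by (simp only: fun_diff_def times_fun_apply sum_fld_apply plus_fun_apply)
    also have "\<dots> = - ?a * (\<Sum>i\<in>UNIV. \<Sum>k\<in>UNIV. dx i (dx i (U k)) \<tau> x * dx k (U j) \<tau> x + 2 * (dx i (U k) \<tau> x * dx i (dx k (U j)) \<tau> x))"
    proof -
      have "(\<Sum>k\<in>UNIV. (dx k (U j) \<tau> x - ?a * (\<Sum>i\<in>UNIV. dx i (dx i (dx k (U j))) \<tau> x)) * U k \<tau> x)
        = (\<Sum>k\<in>UNIV. dx k (U j) \<tau> x * U k \<tau> x) - ?a * (\<Sum>k\<in>UNIV. \<Sum>i\<in>UNIV. dx i (dx i (dx k (U j))) \<tau> x * U k \<tau> x)"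
        by (simp add: left_diff_distrib sum_subtractf sum_distrib_left sum_distrib_right mult.assoc)
      moreover have "(\<Sum>k\<in>UNIV. \<Sum>i\<in>UNIV. dx i (dx i (dx k (U j))) \<tau> x * U k \<tau> x) = (\<Sum>i\<in>UNIV. \<Sum>k\<in>UNIV. dx i (dx i (dx k (U j))) \<tau> x * U k \<tau> x)"
        by (rule sum.swap)
      ultimately show ?thesis by (simp add: sum.distrib algebra_simps)
    qed
    finally show ?case by (simp only: fun_diff_def times_fun_apply sum_fld_apply plus_fun_apply)
  qed
qed

section \<open>Return to Eulerian coordinates\<close>

context small_diff
begin

definition pb :: "'n fld => 'n fld" where "pb F = cf (%y. F 0 (ps y))"

lemma pb_apply: "pb F \<tau> x = F 0 (ps x)" by (simp add: pb_def)

lemma pb_ops: "pb (F + G) = pb F + pb G" "pb (F - G) = pb F - pb G" "pb (F * G) = pb F * pb G" "pb (cst r) = cst r"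
  "pb (\<Sum>i\<in>A. H i) = (\<Sum>i\<in>A. pb (H i))"
  by (simp_all add: fun_eq_iff pb_apply sum_fld_apply)

lemma smooth_pb: "smooth F ==> smooth (pb F)"
  unfolding pb_def by (rule smooth_comp[OF smooth_cf_slice])

lemma dx_pb: assumes F: "smooth F" shows "dx i (pb F) = pb (G1 c i F)"
proof -
  have "cf (F 0) = slice 0 F" by (simp add: cf_def rp_def)
  then have d: "dx k (cf (F 0)) 0 x = dx k F 0 x" for k x using D_rp[OF reparam_const F, of k 0] by (simp add: rp_def)
  show ?thesis
    unfolding pb_def dx_comp[OF smooth_cf_slice[OF F]] by (simp add: fun_eq_iff G1_def sum_fld_apply d)
qed

lemma dx2_pb: assumes F: "smooth F" shows "dx i (dx j (pb F)) = pb (G2 c i j F)"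
  unfolding dx_pb[OF F] dx_pb[OF smooth_G1[OF sm F]] G2_eq[OF sm F] ..

lemma Af_pb: "smooth F ==> Af a (pb F) = pb (F - cst a * (\<Sum>i\<in>UNIV. G2 c i i F))"
  unfolding Af_def dx2_pb pb_ops ..

lemma vf_ps: "vf (%y. w (ps y)) j = pb (vf w j)" by (simp add: fun_eq_iff pb_apply)

lemma Bop_pb:
  assumes v: "\<And>j. c (IV j) = vf v j"
  shows "vf (Bop \<alpha> (%y. v (ps y))) j = pb (bq (\<alpha>\<^sup>2) c j)" "Cinf_ap (%y. v (ps y))"
proof -
  have V: "smooth (vf v k)" for k using smcD[OF sm, of "IV k"] unfolding v .
  show ci: "Cinf_ap (%y. v (ps y))" unfolding Cinf_vf vf_ps using smooth_pb[OF V] by blast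
  show "vf (Bop \<alpha> (%y. v (ps y))) j = pb (bq (\<alpha>\<^sup>2) c j)"
    unfolding vf_Bop[OF ci] bq_def v vf_ps unfolding dx2_pb[OF V] Af_pb[OF V] unfolding dx_pb[OF V] pb_ops ..
qed

text \<open>The equation for \<open>w\<close> says that \<open>A\<close> maps \<open>w\<close>
  composed with \<open>ps\<close> to \<open>B_alpha\<close>; uniqueness for the Helmholtz equation
  identifies this function with the one described by \<open>Ainv\<close>.\<close>

lemma Ainv_Bop_aux:
  assumes v: "\<And>j. c (IV j) = vf v j" and W: "\<And>j. c (IW j) = SS (\<alpha>\<^sup>2) (rhs (\<alpha>\<^sup>2) c j)" and a: "\<alpha> \<noteq> 0"
    and w: "\<And>j x. w x $ j = c (IW j) 0 x"
  shows "Ainv \<alpha> (Bop \<alpha> (%y. v (ps y))) = (%y. w (ps y))"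
proof -
  let ?a = "\<alpha>\<^sup>2" and ?B = "Bop \<alpha> (%y. v (ps y))"
  have a': "?a > 0" using a by simp
  have pw: "vf (%y. w (ps y)) j = pb (c (IW j))" for j by (simp add: fun_eq_iff pb_apply w)
  \<comment> \<open>Undoes the splitting in \<open>rhs\<close>: \<open>SS_inverse\<close> removes
    the resolvent, and \<open>G2r\<close> recombines with the flat Laplacian to
    \<open>G2\<close>.\<close>
  have inv: "c (IW j) - cst ?a * (\<Sum>i\<in>UNIV. G2 c i i (c (IW j))) = bq ?a c j" for j
  proof (intro ext)
    fix \<tau> x
    note sr = smooth_rhs[OF sm, of ?a j]
    have d: "dx i (dx i (SS ?a (rhs ?a c j))) = SS ?a (dx i (dx i (rhs ?a c j)))" for i
      unfolding fop_D[OF fop_SS[OF a'] sr] fop_D[OF fop_SS[OF a'] smooth_D[OF sr]] ..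
    have "c (IW j) \<tau> x - ?a * (\<Sum>i\<in>UNIV. dx i (dx i (c (IW j))) \<tau> x) = rhs ?a c j \<tau> x"
      unfolding W d by (rule SS_inverse[OF a' sr])
    then show "(c (IW j) - cst ?a * (\<Sum>i\<in>UNIV. G2 c i i (c (IW j)))) \<tau> x = bq ?a c j \<tau> x"
      unfolding rhs_def G2_def by (simp add: sum_fld_apply sum.distrib algebra_simps)
  qed
  have 1: "Cinf_ap (%y. w (ps y))" unfolding Cinf_vf pw using smooth_pb[OF smcD[OF sm]] by blast
  have 2: "Aop \<alpha> (%y. w (ps y)) = ?B"
    by (rule vf_inject) (unfold vf_Aop pw Af_pb[OF smcD[OF sm]] inv Bop_pb(1)[OF v], rule refl)
  show ?thesis unfolding Ainv_def
  proof (rule the_equality)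
    fix F assume F: "Cinf_ap F \<and> Aop \<alpha> F = ?B"
    then have "Af ?a (vf F j) = Af ?a (vf (%y. w (ps y)) j)" for j using 2 vf_Aop by metis
    then have e: "Af ?a (vf F j) \<tau> x = Af ?a (vf (%y. w (ps y)) j) \<tau> x" for j \<tau> x by simp
    have "vf F j \<tau> x = vf (%y. w (ps y)) j \<tau> x" for j \<tau> x
    proof (rule helmholtz_unique[where a = ?a])
      show "smooth (vf F j)" "smooth (vf (%y. w (ps y)) j)" using F 1 unfolding Cinf_vf by blast+
      show "vf F j \<tau> x - ?a * (\<Sum>i\<in>UNIV. dx i (dx i (vf F j)) \<tau> x) = vf (%y. w (ps y)) j \<tau> x - ?a * (\<Sum>i\<in>UNIV. dx i (dx i (vf (%y. w (ps y)) j)) \<tau> x)" for x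
        using e[of j \<tau> x] unfolding Af_def fun_diff_def times_fun_apply sum_fld_apply .
    qed simp
    then show "F = (%y. w (ps y))" by (intro vf_inject ext)
  qed (use 1 2 in blast)
qed

end

lemma Ainv_Bop:
  fixes c :: "'n::finite cfg"
  assumes "smc c" "\<And>j. c (IF j) = vf f j" "\<And>j. c (IV j) = vf v j"
    and "\<And>j. c (IW j) = Fout (\<alpha>\<^sup>2) c (IW j)" "\<And>j i. c (IH j i) = Fout (\<alpha>\<^sup>2) c (IH j i)"
    and "\<And>x y. norm (f x - f y) <= (1/2) * norm (x - y)" and "\<alpha> \<noteq> 0" and \<phi>: "\<And>x. \<phi> x = x + f x"
  shows "Ainv \<alpha> (Bop \<alpha> (%y. v (inv \<phi> y))) (\<phi> x) $ j = c (IW j) 0 x"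
proof -
  interpret small_diff c f using assms by unfold_locales simp_all
  have "\<phi> = ph" by (simp add: fun_eq_iff \<phi> ph_def)
  moreover have "Ainv \<alpha> (Bop \<alpha> (%y. v (ps y))) = (%y. (\<chi> j. c (IW j) 0 (ps y)))"
    by (rule Ainv_Bop_aux[where w = "%x. \<chi> j. c (IW j) 0 x"]) (use assms in simp_all)
  ultimately show ?thesis by (simp add: ps_def[symmetric])
qed

text \<open>All operations in \<open>Fout\<close> act in \<open>x\<close> at fixed \<tau>, so they
  commute with substitutions for \<tau>. A constant substitution gives the equations at one time,
  the substitution \<open>ge e\<close> those at one value of the parameter.\<close>

lemma Fout_rp:
  fixes c :: "'n::finite cfg"
  assumes g: "reparam g" and c: "smc c" shows "Fout a (%b. rp g (c b)) b = rp g (Fout a c b)"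
proof -
  have S: "SS a (rp g F) = rp g (SS a F)" for F by (simp add: fun_eq_iff rp_def SS_def EF_def)
  note s0 = smcD[OF c] and s1 = smooth_D[OF smcD[OF c]]
  have "rhs a (%b. rp g (c b)) j = rp g (rhs a c j)" for j
    unfolding rhs_def bq_def G2_def G2r_def dG1r_def G1_def gg_def dgg_def rp_ops D_rp[OF g s0] D_rp[OF g s1] ..
  then show ?thesis by (cases b) (simp_all only: Fout.simps S rp_ops gg_def D_rp[OF g s0])
qed

section \<open>The topology of smooth almost periodic fields\<close>

abbreviation DX :: "'n::finite list => 'n fld => 'n fld" where "DX is \<equiv> DL (map Some is)"

lemma DL_append: "DL (is @ js) F = DL js (DL is F)" by (induction "is" arbitrary: F) auto

lemma DX_cf: "DX is (cf u) = cf (dpart (rev is) u)"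
proof (induction "is" rule: rev_induct)
  case (snoc i "is")
  then show ?case by (simp only: map_append DL_append rev_append list.map DL.simps rev.simps append.simps cf_dpart)
qed simp

lemma DL_add: "smooth F ==> smooth G ==> DL is (F + G) = DL is F + DL is G"
  by (induction "is" arbitrary: F G) (simp_all only: DL.simps D_add smooth_D)

lemma Cinf_Ckb: "Cinf_ap F ==> Ckb k (comp j F)" unfolding Cinf_iff using Ckb_smooth by blast

lemma nv_comp: assumes "Cinf_ap F" "length is <= k" shows "\<bar>DX is (vf F j) \<tau> x\<bar> <= normk_vec k F"
proof -
  have "\<bar>DX is (vf F j) \<tau> x\<bar> <= normk k (comp j F)"
    unfolding vf_def DX_cf cf_apply by (rule normk_ge[OF Cinf_Ckb[OF assms(1)]]) (simp add: assms(2))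
  also have "\<dots> <= normk_vec k F" unfolding normk_vec_def by (rule Max_ge) auto
  finally show ?thesis .
qed

lemma nv_nonneg: "Cinf_ap F ==> 0 <= normk_vec k F" using nv_comp[of F "[]" k undefined 0 0] by simp

lemma nv_le: assumes "\<And>j is x. length is <= k ==> \<bar>DX is (vf F j) 0 x\<bar> <= c" shows "normk_vec k F <= c"
proof -
  have "normk k (comp j F) <= c" for j
  proof (rule normk_le)
    fix "is" :: "'a list" and x assume "length is <= k"
    then show "\<bar>dpart is (comp j F) x\<bar> <= c" using assms[of "rev is" j x] unfolding vf_def DX_cf by simp
  qed
  then show ?thesis unfolding normk_vec_def by simp
qed

lemma nv_ops:
  assumes F: "Cinf_ap F" and G: "Cinf_ap G"
  shows "normk_vec k (fadd F G) <= normk_vec k F + normk_vec k G" "normk_vec k (fsub F G) <= normk_vec k F + normk_vec k G"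
    "normk_vec k (fscale r F) <= \<bar>r\<bar> * normk_vec k F"
proof -
  have s: "smooth (vf F j)" "smooth (vf G j)" for j using F G unfolding Cinf_vf by blast+
  have dc: "smooth H ==> DX is (cst r * H) = cst r * DX is H" for "is" and H :: "'a fld"
    by (induction "is" arbitrary: H) (simp_all only: list.map DL.simps D_cmult smooth_D)
  note b = nv_comp[OF F] nv_comp[OF G]
  show "normk_vec k (fadd F G) <= normk_vec k F + normk_vec k G"
    by (rule nv_le, unfold vf_ops DL_add[OF s] plus_fun_apply) (rule order_trans[OF abs_triangle_ineq add_mono[OF b]])
  show "normk_vec k (fsub F G) <= normk_vec k F + normk_vec k G"
    by (rule nv_le, unfold vf_ops, unfold DL_diff[OF s], unfold fun_diff_def) (rule order_trans[OF abs_triangle_ineq4 add_mono[OF b]])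
  show "normk_vec k (fscale r F) <= \<bar>r\<bar> * normk_vec k F"
    by (rule nv_le, unfold vf_ops dc[OF s(1)] times_fun_apply abs_mult) (intro mult_left_mono b(1) abs_ge_zero)
qed

lemma nv_mono: "Cinf_ap F ==> k <= l ==> normk_vec k F <= normk_vec l F"
  by (intro nv_le nv_comp) simp_all

lemma nv_triangle:
  assumes "Cinf_ap F" "Cinf_ap G" "Cinf_ap H"
  shows "normk_vec k (fsub F H) <= normk_vec k (fsub F G) + normk_vec k (fsub G H)"
proof -
  have "fsub F H = fadd (fsub F G) (fsub G H)" by (simp add: fun_eq_iff fsub_def fadd_def)
  then show ?thesis using nv_ops(1)[OF Cinf_ops(2)[OF assms(1,2)] Cinf_ops(2)[OF assms(2,3)]] by simp
qed

lemma nv_self: assumes "Cinf_ap F" shows "normk_vec k (fsub F F) = 0"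
proof -
  have "fsub F F = fscale 0 F" by (simp add: fun_eq_iff fsub_def fscale_def)
  then show ?thesis using nv_ops(3)[OF assms assms, of k 0] nv_nonneg[OF Cinf_ops(3)[OF assms, of 0], of k] by simp
qed

definition apball :: "nat => 'n::finite vfun => real => 'n vfun set" where
  "apball k F e = {G. Cinf_ap G \<and> normk_vec k (fsub G F) < e}"

lemma apball_open: "Cinf_ap F ==> k >= 1 ==> e > 0 ==> openin ap_top (apball k F e)"
  unfolding ap_top_def apball_def by (rule topology_generated_by_Basis) blast

lemma apball_self: "Cinf_ap F ==> e > 0 ==> F \<in> apball k F e" by (simp add: apball_def nv_self)

lemma apball_mono: assumes "Cinf_ap F" "k <= l" "d <= e" shows "apball l F d \<subseteq> apball k F e"
  unfolding apball_def using nv_mono[OF Cinf_ops(2)[OF _ assms(1)] assms(2)] assms(3) by fastforce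

lemma topspace_ap [simp]: "topspace ap_top = Collect Cinf_ap"
proof
  show "topspace ap_top \<subseteq> Collect Cinf_ap" unfolding ap_top_def topology_generated_by_topspace by blast
  show "Collect Cinf_ap \<subseteq> topspace ap_top"
    using apball_self[of _ 1 1] openin_subset[OF apball_open[of _ 1 1]] by auto
qed

text \<open>The seminorms increase with \<open>k\<close>, so an intersection of two balls around a
  point contains a ball; hence balls are a base and not only a subbase.\<close>

lemma openin_ap:
  "openin ap_top W \<longleftrightarrow> W \<subseteq> Collect Cinf_ap \<and> (\<forall>F\<in>W. \<exists>k e. k >= 1 \<and> e > 0 \<and> apball k F e \<subseteq> W)"
proof
  assume W: "openin ap_top W"
  have "\<forall>F\<in>W. \<exists>k e. k >= 1 \<and> e > 0 \<and> apball k F e \<subseteq> W"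
    using W unfolding ap_top_def openin_topology_generated_by_iff
  proof induction
    case (Int A B)
    show ?case
    proof
      fix F assume F: "F \<in> A \<inter> B"
      have "generate_topology_on {{G. Cinf_ap G \<and> normk_vec k (fsub G F) < e} | F k e. Cinf_ap F \<and> k >= 1 \<and> e > 0} A" by fact
      then have "Cinf_ap F" using F openin_subset[of ap_top A]
        unfolding topspace_ap unfolding ap_top_def openin_topology_generated_by_iff by blast
      obtain k e k' e' where "k >= 1" "e > 0" "apball k F e \<subseteq> A" "k' >= 1" "e' > 0" "apball k' F e' \<subseteq> B" using Int F by blast
      then show "\<exists>k e. k >= 1 \<and> e > 0 \<and> apball k F e \<subseteq> A \<inter> B"
        using apball_mono[OF \<open>Cinf_ap F\<close>, of k "max k k'" "min e e'" e] apball_mono[OF \<open>Cinf_ap F\<close>, of k' "max k k'" "min e e'" e']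
        by (intro exI[of _ "max k k'"] exI[of _ "min e e'"]) auto
    qed
  next
    case (UN K) then show ?case by blast
  next
    case (Basis s)
    then obtain F0 k e where s: "s = {G. Cinf_ap G \<and> normk_vec k (fsub G F0) < e}" "Cinf_ap F0" "k >= 1" "e > 0" by blast
    show ?case
    proof
      fix F assume "F \<in> s"
      then have F: "Cinf_ap F" "normk_vec k (fsub F F0) < e" unfolding s(1) by auto
      have "G \<in> s" if G: "G \<in> apball k F (e - normk_vec k (fsub F F0))" for G
        using nv_triangle[OF _ F(1) s(2), of G k] G unfolding apball_def s(1) by auto
      then show "\<exists>k e. k >= 1 \<and> e > 0 \<and> apball k F e \<subseteq> s" using F s(3) by (intro exI[of _ k] exI[of _ "e - normk_vec k (fsub F F0)"]) auto
    qed
  qed simp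
  then show "W \<subseteq> Collect Cinf_ap \<and> (\<forall>F\<in>W. \<exists>k e. k >= 1 \<and> e > 0 \<and> apball k F e \<subseteq> W)" using openin_subset[OF W] by simp
next
  assume W: "W \<subseteq> Collect Cinf_ap \<and> (\<forall>F\<in>W. \<exists>k e. k >= 1 \<and> e > 0 \<and> apball k F e \<subseteq> W)"
  show "openin ap_top W"
  proof (subst openin_subopen, intro ballI)
    fix F assume F: "F \<in> W"
    then obtain k e where "k >= 1" "e > 0" "apball k F e \<subseteq> W" using W by blast
    then show "\<exists>T. openin ap_top T \<and> F \<in> T \<and> T \<subseteq> W"
      using apball_open apball_self W F by (intro exI[of _ "apball k F e"]) blast
  qed
qed

lemma limitin_ap:
  "limitin ap_top g G Fl \<longleftrightarrow> Cinf_ap G \<and> (\<forall>k\<ge>1. \<forall>e>0. eventually (%s. g s \<in> apball k G e) Fl)"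
proof
  assume l: "limitin ap_top g G Fl"
  have G: "Cinf_ap G" using limitin_topspace[OF l] unfolding topspace_ap by simp
  have "eventually (%s. g s \<in> apball k G e) Fl" if "k >= 1" "e > 0" for k e
    using l apball_open[OF G that] apball_self[OF G that(2)] unfolding limitin_def by simp
  then show "Cinf_ap G \<and> (\<forall>k\<ge>1. \<forall>e>0. eventually (%s. g s \<in> apball k G e) Fl)" using G by simp
next
  assume r: "Cinf_ap G \<and> (\<forall>k\<ge>1. \<forall>e>0. eventually (%s. g s \<in> apball k G e) Fl)"
  show "limitin ap_top g G Fl" unfolding limitin_def
  proof (intro conjI allI impI)
    fix U assume U: "openin ap_top U \<and> G \<in> U"
    then obtain k e where k: "k >= 1" "e > 0" "apball k G e \<subseteq> U" unfolding openin_ap by meson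
    have "eventually (%s. g s \<in> apball k G e) Fl" using r k(1,2) by simp
    then show "eventually (%s. g s \<in> U) Fl" by (rule eventually_mono) (use k in blast)
  qed (use r in simp)
qed

lemma limitin_apI:
  assumes G: "Cinf_ap G" and g: "eventually (%s. Cinf_ap (g s)) Fl"
    and l: "\<And>is j e. e > 0 ==> eventually (%s. \<forall>x. \<bar>DX is (vf (g s) j) 0 x - DX is (vf G j) 0 x\<bar> < e) Fl"
  shows "limitin ap_top g G Fl"
  unfolding limitin_ap
proof (intro conjI G allI impI)
  fix k :: nat and e :: real assume "k >= 1" and e: "e > 0"
  have "finite ({is. set is \<subseteq> (UNIV :: 'a set) \<and> length is <= k} \<times> (UNIV :: 'a set))"
    by (intro finite_cartesian_product finite_lists_length_le) auto
  then have "eventually (%s. \<forall>p \<in> {is. set is \<subseteq> (UNIV :: 'a set) \<and> length is <= k} \<times> (UNIV :: 'a set).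
      \<forall>x. \<bar>DX (fst p) (vf (g s) (snd p)) 0 x - DX (fst p) (vf G (snd p)) 0 x\<bar> < e/2) Fl"
    by (rule eventually_ball_finite) (use l half_gt_zero[OF e] in blast)
  then show "eventually (%s. g s \<in> apball k G e) Fl" using g
  proof eventually_elim
    case (elim s)
    have "normk_vec k (fsub (g s) G) <= e/2"
    proof (rule nv_le)
      fix j :: 'a and "is" :: "'a list" and x assume i: "length is <= k"
      have sm: "smooth (vf (g s) j)" "smooth (vf G j)" using elim(2) G unfolding Cinf_vf by blast+
      have "\<bar>DX is (vf (g s) j) 0 x - DX is (vf G j) 0 x\<bar> < e/2" using elim(1)[rule_format, of "(is, j)" x] i by simp
      then show "\<bar>DX is (vf (fsub (g s) G) j) 0 x\<bar> <= e/2" unfolding vf_ops DL_diff[OF sm] by simp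
    qed
    then show ?case using elim(2) e by (simp add: apball_def)
  qed
qed

lemma limitin_apD:
  assumes l: "limitin ap_top g G Fl" and e: "e > 0"
  shows "eventually (%s. Cinf_ap (g s) \<and> (\<forall>\<tau> x. \<bar>DX is (vf (g s) j) \<tau> x - DX is (vf G j) \<tau> x\<bar> < e)) Fl"
proof -
  have G: "Cinf_ap G" and "eventually (%s. g s \<in> apball (Suc (length is)) G e) Fl" using l e unfolding limitin_ap by auto
  from this(2) show ?thesis
  proof eventually_elim
    case (elim s)
    then have s: "Cinf_ap (g s)" "normk_vec (Suc (length is)) (fsub (g s) G) < e" by (auto simp: apball_def)
    have sm: "smooth (vf (g s) j)" "smooth (vf G j)" using s(1) G unfolding Cinf_vf by blast+
    have "\<bar>DX is (vf (g s) j) \<tau> x - DX is (vf G j) \<tau> x\<bar> < e" for \<tau> x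
      using nv_comp[OF Cinf_ops(2)[OF s(1) G], of "is" "Suc (length is)" j \<tau> x] s(2) unfolding vf_ops DL_diff[OF sm] by simp
    then show ?case using s(1) by blast
  qed
qed

lemma limitin_ap_unique:
  assumes "limitin ap_top g G Fl" "limitin ap_top g H Fl" "Fl \<noteq> bot" shows "G = H"
proof (rule vf_inject, intro ext)
  fix j \<tau> x
  have "\<bar>vf G j \<tau> x - vf H j \<tau> x\<bar> <= 0 + e" if e: "e > 0" for e
  proof -
    have "eventually (%s. \<bar>vf G j \<tau> x - vf H j \<tau> x\<bar> <= e) Fl"
      using limitin_apD[OF assms(1) half_gt_zero[OF e], of "[]" j] limitin_apD[OF assms(2) half_gt_zero[OF e], of "[]" j]
    proof eventually_elim
      case (elim s)
      have "\<bar>vf (g s) j \<tau> x - vf G j \<tau> x\<bar> < e/2" "\<bar>vf (g s) j \<tau> x - vf H j \<tau> x\<bar> < e/2"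
        using elim by (simp_all only: list.map DL.simps)
      then show ?case by linarith
    qed
    then show ?thesis using eventually_happens[of _ Fl] assms(3) by auto
  qed
  then have "\<bar>vf G j \<tau> x - vf H j \<tau> x\<bar> <= 0" by (rule field_le_epsilon)
  then show "vf G j \<tau> x = vf H j \<tau> x" by simp
qed

text \<open>The step from \<open>k\<close> to \<open>Suc k\<close> pays for the Hoelder seminorm,
  which \<open>interpolation\<close> bounds by one more derivative. The derivatives in the parameter
  vanish on \<open>vf G\<close>.\<close>

lemma NN_nv: "\<exists>K\<ge>0. \<forall>G (j :: 'n::finite). Cinf_ap G --> NN k 1 (vf G j) <= K * normk_vec (Suc k) G"
proof -
  have "\<exists>K\<ge>0. \<forall>u B. smooth (cf u) --> (\<forall>is x. length is <= Suc k --> \<bar>DX is (cf u) 0 x\<bar> <= B) --> NN k 1 (cf u :: 'n fld) <= K * B"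
  proof (induction k)
    case 0
    have *: "N0 (cf u) <= (3 + real CARD('n)) * B" if u: "smooth (cf u)" and B: "\<forall>is x. length is <= Suc 0 --> \<bar>DX is (cf u) 0 x\<bar> <= B" for u :: "real^'n => real" and B
    proof -
      have b0: "\<bar>cf u \<tau> x\<bar> <= B" for \<tau> x using B[rule_format, of "[]" x] by simp
      have b1: "\<bar>dx i (cf u) \<tau> x\<bar> <= B" for i \<tau> x using B[rule_format, of "[i]" x] by (simp add: D_cf)
      have "B >= 0" using b0[of 0 0] by simp
      then have "N0 (cf u) <= B + (2 * B + real CARD('n) * B)"
        by (intro N0_le b0 interpolation[OF u b0 b1]) simp
      then show ?thesis by (simp add: algebra_simps)
    qed
    show ?case unfolding NN.simps(1) by (intro exI[of _ "3 + real CARD('n)"] conjI allI impI, simp) (rule *)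
  next
    case (Suc k)
    then obtain K where K: "K >= 0" "\<And>u B. smooth (cf u) ==> (\<And>is x. length is <= Suc k ==> \<bar>DX is (cf u) 0 x\<bar> <= B) ==> NN k 1 (cf u :: 'n fld) <= K * B" by blast
    have *: "NN (Suc k) 1 (cf u) <= (K + real (CARD('n option)) * K) * B"
      if u: "smooth (cf u)" and B: "\<forall>is x. length is <= Suc (Suc k) --> \<bar>DX is (cf u) 0 x\<bar> <= B" for u :: "real^'n => real" and B
    proof -
      have B0: "B >= 0" using B[rule_format, of "[]" 0] by simp
      have "NN k 1 (D i (cf u)) <= K * B" for i :: "'n option"
      proof (cases i)
        case None
        have z: "D i (cf u) = cf (%x. 0)" using hasD_D[OF hasD_None_cf] unfolding None cf_ring(5) by (simp only: zero_fun_def)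
        have "DX is (cf (%x. 0)) = (cst 0 :: 'n fld)" for "is" :: "'n list"
          by (induction "is") (simp_all only: cf_ring(5) list.map DL.simps D_cst zero_fun_def)
        then show ?thesis unfolding z using B0 by (intro K(2)) (simp_all only: cf_ring(5) smooth_cst abs_zero)
      next
        case (Some l)
        have z: "D i (cf u) = cf (pd l u)" unfolding Some D_cf ..
        show ?thesis unfolding z
        proof (rule K(2))
          show "smooth (cf (pd l u))" using smooth_D[OF u, of "Some l"] unfolding D_cf .
          show "\<bar>DX is (cf (pd l u)) 0 x\<bar> <= B" if "length is <= Suc k" for "is" x
            using B[rule_format, of "l # is" x] that unfolding list.map DL.simps D_cf by simp
        qed
      qed
      then have "(\<Sum>i\<in>(UNIV :: 'n option set). NN k 1 (D i (cf u))) <= (\<Sum>i\<in>(UNIV :: 'n option set). K * B)" by (rule sum_mono)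
      moreover have "NN k 1 (cf u) <= K * B" by (rule K(2)[OF u]) (use B in simp)
      ultimately show ?thesis unfolding NN.simps distrib_right sum_constant by simp
    qed
    show ?case by (intro exI[of _ "K + real (CARD('n option)) * K"] conjI allI impI, use K(1) in simp) (rule *)
  qed
  then obtain K where K: "K >= 0" "\<And>u B. smooth (cf u) ==> (\<And>is x. length is <= Suc k ==> \<bar>DX is (cf u) 0 x\<bar> <= B) ==> NN k 1 (cf u :: 'n fld) <= K * B" by blast
  have "NN k 1 (vf G j) <= K * normk_vec (Suc k) G" if G: "Cinf_ap G" for G and j :: 'n
    unfolding vf_def by (rule K(2)) (use G nv_comp[OF G] in \<open>auto simp: Cinf_iff vf_def\<close>)
  then show ?thesis using K(1) by blast
qed

section \<open>The Lagrangian systems\<close>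

definition ge :: "real => complex => complex" where "ge e \<tau> = Complex e (Im \<tau>)"

lemma reparam_ge: "reparam (ge e)"
proof -
  have "dist (Complex e (Im \<tau>)) (Complex e (Im \<tau>')) <= dist \<tau> \<tau>'" for \<tau> \<tau>'
    unfolding dist_Complex_Im using abs_Im_le_cmod[of "\<tau> - \<tau>'"] by (simp add: dist_complex_def)
  then show ?thesis by (simp add: reparam_def ge_def)
qed

text \<open>Linear operators acting in time only, by which position and velocity are recovered from
  the acceleration: combinations of \<open>J\<close> and \<open>E1\<close>.\<close>

definition gop :: "real => real => real => ('n::finite fld => 'n fld) => bool" where
  "gop a C B K \<longleftrightarrow> B >= 0 \<and> (\<forall>F. smooth F --> smooth (K F) \<and> (\<forall>i. dx i (K F) = K (dx i F)) \<and> (\<forall>N. adm a C N --> N (K F) <= B * N F)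
     \<and> (\<forall>e. rp (ge e) (K F) = K (rp (ge e) F)) \<and> (\<forall>G. smooth G --> K (F - G) = K F - K G))"

lemma gopD:
  assumes "gop a C B K"
  shows "B >= 0" "smooth F ==> smooth (K F)" "smooth F ==> dx i (K F) = K (dx i F)" "adm a C N ==> smooth F ==> N (K F) <= B * N F"
    "smooth F ==> rp (ge e) (K F) = K (rp (ge e) F)" "smooth F ==> smooth G ==> K (F - G) = K F - K G"
  using assms unfolding gop_def by blast+

lemma gop_J: "gop a C 1 J" and gop_E1: "gop a C 1 E1"
  unfolding gop_def
  by (intro conjI allI impI zero_le_one smooth_J smooth_E1 fop_D[OF fop_J] fop_D[OF fop_E1] fop_diff[OF fop_J] fop_diff[OF fop_E1] smooth_AC;
      (simp add: admD; fail)?; simp add: rp_def ge_def J_def E1_def)+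

lemma gop_0: "gop a C 0 (%F. 0)"
  unfolding gop_def by (simp add: smooth_0 D_0 rp_ops adm_0)

lemma gop_comp: assumes K: "gop a C B K" and L: "gop a C B' L" shows "gop a C (B * B') (%F. K (L F))"
  unfolding gop_def
proof (intro conjI allI impI)
  fix F G :: "'a fld" and N :: "'a fld => real" and i e assume F: "smooth F"
  note k = gopD[OF K] and l = gopD[OF L]
  show "smooth (K (L F))" by (intro k l F)
  show "dx i (K (L F)) = K (L (dx i F))" unfolding k(3)[OF l(2)[OF F]] l(3)[OF F] ..
  show "rp (ge e) (K (L F)) = K (L (rp (ge e) F))" unfolding k(5)[OF l(2)[OF F]] l(5)[OF F] ..
  show "smooth G ==> K (L (F - G)) = K (L F) - K (L G)" unfolding l(6)[OF F] by (rule k(6)[OF l(2)[OF F] l(2)])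
  assume N: "adm a C N"
  have "N (K (L F)) <= B * N (L F)" by (rule k(4)[OF N l(2)[OF F]])
  also have "\<dots> <= B * (B' * N F)" by (intro mult_left_mono l(4)[OF N F] k(1))
  finally show "N (K (L F)) <= B * B' * N F" by (simp only: mult.assoc)
qed (use gopD(1)[OF K] gopD(1)[OF L] in simp)

lemma gop_diff: assumes K: "gop a C B K" and L: "gop a C B' L" shows "gop a C (B + B') (%F. K F - L F)"
  unfolding gop_def
proof (intro conjI allI impI)
  fix F G :: "'a fld" and N :: "'a fld => real" and i e assume F: "smooth F"
  note k = gopD[OF K] and l = gopD[OF L]
  show "smooth (K F - L F)" by (intro smooth_diff k l F)
  show "dx i (K F - L F) = K (dx i F) - L (dx i F)" unfolding D_diff[OF k(2)[OF F] l(2)[OF F]] k(3)[OF F] l(3)[OF F] ..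
  show "rp (ge e) (K F - L F) = K (rp (ge e) F) - L (rp (ge e) F)" unfolding rp_ops k(5)[OF F] l(5)[OF F] ..
  show "K (F - G) - L (F - G) = K F - L F - (K G - L G)" if G: "smooth G"
    unfolding k(6)[OF F G] l(6)[OF F G] by (simp add: fun_eq_iff)
  assume N: "adm a C N"
  have "N (K F - L F) <= N (K F) + N (L F)" by (rule adm_diff[OF N k(2)[OF F] l(2)[OF F]])
  also have "\<dots> <= (B + B') * N F" unfolding distrib_right by (intro add_mono k(4) l(4) N F)
  finally show "N (K F - L F) <= (B + B') * N F" .
qed (use gopD(1)[OF K] gopD(1)[OF L] in simp)

lemma gop_mono: assumes K: "gop a C B K" and "B <= B'" shows "gop a C B' K"
proof -
  have "N (K F) <= B' * N F" if N: "adm a C N" and F: "smooth F" for N F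
    using gopD(4)[OF K N F] mult_right_mono[OF assms(2) admD(1)[OF N F]] by linarith
  then show ?thesis using assms unfolding gop_def by auto
qed

lemma qn_gop: assumes K: "gop a C B K" and N: "adm a C N" and F: "smooth F" shows "qn N b (K F) <= B * qn N b F"
proof -
  note k = gopD[OF K] and sm = smooth_D[OF F]
  have 1: "(\<Sum>i\<in>UNIV. N (dx i (K F))) <= B * (\<Sum>i\<in>UNIV. N (dx i F))"
    unfolding k(3)[OF F] sum_distrib_left by (intro sum_mono k(4) N sm)
  have 2: "(\<Sum>i\<in>UNIV. \<Sum>j\<in>UNIV. N (dx i (dx j (K F)))) <= B * (\<Sum>i\<in>UNIV. \<Sum>j\<in>UNIV. N (dx i (dx j F)))"
    unfolding k(3)[OF F] k(3)[OF sm] sum_distrib_left by (intro sum_mono k(4) N smooth_D F)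
  show ?thesis
  proof (cases "isH b")
    case True show ?thesis unfolding qn_def if_P[OF True] distrib_left using k(4)[OF N F] 1 by linarith
  next
    case False show ?thesis unfolding qn_def if_not_P[OF False] distrib_left using k(4)[OF N F] 1 2 by linarith
  qed
qed

section \<open>Systems with prescribed data\<close>

lemma qn_cong: "isH b = isH b' ==> qn N b F = qn N b' F" by (simp add: qn_def)

text \<open>Supplies what \<open>Fout\<close> leaves open: the contributions of the acceleration to
  position and velocity.\<close>

fun AD :: "('n::finite fld => 'n fld) => ('n fld => 'n fld) => 'n cfg => 'n cfg" where
  "AD Kf Kv z (IF j) = Kf (z (IW j))"
| "AD Kf Kv z (IV j) = Kv (z (IW j))"
| "AD Kf Kv z (IW j) = z (IW j)"
| "AD Kf Kv z (IH j i) = z (IH j i)"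

fun cp :: "('n::finite => 'n fld) => ('n => 'n fld) => 'n cfg" where
  "cp f v (IF j) = f j" | "cp f v (IV j) = v j" | "cp f v (IW j) = 0" | "cp f v (IH j i) = 0"

lemma lop_AD:
  fixes Kf Kv :: "'n::finite fld => 'n fld"
  assumes Kf: "gop a C 2 Kf" and Kv: "gop a C 2 Kv"
  shows "lop a C (2 * real CARD('n idx)) (AD Kf Kv)"
  unfolding lop_def
proof (intro conjI allI impI)
  show "smc (AD Kf Kv z)" if z: "smc z" for z unfolding smc_def
  proof
    show "smooth (AD Kf Kv z b)" for b by (cases b) (simp_all only: AD.simps gopD(2)[OF Kf] gopD(2)[OF Kv] smcD[OF z])
  qed
  show "AD Kf Kv (z - z') = AD Kf Kv z - AD Kf Kv z'" if z: "smc z" "smc z'" for z z'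
  proof
    show "AD Kf Kv (z - z') b = (AD Kf Kv z - AD Kf Kv z') b" for b
      by (cases b) (simp_all only: AD.simps cfg_minus gopD(6)[OF Kf] gopD(6)[OF Kv] smcD[OF z(1)] smcD[OF z(2)])
  qed
  fix N :: "'n fld => real" and z :: "'n cfg" assume N: "adm a C N" and z: "smc z"
  note s = smcD[OF z]
  have m: "qn N b (z b) <= nc N z" for b by (rule nc_mem[OF N z])
  have n: "nc N z >= 0" by (rule nc_nonneg[OF N z])
  have K: "qn N b (K (z (IW j))) <= 2 * nc N z" if "gop a C 2 K" "\<not> isH b" for b K j
    using qn_gop[OF that(1) N s, of b "IW j"] m[of "IW j"] qn_cong[of b "IW j" N "z (IW j)"] that(2) by simp
  have "qn N b (AD Kf Kv z b) <= 2 * nc N z" for b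
  proof (cases b)
    case (IF j) show ?thesis unfolding IF AD.simps by (rule K[OF Kf]) simp
  next
    case (IV j) show ?thesis unfolding IV AD.simps by (rule K[OF Kv]) simp
  next
    case (IW j) show ?thesis using m[of b] n unfolding IW AD.simps by linarith
  next
    case (IH j i) show ?thesis using m[of b] n unfolding IH AD.simps by linarith
  qed
  then have "nc N (AD Kf Kv z) <= (\<Sum>b\<in>(UNIV::'n idx set). 2 * nc N z)" unfolding nc_def[of N "AD Kf Kv z"] by (rule sum_mono)
  then show "nc N (AD Kf Kv z) <= 2 * real CARD('n idx) * nc N z" by simp
qed simp

text \<open>Three choices of \<open>Kf\<close> and \<open>Kv\<close> occur: \<open>J J\<close> and
  \<open>J\<close> for the initial value problem; \<open>J J - J E1 J J\<close> and
  \<open>J - E1 J J\<close> for prescribed final position; and 0 for both when position and velocity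
  are given and only \<open>w\<close> and \<open>h\<close> are sought.\<close>

definition sys :: "real => ('n::finite fld => 'n fld) => ('n fld => 'n fld) => ('n => 'n fld) => ('n => 'n fld) => 'n cfg => bool" where
  "sys a Kf Kv f v c \<longleftrightarrow> smc c \<and> (\<forall>j. c (IF j) = f j + Kf (c (IW j)) \<and> c (IV j) = v j + Kv (c (IW j)) \<and> c (IW j) = Fout a c (IW j)
     \<and> (\<forall>i. c (IH j i) = Fout a c (IH j i)))"

lemma sys_iff: "sys a Kf Kv f v c \<longleftrightarrow> smc c \<and> c = cp f v + AD Kf Kv (Fout a c)"
proof
  assume s: "sys a Kf Kv f v c"
  have "c b = (cp f v + AD Kf Kv (Fout a c)) b" for b
    unfolding cfg_plus using s unfolding sys_def by (cases b) (simp_all only: AD.simps cp.simps add_0_left)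
  then show "smc c \<and> c = cp f v + AD Kf Kv (Fout a c)" using s unfolding sys_def by blast
next
  assume s: "smc c \<and> c = cp f v + AD Kf Kv (Fout a c)"
  then have e: "c b = cp f v b + AD Kf Kv (Fout a c) b" for b using cfg_plus by metis
  have W: "c (IW j) = Fout a c (IW j)" for j using e[of "IW j"] by (simp only: AD.simps cp.simps add_0_left)
  have H: "c (IH j i) = Fout a c (IH j i)" for i j using e[of "IH j i"] by (simp only: AD.simps cp.simps add_0_left)
  have "c (IF j) = f j + Kf (c (IW j))" "c (IV j) = v j + Kv (c (IW j))" for j
    using e[of "IF j"] e[of "IV j"] unfolding W[of j] by (simp_all only: AD.simps cp.simps)
  then show "sys a Kf Kv f v c" unfolding sys_def using s W H by blast
qed

lemma smc_cp: "(\<And>j. smooth (f j)) ==> (\<And>j. smooth (v j)) ==> smc (cp f v)"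
  unfolding smc_def
proof
  show "(\<And>j. smooth (f j)) ==> (\<And>j. smooth (v j)) ==> smooth (cp f v b)" for b
    by (cases b) (simp_all only: cp.simps smooth_0)
qed

lemma cp_diff: "cp f v - cp f' v' = cp (%j. f j - f' j) (%j. v j - v' j)"
proof
  show "(cp f v - cp f' v') b = cp (%j. f j - f' j) (%j. v j - v' j) b" for b
    unfolding cfg_minus by (cases b) (simp_all only: cp.simps diff_self)
qed

definition vnorm :: "('n::finite fld => real) => ('n => 'n fld) => real" where "vnorm N v = (\<Sum>j\<in>UNIV. qn N (IV j) (v j))"

lemma nc_cp_le:
  fixes f v :: "'n::finite => 'n fld"
  assumes N: "adm a C N" and f: "\<And>j. smooth (f j)" and v: "\<And>j. smooth (v j)"
  shows "nc N (cp f v) <= real CARD('n idx) * (vnorm N f + vnorm N v)"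
proof -
  have nn: "qn N (IV j) (w j) >= 0" if "\<And>j. smooth (w j)" for j and w :: "'n => 'n fld" by (rule qn_nonneg[OF N that])
  have m: "qn N (IV j) (w j) <= vnorm N w" "0 <= vnorm N w" if "\<And>j. smooth (w j)" for j and w :: "'n => 'n fld"
    unfolding vnorm_def using nn[where w = w, OF that] by (auto intro: member_le_sum sum_nonneg)
  have z: "qn N b 0 = 0" for b unfolding qn_def D_0 adm_0[OF N] by (cases "isH b") simp_all
  have "qn N b (cp f v b) <= vnorm N f + vnorm N v" for b
  proof (cases b)
    case (IF j) show ?thesis unfolding IF cp.simps using m(1)[where w = f and j = j, OF f] m(2)[where w = v, OF v] qn_cong[of "IF j" "IV j" N "f j"] by simp
  next
    case (IV j) show ?thesis unfolding IV cp.simps using m(2)[where w = f, OF f] m(1)[where w = v and j = j, OF v] by linarith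
  qed (use z m(2)[where w = f, OF f] m(2)[where w = v, OF v] in \<open>simp_all only: cp.simps add_nonneg_nonneg\<close>)
  then have "nc N (cp f v) <= (\<Sum>b\<in>(UNIV::'n idx set). vnorm N f + vnorm N v)" unfolding nc_def by (intro sum_mono)
  then show ?thesis by simp
qed

text \<open>The motion with velocity \<open>v\<close> and no acceleration: the inhomogeneous term of
  the fixed point equation in both problems.\<close>

definition vp :: "('n::finite => 'n fld) => 'n cfg" where "vp v = cp (%j. J (v j)) v"

lemma smc_vp: "(\<And>j. smooth (v j)) ==> smc (vp v)" unfolding vp_def by (intro smc_cp smooth_J)

lemma vp_diff: "(\<And>j. smooth (v j)) ==> (\<And>j. smooth (v' j)) ==> vp v - vp v' = vp (%j. v j - v' j)"
  unfolding vp_def cp_diff by (simp only: gopD(6)[OF gop_J])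

lemma nc_vp_le:
  fixes v :: "'n::finite => 'n fld"
  assumes N: "adm a C N" and v: "\<And>j. smooth (v j)"
  shows "nc N (vp v) <= 2 * real CARD('n idx) * vnorm N v"
proof -
  have "vnorm N (%j. J (v j)) <= vnorm N v" unfolding vnorm_def
    by (intro sum_mono) (use qn_gop[OF gop_J N v] in simp)
  then have "real CARD('n idx) * (vnorm N (%j. J (v j)) + vnorm N v) <= real CARD('n idx) * (2 * vnorm N v)" by (intro mult_left_mono) auto
  then show ?thesis unfolding vp_def using nc_cp_le[OF N, of "%j. J (v j)" v, OF smooth_J[OF v] v] by linarith
qed

lemma NN_mono: "smooth F ==> 0 <= l ==> l <= 1 ==> NN k l F <= NN k 1 F"
proof (induction k arbitrary: F)
  case (Suc k)
  have "l * (\<Sum>i\<in>UNIV. NN k l (D i F)) <= 1 * (\<Sum>i\<in>UNIV. NN k 1 (D i F))"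
    by (intro mult_mono sum_mono Suc.IH smooth_D sum_nonneg NN_nonneg Suc.prems) auto
  then show ?case using Suc.IH[OF Suc.prems] unfolding NN.simps by linarith
qed simp

lemma NN_Suc_ge: assumes F: "smooth F" shows "NN k 1 F + (\<Sum>i\<in>UNIV. NN k 1 (dx i F)) <= NN (Suc k) 1 F"
proof -
  have "(\<Sum>i\<in>UNIV. NN k 1 (dx i F)) = (\<Sum>o'\<in>range Some. NN k 1 (D o' F))" by (simp add: sum.reindex)
  also have "\<dots> <= (\<Sum>o'\<in>UNIV. NN k 1 (D o' F))" by (intro sum_mono2) (use NN_nonneg[OF smooth_D[OF F]] in auto)
  finally show ?thesis by simp
qed

lemma qn_NN: assumes F: "smooth F" and l: "0 <= l" "l <= 1" shows "qn (NN k l) b F <= NN (Suc (Suc k)) 1 F"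
proof -
  note sm = F smooth_D[OF F] smooth_D[OF smooth_D[OF F]]
  let ?S2 = "\<Sum>i\<in>UNIV. \<Sum>j\<in>UNIV. NN k 1 (dx j (dx i F))"
  have "(if isH b then 0 else (\<Sum>i\<in>UNIV. \<Sum>j\<in>UNIV. NN k l (dx i (dx j F)))) <= (\<Sum>i\<in>UNIV. \<Sum>j\<in>UNIV. NN k 1 (dx i (dx j F)))"
    using sum_mono[of UNIV "%i. \<Sum>j\<in>UNIV. NN k l (dx i (dx j F))" "%i. \<Sum>j\<in>UNIV. NN k 1 (dx i (dx j F))", OF sum_mono[OF NN_mono[OF sm(3) l]]]
      sum_nonneg[of UNIV "%i. \<Sum>j\<in>UNIV. NN k 1 (dx i (dx j F))", OF sum_nonneg[OF NN_nonneg[OF sm(3)]]] by simp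
  also have "\<dots> = ?S2" by (rule sum.swap)
  finally have "qn (NN k l) b F <= NN k 1 F + (\<Sum>i\<in>UNIV. NN k 1 (dx i F)) + ?S2"
    unfolding qn_def by (intro add_mono sum_mono NN_mono l sm)
  moreover have "?S2 <= (\<Sum>i\<in>UNIV. NN (Suc k) 1 (dx i F))"
  proof (rule sum_mono)
    fix i show "(\<Sum>j\<in>UNIV. NN k 1 (dx j (dx i F))) <= NN (Suc k) 1 (dx i F)"
      using NN_Suc_ge[OF smooth_D[OF F, of "Some i"], of k] NN_nonneg[OF smooth_D[OF F, of "Some i"], of 1 k] by linarith
  qed
  ultimately show ?thesis using NN_Suc_ge[OF F, of k] NN_Suc_ge[OF F, of "Suc k"] by linarith
qed

text \<open>Of the three additional derivatives two come from \<open>qn\<close> and one from the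
  Hoelder seminorm.\<close>

lemma vnorm_NN_nv: "\<exists>K\<ge>0. \<forall>l (G :: 'n::finite vfun). 0 <= l --> l <= 1 --> Cinf_ap G --> vnorm (NN k l) (vf G) <= K * normk_vec (k + 3) G"
proof -
  obtain K where K: "K >= 0" "\<And>G (j :: 'n). Cinf_ap G ==> NN (Suc (Suc k)) 1 (vf G j) <= K * normk_vec (Suc (Suc (Suc k))) G"
    using NN_nv[of "Suc (Suc k)"] by blast
  have "vnorm (NN k l) (vf G) <= real CARD('n) * K * normk_vec (k + 3) G" if l: "0 <= l" "l <= 1" and G: "Cinf_ap G" for l and G :: "'n vfun"
  proof -
    have "qn (NN k l) (IV j) (vf G j) <= K * normk_vec (k + 3) G" for j
    proof -
      have "smooth (vf G j)" using G unfolding Cinf_vf by blast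
      from qn_NN[OF this l] have "qn (NN k l) (IV j) (vf G j) <= NN (Suc (Suc k)) 1 (vf G j)" .
      also note K(2)[OF G]
      finally show ?thesis by (simp add: numeral_3_eq_3)
    qed
    then have "vnorm (NN k l) (vf G) <= (\<Sum>j\<in>(UNIV::'n set). K * normk_vec (k + 3) G)" unfolding vnorm_def by (rule sum_mono)
    then show ?thesis by simp
  qed
  then show ?thesis using K(1) by (intro exI[of _ "real CARD('n) * K"]) simp
qed

lemma nc_rp_N0: assumes g: "reparam g" and c: "smc c" shows "nc N0 (%b. rp g (c b)) <= nc N0 c"
proof -
  have n: "N0 (rp g F) <= N0 F" if F: "smooth F" for F :: "'a fld"
    unfolding N0_def[of F] by (rule N0_le) (simp_all add: rp_def sn_ge[OF smooth_AC[OF F]] hs_ge[OF F] hs_nonneg[OF F])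
  note s = smcD[OF c] and sD = smooth_D[OF smcD[OF c]]
  have "qn N0 b (rp g (c b)) <= qn N0 b (c b)" for b
  proof -
    have 2: "(\<Sum>k\<in>UNIV. \<Sum>l\<in>UNIV. N0 (rp g (dx k (dx l (c b))))) <= (\<Sum>k\<in>UNIV. \<Sum>l\<in>UNIV. N0 (dx k (dx l (c b))))"
      by (intro sum_mono n smooth_D s)
    have 1: "(\<Sum>k\<in>UNIV. N0 (rp g (dx k (c b)))) <= (\<Sum>k\<in>UNIV. N0 (dx k (c b)))"
      by (intro sum_mono n smooth_D s)
    show ?thesis unfolding qn_def D_rp[OF g s] D_rp[OF g sD] using 1 2 n[OF s, of b] by simp
  qed
  then show ?thesis unfolding nc_def by (rule sum_mono)
qed

declare vf_apply [simp del] cf_apply [simp del]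

text \<open>\<open>rs\<close> is a common radius: up to it the fixed point theorem applies, and
  first derivatives bounded by it make \<open>f\<close> a contraction by one half and keep the
  Jacobian determinant above one half.\<close>

locale flow =
  fixes al C rs :: real and ty :: "'n::finite itself"
  assumes al: "al \<noteq> 0" and C: "C >= 0" and admN0: "adm (al\<^sup>2) C (N0 :: 'n fld => real)" and rs: "rs > 0"
    and rsn: "real CARD('n) * (real CARD('n) * rs) <= 1/2"
    and det: "\<And>m :: real^'n^'n. (\<And>j k. \<bar>m $ j $ k\<bar> <= rs) ==> det (mat 1 + m) > 1/2"
    and fp: "\<And>\<rho> A. 0 < \<rho> ==> \<rho> <= rs ==> lop (al\<^sup>2) C (2 * real CARD('n idx)) A ==>
    (\<forall>N p p' c c' :: 'n cfg. adm (al\<^sup>2) C N --> smc p --> smc p' --> smc c --> smc c' -->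
       nc N c <= 2 * \<rho> --> nc N c' <= 2 * \<rho> --> c = p + A (Fout (al\<^sup>2) c) --> c' = p' + A (Fout (al\<^sup>2) c') --> nc N (c - c') <= 2 * nc N (p - p')) \<and>
    (\<forall>p :: 'n cfg. smc p --> nc N0 p < \<rho> --> (\<exists>c. smc c \<and> c = p + A (Fout (al\<^sup>2) c) \<and>
       (\<forall>k l. 0 <= l --> nc (NN k l) p <= \<rho> --> nc (NN k l) c <= 2 * \<rho>)))"
begin

abbreviation "a \<equiv> al\<^sup>2"

lemma a0: "a > 0" using al by simp

lemma admN: "l >= 0 ==> adm a C (NN k l :: 'n fld => real)" by (rule adm_NN[OF a0 admN0])

lemma NN0: "NN 0 l = (N0 :: 'n fld => real)" by (intro ext) simp

lemma nc_tri:
  assumes N: "adm a C N" and c: "smc c" "smc c'" shows "nc N c' <= nc N c + nc N (c' - c)"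
proof -
  have "c' = c + (c' - c)" by (simp add: fun_eq_iff)
  then show ?thesis using nc_add[OF N c(1) smc_diff[OF c(2,1)]] by simp
qed

lemma solve:
  fixes f v :: "'n => 'n fld"
  assumes K: "gop a C 2 Kf" "gop a C 2 Kv" and \<rho>: "0 < \<rho>" "\<rho> <= rs" and s: "\<And>j. smooth (f j)" "\<And>j. smooth (v j)"
    and b: "nc N0 (cp f v) < \<rho>"
  shows "\<exists>c. sys a Kf Kv f v c \<and> (\<forall>k l. 0 <= l --> nc (NN k l) (cp f v) <= \<rho> --> nc (NN k l) c <= 2 * \<rho>)"
  using fp[OF \<rho> lop_AD[OF K], THEN conjunct2, rule_format, OF smc_cp[OF s] b] unfolding sys_iff by (simp only: conj_assoc)

lemma sys_lip:
  fixes f v :: "'n => 'n fld"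
  assumes K: "gop a C 2 Kf" "gop a C 2 Kv" and \<rho>: "0 < \<rho>" "\<rho> <= rs"
    and s: "\<And>j. smooth (f j)" "\<And>j. smooth (v j)" "\<And>j. smooth (f' j)" "\<And>j. smooth (v' j)"
    and N: "adm a C N" and c: "sys a Kf Kv f v c" "sys a Kf Kv f' v' c'" and b: "nc N c <= 2 * \<rho>" "nc N c' <= 2 * \<rho>"
  shows "nc N (c - c') <= 2 * nc N (cp f v - cp f' v')"
proof -
  have 1: "smc c" "c = cp f v + AD Kf Kv (Fout a c)" and 2: "smc c'" "c' = cp f' v' + AD Kf Kv (Fout a c')"
    using c unfolding sys_iff by blast+
  show ?thesis by (rule fp[OF \<rho> lop_AD[OF K], THEN conjunct1, rule_format, OF N smc_cp[OF s(1,2)] smc_cp[OF s(3,4)] 1(1) 2(1) b 1(2) 2(2)])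
qed

lemma sys_unique:
  fixes f v :: "'n => 'n fld"
  assumes K: "gop a C 2 Kf" "gop a C 2 Kv" and \<rho>: "0 < \<rho>" "\<rho> <= rs"
    and s: "\<And>j. smooth (f j)" "\<And>j. smooth (v j)"
    and c: "sys a Kf Kv f v c" "sys a Kf Kv f v c'" and b: "nc N0 c <= 2 * \<rho>" "nc N0 c' <= 2 * \<rho>"
  shows "c = c'"
proof
  fix i
  have sm: "smc c" "smc c'" using c unfolding sys_iff by blast+
  have "nc N0 (c - c') <= 2 * nc N0 (cp f v - cp f v)" by (rule sys_lip[OF K \<rho> s s admN0 c b])
  then have "nc N0 (c - c') <= 0" unfolding diff_self nc_0[OF admN0] by simp
  then have "N0 ((c - c') i) <= 0" using nc_cmp(1)[OF admN0 smc_diff[OF sm], of i] by linarith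
  then have "(c - c') i = 0" by (rule N0_eq_0[OF smcD[OF smc_diff[OF sm]]])
  then show "c i = c' i" unfolding cfg_minus by (simp only: right_minus_eq)
qed

end

definition fh :: "'n::finite vfun => real => 'n vfun => 'n => 'n fld" where
  "fh u \<eta> h j = vf u j + snf * (cst \<eta> * vf h j)"

lemma smooth_fh: "Cinf_ap u ==> Cinf_ap h ==> smooth (fh u \<eta> h j)"
  unfolding fh_def Cinf_vf by (intro smooth_add smooth_mult smooth_cst smooth_snf) blast+

lemma fh_rp: "rp (ge e) (fh u \<eta> h j) = vf (fadd u (fscale (sin e * \<eta>) h)) j"
  by (simp add: vf_apply fun_eq_iff rp_def fh_def ge_def snf_def fadd_def fscale_def)

lemma fh_diff: "fh u \<eta> h j - fh u' \<eta> h' j = fh (fsub u u') \<eta> (fsub h h') j"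
  by (simp add: vf_apply fun_eq_iff fh_def fsub_def algebra_simps)

lemma fh_0: "fh u \<eta> (%x. 0) = vf u" by (simp add: vf_apply fun_eq_iff fh_def)

lemma qn_snf:
  assumes N: "adm a C N" and F: "smooth F" and e: "0 <= \<eta>"
  shows "qn N (IV j) (snf * (cst \<eta> * F)) <= N snf * (\<eta> * qn N (IV j) F)"
proof -
  have d: "dx i (snf * (cst \<eta> * G)) = snf * (cst \<eta> * dx i G)" if "smooth G" for i G
    unfolding D_mult[OF smooth_snf smooth_mult[OF smooth_cst that]] D_cmult[OF that] D_snf option.case by (simp only: mult_zero_left add_0_left)
  have b: "N (snf * (cst \<eta> * G)) <= N snf * \<eta> * N G" if G: "smooth G" for G
  proof -
    have "N (snf * (cst \<eta> * G)) <= N snf * N (cst \<eta> * G)" by (rule admD(9)[OF N smooth_snf smooth_mult[OF smooth_cst G]])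
    also have "\<dots> <= N snf * (\<bar>\<eta>\<bar> * N G)" by (intro mult_left_mono admD(2)[OF N G] admD(1)[OF N smooth_snf])
    finally show ?thesis using e by (simp only: abs_of_nonneg mult.assoc)
  qed
  have "qn N (IV j) (snf * (cst \<eta> * F)) <= N snf * \<eta> * N F + (\<Sum>k\<in>UNIV. N snf * \<eta> * N (dx k F)) + (\<Sum>k\<in>UNIV. \<Sum>l\<in>UNIV. N snf * \<eta> * N (dx k (dx l F)))"
    unfolding qn_def isH.simps if_False d[OF F] d[OF smooth_D[OF F]] by (intro add_mono sum_mono b smooth_D F)
  then show ?thesis unfolding qn_def isH.simps if_False by (simp only: sum_distrib_left[symmetric] distrib_left mult.assoc)
qed

section \<open>The solution map and its dependence on the data\<close>

lemma DX_rp: "reparam g ==> smooth F ==> DX is (rp g F) = rp g (DX is F)"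
  by (induction "is" arbitrary: F) (simp_all only: list.map DL.simps D_rp smooth_D)

lemma DL_D: "smooth F ==> DL is (D i F) = D i (DL is F)"
proof (induction "is" arbitrary: F)
  case (Cons j "is")
  show ?case unfolding DL.simps D_commute[OF Cons.prems, of j i] by (rule Cons.IH[OF smooth_D[OF Cons.prems]])
qed simp

text \<open>Common treatment of the initial value problem and of the problem with prescribed final
  position; \<open>s\<close> is the sign with which the double time integral of the acceleration
  enters the output \<open>Y\<close>.\<close>

locale system = flow al C rs ty for al C rs :: real and ty :: "'n::finite itself" +
  fixes Kf Kv :: "'n fld => 'n fld" and s :: real
  assumes Kf: "gop a C 2 Kf" and Kv: "gop a C 2 Kv" and s: "\<bar>s\<bar> <= 1"
begin

text \<open>With data below \<open>rs/4\<close> the solutions stay within \<open>rs/2\<close>. This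
  leaves a margin below \<open>rs\<close> for the neighbouring curves that are compared with them in
  the uniqueness proof.\<close>

definition good :: "('n => 'n fld) => bool" where "good v \<longleftrightarrow> (\<forall>j. smooth (v j)) \<and> nc N0 (vp v) < rs / 4"

lemma goodD: "good v ==> smooth (v j)" "good v ==> nc N0 (vp v) < rs / 4" unfolding good_def by blast+

definition sol :: "('n => 'n fld) => 'n cfg" where
  "sol v = (SOME c. sys a Kf Kv (%j. J (v j)) v c \<and> (\<forall>k l. 0 <= l --> nc (NN k l) (vp v) <= rs/4 --> nc (NN k l) c <= 2 * (rs/4)))"

lemma sol:
  assumes "good v"
  shows "sys a Kf Kv (%j. J (v j)) v (sol v)" "0 <= l ==> nc (NN k l) (vp v) <= rs/4 ==> nc (NN k l) (sol v) <= 2 * (rs/4)"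
    "smc (sol v)" "nc N0 (sol v) <= 2 * (rs/4)"
proof -
  have "\<exists>c. sys a Kf Kv (%j. J (v j)) v c \<and> (\<forall>k l. 0 <= l --> nc (NN k l) (vp v) <= rs/4 --> nc (NN k l) c <= 2 * (rs/4))"
    unfolding vp_def by (rule solve[OF Kf Kv _ _ smooth_J goodD(1)]) (use assms rs goodD in \<open>auto simp: vp_def[symmetric]\<close>)
  from someI_ex[OF this] show 1: "sys a Kf Kv (%j. J (v j)) v (sol v)"
    "\<And>l k. 0 <= l ==> nc (NN k l) (vp v) <= rs/4 ==> nc (NN k l) (sol v) <= 2 * (rs/4)" unfolding sol_def[symmetric] by blast+
  show "smc (sol v)" using 1(1) unfolding sys_def by blast
  show "nc N0 (sol v) <= 2 * (rs/4)" using 1(2)[of 0 0] goodD(2)[OF assms] unfolding NN0 by simp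
qed

lemma sol_eq:
  assumes v: "good v" and c: "sys a Kf Kv (%j. J (v j)) v c" "nc N0 c <= 2 * (rs/4)" shows "sol v = c"
proof -
  have "0 < rs/4" "rs/4 <= rs" using rs by auto
  then show ?thesis
    by (rule sys_unique[OF Kf Kv _ _ smooth_J[OF goodD(1)[OF v]] goodD(1)[OF v] sol(1)[OF v] c(1) sol(4)[OF v] c(2)])
qed

text \<open>For s = 1 this is the final displacement belonging to the initial velocity
  \<open>v\<close>; for s = -1 it is the initial velocity belonging to the final displacement
  \<open>v\<close>.\<close>

definition Y :: "('n => 'n fld) => 'n => 'n fld" where "Y v j = v j + cst s * E1 (J (J (sol v (IW j))))"

lemma smooth_Y: "good v ==> smooth (Y v j)"
  unfolding Y_def by (intro smooth_add smooth_mult smooth_cst smooth_E1 smooth_J smcD sol(3) goodD(1))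

lemma sol_rp:
  assumes v: "good v"
  shows "good (%j. rp (ge e) (v j))" "sol (%j. rp (ge e) (v j)) = (%b. rp (ge e) (sol v b))"
proof -
  note J5 = gopD(5)[OF gop_J] note sm = goodD(1)[OF v] smcD[OF sol(3)[OF v]]
  have vr: "vp (%j. rp (ge e) (v j)) = (%b. rp (ge e) (vp v b))"
  proof
    show "vp (%j. rp (ge e) (v j)) b = rp (ge e) (vp v b)" for b
      unfolding vp_def by (cases b) (simp_all only: cp.simps rp_ops J5[OF sm(1), symmetric])
  qed
  have sv: "smc (vp v)" by (rule smc_vp[OF sm(1)])
  show g: "good (%j. rp (ge e) (v j))" unfolding good_def vr
  proof (intro conjI allI)
    show "smooth (rp (ge e) (v j))" for j by (rule smooth_rp[OF reparam_ge sm(1)])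
    show "nc N0 (%b. rp (ge e) (vp v b)) < rs / 4" using goodD(2)[OF v] nc_rp_N0[OF reparam_ge sv, of e] by linarith
  qed
  show "sol (%j. rp (ge e) (v j)) = (%b. rp (ge e) (sol v b))"
  proof (rule sol_eq[OF g])
    show "nc N0 (%b. rp (ge e) (sol v b)) <= 2 * (rs / 4)"
      using nc_rp_N0[OF reparam_ge sol(3)[OF v], of e] sol(4)[OF v] by linarith
    have S: "sol v (IF j) = J (v j) + Kf (sol v (IW j))" "sol v (IV j) = v j + Kv (sol v (IW j))" "sol v (IW j) = Fout a (sol v) (IW j)"
      "sol v (IH j i) = Fout a (sol v) (IH j i)" for i j using sol(1)[OF v] unfolding sys_def by blast+
    show "sys a Kf Kv (%j. J (rp (ge e) (v j))) (%j. rp (ge e) (v j)) (%b. rp (ge e) (sol v b))"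
      unfolding sys_def
    proof (intro conjI allI)
      show "smc (%b. rp (ge e) (sol v b))" unfolding smc_def using smooth_rp[OF reparam_ge sm(2)] by blast
      show "rp (ge e) (sol v (IF j)) = J (rp (ge e) (v j)) + Kf (rp (ge e) (sol v (IW j)))" for j
        using S(1)[of j] by (simp only: rp_ops J5[OF sm(1)] gopD(5)[OF Kf sm(2)])
      show "rp (ge e) (sol v (IV j)) = rp (ge e) (v j) + Kv (rp (ge e) (sol v (IW j)))" for j
        using S(2)[of j] by (simp only: rp_ops gopD(5)[OF Kv sm(2)])
      show "rp (ge e) (sol v (IW j)) = Fout a (%b. rp (ge e) (sol v b)) (IW j)" for j
        unfolding Fout_rp[OF reparam_ge sol(3)[OF v]] using S(3)[of j] by (rule arg_cong)
      show "rp (ge e) (sol v (IH j i)) = Fout a (%b. rp (ge e) (sol v b)) (IH j i)" for i j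
        unfolding Fout_rp[OF reparam_ge sol(3)[OF v]] using S(4)[of j i] by (rule arg_cong)
    qed
  qed
qed

lemma Y_rp: assumes v: "good v" shows "Y (%j. rp (ge e) (v j)) j = rp (ge e) (Y v j)"
proof -
  note sm = smcD[OF sol(3)[OF v]]
  show ?thesis unfolding Y_def sol_rp(2)[OF v] rp_ops
    unfolding gopD(5)[OF gop_E1 smooth_J[OF smooth_J[OF sm]]] gopD(5)[OF gop_J smooth_J[OF sm]] gopD(5)[OF gop_J sm] ..
qed

text \<open>The factor 3 is 1 for \<open>v\<close> itself plus 2 for the dependence of the solution
  on \<open>v\<close>; the time operators and \<open>s\<close> contribute factors of at most
  1.\<close>

lemma Y_lip:
  assumes v: "good v" "good v'" and l: "0 <= l" and b: "nc (NN k l) (vp v) <= rs/4" "nc (NN k l) (vp v') <= rs/4"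
  shows "NN k l (Y v j - Y v' j) <= 3 * nc (NN k l) (vp (%j. v j - v' j))"
proof -
  let ?N = "NN k l :: 'n fld => real" and ?c = "sol v" and ?c' = "sol v'"
  note N = admN[OF l, of k] note sm = smcD[OF sol(3)[OF v(1)]] smcD[OF sol(3)[OF v(2)]] goodD(1)[OF v(1)] goodD(1)[OF v(2)]
  have r: "0 < rs/4" "rs/4 <= rs" using rs by auto
  have L: "nc ?N (?c - ?c') <= 2 * nc ?N (vp (%j. v j - v' j))"
    unfolding vp_diff[OF sm(3,4), symmetric] vp_def[of v] vp_def[of v']
    by (rule sys_lip[OF Kf Kv r smooth_J[OF sm(3)] sm(3) smooth_J[OF sm(4)] sm(4) N sol(1)[OF v(1)] sol(1)[OF v(2)] sol(2)[OF v(1) l b(1)] sol(2)[OF v(2) l b(2)]])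
  have d: "smooth (v j - v' j)" by (intro smooth_diff sm)
  note w = smooth_diff[OF sm(1,2), of "IW j" "IW j"]
  let ?E = "%F. E1 (J (J F)) :: 'n fld"
  have E: "gop a C 1 ?E" using gop_comp[OF gop_E1 gop_comp[OF gop_J gop_J]] by simp
  let ?W = "?E (?c (IW j) - ?c' (IW j))"
  have W: "smooth ?W" by (rule gopD(2)[OF E w])
  have "Y v j - Y v' j = (v j - v' j) + cst s * (?E (?c (IW j)) - ?E (?c' (IW j)))"
    unfolding Y_def by (simp add: fun_eq_iff algebra_simps)
  then have e: "Y v j - Y v' j = (v j - v' j) + cst s * ?W" unfolding gopD(6)[OF E sm(1,2)] .
  have "?N ((v j - v' j) + cst s * ?W) <= ?N (v j - v' j) + ?N (cst s * ?W)"
    by (rule admD(8)[OF N d smooth_mult[OF smooth_cst W]])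
  moreover have "?N (cst s * ?W) <= \<bar>s\<bar> * ?N ?W" by (rule admD(2)[OF N W])
  moreover have "\<bar>s\<bar> * ?N ?W <= 1 * ?N ?W" by (rule mult_right_mono[OF s admD(1)[OF N W]])
  moreover have "?N ?W <= 1 * ?N (?c (IW j) - ?c' (IW j))" by (rule gopD(4)[OF E N w])
  moreover have "?N (?c (IW j) - ?c' (IW j)) <= 2 * nc ?N (vp (%j. v j - v' j))"
    using nc_cmp(1)[OF N smc_diff[OF sol(3)[OF v(1)] sol(3)[OF v(2)]], of "IW j"] L unfolding cfg_minus by linarith
  moreover have "?N (v j - v' j) <= nc ?N (vp (%j. v j - v' j))"
    using nc_cmp(1)[OF N smc_vp[of "%j. v j - v' j", OF smooth_diff[OF sm(3,4)]], of "IV j"] unfolding vp_def cp.simps .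
  ultimately show ?thesis unfolding e by linarith
qed

lemma nc_fh: "\<exists>K\<ge>0. \<forall>l \<eta> u (h :: 'n vfun). 0 <= l --> l <= 1 --> 0 <= \<eta> --> \<eta> <= 1 --> Cinf_ap u --> Cinf_ap h -->
    nc (NN k l) (vp (fh u \<eta> h)) <= K * (normk_vec (k + 3) u + \<eta> * normk_vec (k + 3) h)"
proof -
  obtain K where K: "K >= 0" "\<And>l (G :: 'n vfun). 0 <= l ==> l <= 1 ==> Cinf_ap G ==> vnorm (NN k l) (vf G) <= K * normk_vec (k + 3) G"
    using vnorm_NN_nv[of k] by blast
  \<comment> \<open>The norm of the sine at l = 1 dominates that for all smaller \<open>l\<close>; 1
    is added so that the term without sine may carry the factor \<open>S\<close> too.\<close>
  define S where "S = 1 + NN k 1 (snf :: 'n fld)"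
  have S1: "S >= 1" unfolding S_def using NN_nonneg[OF smooth_snf, of 1 k] by simp
  have "nc (NN k l) (vp (fh u \<eta> h)) <= (2 * real CARD('n idx) * (S * K)) * (normk_vec (k + 3) u + \<eta> * normk_vec (k + 3) h)"
    if l: "0 <= l" "l <= 1" and e: "0 <= \<eta>" "\<eta> <= 1" and u: "Cinf_ap u" and h: "Cinf_ap h" for l \<eta> u and h :: "'n vfun"
  proof -
    note N = admN[OF l(1), of k]
    have sm: "smooth (vf u j)" "smooth (vf h j)" for j using u h unfolding Cinf_vf by blast+
    have "qn (NN k l) (IV j) (fh u \<eta> h j) <= qn (NN k l) (IV j) (vf u j) + S * (\<eta> * qn (NN k l) (IV j) (vf h j))" for j
    proof -
      have "qn (NN k l) (IV j) (snf * (cst \<eta> * vf h j)) <= NN k l (snf :: 'n fld) * (\<eta> * qn (NN k l) (IV j) (vf h j))" using qn_snf[OF N sm(2)[of j] e(1), of j] .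
      also have "\<dots> <= S * (\<eta> * qn (NN k l) (IV j) (vf h j))"
      proof (intro mult_right_mono mult_nonneg_nonneg e qn_nonneg[OF N sm(2)])
        have "NN k l (snf :: 'n fld) <= NN k 1 (snf :: 'n fld)" by (rule NN_mono[OF smooth_snf l])
        then show "NN k l (snf :: 'n fld) <= S" unfolding S_def by linarith
      qed
      finally show ?thesis using qn_diff(2)[OF N sm(1) smooth_mult[OF smooth_snf smooth_mult[OF smooth_cst sm(2)]], of "IV j" j \<eta> j]
        unfolding fh_def by linarith
    qed
    then have "vnorm (NN k l) (fh u \<eta> h) <= vnorm (NN k l) (vf u) + S * (\<eta> * vnorm (NN k l) (vf h))"
      unfolding vnorm_def sum_distrib_left sum.distrib[symmetric] by (rule sum_mono)
    also have "\<dots> <= S * vnorm (NN k l) (vf u) + S * (\<eta> * vnorm (NN k l) (vf h))"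
    proof -
      have "0 <= vnorm (NN k l) (vf u)" unfolding vnorm_def by (intro sum_nonneg qn_nonneg[OF N sm(1)])
      then show ?thesis using S1 by (simp add: mult_le_cancel_right1)
    qed
    also have "\<dots> <= S * (K * normk_vec (k + 3) u) + S * (\<eta> * (K * normk_vec (k + 3) h))"
      using S1 by (intro add_mono mult_left_mono K(2) l u h e) auto
    finally have "2 * real CARD('n idx) * vnorm (NN k l) (fh u \<eta> h) <= 2 * real CARD('n idx) * (S * (K * normk_vec (k + 3) u) + S * (\<eta> * (K * normk_vec (k + 3) h)))"
      by (intro mult_left_mono) auto
    then show ?thesis using nc_vp_le[OF N, of "fh u \<eta> h", OF smooth_fh[OF u h]] by (simp add: algebra_simps)
  qed
  then show ?thesis using K(1) S1 by (intro exI[of _ "2 * real CARD('n idx) * (S * K)"]) auto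
qed

text \<open>The estimate covers derivatives in the parameter too, so that it yields continuity both
  of the map and of its directional derivative. The norm, through \<open>l\<close>, is adapted to
  \<open>u\<close>, \<open>h\<close> and \<open>k\<close>; this is why the Lipschitz constant is
  only local.\<close>

lemma near:
  fixes u h :: "'n vfun"
  assumes g: "good (fh u \<eta> h)" and u: "Cinf_ap u" and h: "Cinf_ap h" and e: "0 <= \<eta>" "\<eta> <= 1"
  shows "\<exists>L\<ge>0. \<exists>\<delta>>0. \<forall>u' h'. u' \<in> apball (k + 3) u \<delta> --> h' \<in> apball (k + 3) h \<delta> --> good (fh u' \<eta> h') \<and>
     (\<forall>j is \<tau> x. length is <= k --> \<bar>DL is (Y (fh u' \<eta> h') j) \<tau> x - DL is (Y (fh u \<eta> h) j) \<tau> x\<bar>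
        <= L * (normk_vec (k + 3) (fsub u' u) + normk_vec (k + 3) (fsub h' h)))"
proof -
  note smf = smooth_fh[OF u h]
  have sv: "smc (vp (fh u \<eta> h))" by (rule smc_vp[OF smf])
  obtain l where l: "0 < l" "l <= 1" "nc (NN k l) (vp (fh u \<eta> h)) < rs/4"
    using nc_NN_exists[OF sv goodD(2)[OF g], where k = k] by blast
  obtain K where K: "K >= 0" "\<And>l \<eta> u (h :: 'n vfun). 0 <= l ==> l <= 1 ==> 0 <= \<eta> ==> \<eta> <= 1 ==> Cinf_ap u ==> Cinf_ap h ==>
    nc (NN k l) (vp (fh u \<eta> h)) <= K * (normk_vec (k + 3) u + \<eta> * normk_vec (k + 3) h)" using nc_fh[of k] by blast
  obtain K0 where K0: "K0 >= 0" "\<And>l \<eta> u (h :: 'n vfun). 0 <= l ==> l <= 1 ==> 0 <= \<eta> ==> \<eta> <= 1 ==> Cinf_ap u ==> Cinf_ap h ==>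
    nc (NN 0 l) (vp (fh u \<eta> h)) <= K0 * (normk_vec (0 + 3) u + \<eta> * normk_vec (0 + 3) h)" using nc_fh[of 0] by blast
  \<comment> \<open>Two norms must remain below \<open>rs/4\<close>: the strong one, for the
    Lipschitz estimate of derivatives of order \<open>k\<close>, and \<open>N0\<close>, for
    membership in \<open>good\<close>.\<close>
  define gap where "gap = min (rs/4 - nc (NN k l) (vp (fh u \<eta> h))) (rs/4 - nc N0 (vp (fh u \<eta> h)))"
  have gap: "gap > 0" using l(3) goodD(2)[OF g] by (simp add: gap_def)
  define \<delta> where "\<delta> = gap / (2 * (K + K0 + 1))"
  have \<delta>: "\<delta> > 0" using gap K(1) K0(1) by (simp add: \<delta>_def)
  have \<delta>2: "K * (\<delta> + \<delta>) < gap" "K0 * (\<delta> + \<delta>) < gap"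
  proof -
    have "2 * (K + K0 + 1) > 0" using K(1) K0(1) by simp
    then have "2 * (K + K0 + 1) * \<delta> = gap" unfolding \<delta>_def by (metis less_irrefl nonzero_mult_div_cancel_left times_divide_eq_right)
    then have "(K + K0 + 1) * (\<delta> + \<delta>) = gap" by (simp add: algebra_simps)
    moreover have "0 <= K * (\<delta> + \<delta>)" "0 <= K0 * (\<delta> + \<delta>)" using K(1) K0(1) \<delta> by simp_all
    ultimately show "K * (\<delta> + \<delta>) < gap" "K0 * (\<delta> + \<delta>) < gap" using \<delta> by (simp_all add: distrib_right)
  qed
  let ?L = "3 * K / l ^ k"
  have "good (fh u' \<eta> h') \<and> (\<forall>j is \<tau> x. length is <= k --> \<bar>DL is (Y (fh u' \<eta> h') j) \<tau> x - DL is (Y (fh u \<eta> h) j) \<tau> x\<bar>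
        <= ?L * (normk_vec (k + 3) (fsub u' u) + normk_vec (k + 3) (fsub h' h)))"
    if u'h': "u' \<in> apball (k + 3) u \<delta>" "h' \<in> apball (k + 3) h \<delta>" for u' h'
  proof -
    let ?nu = "normk_vec (k + 3) (fsub u' u)" and ?nh = "normk_vec (k + 3) (fsub h' h)"
    have u': "Cinf_ap u'" "?nu < \<delta>" and h': "Cinf_ap h'" "?nh < \<delta>" using u'h' by (auto simp: apball_def)
    note su = Cinf_ops(2)[OF u'(1) u] note sh = Cinf_ops(2)[OF h'(1) h] note smf' = smooth_fh[OF u'(1) h'(1)]
    have n0: "0 <= ?nu" "0 <= ?nh" using nv_nonneg su sh by blast+
    have e': "\<eta> * ?nh <= ?nh" using mult_right_mono[OF e(2) n0(2)] by simp
    have sv': "smc (vp (fh u' \<eta> h'))" by (rule smc_vp[OF smf'])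
    have D: "vp (fh u' \<eta> h') - vp (fh u \<eta> h) = vp (fh (fsub u' u) \<eta> (fsub h' h))"
      unfolding vp_diff[OF smf' smf] fh_diff ..
    have Dk: "nc (NN k l) (vp (fh (fsub u' u) \<eta> (fsub h' h))) <= K * (?nu + ?nh)"
      using K(2)[OF less_imp_le[OF l(1)] l(2) e su sh] mult_left_mono[OF add_left_mono[OF e'] K(1), of ?nu] by linarith
    have tri: "nc N (vp (fh u' \<eta> h')) <= nc N (vp (fh u \<eta> h)) + nc N (vp (fh (fsub u' u) \<eta> (fsub h' h)))" if N: "adm a C N" for N
      using nc_tri[OF N sv sv'] unfolding D .
    have "K * (?nu + ?nh) <= K * (\<delta> + \<delta>)" using u' h' K(1) by (intro mult_left_mono) auto
    then have bk: "nc (NN k l) (vp (fh u' \<eta> h')) < rs/4"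
      using tri[OF admN[OF less_imp_le[OF l(1)]], of k] Dk \<delta>2(1) unfolding gap_def by linarith
    have "nc N0 (vp (fh (fsub u' u) \<eta> (fsub h' h))) <= K0 * (normk_vec (0 + 3) (fsub u' u) + \<eta> * normk_vec (0 + 3) (fsub h' h))"
      using K0(2)[of 1, OF _ _ e su sh] unfolding NN0 by simp
    also have "\<dots> <= K0 * (\<delta> + \<delta>)"
    proof (intro mult_left_mono K0(1) add_mono)
      show "normk_vec (0 + 3) (fsub u' u) <= \<delta>" using nv_mono[OF su, of "0+3" "k+3"] u' by simp
      have "\<eta> * normk_vec (0 + 3) (fsub h' h) <= 1 * normk_vec (k + 3) (fsub h' h)"
        by (intro mult_mono e nv_mono[OF sh] nv_nonneg[OF sh]) auto
      then show "\<eta> * normk_vec (0 + 3) (fsub h' h) <= \<delta>" using h' by simp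
    qed
    finally have "nc N0 (vp (fh u' \<eta> h')) < rs/4" using tri[OF admN0] \<delta>2(2) unfolding gap_def by linarith
    then have g': "good (fh u' \<eta> h')" unfolding good_def using smf' by blast
    have "\<bar>DL is (Y (fh u' \<eta> h') j) \<tau> x - DL is (Y (fh u \<eta> h) j) \<tau> x\<bar> <= ?L * (?nu + ?nh)" if i: "length is <= k" for j "is" \<tau> x
    proof -
      let ?F = "Y (fh u' \<eta> h') j - Y (fh u \<eta> h) j"
      note sY = smooth_Y[OF g', of j] smooth_Y[OF g, of j]
      have F: "smooth ?F" by (rule smooth_diff[OF sY])
      have N: "NN k l ?F <= 3 * (K * (?nu + ?nh))"
        using Y_lip[OF g' g less_imp_le[OF l(1)] less_imp_le[OF bk] less_imp_le[OF l(3)], of j] Dk unfolding fh_diff by linarith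
      have "l ^ k * \<bar>DL is ?F \<tau> x\<bar> <= l ^ length is * N0 (DL is ?F)"
        using l i by (intro mult_mono power_decreasing N0_sn smooth_DL F) auto
      also have "\<dots> <= NN k l ?F" by (rule NN_DL[OF F i less_imp_le[OF l(1)]])
      finally have "l ^ k * \<bar>DL is ?F \<tau> x\<bar> <= 3 * (K * (?nu + ?nh))" using N by linarith
      then have "\<bar>DL is ?F \<tau> x\<bar> <= ?L * (?nu + ?nh)" using l(1) by (simp add: field_simps)
      then show ?thesis unfolding DL_diff[OF sY] by simp
    qed
    then show ?thesis using g' by blast
  qed
  then show ?thesis using \<delta> K(1) l(1) by (intro exI[of _ ?L] conjI exI[of _ \<delta>]) auto
qed

definition Yv :: "'n vfun => 'n vfun" where "Yv u = (%x. \<chi> j. Y (vf u) j 0 x)"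

definition B :: "'n vfun set" where "B = {u. Cinf_ap u \<and> nc N0 (vp (vf u)) < rs/4}"

lemma B_good: "Cinf_ap u ==> u \<in> B \<longleftrightarrow> good (vf u)" unfolding B_def good_def Cinf_vf by simp

lemma vf_Yv: "vf (Yv u) j = slice 0 (Y (vf u) j)" by (simp add: vf_apply fun_eq_iff Yv_def rp_def)

lemma Cinf_Yv: "u \<in> B ==> Cinf_ap (Yv u)"
  unfolding Cinf_vf vf_Yv using smooth_rp[OF reparam_const smooth_Y] B_good B_def by blast

lemma Yv_rp:
  assumes g: "good (fh u \<eta> h)" and u: "Cinf_ap u" "Cinf_ap h"
  shows "fadd u (fscale (sin e * \<eta>) h) \<in> B" "vf (Yv (fadd u (fscale (sin e * \<eta>) h))) j = slice (Complex e 0) (Y (fh u \<eta> h) j)"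
proof -
  let ?u = "fadd u (fscale (sin e * \<eta>) h)"
  have e: "(%j. rp (ge e) (fh u \<eta> h j)) = vf ?u" by (intro ext) (simp only: fh_rp)
  have "Cinf_ap ?u" using Cinf_ops u by blast
  then show "?u \<in> B" using sol_rp(1)[OF g, of e] unfolding e by (simp add: B_good)
  have "Y (vf ?u) j = rp (ge e) (Y (fh u \<eta> h) j)" using Y_rp[OF g, of e j] unfolding e .
  then show "vf (Yv ?u) j = slice (Complex e 0) (Y (fh u \<eta> h) j)"
    unfolding vf_Yv by (simp add: fun_eq_iff rp_def ge_def)
qed

text \<open>The sine is bounded, so a small \<eta> keeps the family in the ball for all values of
  the parameter at once.\<close>

lemma good_small:
  assumes u: "u \<in> B" and h: "Cinf_ap h"
  shows "\<exists>\<eta>>0. \<eta> <= 1 \<and> good (fh u \<eta> h)"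
proof -
  have uC: "Cinf_ap u" "nc N0 (vp (vf u)) < rs/4" using u unfolding B_def by auto
  obtain K where K: "K >= 0" "\<And>l \<eta> u (h :: 'n vfun). 0 <= l ==> l <= 1 ==> 0 <= \<eta> ==> \<eta> <= 1 ==> Cinf_ap u ==> Cinf_ap h ==>
    nc (NN 0 l) (vp (fh u \<eta> h)) <= K * (normk_vec (0 + 3) u + \<eta> * normk_vec (0 + 3) h)" using nc_fh[of 0] by blast
  let ?z = "%x. 0 :: real^'n" and ?n = "normk_vec 3 (fsub h (%x. 0))"
  note sh = Cinf_ops(2)[OF h Cinf_0] note su = Cinf_ops(2)[OF uC(1) uC(1)]
  have n: "?n >= 0" by (rule nv_nonneg[OF sh])
  define gap where "gap = rs/4 - nc N0 (vp (vf u))"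
  define \<eta> where "\<eta> = min 1 (gap / (2 * (K * ?n + 1)))"
  have Kn: "K * ?n >= 0" using K(1) n by simp
  have \<eta>: "0 < \<eta>" "\<eta> <= 1" "(K * ?n + 1) * \<eta> <= gap / 2"
  proof -
    show "0 < \<eta>" using uC(2) Kn by (simp add: \<eta>_def gap_def)
    have "(K * ?n + 1) * \<eta> <= (K * ?n + 1) * (gap / (2 * (K * ?n + 1)))" using Kn by (intro mult_left_mono) (auto simp: \<eta>_def)
    also have "\<dots> = gap / 2" using Kn by (simp add: field_simps)
    finally show "(K * ?n + 1) * \<eta> <= gap / 2" .
  qed (simp add: \<eta>_def)
  note smf = smooth_fh[OF uC(1) h, of \<eta>] note smu = smooth_fh[OF uC(1) Cinf_0, of \<eta>, unfolded fh_0]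
  have sv: "smc (vp (vf u))" "smc (vp (fh u \<eta> h))" by (rule smc_vp, rule smu) (rule smc_vp, rule smf)
  have D: "vp (fh u \<eta> h) - vp (vf u) = vp (fh (fsub u u) \<eta> (fsub h ?z))"
    unfolding fh_diff[symmetric] fh_0 by (rule vp_diff[OF smf smu])
  have 1: "nc N0 (vp (fh u \<eta> h)) <= nc N0 (vp (vf u)) + nc N0 (vp (fh u \<eta> h) - vp (vf u))"
    by (rule nc_tri[OF admN0 sv])
  have 2: "nc N0 (vp (fh u \<eta> h) - vp (vf u)) <= K * (0 + \<eta> * ?n)"
    unfolding D using K(2)[of 1, OF _ _ _ _ su sh, of \<eta>] \<eta> nv_self[OF uC(1), of 3] unfolding NN0 by simp
  have 3: "K * (0 + \<eta> * ?n) <= gap / 2" using \<eta> by (simp add: algebra_simps)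
  have "A < t" if "A <= P + Q" "Q <= R" "R <= (t - P) / 2" "P < t" for A P Q R t :: real
    using that by argo
  from this[OF 1 2 3[unfolded gap_def] uC(2)] have "nc N0 (vp (fh u \<eta> h)) < rs/4" .
  then show ?thesis using \<eta> smf unfolding good_def by blast
qed

end

section \<open>Differentiability of the solution map\<close>

lemma DL_cmult: "smooth F ==> DL is (cst r * F) = cst r * DL is F"
  by (induction "is" arbitrary: F) (simp_all only: DL.simps D_cmult smooth_D)

text \<open>The straight line \<open>u + \<epsilon> h\<close> is the family with velocity
  \<open>u + \<eta> sin e h\<close> taken at \<open>e = arcsin (\<epsilon>/\<eta>)\<close>, whose
  derivative at 0 is \<open>1/\<eta>\<close>. This is the chain rule for the substitution, uniformly
  in \<open>x\<close>.\<close>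

lemma arcsin_quot:
  assumes R: "smooth R" and \<eta>: "\<eta> > 0" and e0: "e0 > 0"
  shows "eventually (%\<epsilon>. \<forall>x. \<bar>(1/\<epsilon>) * (R (Complex (arcsin (\<epsilon>/\<eta>)) 0) x - R 0 x) - (1/\<eta>) * D None R 0 x\<bar> < e0) (at 0)"
proof -
  note R' = smooth_D[OF R, of None]
  obtain M where M: "M > 0" "\<And>\<tau> x. \<bar>D None R \<tau> x\<bar> <= M" using AC_bdd_pos[OF smooth_AC[OF R']] by blast
  \<comment> \<open>The final errors are \<open>\<delta> * M\<close> and
    \<open>\<delta>' * (2/\<eta>)\<close>, each at most \<open>e0/4\<close>; the condition
    \<open>\<delta> \<le> 1/\<eta>\<close> bounds the quotient \<open>q\<close> by
    \<open>2/\<eta>\<close>.\<close>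
  define \<delta> where "\<delta> = min (1/\<eta>) (e0 / (4 * M))"
  have \<delta>: "\<delta> > 0" "\<delta> <= 1/\<eta>" "\<delta> * M <= e0 / 4" using \<eta> e0 M(1) by (auto simp: \<delta>_def min_def field_simps)
  define \<delta>' where "\<delta>' = e0 * \<eta> / 8"
  have \<delta>': "\<delta>' > 0" using e0 \<eta> by (simp add: \<delta>'_def)
  obtain d where d: "d > 0" "\<And>\<tau> \<tau>' x x'. dist \<tau> \<tau>' < d ==> dist x x' < d ==> \<bar>D None R \<tau> x - D None R \<tau>' x'\<bar> < \<delta>'"
    using AC_ucont[OF smooth_AC[OF R'] \<delta>'] by blast
  have "((%\<epsilon>. arcsin (\<epsilon>/\<eta>)) has_real_derivative 1/\<eta>) (at 0)"
    using \<eta> by (auto intro!: derivative_eq_intros)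
  then have "((%\<epsilon>. arcsin (\<epsilon>/\<eta>) / \<epsilon>) \<longlongrightarrow> 1/\<eta>) (at 0)" unfolding DERIV_def by simp
  then have "eventually (%\<epsilon>. dist (arcsin (\<epsilon>/\<eta>) / \<epsilon>) (1/\<eta>) < \<delta>) (at 0)" by (rule tendstoD[OF _ \<delta>(1)])
  moreover have "eventually (%\<epsilon>::real. \<epsilon> \<noteq> 0 \<and> dist \<epsilon> 0 < d * \<eta> / 4) (at 0)"
    unfolding eventually_at using d(1) \<eta> by (intro exI[of _ "d * \<eta> / 4"]) auto
  ultimately show ?thesis
  proof eventually_elim
    case (elim \<epsilon>)
    define q where "q = arcsin (\<epsilon>/\<eta>) / \<epsilon>"
    have \<epsilon>: "\<epsilon> \<noteq> 0" "\<bar>\<epsilon>\<bar> < d * \<eta> / 4" using elim(2) by auto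
    have q: "\<bar>q - 1/\<eta>\<bar> < \<delta>" "arcsin (\<epsilon>/\<eta>) = q * \<epsilon>" using elim(1) \<epsilon> by (auto simp: q_def dist_real_def)
    have q2: "\<bar>q\<bar> <= 2 / \<eta>" using q(1) \<delta>(2) \<eta> by (simp add: field_simps abs_if split: if_splits)
    have "\<bar>q * \<epsilon>\<bar> <= 2 / \<eta> * \<bar>\<epsilon>\<bar>" unfolding abs_mult by (intro mult_right_mono q2) simp
    also have "\<dots> < 2 / \<eta> * (d * \<eta> / 4)" using \<epsilon>(2) \<eta> by (intro mult_strict_left_mono) auto
    finally have qd: "\<bar>q * \<epsilon>\<bar> < d" using \<eta> d(1) by simp
    show ?case
    proof
      fix x
      let ?g = "D None R 0 x"
      have "\<bar>shf None (q * \<epsilon>) R 0 x - R 0 x - (q * \<epsilon>) * ?g\<bar> <= \<delta>' * \<bar>q * \<epsilon>\<bar>"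
      proof (rule hasD_mvt_bound[OF smooth_hasD[OF R]])
        fix s assume "\<bar>s\<bar> <= \<bar>q * \<epsilon>\<bar>"
        then have "dist (complex_of_real s) 0 < d" using qd by simp
        then show "\<bar>shf None s (D None R) 0 x - ?g\<bar> <= \<delta>'" using d(2)[of "complex_of_real s" 0 x x] d(1) by simp
      qed
      then have b: "\<bar>R (Complex (q * \<epsilon>) 0) x - R 0 x - (q * \<epsilon>) * ?g\<bar> <= \<delta>' * \<bar>q * \<epsilon>\<bar>"
        by (simp add: complex_of_real_def)
      have "(1/\<epsilon>) * (R (Complex (q * \<epsilon>) 0) x - R 0 x) - (1/\<eta>) * ?g
        = (R (Complex (q * \<epsilon>) 0) x - R 0 x - (q * \<epsilon>) * ?g) / \<epsilon> + (q - 1/\<eta>) * ?g"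
        using \<epsilon>(1) by (simp add: field_simps)
      also have "\<bar>\<dots>\<bar> <= \<delta>' * \<bar>q\<bar> + \<delta> * M"
      proof (rule order_trans[OF abs_triangle_ineq add_mono])
        have "\<bar>(R (Complex (q * \<epsilon>) 0) x - R 0 x - (q * \<epsilon>) * ?g) / \<epsilon>\<bar> <= (\<delta>' * \<bar>q * \<epsilon>\<bar>) / \<bar>\<epsilon>\<bar>"
          unfolding abs_divide using b by (rule divide_right_mono) simp
        also have "\<dots> = \<delta>' * \<bar>q\<bar>" using \<epsilon>(1) by (simp add: abs_mult)
        finally show "\<bar>(R (Complex (q * \<epsilon>) 0) x - R 0 x - (q * \<epsilon>) * ?g) / \<epsilon>\<bar> <= \<delta>' * \<bar>q\<bar>" .
        show "\<bar>(q - 1/\<eta>) * ?g\<bar> <= \<delta> * M" unfolding abs_mult using q(1) M(2) \<delta>(1) by (intro mult_mono) auto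
      qed
      also have "\<dots> <= \<delta>' * (2 / \<eta>) + e0 / 4" using q2 \<delta>(3) \<delta>' by (intro add_mono mult_left_mono) auto
      also have "\<dots> < e0" using \<eta> e0 by (simp add: \<delta>'_def)
      finally show "\<bar>(1/\<epsilon>) * (R (Complex (arcsin (\<epsilon>/\<eta>)) 0) x - R 0 x) - (1/\<eta>) * ?g\<bar> < e0" unfolding q(2) .
    qed
  qed
qed

lemma continuous_map_apI:
  fixes f :: "'a => 'n::finite vfun"
  assumes "\<And>x. x \<in> topspace X ==> Cinf_ap (f x)"
    and U: "\<And>x k e. x \<in> topspace X ==> k >= 1 ==> e > 0 ==> \<exists>U. openin X U \<and> x \<in> U \<and> (\<forall>y\<in>U. f y \<in> apball k (f x) e)"
  shows "continuous_map X ap_top f"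
  unfolding continuous_map_def
proof (intro conjI allI impI)
  show "f \<in> topspace X \<rightarrow> topspace ap_top" using assms(1) by simp
  fix W :: "'n vfun set" assume W: "openin ap_top W"
  show "openin X {x \<in> topspace X. f x \<in> W}"
  proof (subst openin_subopen, intro ballI)
    fix x assume x: "x \<in> {x \<in> topspace X. f x \<in> W}"
    then have xX: "x \<in> topspace X" and "f x \<in> W" by auto
    from W[unfolded openin_ap, THEN conjunct2, rule_format, OF this(2)]
    obtain k e where k: "k >= 1" "e > 0" "apball k (f x) e \<subseteq> W" by (elim exE conjE)
    from U[OF xX k(1,2)] obtain U where U: "openin X U" "x \<in> U" "\<forall>y\<in>U. f y \<in> apball k (f x) e" by (elim exE conjE)
    then show "\<exists>T. openin X T \<and> x \<in> T \<and> T \<subseteq> {x \<in> topspace X. f x \<in> W}"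
      using k(3) openin_subset[OF U(1)] by (intro exI[of _ U]) blast
  qed
qed

section \<open>Directional derivatives of the solution map\<close>

context system
begin

definition Dv :: "'n vfun => real => 'n vfun => 'n vfun" where
  "Dv u \<eta> h = (%x. \<chi> j. (1/\<eta>) * D None (Y (fh u \<eta> h) j) 0 x)"

lemma vf_Dv: "vf (Dv u \<eta> h) j = cst (1/\<eta>) * slice 0 (D None (Y (fh u \<eta> h) j))"
  by (simp add: vf_apply fun_eq_iff Dv_def rp_def)

lemma Cinf_Dv: "good (fh u \<eta> h) ==> Cinf_ap (Dv u \<eta> h)"
  unfolding Cinf_vf vf_Dv by (intro allI smooth_mult smooth_cst smooth_rp[OF reparam_const] smooth_D smooth_Y)

lemma DX_Dv: assumes g: "good (fh u \<eta> h)" shows "DX is (vf (Dv u \<eta> h) j) \<tau> x = (1/\<eta>) * DL (None # map Some is) (Y (fh u \<eta> h) j) 0 x"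
proof -
  note s = smooth_D[OF smooth_Y[OF g]]
  show ?thesis unfolding vf_Dv DL_cmult[OF smooth_rp[OF reparam_const s]] DX_rp[OF reparam_const s] by (simp add: rp_def)
qed

lemma dirderiv_Y:
  assumes u: "u \<in> B" and h: "Cinf_ap h" and g: "good (fh u \<eta> h)" and \<eta>: "0 < \<eta>" and F: "\<And>u. u \<in> B ==> F u = Yv u"
  shows "has_dirderiv F u h (Dv u \<eta> h)" "dirderiv F u h = Dv u \<eta> h"
proof -
  have uC: "Cinf_ap u" using u unfolding B_def by blast
  have u0: "vf (Yv u) j = slice 0 (Y (fh u \<eta> h) j)" for j
  proof -
    have "fadd u (fscale (sin 0 * \<eta>) h) = u" by (simp add: fun_eq_iff fadd_def fscale_def)
    then show ?thesis using Yv_rp(2)[OF g uC h, of 0 j] by (simp add: zero_complex.code[symmetric])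
  qed
  have ue: "fadd u (fscale \<epsilon> h) \<in> B" "vf (Yv (fadd u (fscale \<epsilon> h))) j = slice (Complex (arcsin (\<epsilon>/\<eta>)) 0) (Y (fh u \<eta> h) j)"
    if "\<bar>\<epsilon>\<bar> < \<eta>" for \<epsilon> j
  proof -
    have "-1 <= \<epsilon>/\<eta>" "\<epsilon>/\<eta> <= 1" using that \<eta> by (auto simp: field_simps)
    then have "sin (arcsin (\<epsilon>/\<eta>)) * \<eta> = \<epsilon>" using \<eta> by simp
    then show "fadd u (fscale \<epsilon> h) \<in> B" "vf (Yv (fadd u (fscale \<epsilon> h))) j = slice (Complex (arcsin (\<epsilon>/\<eta>)) 0) (Y (fh u \<eta> h) j)"
      using Yv_rp[OF g uC h, of "arcsin (\<epsilon>/\<eta>)"] by simp_all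
  qed
  have ev: "eventually (%\<epsilon>. \<bar>\<epsilon>\<bar> < \<eta>) (at 0)" unfolding eventually_at using \<eta> by (intro exI[of _ \<eta>]) auto
  show hd: "has_dirderiv F u h (Dv u \<eta> h)"
    unfolding has_dirderiv_def
  proof (rule limitin_apI[OF Cinf_Dv[OF g]])
    show "\<forall>\<^sub>F \<epsilon> in at 0. Cinf_ap (fscale (1 / \<epsilon>) (fsub (F (fadd u (fscale \<epsilon> h))) (F u)))"
      using ev by (rule eventually_mono) (intro Cinf_ops, simp_all add: F ue(1) u Cinf_Yv)
    fix "is" :: "'n list" and j and e :: real assume e: "e > 0"
    note sY = smooth_Y[OF g, of j]
    let ?R = "DX is (Y (fh u \<eta> h) j)"
    have sR: "smooth ?R" by (rule smooth_DL[OF sY])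
    show "\<forall>\<^sub>F \<epsilon> in at 0. \<forall>x. \<bar>DX is (vf (fscale (1 / \<epsilon>) (fsub (F (fadd u (fscale \<epsilon> h))) (F u))) j) 0 x - DX is (vf (Dv u \<eta> h) j) 0 x\<bar> < e"
      using ev arcsin_quot[OF sR \<eta> e]
    proof eventually_elim
      case (elim \<epsilon>)
      note sl = smooth_rp[OF reparam_const sY]
      have "DX is (vf (fscale (1 / \<epsilon>) (fsub (F (fadd u (fscale \<epsilon> h))) (F u))) j) = cst (1/\<epsilon>) * (slice (Complex (arcsin (\<epsilon>/\<eta>)) 0) ?R - slice 0 ?R)"
        unfolding F[OF ue(1)[OF elim(1)]] F[OF u] vf_ops ue(2)[OF elim(1)] u0 DL_cmult[OF smooth_diff[OF sl sl]] DL_diff[OF sl sl] DX_rp[OF reparam_const sY] ..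
      then show ?case using elim(2) unfolding DX_Dv[OF g] by (simp add: rp_def DL_D[OF sY])
    qed
  qed
  show "dirderiv F u h = Dv u \<eta> h" unfolding dirderiv_def
  proof (rule the_equality[of "has_dirderiv F u h", OF hd])
    show "D = Dv u \<eta> h" if "has_dirderiv F u h D" for D
      using limitin_ap_unique[OF that[unfolded has_dirderiv_def] hd[unfolded has_dirderiv_def]] by simp
  qed
qed

lemma near_Y:
  assumes u: "u \<in> B" and e: "e > 0"
  shows "\<exists>m\<ge>1. \<exists>\<delta>>0. \<forall>u'\<in>apball m u \<delta>. u' \<in> B \<and> Yv u' \<in> apball k (Yv u) e"
proof -
  have uC: "Cinf_ap u" "good (vf u)" using u B_good unfolding B_def by blast+
  \<comment> \<open>\<open>near\<close> is used with direction 0, where the family is constant and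
    equal to \<open>u\<close>.\<close>
  obtain L \<delta> where L: "L >= 0" "\<delta> > 0" "\<And>u' h'. u' \<in> apball (k + 3) u \<delta> ==> h' \<in> apball (k + 3) (%x. 0 :: real^'n) \<delta> ==> good (fh u' 1 h') \<and>
     (\<forall>j is \<tau> x. length is <= k --> \<bar>DL is (Y (fh u' 1 h') j) \<tau> x - DL is (Y (fh u 1 (%x. 0)) j) \<tau> x\<bar>
        <= L * (normk_vec (k + 3) (fsub u' u) + normk_vec (k + 3) (fsub h' (%x. 0))))"
    using near[of u 1 "%x. 0" k, unfolded fh_0, OF uC(2,1) Cinf_0] by (auto simp: fh_0)
  define \<delta>' where "\<delta>' = min \<delta> (e / (L + 1))"
  have \<delta>': "\<delta>' > 0" using L e by (simp add: \<delta>'_def)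
  have "u' \<in> B \<and> Yv u' \<in> apball k (Yv u) e" if u': "u' \<in> apball (k + 3) u \<delta>'" for u'
  proof -
    have u'C: "Cinf_ap u'" "normk_vec (k + 3) (fsub u' u) < \<delta>'" using u' by (auto simp: apball_def)
    then have "u' \<in> apball (k + 3) u \<delta>" by (simp add: apball_def \<delta>'_def)
    from L(3)[OF this apball_self[OF Cinf_0 L(2)]] have g: "good (vf u')" and b: "\<And>j is \<tau> x. length is <= k ==>
       \<bar>DL is (Y (vf u') j) \<tau> x - DL is (Y (vf u) j) \<tau> x\<bar> <= L * normk_vec (k + 3) (fsub u' u)"
      unfolding fh_0 nv_self[OF Cinf_0] by auto
    have u'B: "u' \<in> B" using g B_good[OF u'C(1)] by simp
    have n: "normk_vec (k + 3) (fsub u' u) >= 0" by (rule nv_nonneg[OF Cinf_ops(2)[OF u'C(1) uC(1)]])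
    have "normk_vec k (fsub (Yv u') (Yv u)) <= L * normk_vec (k + 3) (fsub u' u)"
    proof (rule nv_le)
      fix j :: 'n and "is" :: "'n list" and x assume i: "length is <= k"
      note sY = smooth_Y[OF g, of j] smooth_Y[OF uC(2), of j]
      note sl = smooth_rp[OF reparam_const sY(1)] smooth_rp[OF reparam_const sY(2)]
      have "DX is (vf (fsub (Yv u') (Yv u)) j) 0 x = DX is (Y (vf u') j) 0 x - DX is (Y (vf u) j) 0 x"
        unfolding vf_ops vf_Yv DL_diff[OF sl] DX_rp[OF reparam_const sY(1)] DX_rp[OF reparam_const sY(2)] by (simp add: rp_def)
      then show "\<bar>DX is (vf (fsub (Yv u') (Yv u)) j) 0 x\<bar> <= L * normk_vec (k + 3) (fsub u' u)" using b[of "map Some is" j 0 x] i by simp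
    qed
    also have "\<dots> <= (L + 1) * normk_vec (k + 3) (fsub u' u)" using n by (intro mult_right_mono) auto
    also have "\<dots> < (L + 1) * (e / (L + 1))" using u'C(2) L(1) unfolding \<delta>'_def by (intro mult_strict_left_mono) auto
    also have "\<dots> = e" using L(1) by simp
    finally show ?thesis using u'B Cinf_Yv[OF u'B] by (simp add: apball_def)
  qed
  then show ?thesis using \<delta>' by (intro exI[of _ "k + 3"] conjI exI[of _ \<delta>'] ballI) auto
qed

lemma B_open: "openin ap_top B"
  unfolding openin_ap
proof (intro conjI ballI)
  show "B \<subseteq> Collect Cinf_ap" unfolding B_def by blast
  fix u assume "u \<in> B"
  then obtain m \<delta> where "m >= 1" "\<delta> > 0" "\<forall>u'\<in>apball m u \<delta>. u' \<in> B" using near_Y[OF _ zero_less_one] by meson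
  then show "\<exists>k e. k >= 1 \<and> e > 0 \<and> apball k u e \<subseteq> B" by (intro exI[of _ m] exI[of _ \<delta>]) auto
qed

lemma Yv_cont: "continuous_map (subtopology ap_top B) ap_top Yv"
proof (rule continuous_map_apI)
  show "u \<in> topspace (subtopology ap_top B) ==> Cinf_ap (Yv u)" for u using Cinf_Yv by simp
  fix u k and e :: real assume u: "u \<in> topspace (subtopology ap_top B)" and e: "e > 0"
  then have uC: "u \<in> B" "Cinf_ap u" by auto
  then obtain m \<delta> where m: "m >= 1" "\<delta> > 0" "\<And>u'. u' \<in> apball m u \<delta> ==> u' \<in> B \<and> Yv u' \<in> apball k (Yv u) e" using near_Y[OF uC(1) e, of k] by blast
  have "openin (subtopology ap_top B) (apball m u \<delta> \<inter> B)" by (intro openin_subtopology_Int apball_open m uC)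
  then show "\<exists>U. openin (subtopology ap_top B) U \<and> u \<in> U \<and> (\<forall>y\<in>U. Yv y \<in> apball k (Yv u) e)"
    using m uC apball_self[OF uC(2) m(2)] by (intro exI[of _ "apball m u \<delta> \<inter> B"]) auto
qed

lemma C1F_Y:
  assumes V: "openin ap_top V" "V \<subseteq> B" and F: "\<And>u. u \<in> B ==> F u = Yv u"
  shows "C1F V F"
  unfolding C1F_def
proof (intro conjI V ballI)
  show "F ` V \<subseteq> topspace ap_top" using V F Cinf_Yv by auto
  show "\<exists>D. has_dirderiv F u h D" if u: "u \<in> V" and h: "h \<in> topspace ap_top" for u and h :: "'n vfun"
  proof -
    obtain \<eta> where \<eta>: "\<eta> > 0" "good (fh u \<eta> h)" using good_small[of u h] u h V by auto
    then show ?thesis using dirderiv_Y(1)[OF _ _ \<eta>(2,1) F] u h V by auto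
  qed
  let ?X = "subtopology (prod_topology ap_top ap_top) (V \<times> (topspace ap_top :: 'n vfun set))"
  show "continuous_map ?X ap_top (%(x, h). dirderiv F x h)"
  proof (rule continuous_map_apI)
    fix p assume "p \<in> topspace ?X"
    then obtain u h where p: "p = (u, h)" "u \<in> V" "Cinf_ap h" by auto
    then have uB: "u \<in> B" "Cinf_ap u" using V unfolding B_def by auto
    obtain \<eta> where \<eta>: "\<eta> > 0" "\<eta> <= 1" "good (fh u \<eta> h)" using good_small[OF uB(1) p(3)] by blast
    have dd: "dirderiv F u h = Dv u \<eta> h" by (rule dirderiv_Y(2)[OF uB(1) p(3) \<eta>(3,1)]) (rule F)
    show "Cinf_ap (case p of (x, h) => dirderiv F x h)" unfolding p(1) prod.case dd by (rule Cinf_Dv[OF \<eta>(3)])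
    fix k and e :: real assume e: "e > 0"
    \<comment> \<open>\<open>Dv\<close> contains one derivative in the parameter, hence
      \<open>Suc k\<close>. The same \<eta> serves for all nearby pairs because \<open>good\<close>
      persists near \<open>u\<close> and \<open>h\<close>.\<close>
    let ?m = "Suc k + 3"
    obtain L \<delta> where L: "L >= 0" "\<delta> > 0" "\<And>u' h'. u' \<in> apball ?m u \<delta> ==> h' \<in> apball ?m h \<delta> ==> good (fh u' \<eta> h') \<and>
     (\<forall>j is \<tau> x. length is <= Suc k --> \<bar>DL is (Y (fh u' \<eta> h') j) \<tau> x - DL is (Y (fh u \<eta> h) j) \<tau> x\<bar>
        <= L * (normk_vec ?m (fsub u' u) + normk_vec ?m (fsub h' h)))"
      using near[OF \<eta>(3) uB(2) p(3) less_imp_le[OF \<eta>(1)] \<eta>(2), of "Suc k"] by blast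
    define \<delta>' where "\<delta>' = min \<delta> (e * \<eta> / (2 * (L + 1)))"
    have \<delta>': "\<delta>' > 0" "\<delta>' <= \<delta>" "\<delta>' <= e * \<eta> / (2 * (L + 1))" using L e \<eta> by (simp_all add: \<delta>'_def)
    let ?U = "(apball ?m u \<delta>' \<times> apball ?m h \<delta>') \<inter> (V \<times> topspace ap_top)"
    have "openin (prod_topology ap_top ap_top) (apball ?m u \<delta>' \<times> apball ?m h \<delta>')"
      unfolding openin_prod_Times_iff using apball_open[OF uB(2) _ \<delta>'(1), of ?m] apball_open[OF p(3) _ \<delta>'(1), of ?m] by simp
    then have "openin ?X ?U" by (rule openin_subtopology_Int)
    moreover have "p \<in> ?U" using p apball_self[OF uB(2) \<delta>'(1)] apball_self[OF p(3) \<delta>'(1)] by auto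
    moreover have "(case y of (x, h) => dirderiv F x h) \<in> apball k (case p of (x, h) => dirderiv F x h) e" if y: "y \<in> ?U" for y
    proof -
      obtain u' h' where y': "y = (u', h')" "u' \<in> apball ?m u \<delta>'" "h' \<in> apball ?m h \<delta>'" "u' \<in> V" using y by auto
      have C: "Cinf_ap h'" "u' \<in> B" using y' V unfolding apball_def by auto
      have n: "normk_vec ?m (fsub u' u) < \<delta>'" "normk_vec ?m (fsub h' h) < \<delta>'" using y' by (auto simp: apball_def)
      have "u' \<in> apball ?m u \<delta>" "h' \<in> apball ?m h \<delta>"
        using y' apball_mono[OF uB(2) order_refl \<delta>'(2)] apball_mono[OF p(3) order_refl \<delta>'(2)] by blast+
      from L(3)[OF this] have g: "good (fh u' \<eta> h')" and b: "\<And>j is \<tau> x. length is <= Suc k ==>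
          \<bar>DL is (Y (fh u' \<eta> h') j) \<tau> x - DL is (Y (fh u \<eta> h) j) \<tau> x\<bar> <= L * (normk_vec ?m (fsub u' u) + normk_vec ?m (fsub h' h))" by auto
      have dd': "dirderiv F u' h' = Dv u' \<eta> h'" by (rule dirderiv_Y(2)[OF C(2,1) g \<eta>(1)]) (rule F)
      note CD = Cinf_Dv[OF g] Cinf_Dv[OF \<eta>(3)]
      have "normk_vec k (fsub (Dv u' \<eta> h') (Dv u \<eta> h)) <= (1/\<eta>) * (L * (\<delta>' + \<delta>'))"
      proof (rule nv_le)
        fix j :: 'n and "is" :: "'n list" and x assume i: "length is <= k"
        have sm: "smooth (vf (Dv u' \<eta> h') j)" "smooth (vf (Dv u \<eta> h) j)" using CD unfolding Cinf_vf by blast+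
        let ?d = "DL (None # map Some is) (Y (fh u' \<eta> h') j) 0 x - DL (None # map Some is) (Y (fh u \<eta> h) j) 0 x"
        have "DX is (vf (fsub (Dv u' \<eta> h') (Dv u \<eta> h)) j) 0 x = (1/\<eta>) * ?d"
          unfolding vf_ops DL_diff[OF sm] unfolding fun_diff_def DX_Dv[OF g] DX_Dv[OF \<eta>(3)] by (simp only: right_diff_distrib)
        moreover have "\<bar>?d\<bar> <= L * (\<delta>' + \<delta>')"
          using b[of "None # map Some is" j 0 x] i mult_left_mono[OF add_mono[OF less_imp_le[OF n(1)] less_imp_le[OF n(2)]] L(1)] by simp
        ultimately show "\<bar>DX is (vf (fsub (Dv u' \<eta> h') (Dv u \<eta> h)) j) 0 x\<bar> <= (1/\<eta>) * (L * (\<delta>' + \<delta>'))"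
          using \<eta>(1) by (simp add: abs_mult divide_right_mono)
      qed
      also have "\<dots> < (1/\<eta>) * ((L + 1) * (\<delta>' + \<delta>'))" using \<eta>(1) \<delta>'(1) by (intro mult_strict_left_mono mult_strict_right_mono) auto
      also have "\<dots> <= (1/\<eta>) * ((L + 1) * (2 * (e * \<eta> / (2 * (L + 1)))))" using \<eta>(1) \<delta>'(3) L(1) by (intro mult_left_mono) auto
      also have "\<dots> = e"
      proof -
        have "(1/\<eta>) * (M * (2 * (e * \<eta> / (2 * M)))) = e" if "M > 0" for M using that \<eta>(1) by simp
        moreover have "L + 1 > 0" using L(1) by linarith
        ultimately show ?thesis .
      qed
      finally show ?thesis unfolding y'(1) p(1) prod.case dd dd' using CD by (simp add: apball_def)
    qed
    ultimately show "\<exists>U. openin ?X U \<and> p \<in> U \<and> (\<forall>y\<in>U. (case y of (x, h) => dirderiv F x h) \<in> apball k (case p of (x, h) => dirderiv F x h) e)"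
      by (intro exI[of _ ?U] conjI ballI)
  qed
qed

end

section \<open>Existence of geodesics\<close>

lemma curve_deriv_D:
  assumes c: "curve_deriv \<gamma> t G" and s: "\<And>s. s \<in> {0..1} ==> Cinf_ap (\<gamma> s)" and t: "t \<in> {0..1}"
  shows "((%s. DX is (vf (\<gamma> s) j) \<tau> x) has_real_derivative DX is (vf G j) \<tau> x) (at t within {0..1})"
  unfolding has_field_derivative_iff
proof (rule tendstoI)
  fix e :: real assume e: "e > 0"
  let ?S = "{s. t + s \<in> {0..1}}"
  have "eventually (%s. Cinf_ap (fscale (1 / s) (fsub (\<gamma> (t + s)) (\<gamma> t))) \<and>
     (\<forall>\<tau> x. \<bar>DX is (vf (fscale (1 / s) (fsub (\<gamma> (t + s)) (\<gamma> t))) j) \<tau> x - DX is (vf G j) \<tau> x\<bar> < e)) (at 0 within ?S)"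
    by (rule limitin_apD[OF c[unfolded curve_deriv_def] e])
  then obtain d where d: "d > 0" "\<And>s. s \<in> ?S ==> s \<noteq> 0 ==> dist s 0 < d ==>
      \<bar>DX is (vf (fscale (1 / s) (fsub (\<gamma> (t + s)) (\<gamma> t))) j) \<tau> x - DX is (vf G j) \<tau> x\<bar> < e"
    unfolding eventually_at by blast
  show "\<forall>\<^sub>F y in at t within {0..1}. dist ((DX is (vf (\<gamma> y) j) \<tau> x - DX is (vf (\<gamma> t) j) \<tau> x) / (y - t)) (DX is (vf G j) \<tau> x) < e"
    unfolding eventually_at
  proof (intro exI[of _ d] conjI d(1) ballI impI)
    fix y assume y: "y \<in> {0..1}" "y \<noteq> t \<and> dist y t < d"
    have sm: "smooth (vf (\<gamma> y) j)" "smooth (vf (\<gamma> t) j)" using s[OF y(1)] s[OF t] unfolding Cinf_vf by blast+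
    have "DX is (vf (fscale (1 / (y - t)) (fsub (\<gamma> y) (\<gamma> t))) j) \<tau> x = (DX is (vf (\<gamma> y) j) \<tau> x - DX is (vf (\<gamma> t) j) \<tau> x) / (y - t)"
      unfolding vf_ops DL_cmult[OF smooth_diff[OF sm]] DL_diff[OF sm] by simp
    then show "dist ((DX is (vf (\<gamma> y) j) \<tau> x - DX is (vf (\<gamma> t) j) \<tau> x) / (y - t)) (DX is (vf G j) \<tau> x) < e"
      using d(2)[of "y - t"] y by (simp add: dist_real_def)
  qed
qed

definition pr :: "('n::finite => 'n fld) => real => 'n vfun" where "pr w t = (%x. \<chi> j. w j (Complex 0 t) x)"

lemma vf_pr: "vf (pr w t) j = slice (Complex 0 t) (w j)" by (simp add: vf_apply fun_eq_iff pr_def rp_def)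

lemma Cinf_pr: "(\<And>j. smooth (w j)) ==> Cinf_ap (pr w t)"
  unfolding Cinf_vf vf_pr using smooth_rp[OF reparam_const] by blast

lemma DX_J: "smooth F ==> DX is (J F) = J (DX is F)"
  by (induction "is" arbitrary: F) (simp_all only: list.map DL.simps fop_D[OF fop_J] smooth_D)

lemma pr_curve:
  assumes w: "\<And>j. smooth (w j)" and u: "Cinf_ap u" and z: "\<And>j. z j = vf u j + J (w j)" and t: "t \<in> {0..1}"
  shows "curve_deriv (pr z) t (pr w t)"
  unfolding curve_deriv_def
proof (rule limitin_apI[OF Cinf_pr[OF w]])
  have su: "smooth (vf u j)" for j using u unfolding Cinf_vf by blast
  have sz: "smooth (z j)" for j unfolding z by (intro smooth_add su smooth_J w)
  show "\<forall>\<^sub>F s in at 0 within {s. t + s \<in> {0..1}}. Cinf_ap (fscale (1 / s) (fsub (pr z (t + s)) (pr z t)))"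
    by (intro always_eventually allI Cinf_ops Cinf_pr sz)
  fix "is" :: "'a list" and j and e :: real assume e: "e > 0"
  let ?F = "DX is (w j)"
  have sF: "smooth ?F" by (rule smooth_DL[OF w])
  obtain d where d: "d > 0" "\<And>s t a x. \<bar>s - t\<bar> < d ==> s \<in> {0..1} ==> t \<in> {0..1} ==>
    \<bar>J ?F (Complex a s) x - J ?F (Complex a t) x - (s - t) * ?F (Complex a t) x\<bar> <= (e/2) * \<bar>s - t\<bar>"
    using J_quot[OF smooth_AC[OF sF] half_gt_zero[OF e]] by blast
  show "\<forall>\<^sub>F s in at 0 within {s. t + s \<in> {0..1}}. \<forall>x. \<bar>DX is (vf (fscale (1 / s) (fsub (pr z (t + s)) (pr z t))) j) 0 x - DX is (vf (pr w t) j) 0 x\<bar> < e"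
    unfolding eventually_at
  proof (intro exI[of _ d] conjI d(1) ballI impI allI)
    fix s x assume s: "s \<in> {s. t + s \<in> {0..1}}" "s \<noteq> 0 \<and> dist s 0 < d"
    note sl = smooth_rp[OF reparam_const sz]
    have zx: "DX is (z j) \<tau> x = dpart (rev is) (comp j u) x + J ?F \<tau> x" for \<tau>
      unfolding z DL_add[OF su smooth_J[OF w]] DX_J[OF w] plus_fun_apply unfolding vf_def DX_cf by (simp only: cf_apply)
    have "DX is (vf (fscale (1 / s) (fsub (pr z (t + s)) (pr z t))) j) 0 x - DX is (vf (pr w t) j) 0 x
      = (1/s) * (DX is (z j) (Complex 0 (t + s)) x - DX is (z j) (Complex 0 t) x) - ?F (Complex 0 t) x"
      unfolding vf_ops vf_pr DL_cmult[OF smooth_diff[OF sl sl]] DL_diff[OF sl sl] DX_rp[OF reparam_const sz] DX_rp[OF reparam_const w] by (simp add: rp_def)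
    also have "\<dots> = (J ?F (Complex 0 (t + s)) x - J ?F (Complex 0 t) x - s * ?F (Complex 0 t) x) / s"
      unfolding zx using s(2) by (simp add: field_simps)
    also have "\<bar>\<dots>\<bar> <= (e/2) * \<bar>s\<bar> / \<bar>s\<bar>"
      unfolding abs_divide using d(2)[of "t + s" t 0 x] s t by (intro divide_right_mono) auto
    also have "\<dots> < e" using s(2) e by simp
    finally show "\<bar>DX is (vf (fscale (1 / s) (fsub (pr z (t + s)) (pr z t))) j) 0 x - DX is (vf (pr w t) j) 0 x\<bar> < e" .
  qed
qed

lemma J_0: "Im \<tau> = 0 ==> J F \<tau> x = 0" by (simp add: J_def clamp_def)

lemma J_vf_1: "J (vf u j) (Complex e 1) x = u x $ j" by (simp add: J_def clamp_def vf_apply)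

lemma nc_cp_sub:
  assumes N: "adm a C N" and c: "smc c" shows "nc N (cp (%j. c (IF j)) (%j. c (IV j))) <= nc N c"
  unfolding nc_def
proof (rule sum_mono)
  fix b
  have z: "qn N b 0 = 0" for b unfolding qn_def D_0 adm_0[OF N] by (cases "isH b") simp_all
  show "qn N b (cp (%j. c (IF j)) (%j. c (IV j)) b) <= qn N b (c b)"
    using qn_nonneg[OF N smcD[OF c]] z by (cases b) (simp_all only: cp.simps order_refl)
qed

context flow
begin

text \<open>The common bound 2 is dictated by \<open>J - E1 J J\<close>, a difference of two
  operators of norm at most 1.\<close>

lemma J_ops:
  "gop a C 2 (%F. J (J F))" "gop a C 2 J" "gop a C 2 (%F. J F - E1 (J (J F)))" "gop a C 2 (%F. J (J F - E1 (J (J F))))"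
proof -
  note JJ = gop_comp[OF gop_J gop_J, of a C] and E = gop_comp[OF gop_E1 gop_comp[OF gop_J gop_J], of a C]
  show "gop a C 2 (%F. J (J F))" by (rule gop_mono[OF JJ]) simp
  show "gop a C 2 J" by (rule gop_mono[OF gop_J]) simp
  show K: "gop a C 2 (%F. J F - E1 (J (J F)))" by (rule gop_mono[OF gop_diff[OF gop_J E]]) simp
  show "gop a C 2 (%F. J (J F - E1 (J (J F))))" by (rule gop_mono[OF gop_comp[OF gop_J K]]) simp
qed

text \<open>\<open>E\<close> is the initial value problem; its output will be the exponential
  map.\<close>

sublocale E: system al C rs ty "%F. J (J F)" J 1
  by unfold_locales (simp_all add: J_ops)

text \<open>\<open>I\<close> prescribes the displacement \<open>y\<close> at time 1: there
  \<open>J y\<close> equals \<open>y\<close>, and subtracting \<open>E1 J J w\<close> under the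
  outer integral cancels the double integral of \<open>w\<close>.\<close>

sublocale I: system al C rs ty "%F. J (J F - E1 (J (J F)))" "%F. J F - E1 (J (J F))" "-1"
  by unfold_locales (simp_all add: J_ops)

lemma small_field:
  fixes f :: "'n vfun"
  assumes f: "Cinf_ap f" and b: "\<And>j k x. \<bar>dx k (vf f j) 0 x\<bar> <= rs"
  shows "norm (f x - f y) <= (1/2) * norm (x - y)" "det (mat 1 + jac f x) > 1/2"
proof -
  have "\<bar>(f x - f y) $ j\<bar> <= real CARD('n) * rs * dist x y" for j
    using smooth_lipschitz[of "vf f j" 0 rs x y] f b unfolding Cinf_vf by (simp add: vf_apply)
  then have "norm (f x - f y) <= (\<Sum>j\<in>(UNIV::'n set). real CARD('n) * rs * dist x y)"
    by (intro order_trans[OF norm_le_l1_cart] sum_mono)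
  also have "\<dots> = real CARD('n) * (real CARD('n) * rs) * dist x y" by simp
  also have "\<dots> <= (1/2) * dist x y" by (intro mult_right_mono rsn) simp
  finally show "norm (f x - f y) <= (1/2) * norm (x - y)" by (simp add: dist_norm)
  show "det (mat 1 + jac f x) > 1/2"
    by (rule det) (use b[of _ _ x] in \<open>simp add: jac_def vf_def D_cf cf_apply\<close>)
qed

text \<open>The solution of \<open>E\<close> is read off at parameter 0. \<open>pr_curve\<close>
  turns its integral equations into derivatives of curves, and \<open>Ainv_Bop\<close> at each
  frozen time identifies \<open>w\<close> with the acceleration. The bound \<open>rs/2\<close> is
  recorded for the uniqueness proof.\<close>

lemma geod_exists:
  assumes u: "u \<in> E.B"
  shows "\<exists>\<phi> v. geod_sol al u \<phi> v \<and> (\<forall>t\<in>{0..1}. nc N0 (cp (vf (chart (\<phi> t))) (vf (v t))) <= rs/2) \<and> chart (\<phi> 1) = E.Yv u"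
proof -
  have uC: "Cinf_ap u" "E.good (vf u)" using u E.B_good unfolding E.B_def by blast+
  define c where "c = E.sol (vf u)"
  have sc: "smc c" unfolding c_def by (rule E.sol(3)[OF uC(2)])
  note sm = smcD[OF sc]
  have S: "c (IF j) = J (vf u j) + J (J (c (IW j)))" "c (IV j) = vf u j + J (c (IW j))" "c (IW j) = Fout a c (IW j)"
      "c (IH j i) = Fout a c (IH j i)" for i j
    using E.sol(1)[OF uC(2)] unfolding sys_def c_def[symmetric] by blast+
  have cb: "nc N0 c <= rs/2" using E.sol(4)[OF uC(2)] unfolding c_def by simp
  have su: "smooth (vf u j)" for j using uC(1) unfolding Cinf_vf by blast
  define f v where "f = pr (%j. c (IF j))" and "v = pr (%j. c (IV j))"
  define \<phi> where "\<phi> t x = x + f t x" for t x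
  have ch: "chart (\<phi> t) = f t" for t by (simp add: chart_def fsub_def \<phi>_def fun_eq_iff)
  have fC: "Cinf_ap (f t)" and vC: "Cinf_ap (v t)" for t unfolding f_def v_def by (intro Cinf_pr sm)+
  have b: "\<bar>dx k (vf (f t) j) 0 x\<bar> <= rs" for t k j x
  proof -
    have "\<bar>dx k (c (IF j)) (Complex 0 t) x\<bar> <= N0 (dx k (c (IF j)))" by (rule N0_sn[OF smooth_D[OF sm]])
    also have "\<dots> <= nc N0 c" by (rule nc_cmp(2)[OF admN0 sc])
    finally show ?thesis unfolding f_def vf_pr D_rp[OF reparam_const sm] using cb rs by (simp add: rp_def)
  qed
  note sf = small_field[OF fC b]
  have W: "Ainv al (Bop al (%y. v t (inv (\<phi> t) y))) (\<phi> t x) = pr (%j. c (IW j)) t x" for t x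
  proof (rule vec_eq_iff[THEN iffD2], rule allI)
    fix j
    let ?c = "%b. slice (Complex 0 t) (c b)"
    have "Ainv al (Bop al (%y. v t (inv (\<phi> t) y))) (\<phi> t x) $ j = ?c (IW j) 0 x"
    proof (rule Ainv_Bop[where f = "f t" and c = ?c])
      show "smc ?c" unfolding smc_def using smooth_rp[OF reparam_const sm] by blast
      show "?c (IW j) = Fout a ?c (IW j)" for j
        unfolding Fout_rp[OF reparam_const sc] using S(3)[of j] by (rule arg_cong)
      show "?c (IH j i) = Fout a ?c (IH j i)" for j i
        unfolding Fout_rp[OF reparam_const sc] using S(4)[of j i] by (rule arg_cong)
    qed (simp_all only: f_def v_def vf_pr sf(1)[unfolded f_def] al \<phi>_def not_False_eq_True)
    then show "Ainv al (Bop al (%y. v t (inv (\<phi> t) y))) (\<phi> t x) $ j = pr (%j. c (IW j)) t x $ j" by (simp add: rp_def pr_def)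
  qed
  have fz: "c (IF j) = vf (%x. 0) j + J (c (IV j))" for j
  proof -
    have "J (c (IV j)) = J (vf u j) + J (J (c (IW j)))" unfolding S(2)[of j] by (rule J_add[OF smooth_AC[OF su] smooth_AC[OF smooth_J[OF sm]]])
    then show ?thesis using S(1)[of j] by (simp add: fun_eq_iff vf_apply)
  qed
  have "geod_sol al u \<phi> v" unfolding geod_sol_def
  proof (intro conjI ballI)
    have "f 0 x = 0" for x
      unfolding f_def pr_def by (intro vec_eq_iff[THEN iffD2] allI) (simp add: fz vf_apply J_0)
    then show "\<phi> 0 = id" by (simp add: fun_eq_iff \<phi>_def)
    show "v 0 = u" unfolding v_def pr_def by (intro ext vec_eq_iff[THEN iffD2] allI) (simp add: S(2) vf_apply J_0)
    fix t :: real assume t: "t \<in> {0..1}"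
    show "Cinf_ap (v t)" by (rule vC)
    show "Diff_inf (\<phi> t)" unfolding Diff_inf_def Diff_ap_def Let_def ch[unfolded chart_def]
      using fC[of t] sf(2)[of t] unfolding Cinf_ap_def by (intro allI impI conjI exI[of _ "1/2"]) auto
    have "fsub (\<phi> s) (\<phi> r) = fsub (f s) (f r)" for s r by (simp add: fun_eq_iff fsub_def \<phi>_def)
    then show "curve_deriv \<phi> t (v t)"
      using pr_curve[where w = "%j. c (IV j)" and z = "%j. c (IF j)", OF sm Cinf_0 fz t] unfolding curve_deriv_def f_def v_def by simp
    show "curve_deriv v t (%x. Ainv al (Bop al (%y. v t (inv (\<phi> t) y))) (\<phi> t x))"
      unfolding W unfolding v_def by (rule pr_curve[where u = u, OF sm uC(1) S(2) t])
  qed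
  moreover have "nc N0 (cp (vf (chart (\<phi> t))) (vf (v t))) <= rs/2" for t
  proof -
    let ?c = "%b. slice (Complex 0 t) (c b)"
    have s: "smc ?c" unfolding smc_def using smooth_rp[OF reparam_const sm] by blast
    have "vf (f t) = (%j. ?c (IF j))" "vf (v t) = (%j. ?c (IV j))" by (intro ext, simp only: f_def v_def vf_pr)+
    then have "nc N0 (cp (vf (chart (\<phi> t))) (vf (v t))) <= nc N0 ?c" unfolding ch using nc_cp_sub[OF admN0 s] by simp
    then show ?thesis using nc_rp_N0[OF reparam_const sc, of "Complex 0 t"] cb by linarith
  qed
  moreover have "chart (\<phi> 1) = E.Yv u"
  proof (intro ext vec_eq_iff[THEN iffD2] allI)
    fix x j
    have "c (IF j) (Complex 0 1) x = u x $ j + J (J (c (IW j))) (Complex 0 1) x" unfolding S(1)[of j] by (simp add: J_vf_1)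
    also have "\<dots> = E.Yv u x $ j" by (simp add: E.Yv_def E.Y_def vf_apply E1_def c_def)
    finally show "chart (\<phi> 1) x $ j = E.Yv u x $ j" unfolding ch f_def pr_def by simp
  qed
  ultimately show ?thesis by blast
qed

end

section \<open>Uniqueness of geodesics\<close>

text \<open>The mean value inequality is applied to the values and to the differences
  \<open>G s \<tau> x - G s \<tau> y\<close>, that is, to both parts of \<open>N0\<close>; hence the
  factor 2.\<close>

lemma N0_MVT:
  fixes G G' :: "real => 'n::finite fld"
  assumes I: "convex I" and t0: "t0 \<in> I" "s \<in> I" "\<bar>s - t0\<bar> <= \<delta>"
    and d: "\<And>s \<tau> x. s \<in> I ==> ((%s. G s \<tau> x) has_real_derivative G' s \<tau> x) (at s within I)"
    and sm: "\<And>s. s \<in> I ==> smooth (G' s)" and b: "\<And>s. s \<in> I ==> N0 (G' s) <= B" and z: "G t0 = 0"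
  shows "N0 (G s) <= 2 * (B * \<delta>)"
proof -
  have B: "B >= 0" using N0_nonneg[OF sm[OF t0(1)]] b[OF t0(1)] by linarith
  have st: "c * norm (s - t0) <= c * \<delta>" if "c >= 0" for c :: real using t0(3) that by (simp add: mult_left_mono)
  have "N0 (G s) <= B * \<delta> + B * \<delta>"
  proof (rule N0_le)
    fix \<tau> x
    have "norm (G s \<tau> x - G t0 \<tau> x) <= B * norm (s - t0)"
    proof (rule field_differentiable_bound[OF I d _ t0(2,1)])
      show "norm (G' r \<tau> x) <= B" if "r \<in> I" for r using N0_sn[OF sm[OF that], of \<tau> x] b[OF that] by simp
    qed
    then show "\<bar>G s \<tau> x\<bar> <= B * \<delta>" using st[OF B] unfolding z by simp
    fix y
    have "norm ((G s \<tau> x - G s \<tau> y) - (G t0 \<tau> x - G t0 \<tau> y)) <= (B * sqrt (dist x y)) * norm (s - t0)"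
    proof (rule field_differentiable_bound[OF I DERIV_diff[OF d d] _ t0(2,1)])
      fix r assume r: "r \<in> I"
      have "hs (G' r) <= B" using b[OF r] sn_nonneg[OF smooth_AC[OF sm[OF r]]] unfolding N0_def by linarith
      then have "hs (G' r) * sqrt (dist x y) <= B * sqrt (dist x y)" by (intro mult_right_mono) simp_all
      then show "norm (G' r \<tau> x - G' r \<tau> y) <= B * sqrt (dist x y)" using hs_ge[OF sm[OF r], of \<tau> x y] by simp
    qed
    also have "\<dots> <= (B * sqrt (dist x y)) * \<delta>" by (rule st) (simp add: B)
    finally show "\<bar>G s \<tau> x - G s \<tau> y\<bar> <= B * \<delta> * sqrt (dist x y)" unfolding z by (simp add: mult_ac)
    show "B * \<delta> >= 0" using B t0(3) by (simp add: order_trans[OF abs_ge_zero])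
  qed
  then show ?thesis by simp
qed

lemma curve_cont:
  assumes c: "curve_deriv \<gamma> t G" and s: "\<And>s. s \<in> {0..1} ==> Cinf_ap (\<gamma> s)" and t: "t \<in> {0..1}" and e: "e > 0" and k: "k >= 1"
  shows "\<exists>d>0. \<forall>s\<in>{0..1}. \<bar>s - t\<bar> < d --> normk_vec k (fsub (\<gamma> s) (\<gamma> t)) < e"
proof -
  have G: "Cinf_ap G" and "\<forall>\<^sub>F r in at 0 within {r. t + r \<in> {0..1}}. fscale (1 / r) (fsub (\<gamma> (t + r)) (\<gamma> t)) \<in> apball k G 1"
    using c k unfolding curve_deriv_def limitin_ap by auto
  then obtain d where d: "d > 0" "\<And>r. t + r \<in> {0..1} ==> r \<noteq> 0 ==> \<bar>r\<bar> < d ==> fscale (1 / r) (fsub (\<gamma> (t + r)) (\<gamma> t)) \<in> apball k G 1"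
    unfolding eventually_at by auto
  define m where "m = 1 + normk_vec k G"
  have m: "m > 0" using nv_nonneg[OF G, of k] by (simp add: m_def)
  have "normk_vec k (fsub (\<gamma> s) (\<gamma> t)) < e" if s': "s \<in> {0..1}" "\<bar>s - t\<bar> < min d (e / m)" for s
  proof (cases "s = t")
    case True
    then show ?thesis using nv_self[OF s[OF t]] e by simp
  next
    case False
    define X where "X = fscale (1 / (s - t)) (fsub (\<gamma> s) (\<gamma> t))"
    have X: "Cinf_ap X" "normk_vec k (fsub X G) < 1" using d(2)[of "s - t"] s' False unfolding X_def apball_def by auto
    have XG: "Cinf_ap (fsub X G)" by (rule Cinf_ops(2)[OF X(1) G])
    have "fsub (\<gamma> s) (\<gamma> t) = fscale (s - t) (fadd (fsub X G) G)"
      using False by (simp add: fun_eq_iff fsub_def fscale_def fadd_def X_def)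
    then have "normk_vec k (fsub (\<gamma> s) (\<gamma> t)) <= \<bar>s - t\<bar> * normk_vec k (fadd (fsub X G) G)"
      using nv_ops(3)[OF Cinf_ops(1)[OF XG G] G] by simp
    also have "\<dots> <= \<bar>s - t\<bar> * m" unfolding m_def using nv_ops(1)[OF XG G, of k] X(2) by (intro mult_left_mono) auto
    also have "\<dots> < (e / m) * m" using s'(2) m by (intro mult_strict_right_mono) auto
    finally show ?thesis using m by simp
  qed
  then show ?thesis using d(1) e m by (intro exI[of _ "min d (e / m)"]) auto
qed

lemma DX_0: "DX is 0 = 0" by (induction "is") (simp_all only: list.map DL.simps D_0)

context flow
begin

definition Wf :: "'n vfun => 'n vfun => 'n vfun" where
  "Wf f v = (%x. Ainv al (Bop al (%y. v (inv (%x. x + f x) y))) (x + f x))"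

abbreviation "cpv f v \<equiv> cp (vf f) (vf v)"

lemma smc_cpv: "Cinf_ap f ==> Cinf_ap v ==> smc (cpv f v)"
  unfolding Cinf_vf by (intro smc_cp) blast+

text \<open>For given position and velocity the equations for \<open>w\<close> and \<open>h\<close>
  are again a small fixed point problem, now with zero time operators, and its solution is the
  acceleration. So the acceleration is accessible for a curve about whose dependence on time nothing
  is assumed.\<close>

lemma static:
  assumes f: "Cinf_ap f" and v: "Cinf_ap v" and b: "nc N0 (cpv f v) < rs"
  shows "\<exists>c. sys a (%F. 0) (%F. 0) (vf f) (vf v) c \<and> nc N0 c <= 2 * rs \<and> (\<forall>j. vf (Wf f v) j = slice 0 (c (IW j)))"
proof -
  have K: "gop a C 2 (%F. 0 :: 'n fld)" by (rule gop_mono[OF gop_0]) simp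
  have sf: "smooth (vf f j)" "smooth (vf v j)" for j using f v unfolding Cinf_vf by blast+
  obtain c where c: "sys a (%F. 0) (%F. 0) (vf f) (vf v) c" "\<And>k l. 0 <= l ==> nc (NN k l) (cpv f v) <= rs ==> nc (NN k l) c <= 2 * rs"
    using solve[OF K K rs order_refl sf b] by blast
  have S: "smc c" "c (IF j) = vf f j" "c (IV j) = vf v j" "c (IW j) = Fout a c (IW j)" "c (IH j i) = Fout a c (IH j i)" for i j
    using c(1) unfolding sys_def add_0_right by blast+
  have small: "\<bar>dx k (vf f j) 0 x\<bar> <= rs" for j k x
  proof -
    have "\<bar>dx k (vf f j) 0 x\<bar> <= N0 (dx k (vf f j))" by (rule N0_sn[OF smooth_D[OF sf(1)]])
    also have "\<dots> <= nc N0 (cpv f v)" using nc_cmp(2)[OF admN0 smc_cpv[OF f v], of k "IF j"] unfolding cp.simps .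
    finally show ?thesis using b by linarith
  qed
  have "Wf f v x $ j = c (IW j) 0 x" for x j
    unfolding Wf_def by (rule Ainv_Bop[OF S small_field(1)[OF f small] al refl])
  then have "vf (Wf f v) j = slice 0 (c (IW j))" for j by (simp add: fun_eq_iff vf_apply rp_def)
  moreover have "nc N0 c <= 2 * rs" using c(2)[of 0 0] b unfolding NN0 by simp
  ultimately show ?thesis using c(1) by blast
qed

lemma Wf_lip:
  assumes f: "Cinf_ap f" "Cinf_ap v" "nc N0 (cpv f v) < rs" and g: "Cinf_ap g" "Cinf_ap w" "nc N0 (cpv g w) < rs"
  shows "qn N0 (IW j) (vf (Wf f v) j - vf (Wf g w) j) <= 2 * nc N0 (cpv f v - cpv g w)"
proof -
  obtain c where c: "sys a (%F. 0) (%F. 0) (vf f) (vf v) c" "nc N0 c <= 2 * rs" "\<And>j. vf (Wf f v) j = slice 0 (c (IW j))"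
    using static[OF f] by blast
  obtain c' where c': "sys a (%F. 0) (%F. 0) (vf g) (vf w) c'" "nc N0 c' <= 2 * rs" "\<And>j. vf (Wf g w) j = slice 0 (c' (IW j))"
    using static[OF g] by blast
  have K: "gop a C 2 (%F. 0 :: 'n fld)" by (rule gop_mono[OF gop_0]) simp
  have s: "smooth (vf f j)" "smooth (vf v j)" "smooth (vf g j)" "smooth (vf w j)" for j using f g unfolding Cinf_vf by blast+
  have sc: "smc c" "smc c'" using c(1) c'(1) unfolding sys_def by blast+
  have L: "nc N0 (c - c') <= 2 * nc N0 (cpv f v - cpv g w)"
    by (rule sys_lip[OF K K rs order_refl s admN0 c(1) c'(1) c(2) c'(2)])
  let ?d = "%b. slice 0 ((c - c') b)"
  have sd: "smc ?d" unfolding smc_def using smooth_rp[OF reparam_const smcD[OF smc_diff[OF sc]]] by blast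
  have "qn N0 (IW j) (?d (IW j)) <= nc N0 ?d" by (rule nc_mem[OF admN0 sd])
  also have "\<dots> <= nc N0 (c - c')" by (rule nc_rp_N0[OF reparam_const smc_diff[OF sc]])
  finally show ?thesis using L unfolding c(3) c'(3) cfg_minus rp_ops by linarith
qed

text \<open>Only \<open>\<psi>\<close> is known to be small. The set of times of agreement is closed
  by continuity. It is open because near such a time the other geodesic is small too; the difference
  then solves an equation with Lipschitz right side, and on a short interval any bound for it can be
  halved.\<close>

lemma geod_unique:
  fixes u :: "'n vfun"
  assumes 1: "geod_sol al u \<phi> v" and 2: "geod_sol al u \<psi> w" and b: "\<And>t. t \<in> {0..1} ==> nc N0 (cpv (chart (\<psi> t)) (w t)) <= rs/2"
    and t: "t \<in> {0..1}"
  shows "\<phi> t = \<psi> t"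
proof -
  have fields: "Cinf_ap (chart (\<phi> t))" "Cinf_ap (v t)" "curve_deriv (%t. chart (\<phi> t)) t (v t)" "curve_deriv v t (Wf (chart (\<phi> t)) (v t))"
    if g: "geod_sol al u \<phi> v" and t: "t \<in> {0..1}" for \<phi> v :: "real => 'n vfun" and t
  proof -
    have G: "Diff_inf (\<phi> t)" "Cinf_ap (v t)" "curve_deriv \<phi> t (v t)"
      "curve_deriv v t (%x. Ainv al (Bop al (%y. v t (inv (\<phi> t) y))) (\<phi> t x))" using g t unfolding geod_sol_def by blast+
    show "Cinf_ap (v t)" by (rule G)
    show "Cinf_ap (chart (\<phi> t))" using G(1) unfolding Diff_inf_def Diff_ap_def Let_def Cinf_ap_def chart_def by blast
    have "fsub (chart (\<phi> s)) (chart (\<phi> r)) = fsub (\<phi> s) (\<phi> r)" for s r by (simp add: fun_eq_iff chart_def fsub_def)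
    then show "curve_deriv (%t. chart (\<phi> t)) t (v t)" using G(3) unfolding curve_deriv_def by simp
    have "(%x. x + chart (\<phi> t) x) = \<phi> t" "x + chart (\<phi> t) x = \<phi> t x" for x by (simp_all add: fun_eq_iff chart_def fsub_def)
    then show "curve_deriv v t (Wf (chart (\<phi> t)) (v t))" using G(4) unfolding Wf_def by simp
  qed
  note F = fields[OF 1] and G = fields[OF 2]
  let ?f = "%t. chart (\<phi> t)" and ?g = "%t. chart (\<psi> t)"
  define \<Delta> where "\<Delta> t = cpv (?f t) (v t) - cpv (?g t) (w t)" for t
  define \<Delta>' where "\<Delta>' t = cpv (v t) (Wf (?f t) (v t)) - cpv (w t) (Wf (?g t) (w t))" for t
  have WC: "Cinf_ap (Wf (?f t) (v t))" "Cinf_ap (Wf (?g t) (w t))" if "t \<in> {0..1}" for t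
    using F(4)[OF that] G(4)[OF that] unfolding curve_deriv_def limitin_ap by blast+
  have sP: "smc (cpv (?f t) (v t))" "smc (cpv (?g t) (w t))" if "t \<in> {0..1}" for t
    using F(1,2)[OF that] G(1,2)[OF that] by (auto intro: smc_cpv)
  have s\<Delta>: "smc (\<Delta> t)" "smc (\<Delta>' t)" if "t \<in> {0..1}" for t
    unfolding \<Delta>_def \<Delta>'_def using F(1,2)[OF that] G(1,2)[OF that] WC[OF that] by (auto intro!: smc_diff smc_cpv)
  have der: "((%s. DX is (\<Delta> s b) \<tau> x) has_real_derivative DX is (\<Delta>' t b) \<tau> x) (at t within {0..1})" if t: "t \<in> {0..1}" for t b "is" \<tau> x
  proof -
    have sm: "smooth (vf (?f s) j)" "smooth (vf (?g s) j)" "smooth (vf (v s) j)" "smooth (vf (w s) j)" if "s \<in> {0..1}" for s j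
      using F(1,2)[OF that] G(1,2)[OF that] unfolding Cinf_vf by blast+
    have sW: "smooth (vf (Wf (?f t) (v t)) j)" "smooth (vf (Wf (?g t) (w t)) j)" for j using WC[OF t] unfolding Cinf_vf by blast+
    note dd = DERIV_diff[OF curve_deriv_D[OF F(3)[OF t] F(1) t] curve_deriv_D[OF G(3)[OF t] G(1) t]]
      DERIV_diff[OF curve_deriv_D[OF F(4)[OF t] F(2) t] curve_deriv_D[OF G(4)[OF t] G(2) t]]
    show ?thesis
    proof (cases b)
      case (IF j)
      have e1: "DX is (\<Delta> s b) \<tau> x = DX is (vf (?f s) j) \<tau> x - DX is (vf (?g s) j) \<tau> x" if "s \<in> {0..1}" for s
        unfolding \<Delta>_def IF cfg_minus cp.simps DL_diff[OF sm(1,2)[OF that]] by simp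
      have e2: "DX is (\<Delta>' t b) \<tau> x = DX is (vf (v t) j) \<tau> x - DX is (vf (w t) j) \<tau> x"
        unfolding \<Delta>'_def IF cfg_minus cp.simps DL_diff[OF sm(3,4)[OF t]] by simp
      show ?thesis unfolding e2
        by (rule has_field_derivative_transform_within[OF dd(1) zero_less_one t]) (assumption, assumption, rule e1[symmetric])
    next
      case (IV j)
      have e1: "DX is (\<Delta> s b) \<tau> x = DX is (vf (v s) j) \<tau> x - DX is (vf (w s) j) \<tau> x" if "s \<in> {0..1}" for s
        unfolding \<Delta>_def IV cfg_minus cp.simps DL_diff[OF sm(3,4)[OF that]] by simp
      have e2: "DX is (\<Delta>' t b) \<tau> x = DX is (vf (Wf (?f t) (v t)) j) \<tau> x - DX is (vf (Wf (?g t) (w t)) j) \<tau> x"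
        unfolding \<Delta>'_def IV cfg_minus cp.simps DL_diff[OF sW] by simp
      show ?thesis unfolding e2
        by (rule has_field_derivative_transform_within[OF dd(2) zero_less_one t]) (assumption, assumption, rule e1[symmetric])
    qed (simp_all add: \<Delta>_def \<Delta>'_def DX_0)
  qed
  define n where "n = real CARD('n)"
  \<comment> \<open>For each component the value, \<open>n\<close> first and \<open>n * n\<close>
    second derivatives are integrated; 4 is the factor 2 of \<open>N0_MVT\<close> times the factor 2
    of \<open>Wf_lip\<close>.\<close>
  define Q where "Q = real CARD('n idx) * (4 * (1 + n + n * n))"
  have Q: "Q >= 0" unfolding Q_def n_def by simp
  have step: "\<exists>\<delta>>0. \<forall>s\<in>{0..1}. \<bar>s - t0\<bar> < \<delta> --> \<Delta> s = 0" if t0: "t0 \<in> {0..1}" and z: "\<Delta> t0 = 0" for t0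
  proof -
    obtain K where K: "K >= 0" "\<And>l (G :: 'n vfun). 0 <= l ==> l <= 1 ==> Cinf_ap G ==> vnorm (NN 0 l) (vf G) <= K * normk_vec (0 + 3) G"
      using vnorm_NN_nv[of 0] by blast
    define M where "M = real CARD('n idx) * (K * 2)"
    have M: "M >= 0" using K(1) by (simp add: M_def)
    \<comment> \<open>Makes the change of the configuration since time \<open>t0\<close> less than
      \<open>rs/2\<close>, which added to the bound at \<open>t0\<close> stays below
      \<open>rs\<close>.\<close>
    define e where "e = rs / (2 * (M + 1))"
    have e: "e > 0" using rs M by (simp add: e_def)
    obtain d1 where d1: "d1 > 0" "\<And>s. s \<in> {0..1} ==> \<bar>s - t0\<bar> < d1 ==> normk_vec 3 (fsub (?f s) (?f t0)) < e"
      using curve_cont[OF F(3)[OF t0] F(1) t0 e, of 3] by auto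
    obtain d2 where d2: "d2 > 0" "\<And>s. s \<in> {0..1} ==> \<bar>s - t0\<bar> < d2 ==> normk_vec 3 (fsub (v s) (v t0)) < e"
      using curve_cont[OF F(4)[OF t0] F(2) t0 e, of 3] by auto
    define \<delta> where "\<delta> = min (min d1 d2) (1 / (2 * (Q + 1)))"
    have \<delta>: "\<delta> > 0" "\<delta> <= d1" "\<delta> <= d2" using d1(1) d2(1) Q by (auto simp: \<delta>_def)
    have Q\<delta>: "Q * \<delta> <= 1/2"
    proof -
      have "Q * \<delta> <= (Q + 1) * (1 / (2 * (Q + 1)))" using Q \<delta>(1) by (intro mult_mono) (auto simp: \<delta>_def)
      also have "\<dots> = 1/2" using Q by simp
      finally show ?thesis .
    qed
    let ?I = "{0..1} \<inter> ball t0 \<delta>"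
    have I: "convex ?I" by (intro convex_Int convex_ball) simp
    have I': "s \<in> {0..1}" "\<bar>s - t0\<bar> < \<delta>" if "s \<in> ?I" for s using that by (auto simp: dist_real_def)
    have small: "nc N0 (cpv (?f s) (v s)) < rs" if s: "s \<in> ?I" for s
    proof -
      note s' = I'[OF s]
      let ?F = "fsub (?f s) (?f t0)" and ?V = "fsub (v s) (v t0)"
      have C: "Cinf_ap ?F" "Cinf_ap ?V" by (rule Cinf_ops(2)[OF F(1)[OF s'(1)] F(1)[OF t0]], rule Cinf_ops(2)[OF F(2)[OF s'(1)] F(2)[OF t0]])
      have sC: "smooth (vf ?F j)" "smooth (vf ?V j)" for j using C unfolding Cinf_vf by blast+
      have t0b: "nc N0 (cpv (?f t0) (v t0)) <= rs/2" using z b[OF t0] unfolding \<Delta>_def by simp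
      have "cpv (?f s) (v s) - cpv (?f t0) (v t0) = cpv ?F ?V" unfolding cp_diff vf_ops[abs_def, symmetric] by simp
      then have "nc N0 (cpv (?f s) (v s)) <= nc N0 (cpv (?f t0) (v t0)) + nc N0 (cpv ?F ?V)"
        using nc_tri[OF admN0 sP(1)[OF t0] sP(1)[OF s'(1)]] by simp
      moreover have "nc N0 (cpv ?F ?V) <= real CARD('n idx) * (vnorm N0 (vf ?F) + vnorm N0 (vf ?V))"
        by (rule nc_cp_le[OF admN0 sC])
      moreover have "\<dots> <= real CARD('n idx) * (K * e + K * e)"
      proof (intro mult_left_mono add_mono)
        show "vnorm N0 (vf ?F) <= K * e"
          using K(2)[of 1, OF _ _ C(1)] d1(2)[OF s'(1)] s'(2) \<delta>(2) mult_left_mono[OF _ K(1), of "normk_vec 3 ?F" e] unfolding NN0 by simp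
        show "vnorm N0 (vf ?V) <= K * e"
          using K(2)[of 1, OF _ _ C(2)] d2(2)[OF s'(1)] s'(2) \<delta>(3) mult_left_mono[OF _ K(1), of "normk_vec 3 ?V" e] unfolding NN0 by simp
      qed simp
      moreover have "real CARD('n idx) * (K * e + K * e) = M * e" by (simp add: M_def)
      moreover have "M * e < (M + 1) * e" using e by simp
      moreover have "(M + 1) * e = rs/2"
      proof -
        have "m * (rs / (2 * m)) = rs/2" if "m > 0" for m :: real using that by simp
        moreover have "M + 1 > 0" using M by linarith
        ultimately show ?thesis unfolding e_def .
      qed
      ultimately show ?thesis using t0b by linarith
    qed
    \<comment> \<open>A bound \<open>m\<close> for the difference bounds its derivative by
      \<open>2 * m\<close>; integrating from \<open>t0\<close>, where it vanishes, over length
      \<open>\<delta>\<close> gives \<open>Q * \<delta> * m\<close>.\<close>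
    have halve: "nc N0 (\<Delta> s) <= m / 2" if s: "s \<in> ?I" and m: "\<And>s. s \<in> ?I ==> nc N0 (\<Delta> s) <= m" for s m
    proof -
      have t0I: "t0 \<in> ?I" using t0 \<delta>(1) by simp
      have m0: "m >= 0" using m[OF t0I] nc_nonneg[OF admN0 s\<Delta>(1)[OF t0]] by linarith
      have zq: "qn N0 b (0 :: 'n fld) = 0" for b unfolding qn_def D_0 adm_0[OF admN0] by (cases "isH b") simp_all
      have q': "qn N0 b (\<Delta>' r b) <= 2 * m" if r: "r \<in> ?I" for r b
      proof (cases b)
        case (IF j)
        have "qn N0 (IV j) (\<Delta> r (IV j)) <= nc N0 (\<Delta> r)" by (rule nc_mem[OF admN0 s\<Delta>(1)[OF I'(1)[OF r]]])
        then show ?thesis using m[OF r] m0 qn_cong[of "IF j" "IV j" N0 "\<Delta> r (IV j)"] unfolding IF \<Delta>_def \<Delta>'_def cfg_minus cp.simps by simp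
      next
        case (IV j)
        note r' = I'(1)[OF r]
        have "nc N0 (cpv (?g r) (w r)) < rs" using b[OF r'] rs by linarith
        from Wf_lip[OF F(1,2)[OF r'] small[OF r] G(1,2)[OF r'] this, of j]
        have "qn N0 (IW j) (vf (Wf (?f r) (v r)) j - vf (Wf (?g r) (w r)) j) <= 2 * nc N0 (\<Delta> r)" unfolding \<Delta>_def .
        then show ?thesis using m[OF r] qn_cong[of "IV j" "IW j" N0] unfolding IV \<Delta>'_def cfg_minus cp.simps by simp
      qed (use zq m0 in \<open>simp_all add: \<Delta>'_def\<close>)
      have N: "N0 (DX is (\<Delta> s b)) <= 2 * (2 * m * \<delta>)" if "is": "\<And>r. r \<in> ?I ==> N0 (DX is (\<Delta>' r b)) <= 2 * m" for "is" b
      proof (rule N0_MVT[OF I t0I s, where G' = "%r. DX is (\<Delta>' r b)"])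
        show "\<bar>s - t0\<bar> <= \<delta>" using I'(2)[OF s] by simp
        show "((%s. DX is (\<Delta> s b) \<tau> x) has_real_derivative DX is (\<Delta>' r b) \<tau> x) (at r within ?I)" if "r \<in> ?I" for r \<tau> x
          by (rule has_field_derivative_subset[OF der[OF I'(1)[OF that]]]) simp
        show "smooth (DX is (\<Delta>' r b))" if "r \<in> ?I" for r by (rule smooth_DL[OF smcD[OF s\<Delta>(2)[OF I'(1)[OF that]]]])
        show "DX is (\<Delta> t0 b) = 0" unfolding z cfg_zero by (rule DX_0)
      qed (rule "is")
      have "qn N0 b (\<Delta> s b) <= 4 * (1 + n + n * n) * (m * \<delta>)" for b
      proof (cases "isH b")
        case True
        then have "\<Delta> s b = 0" unfolding \<Delta>_def by (cases b) (simp_all add: cfg_minus)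
        then show ?thesis unfolding n_def using zq[of b] m0 \<delta>(1) by simp
      next
        case False
        have le: "N0 (\<Delta>' r b) <= 2 * m" "N0 (dx k (\<Delta>' r b)) <= 2 * m" "N0 (dx k (dx l (\<Delta>' r b))) <= 2 * m" if r: "r \<in> ?I" for r k l
          using qn_mono[OF admN0 smcD[OF s\<Delta>(2)[OF I'(1)[OF r]]], where b = b] q'[OF r, of b] False order_trans by blast+
        have "N0 (\<Delta> s b) <= 4 * (m * \<delta>)" using N[of "[]" b] le(1) by simp
        moreover have "N0 (dx k (\<Delta> s b)) <= 4 * (m * \<delta>)" for k using N[of "[k]" b] le(2) by simp
        then have "(\<Sum>k\<in>UNIV. N0 (dx k (\<Delta> s b))) <= (\<Sum>k\<in>(UNIV::'n set). 4 * (m * \<delta>))" by (rule sum_mono)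
        moreover have "N0 (dx k (dx l (\<Delta> s b))) <= 4 * (m * \<delta>)" for k l using N[of "[l, k]" b] le(3) by simp
        then have "(\<Sum>k\<in>UNIV. \<Sum>l\<in>UNIV. N0 (dx k (dx l (\<Delta> s b)))) <= (\<Sum>k\<in>(UNIV::'n set). \<Sum>l\<in>(UNIV::'n set). 4 * (m * \<delta>))" by (intro sum_mono)
        ultimately have "qn N0 b (\<Delta> s b) <= 4 * (m * \<delta>) + n * (4 * (m * \<delta>)) + n * (n * (4 * (m * \<delta>)))"
          unfolding qn_def if_not_P[OF False] n_def by simp
        then show ?thesis by (simp add: algebra_simps)
      qed
      then have "nc N0 (\<Delta> s) <= (\<Sum>b\<in>(UNIV::'n idx set). 4 * (1 + n + n * n) * (m * \<delta>))" unfolding nc_def by (rule sum_mono)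
      also have "\<dots> = Q * \<delta> * m" by (simp add: Q_def)
      also have "\<dots> <= 1/2 * m" by (intro mult_right_mono Q\<delta> m0)
      finally show ?thesis by simp
    qed
    have pow: "\<forall>s\<in>?I. nc N0 (\<Delta> s) <= 2 * rs * (1/2) ^ k" for k
    proof (induction k)
      case 0
      show ?case
      proof
        fix s assume s: "s \<in> ?I"
        note s' = I'(1)[OF s]
        have "nc N0 (\<Delta> s) <= nc N0 (cpv (?f s) (v s)) + nc N0 (cpv (?g s) (w s))"
          unfolding \<Delta>_def by (rule nc_diff[OF admN0 sP[OF s']])
        then show "nc N0 (\<Delta> s) <= 2 * rs * (1/2) ^ 0" using small[OF s] b[OF s'] rs by simp
      qed
    next
      case (Suc k)
      then show ?case using halve[of _ "2 * rs * (1/2) ^ k"] by simp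
    qed
    have "\<Delta> s = 0" if s: "s \<in> {0..1}" "\<bar>s - t0\<bar> < \<delta>" for s
    proof
      fix b
      have "s \<in> ?I" using s by (simp add: dist_real_def abs_minus_commute)
      then have "nc N0 (\<Delta> s) <= 2 * rs * (1/2) ^ k" for k using pow by blast
      moreover have "(%k. 2 * rs * (1/2) ^ k) \<longlonglongrightarrow> 2 * rs * 0" by (intro tendsto_intros LIMSEQ_power_zero) simp
      ultimately have "nc N0 (\<Delta> s) <= 0" using LIMSEQ_le_const[of "%k. 2 * rs * (1/2) ^ k" "2 * rs * 0"] by auto
      then have "N0 (\<Delta> s b) <= 0" using nc_cmp(1)[OF admN0 s\<Delta>(1)[OF s(1)], of b] by linarith
      then show "\<Delta> s b = 0 b" unfolding cfg_zero by (rule N0_eq_0[OF smcD[OF s\<Delta>(1)[OF s(1)]]])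
    qed
    then show ?thesis using \<delta>(1) by blast
  qed
  define Z where "Z = {t \<in> {0..1}. \<Delta> t = 0}"
  have "openin (top_of_set {0..1}) Z"
    unfolding openin_contains_ball
  proof (intro conjI ballI)
    fix t0 assume "t0 \<in> Z"
    then obtain \<delta> where "\<delta> > 0" "\<And>s. s \<in> {0..1} ==> \<bar>s - t0\<bar> < \<delta> ==> \<Delta> s = 0" using step[of t0] unfolding Z_def by auto
    then show "\<exists>e>0. ball t0 e \<inter> {0..1} \<subseteq> Z"
      unfolding Z_def by (intro exI[of _ \<delta>]) (auto simp: dist_real_def abs_minus_commute)
  qed (auto simp: Z_def)
  moreover have "closedin (top_of_set {0..1}) Z"
  proof -
    have "Z = (\<Inter>p. {s \<in> {0..1}. \<Delta> s (fst p) (fst (snd p)) (snd (snd p)) = 0})" unfolding Z_def by (auto simp: fun_eq_iff)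
    moreover have "closedin (top_of_set {0..1}) {s \<in> {0..1}. \<Delta> s b \<tau> x = 0}" for b \<tau> x
      by (rule continuous_closedin_preimage_constant, rule DERIV_continuous_on, rule der[of _ "[]", simplified]) simp
    ultimately show ?thesis by (simp only: closedin_Inter image_is_empty UNIV_not_empty) (intro closedin_Inter, auto)
  qed
  moreover have "0 \<in> Z"
  proof -
    have "\<phi> 0 = id" "\<psi> 0 = id" "v 0 = u" "w 0 = u" using 1 2 unfolding geod_sol_def by blast+
    then show ?thesis unfolding Z_def \<Delta>_def by simp
  qed
  ultimately have "Z = {0..1}" using connected_Icc[of 0 1] unfolding connected_clopen by blast
  then have "\<Delta> t = 0" using t unfolding Z_def by blast
  then have "vf (?f t) j = vf (?g t) j" for j
    using fun_cong[of "\<Delta> t" 0 "IF j"] unfolding \<Delta>_def cfg_minus cp.simps cfg_zero by (simp only: right_minus_eq)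
  then have "?f t = ?g t" by (rule vf_inject)
  then have "?f t x = ?g t x" for x by (rule fun_cong)
  then show "\<phi> t = \<psi> t" unfolding chart_def fsub_def by (intro ext) simp
qed

end

section \<open>The exponential map\<close>

context system
begin

text \<open>Data constant in the parameter give an output constant in the parameter, and
  \<open>E1\<close> removes the time; so the slice in \<open>vf_Yv\<close> may be dropped.\<close>

lemma Yv_eq: assumes u: "u \<in> B" shows "vf (Yv u) j = vf u j + cst s * E1 (J (J (sol (vf u) (IW j))))"
proof (intro ext)
  fix \<tau> x
  have g: "good (vf u)" using u B_good unfolding B_def by blast
  have r: "(%j. rp (ge 0) (vf u j)) = vf u" by (simp add: fun_eq_iff rp_def vf_apply)
  have "Y (vf u) j = rp (ge 0) (Y (vf u) j)" using Y_rp[OF g, of 0 j] unfolding r .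
  then have "Y (vf u) j \<tau> x = Y (vf u) j (Complex 0 (Im \<tau>)) x" by (metis rp_def ge_def)
  also have "\<dots> = Y (vf u) j 0 x" by (simp add: Y_def vf_apply E1_def)
  finally show "vf (Yv u) j \<tau> x = (vf u j + cst s * E1 (J (J (sol (vf u) (IW j))))) \<tau> x"
    unfolding vf_Yv by (simp add: rp_def Y_def)
qed

lemma Yv_0: "(%x. 0) \<in> B" "Yv (%x. 0) = (%x. 0)"
proof -
  let ?z = "%x. 0 :: real^'n"
  have z: "vf ?z j = 0" for j by (simp add: fun_eq_iff vf_apply)
  have J0: "J 0 = (0 :: 'n fld)" "E1 0 = (0 :: 'n fld)" by (simp_all add: fun_eq_iff J_def E1_def)
  have K0: "K 0 = (0 :: 'n fld)" if "gop a C 2 K" for K using gopD(6)[OF that smooth_0 smooth_0] by simp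
  have "vp (vf ?z) b = 0 b" for b unfolding vp_def cfg_zero by (cases b) (simp_all only: cp.simps z J0)
  then have v0: "vp (vf ?z) = 0" by (rule ext)
  show B0: "?z \<in> B" unfolding B_def mem_Collect_eq v0 nc_0[OF admN0] using rs Cinf_0 by simp
  then have g: "good (vf ?z)" using B_good[OF Cinf_0] by blast
  obtain K where "\<And>N (c :: 'n cfg) c'. adm a C N ==> smc c ==> smc c' ==> nc N c <= 1 ==> nc N c' <= 1 ==> nc N (Fout a c) <= K * (nc N c)\<^sup>2"
    using Fout_bound[OF a0 C] by blast
  from this[OF admN0 smc_0 smc_0] have n: "nc N0 (Fout a (0 :: 'n cfg)) <= 0" unfolding nc_0[OF admN0] by simp
  note sF = smc_Fout[OF a0 smc_0]
  have F0: "Fout a (0 :: 'n cfg) b = 0" for b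
    using nc_cmp(1)[OF admN0 sF, of b] n by (intro N0_eq_0[OF smcD[OF sF]]) linarith
  have "sol (vf ?z) = 0"
  proof (rule sol_eq[OF g])
    show "nc N0 (0 :: 'n cfg) <= 2 * (rs / 4)" unfolding nc_0[OF admN0] using rs by simp
    show "sys a Kf Kv (%j. J (vf ?z j)) (vf ?z) 0"
      unfolding sys_def
    proof (intro conjI allI smc_0)
      fix i j
      show "(0 :: 'n cfg) (IF j) = J (vf ?z j) + Kf ((0 :: 'n cfg) (IW j))" "(0 :: 'n cfg) (IV j) = vf ?z j + Kv ((0 :: 'n cfg) (IW j))"
        by (simp_all only: cfg_zero z J0 K0[OF Kf] K0[OF Kv] add_0_right)
      show "(0 :: 'n cfg) (IW j) = Fout a 0 (IW j)" "(0 :: 'n cfg) (IH j i) = Fout a 0 (IH j i)" unfolding F0 by (rule cfg_zero)+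
    qed
  qed
  then have "vf (Yv ?z) j = vf ?z j" for j
    unfolding Yv_eq[OF B0] by (simp add: J0[unfolded zero_fun_def] fun_eq_iff J_def E1_def)
  then show "Yv ?z = ?z" by (rule vf_inject)
qed

lemma preimage_open: "openin ap_top {u \<in> B. Yv u \<in> B}"
proof -
  have "openin (subtopology ap_top B) {u \<in> topspace (subtopology ap_top B). Yv u \<in> B}"
    by (rule openin_continuous_map_preimage[OF Yv_cont B_open])
  moreover have "{u \<in> topspace (subtopology ap_top B). Yv u \<in> B} = {u \<in> B. Yv u \<in> B}" unfolding B_def by auto
  ultimately show ?thesis using openin_open_subtopology[OF B_open] by simp
qed

end

context flow
begin

lemma Exp:
  assumes u: "u \<in> E.B" shows "Exp_wd al u" "chart (Exp al u) = E.Yv u" "Diff_inf (Exp al u)"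
proof -
  obtain \<psi> w where w: "geod_sol al u \<psi> w" "\<And>t. t \<in> {0..1} ==> nc N0 (cpv (chart (\<psi> t)) (w t)) <= rs/2" "chart (\<psi> 1) = E.Yv u"
    using geod_exists[OF u] by blast
  have un: "p = \<psi> 1" if sol: "\<exists>\<phi> v. geod_sol al u \<phi> v \<and> \<phi> 1 = p" for p
  proof -
    from sol obtain \<phi> v where p: "geod_sol al u \<phi> v" "\<phi> 1 = p" by (elim exE conjE)
    show ?thesis using geod_unique[OF p(1) w(1,2), of 1] p(2) by simp
  qed
  have ex: "\<exists>\<phi> v. geod_sol al u \<phi> v \<and> \<phi> 1 = \<psi> 1" using w(1) by blast
  show "Exp_wd al u" unfolding Exp_wd_def using ex un by (rule ex1I)
  have e: "Exp al u = \<psi> 1" unfolding Exp_def using ex un by (rule the_equality)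
  show "chart (Exp al u) = E.Yv u" unfolding e by (rule w(3))
  show "Diff_inf (Exp al u)" unfolding e using w(1) unfolding geod_sol_def by simp
qed

lemma J_shift:
  fixes W :: "'n fld"
  assumes W: "smooth W" and u: "smooth u"
  shows "J (u + cst k * E1 (J (J W))) = J u + cst k * J (E1 (J (J W)))" "J (J W - E1 (J (J W))) = J (J W) - J (E1 (J (J W)))"
proof -
  have s: "smooth (J W)" "smooth (E1 (J (J W)))" by (intro smooth_E1 smooth_J W)+
  show "J (u + cst k * E1 (J (J W))) = J u + cst k * J (E1 (J (J W)))"
    unfolding J_add[OF smooth_AC[OF u] smooth_AC[OF smooth_mult[OF smooth_cst s(2)]]] J_cmult ..
  show "J (J W - E1 (J (J W))) = J (J W) - J (E1 (J (J W)))" by (rule gopD(6)[OF gop_J s])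
qed

text \<open>A solution of the system with prescribed initial velocity also solves the system with prescribed final position,
  and conversely; hence the two solution maps are inverse to each other.\<close>

lemma inverse_maps:
  assumes u: "u \<in> E.B"
  shows "E.Yv u \<in> E.B ==> I.Yv (E.Yv u) = u" "I.Yv u \<in> E.B ==> E.Yv (I.Yv u) = u"
proof -
  \<comment> \<open>\<open>good\<close> and \<open>B\<close> only involve the data and not the
    operators \<open>Kf\<close>, \<open>Kv\<close>, so they are the same for both systems.\<close>
  have g: "E.good (vf u)" "I.good (vf u)" if "u \<in> E.B" for u
    using that E.B_good unfolding E.B_def by blast+
  have su: "smooth (vf u j)" for j using u unfolding E.B_def Cinf_vf by blast
  show "I.Yv (E.Yv u) = u" if y: "E.Yv u \<in> E.B"
  proof (rule vf_inject)
    fix j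
    let ?c = "E.sol (vf u)"
    let ?E = "%j. E1 (J (J (?c (IW j))))"
    note c = E.sol[OF g(1)[OF u]] note sW = smcD[OF c(3)]
    have S: "?c (IF j) = J (vf u j) + J (J (?c (IW j)))" "?c (IV j) = vf u j + J (?c (IW j))" "?c (IW j) = Fout a ?c (IW j)"
      "?c (IH j i) = Fout a ?c (IH j i)" for i j using c(1) unfolding sys_def by blast+
    have eq: "I.sol (vf (E.Yv u)) = ?c"
    proof (rule I.sol_eq[OF g(2)[OF y] _ c(4)])
      have 1: "?c (IF j) = J (vf (E.Yv u) j) + J (J (?c (IW j)) - ?E j)" for j
        unfolding S(1)[of j] E.Yv_eq[OF u] J_shift[OF sW su] by (simp add: fun_eq_iff)
      have 2: "?c (IV j) = vf (E.Yv u) j + (J (?c (IW j)) - ?E j)" for j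
        unfolding S(2)[of j] E.Yv_eq[OF u] by (simp add: fun_eq_iff)
      show "sys a (%F. J (J F - E1 (J (J F)))) (%F. J F - E1 (J (J F))) (%j. J (vf (E.Yv u) j)) (vf (E.Yv u)) ?c"
        unfolding sys_def using c(3) 1 2 S(3,4) by blast
    qed
    have "vf (I.Yv (E.Yv u)) j = vf (E.Yv u) j + cst (- 1) * ?E j" using I.Yv_eq[OF y, of j] unfolding eq .
    then show "vf (I.Yv (E.Yv u)) j = vf u j" unfolding E.Yv_eq[OF u] by (simp add: fun_eq_iff)
  qed
  show "E.Yv (I.Yv u) = u" if y: "I.Yv u \<in> E.B"
  proof (rule vf_inject)
    fix j
    let ?c = "I.sol (vf u)"
    let ?E = "%j. E1 (J (J (?c (IW j))))"
    note c = I.sol[OF g(2)[OF u]] note sW = smcD[OF c(3)]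
    have S: "?c (IF j) = J (vf u j) + J (J (?c (IW j)) - ?E j)" "?c (IV j) = vf u j + (J (?c (IW j)) - ?E j)" "?c (IW j) = Fout a ?c (IW j)"
      "?c (IH j i) = Fout a ?c (IH j i)" for i j using c(1) unfolding sys_def by blast+
    have eq: "E.sol (vf (I.Yv u)) = ?c"
    proof (rule E.sol_eq[OF g(1)[OF y] _ c(4)])
      have 1: "?c (IF j) = J (vf (I.Yv u) j) + J (J (?c (IW j)))" for j
        unfolding S(1)[of j] I.Yv_eq[OF u] J_shift[OF sW su] by (simp add: fun_eq_iff)
      have 2: "?c (IV j) = vf (I.Yv u) j + J (?c (IW j))" for j
        unfolding S(2)[of j] I.Yv_eq[OF u] by (simp add: fun_eq_iff)
      show "sys a (%F. J (J F)) J (%j. J (vf (I.Yv u) j)) (vf (I.Yv u)) ?c"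
        unfolding sys_def using c(3) 1 2 S(3,4) by blast
    qed
    have "vf (E.Yv (I.Yv u)) j = vf (I.Yv u) j + cst 1 * ?E j" using E.Yv_eq[OF y, of j] unfolding eq .
    then show "vf (E.Yv (I.Yv u)) j = vf u j" unfolding I.Yv_eq[OF u] by (simp add: fun_eq_iff)
  qed
qed

lemma Exp_diffeo:
  "\<exists>(V :: 'n vfun set) (U :: 'n vfun set).
     openin ap_top V \<and> (%x. 0) \<in> V \<and> U \<subseteq> {\<phi>. Diff_inf \<phi>} \<and> id \<in> U \<and> openin ap_top (chart ` U) \<and>
     (\<forall>u\<in>V. Exp_wd al u) \<and> C1F_diffeo V (chart ` U) (%u. chart (Exp al u))"
proof -
  \<comment> \<open>Neither map need send \<open>B\<close> into itself. Both neighbourhoods are cut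
    down to the points whose image lies in \<open>B\<close> again; between them the two maps are
    mutually inverse.\<close>
  define V where "V = {u \<in> E.B. E.Yv u \<in> E.B}"
  define W where "W = {u \<in> E.B. I.Yv u \<in> E.B}"
  define U where "U = {\<phi>. chart \<phi> \<in> W}"
  have ch: "chart (%x. x + f x) = f" for f :: "'n vfun" by (simp add: fun_eq_iff chart_def fsub_def)
  have cU: "chart ` U = W"
  proof
    show "W \<subseteq> chart ` U"
    proof
      fix f assume "f \<in> W"
      then have "(%x. x + f x) \<in> U" unfolding U_def using ch[of f] by simp
      then show "f \<in> chart ` U" using ch[of f] by (metis image_eqI)
    qed
  qed (auto simp: U_def)
  have Vo: "openin ap_top V" unfolding V_def by (rule E.preimage_open)
  have Wo: "openin ap_top W" unfolding W_def by (rule I.preimage_open)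
  have VW: "E.Yv u \<in> W" "I.Yv (E.Yv u) = u" if "u \<in> V" for u using that inverse_maps(1)[of u] unfolding V_def W_def by auto
  have WV: "I.Yv y \<in> V" "E.Yv (I.Yv y) = y" if "y \<in> W" for y using that inverse_maps(2)[of y] unfolding V_def W_def by auto
  have VB: "V \<subseteq> E.B" "W \<subseteq> I.B" unfolding V_def W_def by auto
  have f: "chart (Exp al u) = E.Yv u" if "u \<in> E.B" for u by (rule Exp(2)[OF that])
  \<comment> \<open>Each member of \<open>U\<close> is the end point of a geodesic, and this gives
    the determinant condition.\<close>
  have dU: "U \<subseteq> {\<phi>. Diff_inf \<phi>}"
  proof
    fix \<phi> assume that: "\<phi> \<in> U"
    have c: "chart \<phi> \<in> W" using that unfolding U_def by simp
    have i: "I.Yv (chart \<phi>) \<in> E.B" using WV(1)[OF c] VB(1) by blast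
    have "chart (Exp al (I.Yv (chart \<phi>))) = chart \<phi>" unfolding f[OF i] by (rule WV(2)[OF c])
    then have "chart (Exp al (I.Yv (chart \<phi>))) x = chart \<phi> x" for x by (rule fun_cong)
    then have "Exp al (I.Yv (chart \<phi>)) = \<phi>" unfolding chart_def fsub_def by (intro ext) simp
    then show "\<phi> \<in> {\<phi>. Diff_inf \<phi>}" using Exp(3)[OF i] by simp
  qed
  have zV: "(%x. 0) \<in> V" unfolding V_def using E.Yv_0 by simp
  have iU: "id \<in> U"
  proof -
    have "chart id = (%x. 0 :: real^'n)" by (simp add: fun_eq_iff chart_def fsub_def)
    then show ?thesis unfolding U_def W_def using I.Yv_0 by simp
  qed
  have df: "C1F_diffeo V W (%u. chart (Exp al u))"
    unfolding C1F_diffeo_def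
  proof (intro exI[of _ I.Yv] conjI)
    have c1: "continuous_map (subtopology ap_top V) ap_top (%u. chart (Exp al u))"
      using continuous_map_from_subtopology_mono[OF E.Yv_cont VB(1)] by (rule continuous_map_eq) (use f VB(1) in auto)
    have c2: "continuous_map (subtopology ap_top W) ap_top I.Yv"
      by (rule continuous_map_from_subtopology_mono[OF I.Yv_cont VB(2)])
    show "homeomorphic_maps (subtopology ap_top V) (subtopology ap_top W) (%u. chart (Exp al u)) I.Yv"
      unfolding homeomorphic_maps_def continuous_map_in_subtopology
    proof (intro conjI ballI c1 c2)
      show "(%u. chart (Exp al u)) \<in> topspace (subtopology ap_top V) \<rightarrow> W" using f VB(1) VW(1) by auto
      show "I.Yv \<in> topspace (subtopology ap_top W) \<rightarrow> V" using WV(1) by auto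
      show "I.Yv (chart (Exp al u)) = u" if "u \<in> topspace (subtopology ap_top V)" for u using that f VB(1) VW(2) by auto
      show "chart (Exp al (I.Yv y)) = y" if "y \<in> topspace (subtopology ap_top W)" for y
      proof -
        have y: "y \<in> W" using that by simp
        then have "I.Yv y \<in> E.B" using WV(1) VB(1) by blast
        then show ?thesis using f WV(2)[OF y] by simp
      qed
    qed
    show "C1F V (%u. chart (Exp al u))" by (rule E.C1F_Y[OF Vo VB(1) f])
    show "C1F W I.Yv" by (rule I.C1F_Y[OF Wo VB(2) refl])
  qed
  have wd: "\<forall>u\<in>V. Exp_wd al u" using Exp(1) VB(1) by auto
  show ?thesis
    by (rule exI[of _ V], rule exI[of _ U], unfold cU) (intro conjI Vo zV dU iU Wo wd df)
qed

end

section \<open>Choice of the constants\<close>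

lemma det_near_1: "\<exists>d>0. \<forall>m :: real^'n::finite^'n. (\<forall>j k. \<bar>m $ j $ k\<bar> <= d) --> det (mat 1 + m) > 1/2"
proof -
  have "continuous_on UNIV (%A :: real^'n^'n. det A)" unfolding det_def by (intro continuous_intros)
  then obtain d where d: "d > 0" "\<And>A :: real^'n^'n. dist A (mat 1) < d ==> dist (det A) (det (mat 1 :: real^'n^'n)) < 1/2"
    unfolding continuous_on_iff by (metis UNIV_I half_gt_zero zero_less_one)
  define n where "n = real CARD('n)"
  have n: "n > 0" by (simp add: n_def)
  have "det (mat 1 + m) > 1/2" if m: "\<forall>j k. \<bar>m $ j $ k\<bar> <= d / (2 * (n * n))" for m :: "real^'n^'n"
  proof -
    have "norm m <= (\<Sum>j\<in>UNIV. norm (m $ j))" unfolding norm_vec_def[of m] by (rule L2_set_le_sum) simp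
    also have "\<dots> <= (\<Sum>j\<in>UNIV. \<Sum>k\<in>UNIV. \<bar>m $ j $ k\<bar>)" by (intro sum_mono norm_le_l1_cart)
    also have "\<dots> <= (\<Sum>j\<in>(UNIV::'n set). \<Sum>k\<in>(UNIV::'n set). d / (2 * (n * n)))" using m by (intro sum_mono) blast
    also have "\<dots> = d / 2" using n by (simp add: n_def field_simps)
    also have "\<dots> < d" using d(1) by simp
    finally have "dist (mat 1 + m) (mat 1) < d" by (simp add: dist_norm)
    from d(2)[OF this] show ?thesis unfolding det_I dist_real_def by (simp add: abs_if split: if_splits)
  qed
  then show ?thesis using d(1) n by (intro exI[of _ "d / (2 * (n * n))"]) auto
qed

lemma flow_exists:
  assumes "\<alpha> \<noteq> 0" shows "\<exists>C rs. flow TYPE('n::finite) \<alpha> C rs"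
proof -
  have a: "\<alpha>\<^sup>2 > 0" using assms by simp
  obtain C where C: "C >= 1" "adm (\<alpha>\<^sup>2) C (N0 :: 'n fld => real)" using adm_N0[OF a] by blast
  have C0: "C >= 0" using C(1) by simp
  from det_near_1 obtain d where d: "d > 0" "\<forall>m :: real^'n^'n. (\<forall>j k. \<bar>m $ j $ k\<bar> <= d) --> det (mat 1 + m) > 1/2"
    by (elim exE conjE)
  \<comment> \<open>\<open>2 * CARD('n idx)\<close> is the bound for the operators \<open>AD\<close>
    found in \<open>lop_AD\<close>.\<close>
  from fixed_point[OF a C0 C(2), of "2 * real CARD('n idx)"]
  obtain r0 where r0: "r0 > 0" and fp: "\<forall>r. 0 < r --> r <= r0 --> (\<forall>A. lop (\<alpha>\<^sup>2) C (2 * real CARD('n idx)) A -->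
    (\<forall>N p p' c c' :: 'n cfg. adm (\<alpha>\<^sup>2) C N --> smc p --> smc p' --> smc c --> smc c' -->
       nc N c <= 2 * r --> nc N c' <= 2 * r --> c = p + A (Fout (\<alpha>\<^sup>2) c) --> c' = p' + A (Fout (\<alpha>\<^sup>2) c') --> nc N (c - c') <= 2 * nc N (p - p')) \<and>
    (\<forall>p :: 'n cfg. smc p --> nc N0 p < r --> (\<exists>c. smc c \<and> c = p + A (Fout (\<alpha>\<^sup>2) c) \<and>
       (\<forall>k l. 0 <= l --> nc (NN k l) p <= r --> nc (NN k l) c <= 2 * r))))"
    by (elim exE conjE)
  define n where "n = real CARD('n)"
  have n: "n > 0" by (simp add: n_def)
  \<comment> \<open>The three entries serve the fixed point theorem, the determinant, and the
    Lipschitz constant one half of \<open>f\<close>, which requires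
    \<open>n * (n * rs) \<le> 1/2\<close>.\<close>
  define rs where "rs = min r0 (min d (1 / (2 * (n * n))))"
  have rs: "rs > 0" "rs <= r0" "rs <= d" using r0 d(1) n by (auto simp: rs_def)
  have "flow TYPE('n) \<alpha> C rs"
  proof
    have "n * (n * rs) <= n * (n * (1 / (2 * (n * n))))" using n by (intro mult_left_mono) (auto simp: rs_def)
    also have "\<dots> = 1/2" using n by simp
    finally show "real CARD('n) * (real CARD('n) * rs) <= 1/2" unfolding n_def .
    show "det (mat 1 + m) > 1/2" if "\<And>j k. \<bar>m $ j $ k\<bar> <= rs" for m :: "real^'n^'n"
      by (rule d(2)[rule_format]) (rule order_trans[OF that rs(3)])
  qed (rule assms C0 C(2) rs(1) | rule fp[THEN spec, THEN mp, THEN mp, THEN spec, THEN mp], assumption, erule order_trans[OF _ rs(2)], assumption)+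
  then show ?thesis by blast
qed

theorem theorem1p1:
  fixes \<alpha> :: real
  assumes "\<alpha> \<noteq> 0"
  shows "\<exists>(V :: 'n::finite vfun set) (U :: 'n vfun set).
           openin ap_top V \<and> (\<lambda>x. 0) \<in> V \<and>
           U \<subseteq> {\<phi>. Diff_inf \<phi>} \<and> id \<in> U \<and> openin ap_top (chart ` U) \<and>
           (\<forall>u\<in>V. Exp_wd \<alpha> u) \<and>
           C1F_diffeo V (chart ` U) (\<lambda>u. chart (Exp \<alpha> u))"
proof -
  obtain C rs where "flow TYPE('n) \<alpha> C rs" using flow_exists[OF assms] by blast
  then show ?thesis by (rule flow.Exp_diffeo)
qed

end
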